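(* The 2-category $\mathfrak{SCG}$ of symmetric categorical groups is 2-equivalent to the 2-category of right 2-modules over the 2-ring $\Phi$.
   Context: **Symmetric categorical groups.** A symmetric categorical group is a symmetric monoidal groupoid $(\mathbb A,+,0)$ such that each functor $x+(-)$ is an equivalence. They form the 2-category $\mathfrak{SCG}$ (symmetric monoidal functors; 2-cells, called tracks, are monoidal natural transformations). **2-rings and 2-modules.** A 2-ring (categorical ring) is a symmetric categorical group $R$ with a multiplication functor $R\times R\to R$, an object $1$, and natural isomorphisms of associativity, unit, and left and right distributivity, such that multiplication is monoidal (pentagon and triangle), the functors $x\cdot(-)$ and $(-)\cdot x$ are symmetric monoidal via distributivity, the two ways of expanding $(x+x')(y+y')$ agree up to the canonical isomorphism, and the associativity and unit isomorphisms are monoidal in each variable. A right 2-module (categorical module) over $R$ is a symmetric categorical group with a right action of $R$ that is distributive in both variables, associative and unital up to natural isomorphisms satisfying the analogous coherence conditions; morphisms are symmetric monoidal functors commuting with the action up to coherent natural isomorphisms, and tracks are compatible monoidal natural transformations. **The 2-ring $\Phi$.** The objects of $\Phi$ are the integers; there is no morphism $n\to m$ if $n\ne m$; $\mathrm{Aut}(n)$ is cyclic of order two with generator $\epsilon_n$. Addition is induced by addition of integers, associativity and unit constraints are identities, and the commutativity constraint $n+m\to m+n$ equals $nm\,\epsilon_{n+m}$. The multiplication is induced by multiplication of integers (on automorphisms: $(a\epsilon_n)\cdot(b\epsilon_m)=(am+nb)\epsilon_{nm}$ for $a,b\in\mathbb Z/2$), with all associativity, unit and distributivity constraints trivial. **2-equivalence.**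 A 2-equivalence $F:\mathfrak T\to\mathfrak T'$ of groupoid-enriched categories is a 2-functor (pseudo-functor) inducing equivalences of all hom groupoids and such that each object of $\mathfrak T'$ is equivalent to some $F(A)$.
   Formalization: The distributivity constraints of Φ cannot all be trivial (the two expansions of (1+1)(1+1) differ by ε); here xz+yz→(x+y)z is the identity but xy+xz→x(y+z) is x(x-1)/2·yz·ε, which makes Φ a 2-ring. *)

theory Defs
  imports Main "HOL-Library.FuncSet" "HOL-Library.Z2"
begin

section \<open>Groupoids, functors and equivalences\<close>

record ('o, 'a) gpd =
  Obj :: "'o set"
  Arr :: "'a set"
  Dom :: "'a \<Rightarrow> 'o"
  Cod :: "'a \<Rightarrow> 'o"
  Ide :: "'o \<Rightarrow> 'a"
  comp :: "'a \<Rightarrow> 'a \<Rightarrow> 'a" (infixr "\<cdot>\<index>" 68)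

definition ghom :: "('o, 'a, 'm) gpd_scheme \<Rightarrow> 'o \<Rightarrow> 'o \<Rightarrow> 'a set" where
  "ghom G x y = {f \<in> Arr G. Dom G f = x \<and> Cod G f = y}"

locale groupoid =
  fixes G :: "('o, 'a, 'm) gpd_scheme" (structure)
  assumes Dom_Obj: "f \<in> Arr G \<Longrightarrow> Dom G f \<in> Obj G"
    and Cod_Obj: "f \<in> Arr G \<Longrightarrow> Cod G f \<in> Obj G"
    and Ide_hom: "x \<in> Obj G \<Longrightarrow> Ide G x \<in> ghom G x x"
    and comp_hom: "f \<in> ghom G x y \<Longrightarrow> g \<in> ghom G y z \<Longrightarrow> g \<cdot> f \<in> ghom G x z"
    and comp_assoc: "f \<in> ghom G w x \<Longrightarrow> g \<in> ghom G x y \<Longrightarrow> h \<in> ghom G y z \<Longrightarrow>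
        (h \<cdot> g) \<cdot> f = h \<cdot> (g \<cdot> f)"
    and comp_Ide_right: "f \<in> ghom G x y \<Longrightarrow> f \<cdot> Ide G x = f"
    and comp_Ide_left: "f \<in> ghom G x y \<Longrightarrow> Ide G y \<cdot> f = f"
    and inverse_ex: "f \<in> ghom G x y \<Longrightarrow> \<exists>g \<in> ghom G y x. g \<cdot> f = Ide G x \<and> f \<cdot> g = Ide G y"

definition ginv :: "('o, 'a, 'm) gpd_scheme \<Rightarrow> 'a \<Rightarrow> 'a" where
  "ginv G f = (THE g. g \<in> ghom G (Cod G f) (Dom G f)
     \<and> g \<cdot>\<^bsub>G\<^esub> f = Ide G (Dom G f) \<and> f \<cdot>\<^bsub>G\<^esub> g = Ide G (Cod G f))"

record ('o, 'a, 'p, 'b) functr =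
  fO :: "'o \<Rightarrow> 'p"
  fA :: "'a \<Rightarrow> 'b"

locale gfunctor = A?: groupoid A + B?: groupoid B
  for A :: "('o, 'a, 'm) gpd_scheme" (structure)
  and B :: "('p, 'b, 'n) gpd_scheme" (structure) +
  fixes F :: "('o, 'a, 'p, 'b, 'k) functr_scheme"
  assumes fO_Obj: "x \<in> Obj A \<Longrightarrow> fO F x \<in> Obj B"
    and fA_hom: "f \<in> ghom A x y \<Longrightarrow> fA F f \<in> ghom B (fO F x) (fO F y)"
    and fA_Ide: "x \<in> Obj A \<Longrightarrow> fA F (Ide A x) = Ide B (fO F x)"
    and fA_comp: "f \<in> ghom A x y \<Longrightarrow> g \<in> ghom A y z \<Longrightarrow>
        fA F (g \<cdot>\<^bsub>A\<^esub> f) = fA F g \<cdot>\<^bsub>B\<^esub> fA F f"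

definition id_functr :: "('o, 'a, 'o, 'a) functr" where
  "id_functr = \<lparr>fO = \<lambda>x. x, fA = \<lambda>f. f\<rparr>"

definition functr_comp ::
  "('p, 'b, 'q, 'c, 'k) functr_scheme \<Rightarrow> ('o, 'a, 'p, 'b, 'l) functr_scheme \<Rightarrow> ('o, 'a, 'q, 'c) functr"
  where "functr_comp G F = \<lparr>fO = \<lambda>x. fO G (fO F x), fA = \<lambda>f. fA G (fA F f)\<rparr>"

locale nat_trans = F: gfunctor A B F + G: gfunctor A B G
  for A :: "('o, 'a, 'm) gpd_scheme" (structure)
  and B :: "('p, 'b, 'n) gpd_scheme" (structure)
  and F :: "('o, 'a, 'p, 'b, 'k) functr_scheme"
  and G :: "('o, 'a, 'p, 'b, 'l) functr_scheme" +
  fixes t :: "'o \<Rightarrow> 'b"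
  assumes t_hom: "x \<in> Obj A \<Longrightarrow> t x \<in> ghom B (fO F x) (fO G x)"
    and t_natural: "f \<in> ghom A x y \<Longrightarrow> t y \<cdot>\<^bsub>B\<^esub> fA F f = fA G f \<cdot>\<^bsub>B\<^esub> t x"

text \<open>In a groupoid every natural transformation is a natural isomorphism.\<close>

definition equivalence ::
  "('o, 'a, 'm) gpd_scheme \<Rightarrow> ('p, 'b, 'n) gpd_scheme \<Rightarrow> ('o, 'a, 'p, 'b, 'k) functr_scheme \<Rightarrow> bool"
  where
  "equivalence A B F \<longleftrightarrow> gfunctor A B F \<and>
     (\<exists>G :: ('p, 'b, 'o, 'a) functr. gfunctor B A G
        \<and> (\<exists>t. nat_trans A A id_functr (functr_comp G F) t)
        \<and> (\<exists>t. nat_trans B B (functr_comp F G) id_functr t))"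


section \<open>Symmetric categorical groups\<close>

text \<open>\<open>\<oplus>\<close> is the sum of objects, \<open>\<uplus>\<close> the sum of arrows.\<close>

record ('o, 'a) scg = "('o, 'a) gpd" +
  add :: "'o \<Rightarrow> 'o \<Rightarrow> 'o" (infixl "\<oplus>\<index>" 70)
  addA :: "'a \<Rightarrow> 'a \<Rightarrow> 'a" (infixl "\<uplus>\<index>" 70)
  zero :: "'o" ("\<zero>\<index>")
  asc :: "'o \<Rightarrow> 'o \<Rightarrow> 'o \<Rightarrow> 'a"
  lun :: "'o \<Rightarrow> 'a"
  run :: "'o \<Rightarrow> 'a"
  sym :: "'o \<Rightarrow> 'o \<Rightarrow> 'a"

definition translation :: "('o, 'a, 'm) scg_scheme \<Rightarrow> 'o \<Rightarrow> ('o, 'a, 'o, 'a) functr" where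
  "translation A x = \<lparr>fO = \<lambda>y. x \<oplus>\<^bsub>A\<^esub> y, fA = \<lambda>f. Ide A x \<uplus>\<^bsub>A\<^esub> f\<rparr>"

locale scg = groupoid A for A :: "('o, 'a, 'm) scg_scheme" (structure) +
  assumes zero_Obj: "\<zero> \<in> Obj A"
    and add_Obj: "x \<in> Obj A \<Longrightarrow> y \<in> Obj A \<Longrightarrow> x \<oplus> y \<in> Obj A"
    and addA_hom: "f \<in> ghom A x x' \<Longrightarrow> g \<in> ghom A y y' \<Longrightarrow> f \<uplus> g \<in> ghom A (x \<oplus> y) (x' \<oplus> y')"
    and addA_Ide: "x \<in> Obj A \<Longrightarrow> y \<in> Obj A \<Longrightarrow> Ide A x \<uplus> Ide A y = Ide A (x \<oplus> y)"
    and addA_comp: "f \<in> ghom A x x' \<Longrightarrow> f' \<in> ghom A x' x'' \<Longrightarrow>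
        g \<in> ghom A y y' \<Longrightarrow> g' \<in> ghom A y' y'' \<Longrightarrow>
        (f' \<cdot> f) \<uplus> (g' \<cdot> g) = (f' \<uplus> g') \<cdot> (f \<uplus> g)"
    and asc_hom: "x \<in> Obj A \<Longrightarrow> y \<in> Obj A \<Longrightarrow> z \<in> Obj A \<Longrightarrow>
        asc A x y z \<in> ghom A ((x \<oplus> y) \<oplus> z) (x \<oplus> (y \<oplus> z))"
    and asc_natural: "f \<in> ghom A x x' \<Longrightarrow> g \<in> ghom A y y' \<Longrightarrow> h \<in> ghom A z z' \<Longrightarrow>
        asc A x' y' z' \<cdot> ((f \<uplus> g) \<uplus> h) = (f \<uplus> (g \<uplus> h)) \<cdot> asc A x y z"
    and lun_hom: "x \<in> Obj A \<Longrightarrow> lun A x \<in> ghom A (\<zero> \<oplus> x) x"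
    and lun_natural: "f \<in> ghom A x y \<Longrightarrow> lun A y \<cdot> (Ide A \<zero> \<uplus> f) = f \<cdot> lun A x"
    and run_hom: "x \<in> Obj A \<Longrightarrow> run A x \<in> ghom A (x \<oplus> \<zero>) x"
    and run_natural: "f \<in> ghom A x y \<Longrightarrow> run A y \<cdot> (f \<uplus> Ide A \<zero>) = f \<cdot> run A x"
    and sym_hom: "x \<in> Obj A \<Longrightarrow> y \<in> Obj A \<Longrightarrow> sym A x y \<in> ghom A (x \<oplus> y) (y \<oplus> x)"
    and sym_natural: "f \<in> ghom A x x' \<Longrightarrow> g \<in> ghom A y y' \<Longrightarrow>
        sym A x' y' \<cdot> (f \<uplus> g) = (g \<uplus> f) \<cdot> sym A x y"
    and pentagon: "w \<in> Obj A \<Longrightarrow> x \<in> Obj A \<Longrightarrow> y \<in> Obj A \<Longrightarrow> z \<in> Obj A \<Longrightarrow>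
        asc A w x (y \<oplus> z) \<cdot> asc A (w \<oplus> x) y z
        = (Ide A w \<uplus> asc A x y z) \<cdot> asc A w (x \<oplus> y) z \<cdot> (asc A w x y \<uplus> Ide A z)"
    and triangle: "x \<in> Obj A \<Longrightarrow> y \<in> Obj A \<Longrightarrow>
        (Ide A x \<uplus> lun A y) \<cdot> asc A x \<zero> y = run A x \<uplus> Ide A y"
    and hexagon: "x \<in> Obj A \<Longrightarrow> y \<in> Obj A \<Longrightarrow> z \<in> Obj A \<Longrightarrow>
        asc A y z x \<cdot> sym A x (y \<oplus> z) \<cdot> asc A x y z
        = (Ide A y \<uplus> sym A x z) \<cdot> asc A y x z \<cdot> (sym A x y \<uplus> Ide A z)"
    and sym_sym: "x \<in> Obj A \<Longrightarrow> y \<in> Obj A \<Longrightarrow> sym A y x \<cdot> sym A x y = Ide A (x \<oplus> y)"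
    and translation_equivalence: "x \<in> Obj A \<Longrightarrow> equivalence A A (translation A x)"

text \<open>The canonical isomorphism \<open>(a + b) + (c + d) \<rightarrow> (a + c) + (b + d)\<close>.\<close>

definition mid :: "('o, 'a, 'm) scg_scheme \<Rightarrow> 'o \<Rightarrow> 'o \<Rightarrow> 'o \<Rightarrow> 'o \<Rightarrow> 'a" where
  "mid A a b c d =
     ginv A (asc A a c (b \<oplus>\<^bsub>A\<^esub> d))
     \<cdot>\<^bsub>A\<^esub> (Ide A a \<uplus>\<^bsub>A\<^esub>
          (asc A c b d \<cdot>\<^bsub>A\<^esub> (sym A b c \<uplus>\<^bsub>A\<^esub> Ide A d) \<cdot>\<^bsub>A\<^esub> ginv A (asc A b c d)))
     \<cdot>\<^bsub>A\<^esub> asc A a b (c \<oplus>\<^bsub>A\<^esub> d)"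

text \<open>\<open>fM F x y : F x + F y \<rightarrow> F (x + y)\<close> and \<open>fU F : 0 \<rightarrow> F 0\<close>.\<close>

record ('o, 'a, 'p, 'b) smfun = "('o, 'a, 'p, 'b) functr" +
  fM :: "'o \<Rightarrow> 'o \<Rightarrow> 'b"
  fU :: "'b"

locale sm_functor = gfunctor A B F + A?: scg A + B?: scg B
  for A :: "('o, 'a, 'm) scg_scheme" (structure)
  and B :: "('p, 'b, 'n) scg_scheme" (structure)
  and F :: "('o, 'a, 'p, 'b, 'k) smfun_scheme" +
  assumes fM_hom: "x \<in> Obj A \<Longrightarrow> y \<in> Obj A \<Longrightarrow>
        fM F x y \<in> ghom B (fO F x \<oplus>\<^bsub>B\<^esub> fO F y) (fO F (x \<oplus>\<^bsub>A\<^esub> y))"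
    and fM_natural: "f \<in> ghom A x x' \<Longrightarrow> g \<in> ghom A y y' \<Longrightarrow>
        fM F x' y' \<cdot>\<^bsub>B\<^esub> (fA F f \<uplus>\<^bsub>B\<^esub> fA F g) = fA F (f \<uplus>\<^bsub>A\<^esub> g) \<cdot>\<^bsub>B\<^esub> fM F x y"
    and fU_hom: "fU F \<in> ghom B \<zero>\<^bsub>B\<^esub> (fO F \<zero>\<^bsub>A\<^esub>)"
    and fM_asc: "x \<in> Obj A \<Longrightarrow> y \<in> Obj A \<Longrightarrow> z \<in> Obj A \<Longrightarrow>
        fA F (asc A x y z) \<cdot>\<^bsub>B\<^esub> fM F (x \<oplus>\<^bsub>A\<^esub> y) z \<cdot>\<^bsub>B\<^esub> (fM F x y \<uplus>\<^bsub>B\<^esub> Ide B (fO F z))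
        = fM F x (y \<oplus>\<^bsub>A\<^esub> z) \<cdot>\<^bsub>B\<^esub> (Ide B (fO F x) \<uplus>\<^bsub>B\<^esub> fM F y z)
            \<cdot>\<^bsub>B\<^esub> asc B (fO F x) (fO F y) (fO F z)"
    and fM_lun: "x \<in> Obj A \<Longrightarrow>
        fA F (lun A x) \<cdot>\<^bsub>B\<^esub> fM F \<zero>\<^bsub>A\<^esub> x \<cdot>\<^bsub>B\<^esub> (fU F \<uplus>\<^bsub>B\<^esub> Ide B (fO F x)) = lun B (fO F x)"
    and fM_run: "x \<in> Obj A \<Longrightarrow>
        fA F (run A x) \<cdot>\<^bsub>B\<^esub> fM F x \<zero>\<^bsub>A\<^esub> \<cdot>\<^bsub>B\<^esub> (Ide B (fO F x) \<uplus>\<^bsub>B\<^esub> fU F) = run B (fO F x)"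
    and fM_sym: "x \<in> Obj A \<Longrightarrow> y \<in> Obj A \<Longrightarrow>
        fA F (sym A x y) \<cdot>\<^bsub>B\<^esub> fM F x y = fM F y x \<cdot>\<^bsub>B\<^esub> sym B (fO F x) (fO F y)"

definition id_smfun :: "('o, 'a, 'm) scg_scheme \<Rightarrow> ('o, 'a, 'o, 'a) smfun" where
  "id_smfun A = \<lparr>fO = \<lambda>x. x, fA = \<lambda>f. f, fM = \<lambda>x y. Ide A (x \<oplus>\<^bsub>A\<^esub> y), fU = Ide A \<zero>\<^bsub>A\<^esub>\<rparr>"

definition smcomp ::
  "('q, 'c, 'm) scg_scheme \<Rightarrow> ('p, 'b, 'q, 'c, 'k) smfun_scheme \<Rightarrow> ('o, 'a, 'p, 'b, 'l) smfun_scheme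
    \<Rightarrow> ('o, 'a, 'q, 'c) smfun" where
  "smcomp C G F =
     \<lparr>fO = \<lambda>x. fO G (fO F x),
      fA = \<lambda>f. fA G (fA F f),
      fM = \<lambda>x y. fA G (fM F x y) \<cdot>\<^bsub>C\<^esub> fM G (fO F x) (fO F y),
      fU = fA G (fU F) \<cdot>\<^bsub>C\<^esub> fU G\<rparr>"

locale sm_trans = nat_trans A B F G t + F: sm_functor A B F + G: sm_functor A B G
  for A :: "('o, 'a, 'm) scg_scheme" (structure)
  and B :: "('p, 'b, 'n) scg_scheme" (structure)
  and F :: "('o, 'a, 'p, 'b, 'k) smfun_scheme"
  and G :: "('o, 'a, 'p, 'b, 'l) smfun_scheme"
  and t :: "'o \<Rightarrow> 'b" +
  assumes t_fM: "x \<in> Obj A \<Longrightarrow> y \<in> Obj A \<Longrightarrow>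
        t (x \<oplus>\<^bsub>A\<^esub> y) \<cdot>\<^bsub>B\<^esub> fM F x y = fM G x y \<cdot>\<^bsub>B\<^esub> (t x \<uplus>\<^bsub>B\<^esub> t y)"
    and t_fU: "t \<zero>\<^bsub>A\<^esub> \<cdot>\<^bsub>B\<^esub> fU F = fU G"


section \<open>2-rings\<close>

text \<open>
  \<open>\<otimes>\<close> is the product of objects, \<open>\<star>\<close> the product of arrows.
  The distributivity constraints are oriented as the constraints of the symmetric monoidal
  functors \<open>x\<cdot>(-)\<close> and \<open>(-)\<cdot>x\<close>, and include their nullary parts:
  \<open>ldist x y z : xy + xz \<rightarrow> x(y + z)\<close>, \<open>lzero x : 0 \<rightarrow> x0\<close>,
  \<open>rdist x y z : xz + yz \<rightarrow> (x + y)z\<close>, \<open>rzero x : 0 \<rightarrow> 0x\<close>.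
  As every object is invertible, the binary part determines the nullary one.
\<close>

record ('o, 'a) ring2 = "('o, 'a) scg" +
  mul :: "'o \<Rightarrow> 'o \<Rightarrow> 'o" (infixl "\<otimes>\<index>" 75)
  mulA :: "'a \<Rightarrow> 'a \<Rightarrow> 'a" (infixl "\<star>\<index>" 75)
  one :: "'o" ("\<one>\<index>")
  masc :: "'o \<Rightarrow> 'o \<Rightarrow> 'o \<Rightarrow> 'a"
  mlun :: "'o \<Rightarrow> 'a"
  mrun :: "'o \<Rightarrow> 'a"
  ldist :: "'o \<Rightarrow> 'o \<Rightarrow> 'o \<Rightarrow> 'a"
  lzero :: "'o \<Rightarrow> 'a"
  rdist :: "'o \<Rightarrow> 'o \<Rightarrow> 'o \<Rightarrow> 'a"
  rzero :: "'o \<Rightarrow> 'a"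

definition lmul :: "('o, 'a, 'm) ring2_scheme \<Rightarrow> 'o \<Rightarrow> ('o, 'a, 'o, 'a) smfun" where
  "lmul R x = \<lparr>fO = \<lambda>y. x \<otimes>\<^bsub>R\<^esub> y, fA = \<lambda>f. Ide R x \<star>\<^bsub>R\<^esub> f, fM = ldist R x, fU = lzero R x\<rparr>"

definition rmul :: "('o, 'a, 'm) ring2_scheme \<Rightarrow> 'o \<Rightarrow> ('o, 'a, 'o, 'a) smfun" where
  "rmul R x = \<lparr>fO = \<lambda>y. y \<otimes>\<^bsub>R\<^esub> x, fA = \<lambda>f. f \<star>\<^bsub>R\<^esub> Ide R x, fM = \<lambda>y z. rdist R y z x, fU = rzero R x\<rparr>"

locale two_ring = scg R for R :: "('o, 'a, 'm) ring2_scheme" (structure) +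
  assumes one_Obj: "\<one> \<in> Obj R"
    and mul_Obj: "x \<in> Obj R \<Longrightarrow> y \<in> Obj R \<Longrightarrow> x \<otimes> y \<in> Obj R"
    and mulA_hom: "f \<in> ghom R x x' \<Longrightarrow> g \<in> ghom R y y' \<Longrightarrow> f \<star> g \<in> ghom R (x \<otimes> y) (x' \<otimes> y')"
    and mulA_Ide: "x \<in> Obj R \<Longrightarrow> y \<in> Obj R \<Longrightarrow> Ide R x \<star> Ide R y = Ide R (x \<otimes> y)"
    and mulA_comp: "f \<in> ghom R x x' \<Longrightarrow> f' \<in> ghom R x' x'' \<Longrightarrow>
        g \<in> ghom R y y' \<Longrightarrow> g' \<in> ghom R y' y'' \<Longrightarrow>
        (f' \<cdot> f) \<star> (g' \<cdot> g) = (f' \<star> g') \<cdot> (f \<star> g)"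
    and masc_hom: "x \<in> Obj R \<Longrightarrow> y \<in> Obj R \<Longrightarrow> z \<in> Obj R \<Longrightarrow>
        masc R x y z \<in> ghom R ((x \<otimes> y) \<otimes> z) (x \<otimes> (y \<otimes> z))"
    and masc_natural: "f \<in> ghom R x x' \<Longrightarrow> g \<in> ghom R y y' \<Longrightarrow> h \<in> ghom R z z' \<Longrightarrow>
        masc R x' y' z' \<cdot> ((f \<star> g) \<star> h) = (f \<star> (g \<star> h)) \<cdot> masc R x y z"
    and mul_pentagon: "w \<in> Obj R \<Longrightarrow> x \<in> Obj R \<Longrightarrow> y \<in> Obj R \<Longrightarrow> z \<in> Obj R \<Longrightarrow>
        masc R w x (y \<otimes> z) \<cdot> masc R (w \<otimes> x) y z
        = (Ide R w \<star> masc R x y z) \<cdot> masc R w (x \<otimes> y) z \<cdot> (masc R w x y \<star> Ide R z)"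
    and mul_triangle: "x \<in> Obj R \<Longrightarrow> y \<in> Obj R \<Longrightarrow>
        (Ide R x \<star> mlun R y) \<cdot> masc R x \<one> y = mrun R x \<star> Ide R y"
    and lmul_functor: "x \<in> Obj R \<Longrightarrow> sm_functor R R (lmul R x)"
    and rmul_functor: "x \<in> Obj R \<Longrightarrow> sm_functor R R (rmul R x)"
    \<comment> \<open>the distributivity isomorphisms are natural in the remaining variable as well\<close>
    and lmul_trans: "f \<in> ghom R x x' \<Longrightarrow>
        sm_trans R R (lmul R x) (lmul R x') (\<lambda>y. f \<star> Ide R y)"
    and rmul_trans: "f \<in> ghom R x x' \<Longrightarrow>
        sm_trans R R (rmul R x) (rmul R x') (\<lambda>y. Ide R y \<star> f)"
    and interchange: "x \<in> Obj R \<Longrightarrow> x' \<in> Obj R \<Longrightarrow> y \<in> Obj R \<Longrightarrow> y' \<in> Obj R \<Longrightarrow>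
        rdist R x x' (y \<oplus> y') \<cdot> (ldist R x y y' \<uplus> ldist R x' y y')
        = ldist R (x \<oplus> x') y y' \<cdot> (rdist R x x' y \<uplus> rdist R x x' y')
            \<cdot> mid R (x \<otimes> y) (x \<otimes> y') (x' \<otimes> y) (x' \<otimes> y')"
    and masc_monoidal1: "y \<in> Obj R \<Longrightarrow> z \<in> Obj R \<Longrightarrow>
        sm_trans R R (smcomp R (rmul R z) (rmul R y)) (rmul R (y \<otimes> z)) (\<lambda>x. masc R x y z)"
    and masc_monoidal2: "x \<in> Obj R \<Longrightarrow> z \<in> Obj R \<Longrightarrow>
        sm_trans R R (smcomp R (rmul R z) (lmul R x)) (smcomp R (lmul R x) (rmul R z))
          (\<lambda>y. masc R x y z)"
    and masc_monoidal3: "x \<in> Obj R \<Longrightarrow> y \<in> Obj R \<Longrightarrow>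
        sm_trans R R (lmul R (x \<otimes> y)) (smcomp R (lmul R x) (lmul R y)) (\<lambda>z. masc R x y z)"
    and mlun_monoidal: "sm_trans R R (lmul R \<one>) (id_smfun R) (mlun R)"
    and mrun_monoidal: "sm_trans R R (rmul R \<one>) (id_smfun R) (mrun R)"


section \<open>Right 2-modules\<close>

text \<open>
  \<open>\<odot>\<close> is the action on objects, \<open>\<diamondop>\<close> the action on arrows. Constraints, for objects
  \<open>m, n\<close> of the module and \<open>r, s\<close> of the 2-ring:
  \<open>aasc m r s : (mr)s \<rightarrow> m(rs)\<close>, \<open>aun m : m1 \<rightarrow> m\<close>,
  \<open>adl m r s : mr + ms \<rightarrow> m(r + s)\<close>, \<open>adl0 m : 0 \<rightarrow> m0\<close>,
  \<open>adr m n r : mr + nr \<rightarrow> (m + n)r\<close>, \<open>adr0 r : 0 \<rightarrow> 0r\<close>.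
\<close>

record ('o, 'a, 'r, 's) rmod = "('o, 'a) scg" +
  act :: "'o \<Rightarrow> 'r \<Rightarrow> 'o" (infixl "\<odot>\<index>" 75)
  actA :: "'a \<Rightarrow> 's \<Rightarrow> 'a" (infixl "\<diamondop>\<index>" 75)
  aasc :: "'o \<Rightarrow> 'r \<Rightarrow> 'r \<Rightarrow> 'a"
  aun :: "'o \<Rightarrow> 'a"
  adl :: "'o \<Rightarrow> 'r \<Rightarrow> 'r \<Rightarrow> 'a"
  adl0 :: "'o \<Rightarrow> 'a"
  adr :: "'o \<Rightarrow> 'o \<Rightarrow> 'r \<Rightarrow> 'a"
  adr0 :: "'r \<Rightarrow> 'a"

definition lact ::
  "('r, 's, 'n) ring2_scheme \<Rightarrow> ('o, 'a, 'r, 's, 'm) rmod_scheme \<Rightarrow> 'o \<Rightarrow> ('r, 's, 'o, 'a) smfun" where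
  "lact R M m = \<lparr>fO = \<lambda>r. m \<odot>\<^bsub>M\<^esub> r, fA = \<lambda>a. Ide M m \<diamondop>\<^bsub>M\<^esub> a, fM = adl M m, fU = adl0 M m\<rparr>"

definition ract ::
  "('r, 's, 'n) ring2_scheme \<Rightarrow> ('o, 'a, 'r, 's, 'm) rmod_scheme \<Rightarrow> 'r \<Rightarrow> ('o, 'a, 'o, 'a) smfun" where
  "ract R M r =
     \<lparr>fO = \<lambda>m. m \<odot>\<^bsub>M\<^esub> r, fA = \<lambda>f. f \<diamondop>\<^bsub>M\<^esub> Ide R r, fM = \<lambda>m n. adr M m n r, fU = adr0 M r\<rparr>"

locale rmodule = R?: two_ring R + M?: scg M
  for R :: "('r, 's, 'n) ring2_scheme" (structure)
  and M :: "('o, 'a, 'r, 's, 'm) rmod_scheme" (structure) +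
  assumes act_Obj: "m \<in> Obj M \<Longrightarrow> r \<in> Obj R \<Longrightarrow> m \<odot>\<^bsub>M\<^esub> r \<in> Obj M"
    and actA_hom: "f \<in> ghom M m m' \<Longrightarrow> a \<in> ghom R r r' \<Longrightarrow>
        f \<diamondop>\<^bsub>M\<^esub> a \<in> ghom M (m \<odot>\<^bsub>M\<^esub> r) (m' \<odot>\<^bsub>M\<^esub> r')"
    and actA_Ide: "m \<in> Obj M \<Longrightarrow> r \<in> Obj R \<Longrightarrow> Ide M m \<diamondop>\<^bsub>M\<^esub> Ide R r = Ide M (m \<odot>\<^bsub>M\<^esub> r)"
    and actA_comp: "f \<in> ghom M m m' \<Longrightarrow> f' \<in> ghom M m' m'' \<Longrightarrow>
        a \<in> ghom R r r' \<Longrightarrow> a' \<in> ghom R r' r'' \<Longrightarrow>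
        (f' \<cdot>\<^bsub>M\<^esub> f) \<diamondop>\<^bsub>M\<^esub> (a' \<cdot>\<^bsub>R\<^esub> a) = (f' \<diamondop>\<^bsub>M\<^esub> a') \<cdot>\<^bsub>M\<^esub> (f \<diamondop>\<^bsub>M\<^esub> a)"
    and aasc_hom: "m \<in> Obj M \<Longrightarrow> r \<in> Obj R \<Longrightarrow> s \<in> Obj R \<Longrightarrow>
        aasc M m r s \<in> ghom M ((m \<odot>\<^bsub>M\<^esub> r) \<odot>\<^bsub>M\<^esub> s) (m \<odot>\<^bsub>M\<^esub> (r \<otimes>\<^bsub>R\<^esub> s))"
    and aasc_natural: "f \<in> ghom M m m' \<Longrightarrow> a \<in> ghom R r r' \<Longrightarrow> b \<in> ghom R s s' \<Longrightarrow>
        aasc M m' r' s' \<cdot>\<^bsub>M\<^esub> ((f \<diamondop>\<^bsub>M\<^esub> a) \<diamondop>\<^bsub>M\<^esub> b)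
        = (f \<diamondop>\<^bsub>M\<^esub> (a \<star>\<^bsub>R\<^esub> b)) \<cdot>\<^bsub>M\<^esub> aasc M m r s"
    and act_pentagon: "m \<in> Obj M \<Longrightarrow> r \<in> Obj R \<Longrightarrow> s \<in> Obj R \<Longrightarrow> u \<in> Obj R \<Longrightarrow>
        aasc M m r (s \<otimes>\<^bsub>R\<^esub> u) \<cdot>\<^bsub>M\<^esub> aasc M (m \<odot>\<^bsub>M\<^esub> r) s u
        = (Ide M m \<diamondop>\<^bsub>M\<^esub> masc R r s u) \<cdot>\<^bsub>M\<^esub> aasc M m (r \<otimes>\<^bsub>R\<^esub> s) u
            \<cdot>\<^bsub>M\<^esub> (aasc M m r s \<diamondop>\<^bsub>M\<^esub> Ide R u)"
    and act_triangle: "m \<in> Obj M \<Longrightarrow> r \<in> Obj R \<Longrightarrow>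
        (Ide M m \<diamondop>\<^bsub>M\<^esub> mlun R r) \<cdot>\<^bsub>M\<^esub> aasc M m \<one>\<^bsub>R\<^esub> r = aun M m \<diamondop>\<^bsub>M\<^esub> Ide R r"
    and lact_functor: "m \<in> Obj M \<Longrightarrow> sm_functor R M (lact R M m)"
    and ract_functor: "r \<in> Obj R \<Longrightarrow> sm_functor M M (ract R M r)"
    and lact_trans: "f \<in> ghom M m m' \<Longrightarrow>
        sm_trans R M (lact R M m) (lact R M m') (\<lambda>r. f \<diamondop>\<^bsub>M\<^esub> Ide R r)"
    and ract_trans: "a \<in> ghom R r r' \<Longrightarrow>
        sm_trans M M (ract R M r) (ract R M r') (\<lambda>m. Ide M m \<diamondop>\<^bsub>M\<^esub> a)"
    and act_interchange: "m \<in> Obj M \<Longrightarrow> n \<in> Obj M \<Longrightarrow> r \<in> Obj R \<Longrightarrow> s \<in> Obj R \<Longrightarrow>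
        adr M m n (r \<oplus>\<^bsub>R\<^esub> s) \<cdot>\<^bsub>M\<^esub> (adl M m r s \<uplus>\<^bsub>M\<^esub> adl M n r s)
        = adl M (m \<oplus>\<^bsub>M\<^esub> n) r s \<cdot>\<^bsub>M\<^esub> (adr M m n r \<uplus>\<^bsub>M\<^esub> adr M m n s)
            \<cdot>\<^bsub>M\<^esub> mid M (m \<odot>\<^bsub>M\<^esub> r) (m \<odot>\<^bsub>M\<^esub> s) (n \<odot>\<^bsub>M\<^esub> r) (n \<odot>\<^bsub>M\<^esub> s)"
    and aasc_monoidal1: "r \<in> Obj R \<Longrightarrow> s \<in> Obj R \<Longrightarrow>
        sm_trans M M (smcomp M (ract R M s) (ract R M r)) (ract R M (r \<otimes>\<^bsub>R\<^esub> s)) (\<lambda>m. aasc M m r s)"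
    and aasc_monoidal2: "m \<in> Obj M \<Longrightarrow> s \<in> Obj R \<Longrightarrow>
        sm_trans R M (smcomp M (ract R M s) (lact R M m)) (smcomp M (lact R M m) (rmul R s))
          (\<lambda>r. aasc M m r s)"
    and aasc_monoidal3: "m \<in> Obj M \<Longrightarrow> r \<in> Obj R \<Longrightarrow>
        sm_trans R M (lact R M (m \<odot>\<^bsub>M\<^esub> r)) (smcomp M (lact R M m) (lmul R r)) (\<lambda>s. aasc M m r s)"
    and aun_monoidal: "sm_trans M M (ract R M \<one>\<^bsub>R\<^esub>) (id_smfun M) (aun M)"

text \<open>\<open>fAct F m r : (F m)r \<rightarrow> F (mr)\<close>.\<close>

record ('o, 'a, 'p, 'b, 'r) modfun = "('o, 'a, 'p, 'b) smfun" +
  fAct :: "'o \<Rightarrow> 'r \<Rightarrow> 'b"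

locale rmod_functor = sm_functor M N F + M?: rmodule R M + N?: rmodule R N
  for R :: "('r, 's, 'q) ring2_scheme" (structure)
  and M :: "('o, 'a, 'r, 's, 'm) rmod_scheme" (structure)
  and N :: "('p, 'b, 'r, 's, 'n) rmod_scheme" (structure)
  and F :: "('o, 'a, 'p, 'b, 'r, 'k) modfun_scheme" +
  assumes fAct_hom: "m \<in> Obj M \<Longrightarrow> r \<in> Obj R \<Longrightarrow>
        fAct F m r \<in> ghom N (fO F m \<odot>\<^bsub>N\<^esub> r) (fO F (m \<odot>\<^bsub>M\<^esub> r))"
    and fAct_natural: "f \<in> ghom M m m' \<Longrightarrow> a \<in> ghom R r r' \<Longrightarrow>
        fAct F m' r' \<cdot>\<^bsub>N\<^esub> (fA F f \<diamondop>\<^bsub>N\<^esub> a) = fA F (f \<diamondop>\<^bsub>M\<^esub> a) \<cdot>\<^bsub>N\<^esub> fAct F m r"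
    and fAct_aasc: "m \<in> Obj M \<Longrightarrow> r \<in> Obj R \<Longrightarrow> s \<in> Obj R \<Longrightarrow>
        fA F (aasc M m r s) \<cdot>\<^bsub>N\<^esub> fAct F (m \<odot>\<^bsub>M\<^esub> r) s \<cdot>\<^bsub>N\<^esub> (fAct F m r \<diamondop>\<^bsub>N\<^esub> Ide R s)
        = fAct F m (r \<otimes>\<^bsub>R\<^esub> s) \<cdot>\<^bsub>N\<^esub> aasc N (fO F m) r s"
    and fAct_aun: "m \<in> Obj M \<Longrightarrow>
        fA F (aun M m) \<cdot>\<^bsub>N\<^esub> fAct F m \<one>\<^bsub>R\<^esub> = aun N (fO F m)"
    and fAct_monoidal_left: "r \<in> Obj R \<Longrightarrow>
        sm_trans M N (smcomp N (ract R N r) F) (smcomp N F (ract R M r)) (\<lambda>m. fAct F m r)"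
    and fAct_monoidal_right: "m \<in> Obj M \<Longrightarrow>
        sm_trans R N (lact R N (fO F m)) (smcomp N F (lact R M m)) (\<lambda>r. fAct F m r)"

definition id_modfun ::
  "('r, 's, 'q) ring2_scheme \<Rightarrow> ('o, 'a, 'r, 's, 'm) rmod_scheme \<Rightarrow> ('o, 'a, 'o, 'a, 'r) modfun" where
  "id_modfun R M = smfun.extend (id_smfun M) \<lparr>fAct = \<lambda>m r. Ide M (m \<odot>\<^bsub>M\<^esub> r)\<rparr>"

definition modcomp ::
  "('q, 'c, 'm) scg_scheme \<Rightarrow> ('p, 'b, 'q, 'c, 'r, 'k) modfun_scheme
    \<Rightarrow> ('o, 'a, 'p, 'b, 'r, 'l) modfun_scheme \<Rightarrow> ('o, 'a, 'q, 'c, 'r) modfun" where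
  "modcomp P G F =
     smfun.extend (smcomp P G F) \<lparr>fAct = \<lambda>m r. fA G (fAct F m r) \<cdot>\<^bsub>P\<^esub> fAct G (fO F m) r\<rparr>"

locale rmod_trans = sm_trans M N F G t + F: rmod_functor R M N F + G: rmod_functor R M N G
  for R :: "('r, 's, 'q) ring2_scheme" (structure)
  and M :: "('o, 'a, 'r, 's, 'm) rmod_scheme" (structure)
  and N :: "('p, 'b, 'r, 's, 'n) rmod_scheme" (structure)
  and F :: "('o, 'a, 'p, 'b, 'r, 'k) modfun_scheme"
  and G :: "('o, 'a, 'p, 'b, 'r, 'l) modfun_scheme"
  and t :: "'o \<Rightarrow> 'b" +
  assumes t_fAct: "m \<in> Obj M \<Longrightarrow> r \<in> Obj R \<Longrightarrow>
        t (m \<odot>\<^bsub>M\<^esub> r) \<cdot>\<^bsub>N\<^esub> fAct F m r = fAct G m r \<cdot>\<^bsub>N\<^esub> (t m \<diamondop>\<^bsub>N\<^esub> Ide R r)"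


section \<open>Groupoid-enriched categories and 2-equivalences\<close>

text \<open>\<open>Comp1 T A B C g f\<close> is the composite of \<open>f : A \<rightarrow> B\<close> and \<open>g : B \<rightarrow> C\<close>;
  \<open>Comp2\<close> is the horizontal composition of 2-cells.\<close>

record ('c, 'f, 't) two_cat =
  Cell0 :: "'c set"
  Hom :: "'c \<Rightarrow> 'c \<Rightarrow> ('f, 't) gpd"
  Id1 :: "'c \<Rightarrow> 'f"
  Comp1 :: "'c \<Rightarrow> 'c \<Rightarrow> 'c \<Rightarrow> 'f \<Rightarrow> 'f \<Rightarrow> 'f"
  Comp2 :: "'c \<Rightarrow> 'c \<Rightarrow> 'c \<Rightarrow> 't \<Rightarrow> 't \<Rightarrow> 't"

locale groupoid_enriched =
  fixes T :: "('c, 'f, 't) two_cat"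
  assumes Hom_groupoid: "A \<in> Cell0 T \<Longrightarrow> B \<in> Cell0 T \<Longrightarrow> groupoid (Hom T A B)"
    and Id1_Obj: "A \<in> Cell0 T \<Longrightarrow> Id1 T A \<in> Obj (Hom T A A)"
    and Comp1_Obj: "A \<in> Cell0 T \<Longrightarrow> B \<in> Cell0 T \<Longrightarrow> C \<in> Cell0 T \<Longrightarrow>
        f \<in> Obj (Hom T A B) \<Longrightarrow> g \<in> Obj (Hom T B C) \<Longrightarrow> Comp1 T A B C g f \<in> Obj (Hom T A C)"
    and Comp2_hom: "A \<in> Cell0 T \<Longrightarrow> B \<in> Cell0 T \<Longrightarrow> C \<in> Cell0 T \<Longrightarrow>
        t \<in> ghom (Hom T A B) f f' \<Longrightarrow> s \<in> ghom (Hom T B C) g g' \<Longrightarrow>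
        Comp2 T A B C s t \<in> ghom (Hom T A C) (Comp1 T A B C g f) (Comp1 T A B C g' f')"
    and Comp2_Ide: "A \<in> Cell0 T \<Longrightarrow> B \<in> Cell0 T \<Longrightarrow> C \<in> Cell0 T \<Longrightarrow>
        f \<in> Obj (Hom T A B) \<Longrightarrow> g \<in> Obj (Hom T B C) \<Longrightarrow>
        Comp2 T A B C (Ide (Hom T B C) g) (Ide (Hom T A B) f) = Ide (Hom T A C) (Comp1 T A B C g f)"
    and Comp2_comp: "A \<in> Cell0 T \<Longrightarrow> B \<in> Cell0 T \<Longrightarrow> C \<in> Cell0 T \<Longrightarrow>
        t \<in> ghom (Hom T A B) f f' \<Longrightarrow> t' \<in> ghom (Hom T A B) f' f'' \<Longrightarrow>
        s \<in> ghom (Hom T B C) g g' \<Longrightarrow> s' \<in> ghom (Hom T B C) g' g'' \<Longrightarrow>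
        Comp2 T A B C (s' \<cdot>\<^bsub>Hom T B C\<^esub> s) (t' \<cdot>\<^bsub>Hom T A B\<^esub> t)
        = Comp2 T A B C s' t' \<cdot>\<^bsub>Hom T A C\<^esub> Comp2 T A B C s t"
    and Comp1_assoc: "A \<in> Cell0 T \<Longrightarrow> B \<in> Cell0 T \<Longrightarrow> C \<in> Cell0 T \<Longrightarrow> D \<in> Cell0 T \<Longrightarrow>
        f \<in> Obj (Hom T A B) \<Longrightarrow> g \<in> Obj (Hom T B C) \<Longrightarrow> h \<in> Obj (Hom T C D) \<Longrightarrow>
        Comp1 T A B D (Comp1 T B C D h g) f = Comp1 T A C D h (Comp1 T A B C g f)"
    and Comp2_assoc: "A \<in> Cell0 T \<Longrightarrow> B \<in> Cell0 T \<Longrightarrow> C \<in> Cell0 T \<Longrightarrow> D \<in> Cell0 T \<Longrightarrow>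
        r \<in> Arr (Hom T A B) \<Longrightarrow> s \<in> Arr (Hom T B C) \<Longrightarrow> t \<in> Arr (Hom T C D) \<Longrightarrow>
        Comp2 T A B D (Comp2 T B C D t s) r = Comp2 T A C D t (Comp2 T A B C s r)"
    and Comp1_Id1_left: "A \<in> Cell0 T \<Longrightarrow> B \<in> Cell0 T \<Longrightarrow> f \<in> Obj (Hom T A B) \<Longrightarrow>
        Comp1 T A B B (Id1 T B) f = f"
    and Comp1_Id1_right: "A \<in> Cell0 T \<Longrightarrow> B \<in> Cell0 T \<Longrightarrow> f \<in> Obj (Hom T A B) \<Longrightarrow>
        Comp1 T A A B f (Id1 T A) = f"
    and Comp2_Id1_left: "A \<in> Cell0 T \<Longrightarrow> B \<in> Cell0 T \<Longrightarrow> t \<in> Arr (Hom T A B) \<Longrightarrow>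
        Comp2 T A B B (Ide (Hom T B B) (Id1 T B)) t = t"
    and Comp2_Id1_right: "A \<in> Cell0 T \<Longrightarrow> B \<in> Cell0 T \<Longrightarrow> t \<in> Arr (Hom T A B) \<Longrightarrow>
        Comp2 T A A B t (Ide (Hom T A A) (Id1 T A)) = t"

definition equivalent_objects :: "('c, 'f, 't) two_cat \<Rightarrow> 'c \<Rightarrow> 'c \<Rightarrow> bool" where
  "equivalent_objects T A B \<longleftrightarrow>
     (\<exists>f \<in> Obj (Hom T A B). \<exists>g \<in> Obj (Hom T B A).
        ghom (Hom T A A) (Comp1 T A B A g f) (Id1 T A) \<noteq> {}
        \<and> ghom (Hom T B B) (Comp1 T B A B f g) (Id1 T B) \<noteq> {})"

text \<open>\<open>pC P A B C g f : P g \<circ> P f \<rightarrow> P (g \<circ> f)\<close> and \<open>pU P A : 1 \<rightarrow> P 1\<close>.\<close>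

record ('c, 'f, 't, 'd, 'g, 'u) psfun =
  pO :: "'c \<Rightarrow> 'd"
  pH :: "'c \<Rightarrow> 'c \<Rightarrow> ('f, 't, 'g, 'u) functr"
  pC :: "'c \<Rightarrow> 'c \<Rightarrow> 'c \<Rightarrow> 'f \<Rightarrow> 'f \<Rightarrow> 'u"
  pU :: "'c \<Rightarrow> 'u"

locale pseudo_functor = S?: groupoid_enriched S + T?: groupoid_enriched T
  for S :: "('c, 'f, 't) two_cat" and T :: "('d, 'g, 'u) two_cat" +
  fixes P :: "('c, 'f, 't, 'd, 'g, 'u) psfun"
  assumes pO_Cell0: "A \<in> Cell0 S \<Longrightarrow> pO P A \<in> Cell0 T"
    and pH_functor: "A \<in> Cell0 S \<Longrightarrow> B \<in> Cell0 S \<Longrightarrow>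
        gfunctor (Hom S A B) (Hom T (pO P A) (pO P B)) (pH P A B)"
    and pC_hom: "A \<in> Cell0 S \<Longrightarrow> B \<in> Cell0 S \<Longrightarrow> C \<in> Cell0 S \<Longrightarrow>
        f \<in> Obj (Hom S A B) \<Longrightarrow> g \<in> Obj (Hom S B C) \<Longrightarrow>
        pC P A B C g f \<in> ghom (Hom T (pO P A) (pO P C))
          (Comp1 T (pO P A) (pO P B) (pO P C) (fO (pH P B C) g) (fO (pH P A B) f))
          (fO (pH P A C) (Comp1 S A B C g f))"
    and pC_natural: "A \<in> Cell0 S \<Longrightarrow> B \<in> Cell0 S \<Longrightarrow> C \<in> Cell0 S \<Longrightarrow>
        t \<in> ghom (Hom S A B) f f' \<Longrightarrow> s \<in> ghom (Hom S B C) g g' \<Longrightarrow>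
        pC P A B C g' f' \<cdot>\<^bsub>Hom T (pO P A) (pO P C)\<^esub>
          Comp2 T (pO P A) (pO P B) (pO P C) (fA (pH P B C) s) (fA (pH P A B) t)
        = fA (pH P A C) (Comp2 S A B C s t) \<cdot>\<^bsub>Hom T (pO P A) (pO P C)\<^esub> pC P A B C g f"
    and pU_hom: "A \<in> Cell0 S \<Longrightarrow>
        pU P A \<in> ghom (Hom T (pO P A) (pO P A)) (Id1 T (pO P A)) (fO (pH P A A) (Id1 S A))"
    and pC_assoc: "A \<in> Cell0 S \<Longrightarrow> B \<in> Cell0 S \<Longrightarrow> C \<in> Cell0 S \<Longrightarrow> D \<in> Cell0 S \<Longrightarrow>
        f \<in> Obj (Hom S A B) \<Longrightarrow> g \<in> Obj (Hom S B C) \<Longrightarrow> h \<in> Obj (Hom S C D) \<Longrightarrow>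
        pC P A C D h (Comp1 S A B C g f) \<cdot>\<^bsub>Hom T (pO P A) (pO P D)\<^esub>
          Comp2 T (pO P A) (pO P C) (pO P D)
            (Ide (Hom T (pO P C) (pO P D)) (fO (pH P C D) h)) (pC P A B C g f)
        = pC P A B D (Comp1 S B C D h g) f \<cdot>\<^bsub>Hom T (pO P A) (pO P D)\<^esub>
          Comp2 T (pO P A) (pO P B) (pO P D)
            (pC P B C D h g) (Ide (Hom T (pO P A) (pO P B)) (fO (pH P A B) f))"
    and pC_pU_left: "A \<in> Cell0 S \<Longrightarrow> B \<in> Cell0 S \<Longrightarrow> f \<in> Obj (Hom S A B) \<Longrightarrow>
        pC P A B B (Id1 S B) f \<cdot>\<^bsub>Hom T (pO P A) (pO P B)\<^esub>
          Comp2 T (pO P A) (pO P B) (pO P B)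
            (pU P B) (Ide (Hom T (pO P A) (pO P B)) (fO (pH P A B) f))
        = Ide (Hom T (pO P A) (pO P B)) (fO (pH P A B) f)"
    and pC_pU_right: "A \<in> Cell0 S \<Longrightarrow> B \<in> Cell0 S \<Longrightarrow> f \<in> Obj (Hom S A B) \<Longrightarrow>
        pC P A A B f (Id1 S A) \<cdot>\<^bsub>Hom T (pO P A) (pO P B)\<^esub>
          Comp2 T (pO P A) (pO P A) (pO P B)
            (Ide (Hom T (pO P A) (pO P B)) (fO (pH P A B) f)) (pU P A)
        = Ide (Hom T (pO P A) (pO P B)) (fO (pH P A B) f)"

locale two_equivalence = pseudo_functor S T P
  for S :: "('c, 'f, 't) two_cat" and T :: "('d, 'g, 'u) two_cat"
  and P :: "('c, 'f, 't, 'd, 'g, 'u) psfun" +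
  assumes pH_equivalence: "A \<in> Cell0 S \<Longrightarrow> B \<in> Cell0 S \<Longrightarrow>
        equivalence (Hom S A B) (Hom T (pO P A) (pO P B)) (pH P A B)"
    and essentially_surjective: "D \<in> Cell0 T \<Longrightarrow>
        \<exists>A \<in> Cell0 S. equivalent_objects T (pO P A) D"

definition two_equivalent :: "('c, 'f, 't) two_cat \<Rightarrow> ('d, 'g, 'u) two_cat \<Rightarrow> bool" where
  "two_equivalent S T \<longleftrightarrow> (\<exists>P. two_equivalence S T P)"


section \<open>The 2-categories of symmetric categorical groups and of right 2-modules\<close>

text \<open>
  Functors and tracks are given by HOL functions on whole types. To make their equality the equality
  of functors and tracks, the 1-cells and 2-cells are normalised to be \<^const>\<open>undefined\<close> off the
  carriers (as with \<^const>\<open>extensional\<close>); \<open>smres\<close> and \<open>modres\<close> do so.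
  A track carries its source and its target.
\<close>

record ('f, 'd) track =
  src :: 'f
  trg :: 'f
  cmp :: 'd

definition smres ::
  "('o, 'a, 'm) scg_scheme \<Rightarrow> ('o, 'a, 'p, 'b, 'k) smfun_scheme \<Rightarrow> ('o, 'a, 'p, 'b, 'k) smfun_scheme" where
  "smres A F =
     F\<lparr>fO := restrict (fO F) (Obj A),
       fA := restrict (fA F) (Arr A),
       fM := (\<lambda>x \<in> Obj A. \<lambda>y \<in> Obj A. fM F x y)\<rparr>"

definition modres ::
  "('r, 's, 'n) ring2_scheme \<Rightarrow> ('o, 'a, 'm) scg_scheme \<Rightarrow> ('o, 'a, 'p, 'b, 'r, 'k) modfun_scheme
    \<Rightarrow> ('o, 'a, 'p, 'b, 'r, 'k) modfun_scheme" where
  "modres R M F = (smres M F)\<lparr>fAct := (\<lambda>m \<in> Obj M. \<lambda>r \<in> Obj R. fAct F m r)\<rparr>"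

definition track_gpd ::
  "('o, 'a, 'm) gpd_scheme \<Rightarrow> ('p, 'b, 'n) gpd_scheme \<Rightarrow> ('o, 'a, 'p, 'b, 'k) functr_scheme set
    \<Rightarrow> (('o, 'a, 'p, 'b, 'k) functr_scheme \<Rightarrow> ('o, 'a, 'p, 'b, 'k) functr_scheme \<Rightarrow> ('o \<Rightarrow> 'b) \<Rightarrow> bool)
    \<Rightarrow> (('o, 'a, 'p, 'b, 'k) functr_scheme, (('o, 'a, 'p, 'b, 'k) functr_scheme, 'o \<Rightarrow> 'b) track) gpd"
  where
  "track_gpd A B X tr =
     \<lparr>Obj = X,
      Arr = {t. src t \<in> X \<and> trg t \<in> X \<and> cmp t \<in> extensional (Obj A) \<and> tr (src t) (trg t) (cmp t)},
      Dom = src,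
      Cod = trg,
      Ide = \<lambda>F. \<lparr>src = F, trg = F, cmp = \<lambda>x \<in> Obj A. Ide B (fO F x)\<rparr>,
      comp = \<lambda>s t. \<lparr>src = src t, trg = trg s, cmp = \<lambda>x \<in> Obj A. cmp s x \<cdot>\<^bsub>B\<^esub> cmp t x\<rparr>\<rparr>"

definition track_hcomp ::
  "('o, 'a, 'm) gpd_scheme \<Rightarrow> ('q, 'c, 'n) gpd_scheme \<Rightarrow> ('p, 'b, 'q, 'c, 'k) functr_scheme
    \<Rightarrow> ('o, 'a, 'p, 'b, 'l) functr_scheme \<Rightarrow> ('p \<Rightarrow> 'c) \<Rightarrow> ('o \<Rightarrow> 'b) \<Rightarrow> 'o \<Rightarrow> 'c" where
  "track_hcomp A C G F' s t = (\<lambda>x \<in> Obj A. s (fO F' x) \<cdot>\<^bsub>C\<^esub> fA G (t x))"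

type_synonym ('o, 'a) scg_two_cat =
  "(('o, 'a) scg, ('o, 'a, 'o, 'a) smfun, (('o, 'a, 'o, 'a) smfun, 'o \<Rightarrow> 'a) track) two_cat"

definition SCG :: "('o, 'a) scg_two_cat" where
  "SCG =
     \<lparr>Cell0 = {A. scg A},
      Hom = \<lambda>A B. track_gpd A B {F. sm_functor A B F \<and> smres A F = F} (sm_trans A B),
      Id1 = \<lambda>A. smres A (id_smfun A),
      Comp1 = \<lambda>A B C G F. smres A (smcomp C G F),
      Comp2 = \<lambda>A B C s t.
        \<lparr>src = smres A (smcomp C (src s) (src t)),
         trg = smres A (smcomp C (trg s) (trg t)),
         cmp = track_hcomp A C (src s) (trg t) (cmp s) (cmp t)\<rparr>\<rparr>"

type_synonym ('o, 'a, 'r, 's) rmod_two_cat =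
  "(('o, 'a, 'r, 's) rmod, ('o, 'a, 'o, 'a, 'r) modfun,
    (('o, 'a, 'o, 'a, 'r) modfun, 'o \<Rightarrow> 'a) track) two_cat"

definition RMod :: "('r, 's, 'n) ring2_scheme \<Rightarrow> ('o, 'a, 'r, 's) rmod_two_cat" where
  "RMod R =
     \<lparr>Cell0 = {M. rmodule R M},
      Hom = \<lambda>M N. track_gpd M N {F. rmod_functor R M N F \<and> modres R M F = F} (rmod_trans R M N),
      Id1 = \<lambda>M. modres R M (id_modfun R M),
      Comp1 = \<lambda>M N P G F. modres R M (modcomp P G F),
      Comp2 = \<lambda>M N P s t.
        \<lparr>src = modres R M (modcomp P (src s) (src t)),
         trg = modres R M (modcomp P (trg s) (trg t)),
         cmp = track_hcomp M P (src s) (trg t) (cmp s) (cmp t)\<rparr>\<rparr>"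


section \<open>The 2-ring \<open>\<Phi>\<close>\<close>

text \<open>
  The arrow \<open>(n, a)\<close> is the automorphism \<open>a \<epsilon>\<^sub>n\<close> of the integer \<open>n\<close>, with \<open>a \<in> \<int>/2\<close>.

  All constraints other than \<open>sym\<close> are identities, with one exception. The two distributivity
  constraints cannot both be identities: the two expansions of \<open>(x + x')(y + y')\<close>
  differ by the canonical isomorphism exchanging \<open>xy'\<close> and \<open>x'y\<close>, which is \<open>xx'yy' \<epsilon>\<close> and does not
  vanish for \<open>x = x' = y = y' = 1\<close> (\<open>not_two_ring_Phi_trivial_ldist\<close> below). With
  \<open>(x + y)z = xz + yz\<close> an identity, the constraint \<open>xy + xz \<rightarrow> x(y + z)\<close> is
  \<open>(x choose 2) yz \<epsilon>\<close>, the sign of the permutation that rearranges \<open>x\<close> copies of \<open>y + z\<close>.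
\<close>

definition choose2 :: "int \<Rightarrow> int" where "choose2 n = n * (n - 1) div 2"

definition Phi :: "(int, int \<times> bit) ring2" where
  "Phi =
     \<lparr>Obj = UNIV,
      Arr = UNIV,
      Dom = fst,
      Cod = fst,
      Ide = \<lambda>n. (n, 0),
      comp = \<lambda>g f. (fst f, snd g + snd f),
      add = \<lambda>n m. n + m,
      addA = \<lambda>f g. (fst f + fst g, snd f + snd g),
      zero = 0,
      asc = \<lambda>n m k. (n + m + k, 0),
      lun = \<lambda>n. (n, 0),
      run = \<lambda>n. (n, 0),
      sym = \<lambda>n m. (n + m, of_int (n * m)),
      mul = \<lambda>n m. n * m,
      mulA = \<lambda>f g. (fst f * fst g, snd f * of_int (fst g) + of_int (fst f) * snd g),
      one = 1,
      masc = \<lambda>n m k. (n * m * k, 0),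
      mlun = \<lambda>n. (n, 0),
      mrun = \<lambda>n. (n, 0),
      ldist = \<lambda>n m k. (n * (m + k), of_int (choose2 n * (m * k))),
      lzero = \<lambda>n. (0, 0),
      rdist = \<lambda>n m k. ((n + m) * k, 0),
      rzero = \<lambda>n. (0, 0)\<rparr>"

lemma choose2_double: "2 * (n * (n - 1) div 2) = n * (n - 1)" for n :: int
  by (rule dvd_mult_div_cancel) auto

lemma choose2_add: "(m + n) * (m + n - 1) div 2 = m * (m - 1) div 2 + n * (n - 1) div 2 + m * n"
  for m n :: int
proof -
  have "2 * ((m + n) * (m + n - 1) div 2)
        = 2 * (m * (m - 1) div 2) + 2 * (n * (n - 1) div 2) + 2 * (m * n)"
    unfolding choose2_double by (simp add: algebra_simps)
  then show ?thesis by presburger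
qed

lemma choose2_mult:
  "(m * n) * (m * n - 1) div 2 = m * (n * (n - 1) div 2) + n * n * (m * (m - 1) div 2)" for m n :: int
proof -
  have "2 * ((m * n) * (m * n - 1) div 2)
        = m * (2 * (n * (n - 1) div 2)) + n * n * (2 * (m * (m - 1) div 2))"
    unfolding choose2_double by (simp add: algebra_simps)
  also have "\<dots> = 2 * (m * (n * (n - 1) div 2) + n * n * (m * (m - 1) div 2))"
    by (simp only: distrib_left mult.left_commute mult.commute)
  finally show ?thesis by (simp only: mult_cancel_left) simp
qed

lemma bit_idem: "a * (a * b) = a * b" "a * a = a" for a b :: bit
  by (cases a; simp)+

lemma bit_add_self: "a + a = 0" "a + (a + b) = b" for a b :: bit
  by (cases a; cases b; simp)+

declare add_bit_eq_xor [simp del] mult_bit_eq_and [simp del]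

lemmas bit_simps = bit_add_self bit_idem algebra_simps

lemma choose2_simps:
  "choose2 (m + n) = choose2 m + choose2 n + m * n"
  "choose2 (m * n) = m * choose2 n + n * n * choose2 m"
  "choose2 0 = 0" "choose2 1 = 0"
  by (simp_all add: choose2_def choose2_add choose2_mult)

lemma Phi_sel [simp]:
  "Obj Phi = UNIV" "Arr Phi = UNIV" "Dom Phi f = fst f" "Cod Phi f = fst f" "Ide Phi n = (n, 0)"
  "g \<cdot>\<^bsub>Phi\<^esub> f = (fst f, snd g + snd f)" "n \<oplus>\<^bsub>Phi\<^esub> m = n + m"
  "f \<uplus>\<^bsub>Phi\<^esub> g = (fst f + fst g, snd f + snd g)" "\<zero>\<^bsub>Phi\<^esub> = 0"
  "asc Phi n m k = (n + m + k, 0)" "lun Phi n = (n, 0)" "run Phi n = (n, 0)"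
  "sym Phi n m = (n + m, of_int (n * m))" "n \<otimes>\<^bsub>Phi\<^esub> m = n * m"
  "f \<star>\<^bsub>Phi\<^esub> g = (fst f * fst g, snd f * of_int (fst g) + of_int (fst f) * snd g)"
  "\<one>\<^bsub>Phi\<^esub> = 1" "masc Phi n m k = (n * m * k, 0)" "mlun Phi n = (n, 0)" "mrun Phi n = (n, 0)"
  "ldist Phi n m k = (n * (m + k), of_int (choose2 n * (m * k)))" "lzero Phi n = (0, 0)"
  "rdist Phi n m k = ((n + m) * k, 0)" "rzero Phi n = (0, 0)"
  by (simp_all add: Phi_def)

lemma Phi_ghom [simp]: "f \<in> ghom Phi n m \<longleftrightarrow> n = m \<and> fst f = n"
  by (auto simp: ghom_def)

lemma Phi_groupoid: "groupoid Phi"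
proof
  show "\<exists>g \<in> ghom Phi y x. g \<cdot>\<^bsub>Phi\<^esub> f = Ide Phi x \<and> f \<cdot>\<^bsub>Phi\<^esub> g = Ide Phi y"
    if "f \<in> ghom Phi x y" for f x y
    using that by (intro bexI[of _ f]) (auto simp: bit_simps)
qed (auto simp: bit_simps prod_eq_iff)

lemma Phi_ginv: "ginv Phi f = f"
  unfolding ginv_def
proof (rule the_equality)
  fix g
  assume "g \<in> ghom Phi (Cod Phi f) (Dom Phi f)
     \<and> g \<cdot>\<^bsub>Phi\<^esub> f = Ide Phi (Dom Phi f) \<and> f \<cdot>\<^bsub>Phi\<^esub> g = Ide Phi (Cod Phi f)"
  then have "fst g = fst f" "snd f + snd g = 0" by auto
  then show "g = f"
    by (metis bit_add_self(2) add.right_neutral prod_eq_iff)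
qed (auto simp: bit_simps)

lemma Phi_gfunctor:
  "gfunctor Phi Phi F \<longleftrightarrow> (\<forall>n a. fst (fA F (n, a)) = fO F n \<and> snd (fA F (n, 0)) = 0
     \<and> (\<forall>b. snd (fA F (n, a + b)) = snd (fA F (n, a)) + snd (fA F (n, b))))"
  (is "?l \<longleftrightarrow> ?r")
proof
  assume ?l
  then interpret gfunctor Phi Phi F .
  show ?r
  proof (intro allI conjI)
    fix n a b
    show "fst (fA F (n, a)) = fO F n" using fA_hom[of "(n, a)" n n] by simp
    show "snd (fA F (n, 0)) = 0" using fA_Ide[of n] by simp
    show "snd (fA F (n, a + b)) = snd (fA F (n, a)) + snd (fA F (n, b))"
      using fA_comp[of "(n, b)" n n "(n, a)" n] by simp
  qed
next
  assume ?r
  then show ?l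
    by (intro gfunctor.intro gfunctor_axioms.intro Phi_groupoid) (auto simp: prod_eq_iff)
qed

lemma Phi_translation: "equivalence Phi Phi (translation Phi x)"
proof -
  have nt: "nat_trans Phi Phi F G (\<lambda>y. (y, 0))"
    if "gfunctor Phi Phi F" "gfunctor Phi Phi G"
      "\<And>f. fA F f = f" "\<And>f. fA G f = f" "\<And>y. fO F y = y" "\<And>y. fO G y = y"
    for F G :: "(int, int \<times> bit, int, int \<times> bit) functr"
    using that by (intro nat_trans.intro nat_trans_axioms.intro) auto
  show ?thesis
    unfolding equivalence_def
    by (intro conjI exI[of _ "translation Phi (-x)"] exI[of _ "\<lambda>y. (y, 0)"] nt;
      simp add: Phi_gfunctor translation_def functr_comp_def id_functr_def)
qed

lemma Phi_scg: "scg Phi"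
  by (intro scg.intro scg_axioms.intro Phi_groupoid Phi_translation) (auto simp: bit_simps)

lemma Phi_mid: "mid Phi a b c d = (a + b + c + d, of_int (b * c))"
  by (simp add: mid_def Phi_ginv)

lemma Phi_sm_functor:
  "gfunctor Phi Phi F \<Longrightarrow> sm_functor_axioms Phi Phi F \<Longrightarrow> sm_functor Phi Phi F"
  by (intro sm_functor.intro Phi_scg)

lemma Phi_lmul: "sm_functor Phi Phi (lmul Phi x)"
  by (intro Phi_sm_functor sm_functor_axioms.intro)
    (auto simp: Phi_gfunctor lmul_def choose2_simps bit_simps)

lemma Phi_rmul: "sm_functor Phi Phi (rmul Phi x)"
  by (intro Phi_sm_functor sm_functor_axioms.intro)
    (auto simp: Phi_gfunctor rmul_def bit_simps)

lemma Phi_id_smfun: "sm_functor Phi Phi (id_smfun Phi)"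
  by (intro Phi_sm_functor sm_functor_axioms.intro)
    (auto simp: Phi_gfunctor id_smfun_def bit_simps)

lemma Phi_smcomp:
  "sm_functor Phi Phi (smcomp Phi (rmul Phi x) (rmul Phi y))"
  "sm_functor Phi Phi (smcomp Phi (lmul Phi x) (rmul Phi y))"
  "sm_functor Phi Phi (smcomp Phi (rmul Phi x) (lmul Phi y))"
  "sm_functor Phi Phi (smcomp Phi (lmul Phi x) (lmul Phi y))"
  by (intro Phi_sm_functor sm_functor_axioms.intro;
    simp add: Phi_gfunctor smcomp_def lmul_def rmul_def choose2_simps bit_simps)+

lemma Phi_sm_trans:
  "sm_functor Phi Phi F \<Longrightarrow> sm_functor Phi Phi G \<Longrightarrow> nat_trans_axioms Phi Phi F G t
    \<Longrightarrow> sm_trans_axioms Phi Phi F G t \<Longrightarrow> sm_trans Phi Phi F G t"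
  by (intro sm_trans.intro nat_trans.intro sm_functor.axioms)

theorem two_ring_Phi: "two_ring Phi"
  by (intro two_ring.intro two_ring_axioms.intro Phi_scg Phi_lmul Phi_rmul Phi_sm_trans
      nat_trans_axioms.intro sm_trans_axioms.intro Phi_smcomp Phi_id_smfun)
    (auto simp: Phi_mid smcomp_def lmul_def rmul_def id_smfun_def choose2_simps bit_simps)

lemma not_two_ring_Phi_trivial_ldist:
  "\<not> two_ring (Phi\<lparr>ldist := \<lambda>n m k. (n * (m + k), 0)\<rparr>)" (is "\<not> two_ring ?R")
proof
  assume "two_ring ?R"
  then have "rdist ?R 1 1 (1 \<oplus>\<^bsub>?R\<^esub> 1) \<cdot>\<^bsub>?R\<^esub> (ldist ?R 1 1 1 \<uplus>\<^bsub>?R\<^esub> ldist ?R 1 1 1)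
      = ldist ?R (1 \<oplus>\<^bsub>?R\<^esub> 1) 1 1 \<cdot>\<^bsub>?R\<^esub> (rdist ?R 1 1 1 \<uplus>\<^bsub>?R\<^esub> rdist ?R 1 1 1)
          \<cdot>\<^bsub>?R\<^esub> mid ?R (1 \<otimes>\<^bsub>?R\<^esub> 1) (1 \<otimes>\<^bsub>?R\<^esub> 1) (1 \<otimes>\<^bsub>?R\<^esub> 1) (1 \<otimes>\<^bsub>?R\<^esub> 1)"
    by (rule two_ring.interchange) (simp_all add: Phi_def)
  moreover have "mid ?R a b c d = mid Phi a b c d" for a b c d
    by (simp add: mid_def ginv_def ghom_def Phi_def)
  ultimately show False
    by (simp add: Phi_mid)
qed

end

theory Submission
  imports Defs
begin

text \<open>
  The symmetric categorical group underlying \<open>\<Phi>\<close> is free on the object 1: there is a symmetric monoidal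
  functor \<open>\<Phi> \<rightarrow> A\<close> with any prescribed value at 1, and a monoidal transformation between two such
  functors is the same thing as an arrow between their values at 1. So an identity between
  transformations out of \<open>\<Phi>\<close> may be checked at 1.

  A symmetric categorical group \<open>A\<close> becomes a \<open>\<Phi>\<close>-module when \<open>m \<odot> -\<close> is a functor \<open>\<Phi> \<rightarrow> A\<close> with value
      \<open>m\<close> at 1;
  the structure isomorphisms and their coherence come from freeness. Also by freeness, a symmetric
  monoidal functor between \<open>\<Phi>\<close>-modules underlies exactly one morphism of modules, and every monoidal
  transformation is a track. Hence the construction is bijective on 1-cells and on 2-cells, and every
  \<open>\<Phi>\<close>-module is equivalent to the one constructed on its underlying symmetric categorical group.
\<close>

section \<open>Groupoids and symmetric categorical groups\<close>

text \<open>Freeness of \<open>Phi\<close> has to reach negative integers and the exact value at 1.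
  Both come from invertibility of objects: translations are fully faithful and essentially
  surjective, so a recursion from n to n + 1 can also be run backwards, and the inductions over the
  integers have equivalences as steps. The generator \<epsilon> must go to the symmetry of m + m,
  which is the translate of a loop at zero of order two; the quadratic symmetry constraint of
  \<open>Phi\<close> then follows from additivity of the hexagon in each variable.

  Uniqueness applies to a module law only once both its sides are known to be monoidal
  transformations. For laws about sums this requires that the pointwise sum of two symmetric
  monoidal functors is again one, which rests on the coherence of the interchange
  \<open>mid\<close>.

  The module is put on the carriers of the given symmetric categorical group. A lifted functor then
  acquires only an action constraint, which is unique; hence the pseudo-functor is strict, and the
  identity functor compares a module with the one rebuilt from it.\<close>

lemma ghom_iff [simp]: "f \<in> ghom G x y \<longleftrightarrow> f \<in> Arr G \<and> Dom G f = x \<and> Cod G f = y"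
  by (simp add: ghom_def)

context groupoid begin

lemma Dom_Cod_Obj [simp]: "f \<in> Arr G \<Longrightarrow> Dom G f \<in> Obj G" "f \<in> Arr G \<Longrightarrow> Cod G f \<in> Obj G"
  by (simp_all add: Dom_Obj Cod_Obj)

lemma Ide_simps [simp]:
  assumes "x \<in> Obj G"
  shows "Ide G x \<in> Arr G" "Dom G (Ide G x) = x" "Cod G (Ide G x) = x"
  using Ide_hom[OF assms] by auto

lemma comp_simps [simp]:
  assumes "f \<in> Arr G" "g \<in> Arr G" "Dom G g = Cod G f"
  shows "g \<cdot> f \<in> Arr G" "Dom G (g \<cdot> f) = Dom G f" "Cod G (g \<cdot> f) = Cod G g"
  using comp_hom[of f "Dom G f" "Cod G f" g "Cod G g"] assms by auto

lemma comp_assoc_simp [simp]: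
  assumes "f \<in> Arr G" "g \<in> Arr G" "h \<in> Arr G" "Dom G g = Cod G f" "Dom G h = Cod G g"
  shows "(h \<cdot> g) \<cdot> f = h \<cdot> (g \<cdot> f)"
  using assms by (intro comp_assoc[of f "Dom G f" "Cod G f" g "Cod G g" h "Cod G h"]) auto

lemma comp_Ide [simp]:
  "f \<in> Arr G \<Longrightarrow> Dom G f = x \<Longrightarrow> f \<cdot> Ide G x = f"
  "f \<in> Arr G \<Longrightarrow> Cod G f = x \<Longrightarrow> Ide G x \<cdot> f = f"
  using comp_Ide_right comp_Ide_left by auto

lemma ginv_ex1:
  assumes "f \<in> Arr G"
  shows "\<exists>!g. g \<in> ghom G (Cod G f) (Dom G f)
     \<and> g \<cdot> f = Ide G (Dom G f) \<and> f \<cdot> g = Ide G (Cod G f)"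
proof -
  obtain g where g: "g \<in> ghom G (Cod G f) (Dom G f)"
    "g \<cdot> f = Ide G (Dom G f)" "f \<cdot> g = Ide G (Cod G f)"
    using inverse_ex[of f "Dom G f" "Cod G f"] assms by auto
  show ?thesis
  proof (rule ex1I[of _ g])
    fix h assume h: "h \<in> ghom G (Cod G f) (Dom G f)
     \<and> h \<cdot> f = Ide G (Dom G f) \<and> f \<cdot> h = Ide G (Cod G f)"
    have "h = h \<cdot> (f \<cdot> g)" using g(3) h assms by simp
    also have "\<dots> = (h \<cdot> f) \<cdot> g" using g h assms by (subst comp_assoc_simp) auto
    also have "\<dots> = g" using g h assms by simp
    finally show "h = g" .
  qed (use g in auto)
qed

lemma ginv_simps [simp]:
  assumes "f \<in> Arr G"
  shows "ginv G f \<in> Arr G" "Dom G (ginv G f) = Cod G f" "Cod G (ginv G f) = Dom G f"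
    "ginv G f \<cdot> f = Ide G (Dom G f)" "f \<cdot> ginv G f = Ide G (Cod G f)"
  using theI'[OF ginv_ex1[OF assms]] unfolding ginv_def[symmetric] by auto

lemma ginv_tail [simp]:
  assumes "f \<in> Arr G" "h \<in> Arr G"
  shows "Cod G h = Dom G f \<Longrightarrow> ginv G f \<cdot> (f \<cdot> h) = h"
    "Cod G h = Cod G f \<Longrightarrow> f \<cdot> (ginv G f \<cdot> h) = h"
  using assms by (simp_all flip: comp_assoc_simp)

lemma cancel_left:
  assumes "f \<in> Arr G" "g \<in> Arr G" "h \<in> Arr G" "Dom G h = Cod G f" "Dom G h = Cod G g"
  shows "h \<cdot> f = h \<cdot> g \<longleftrightarrow> f = g"
proof
  assume eq: "h \<cdot> f = h \<cdot> g"
  have "f = ginv G h \<cdot> (h \<cdot> f)" using assms by simp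
  also have "\<dots> = g" unfolding eq using assms by simp
  finally show "f = g" .
qed simp

lemma cancel_right:
  assumes "f \<in> Arr G" "g \<in> Arr G" "h \<in> Arr G" "Dom G f = Cod G h" "Dom G g = Cod G h"
  shows "f \<cdot> h = g \<cdot> h \<longleftrightarrow> f = g"
proof
  assume eq: "f \<cdot> h = g \<cdot> h"
  have "f = (f \<cdot> h) \<cdot> ginv G h" using assms by simp
  also have "\<dots> = g" unfolding eq using assms by simp
  finally show "f = g" .
qed simp

text \<open>Composites are kept nested to the right, where \<open>g \<cdot> f\<close> is not a
  subterm of \<open>g \<cdot> (f \<cdot> r)\<close>. This form rewrites it there; many naturality
  laws below are paired with such a tail version.\<close>

lemma comp_reduce:
  assumes "g \<cdot> f = k" "f \<in> Arr G" "g \<in> Arr G" "r \<in> Arr G" "Dom G g = Cod G f" "Dom G f = Cod G r"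
  shows "g \<cdot> (f \<cdot> r) = k \<cdot> r"
  using assms(2-) by (simp flip: assms(1))

lemma ginv_unique:
  assumes "f \<in> Arr G" "g \<in> Arr G" "Dom G g = Cod G f" "g \<cdot> f = Ide G (Dom G f)"
  shows "ginv G f = g"
proof -
  have "g \<cdot> (f \<cdot> ginv G f) = Ide G (Dom G f) \<cdot> ginv G f"
    using assms by (intro comp_reduce) auto
  then show ?thesis using assms by simp
qed

lemma ginv_comp [simp]:
  assumes "f \<in> Arr G" "g \<in> Arr G" "Dom G g = Cod G f"
  shows "ginv G (g \<cdot> f) = ginv G f \<cdot> ginv G g"
  using assms by (intro ginv_unique) auto

lemma ginv_ginv [simp]: "f \<in> Arr G \<Longrightarrow> ginv G (ginv G f) = f"
  by (rule ginv_unique) auto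

lemma ginv_Ide [simp]: "x \<in> Obj G \<Longrightarrow> ginv G (Ide G x) = Ide G x"
  by (rule ginv_unique) auto

lemma ginv_move_left:
  assumes "f \<in> Arr G" "g \<in> Arr G" "h \<in> Arr G" "Dom G f = Cod G g" "Cod G f = Cod G h"
  shows "f \<cdot> g = h \<longleftrightarrow> g = ginv G f \<cdot> h"
  using assms by auto

lemma ginv_move_right:
  assumes "f \<in> Arr G" "g \<in> Arr G" "h \<in> Arr G" "Dom G f = Cod G g" "Dom G g = Dom G h"
  shows "f \<cdot> g = h \<longleftrightarrow> f = h \<cdot> ginv G g"
  using assms by auto

end

section \<open>Functors, natural transformations and equivalences of groupoids\<close>

context gfunctor begin

lemma fO_in [simp]: "x \<in> Obj A \<Longrightarrow> fO F x \<in> Obj B"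
  by (rule fO_Obj)

lemma fA_simps [simp]:
  assumes "f \<in> Arr A"
  shows "fA F f \<in> Arr B" "Dom B (fA F f) = fO F (Dom A f)" "Cod B (fA F f) = fO F (Cod A f)"
  using fA_hom[of f "Dom A f" "Cod A f"] assms by auto

lemma fA_Ide_simp [simp]: "x \<in> Obj A \<Longrightarrow> fA F (Ide A x) = Ide B (fO F x)"
  by (rule fA_Ide)

lemma fA_comp_simp:
  assumes "f \<in> Arr A" "g \<in> Arr A" "Dom A g = Cod A f"
  shows "fA F (g \<cdot>\<^bsub>A\<^esub> f) = fA F g \<cdot>\<^bsub>B\<^esub> fA F f"
  using fA_comp[of f "Dom A f" "Cod A f" g "Cod A g"] assms by auto

lemma fA_ginv:
  assumes "f \<in> Arr A"
  shows "fA F (ginv A f) = ginv B (fA F f)"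
  using assms fA_comp_simp[of f "ginv A f"] by (intro B.ginv_unique[symmetric]) auto

end

context nat_trans begin

lemma t_simps [simp]:
  assumes "x \<in> Obj A"
  shows "t x \<in> Arr B" "Dom B (t x) = fO F x" "Cod B (t x) = fO G x"
  using t_hom[OF assms] by auto

lemma t_nat: "f \<in> Arr A \<Longrightarrow> t (Cod A f) \<cdot>\<^bsub>B\<^esub> fA F f = fA G f \<cdot>\<^bsub>B\<^esub> t (Dom A f)"
  by (rule t_natural) auto

end

text \<open>The naturality squares of the isomorphism \<open>s\<close> conjugate an arrow f to GFf,
  which gives faithfulness; a preimage of h is obtained by conjugating Gh back. To conclude Ff = h
  from GFf = Gh one uses faithfulness of the quasi-inverse G, which comes from \<open>t\<close> in
  the same way.\<close>

lemma equivalence_props: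
  fixes A :: "('o, 'a, 'm) gpd_scheme" and B :: "('p, 'b, 'n) gpd_scheme"
  assumes "equivalence A B F"
  shows equivalence_faithful: "f \<in> Arr A \<Longrightarrow> g \<in> Arr A \<Longrightarrow> Dom A f = Dom A g \<Longrightarrow> Cod A f = Cod A g
      \<Longrightarrow> fA F f = fA F g \<Longrightarrow> f = g"
    and equivalence_full: "x \<in> Obj A \<Longrightarrow> y \<in> Obj A \<Longrightarrow> h \<in> Arr B \<Longrightarrow> Dom B h = fO F x \<Longrightarrow> Cod B h = fO F y
      \<Longrightarrow> \<exists>f \<in> ghom A x y. fA F f = h"
    and equivalence_surj: "z \<in> Obj B \<Longrightarrow> \<exists>x \<in> Obj A. \<exists>h. h \<in> ghom B (fO F x) z"
proof -
  obtain G :: "('p, 'b, 'o, 'a) functr" and s t where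
    G: "gfunctor B A G" and s: "nat_trans A A id_functr (functr_comp G F) s"
    and t: "nat_trans B B (functr_comp F G) id_functr t" and F: "gfunctor A B F"
    using assms unfolding equivalence_def by blast
  interpret F: gfunctor A B F by fact
  interpret G: gfunctor B A G by fact
  interpret s: nat_trans A A id_functr "functr_comp G F" s by fact
  interpret t: nat_trans B B "functr_comp F G" id_functr t by fact
  note [simp] = id_functr_def functr_comp_def
  show faithful: "f = g" if "f \<in> Arr A" "g \<in> Arr A" "Dom A f = Dom A g" "Cod A f = Cod A g"
    "fA F f = fA F g" for f g
  proof -
    have "s (Cod A f) \<cdot>\<^bsub>A\<^esub> f = s (Cod A f) \<cdot>\<^bsub>A\<^esub> g"
      using s.t_nat[of f] s.t_nat[of g] that by simp
    then show "f = g"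
      using that s.t_simps[of "Cod A f"] by (subst (asm) F.A.cancel_left) simp_all
  qed
  have faithful': "f = g" if "f \<in> Arr B" "g \<in> Arr B" "Dom B f = Dom B g" "Cod B f = Cod B g"
    "fA G f = fA G g" for f g
  proof -
    have "f \<cdot>\<^bsub>B\<^esub> t (Dom B f) = g \<cdot>\<^bsub>B\<^esub> t (Dom B f)"
      using t.t_nat[of f] t.t_nat[of g] that by simp
    then show "f = g"
      using that t.t_simps[of "Dom B f"] by (subst (asm) F.B.cancel_right) simp_all
  qed
  show "\<exists>f \<in> ghom A x y. fA F f = h"
    if h: "x \<in> Obj A" "y \<in> Obj A" "h \<in> Arr B" "Dom B h = fO F x" "Cod B h = fO F y" for x y h
  proof -
    have s: "s x \<in> Arr A" "s y \<in> Arr A" "Dom A (s x) = x" "Dom A (s y) = y"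
      "Cod A (s x) = fO G (fO F x)" "Cod A (s y) = fO G (fO F y)"
      using h s.t_simps[of x] s.t_simps[of y] by auto
    define f where "f = ginv A (s y) \<cdot>\<^bsub>A\<^esub> (fA G h \<cdot>\<^bsub>A\<^esub> s x)"
    have f: "f \<in> ghom A x y" using h s by (simp add: f_def)
    have "fA G (fA F f) \<cdot>\<^bsub>A\<^esub> s x = fA G h \<cdot>\<^bsub>A\<^esub> s x"
      using s.t_nat[of f] f h s by (simp add: f_def)
    then have "fA G (fA F f) = fA G h"
      using f h s by (subst (asm) F.A.cancel_right) auto
    then have "fA F f = h" using f h by (intro faithful') auto
    then show ?thesis using f by blast
  qed
  show "\<exists>x \<in> Obj A. \<exists>h. h \<in> ghom B (fO F x) z" if "z \<in> Obj B" for z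
    using that t.t_simps[OF that] by (intro bexI[of _ "fO G z"] exI[of _ "t z"]) auto
qed

section \<open>Cancellation, division and unit coherence in a symmetric categorical group\<close>

context scg begin

lemma zero_in [simp]: "\<zero> \<in> Obj A" by (rule zero_Obj)

lemma add_in [simp]: "x \<in> Obj A \<Longrightarrow> y \<in> Obj A \<Longrightarrow> x \<oplus> y \<in> Obj A" by (rule add_Obj)

lemma addA_simps [simp]:
  assumes "f \<in> Arr A" "g \<in> Arr A"
  shows "f \<uplus> g \<in> Arr A" "Dom A (f \<uplus> g) = Dom A f \<oplus> Dom A g" "Cod A (f \<uplus> g) = Cod A f \<oplus> Cod A g"
  using addA_hom[of f "Dom A f" "Cod A f" g "Dom A g" "Cod A g"] assms by auto

lemma addA_Ide_simp [simp]: "x \<in> Obj A \<Longrightarrow> y \<in> Obj A \<Longrightarrow> Ide A x \<uplus> Ide A y = Ide A (x \<oplus> y)"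
  by (rule addA_Ide)

text \<open>Interchange is oriented towards one sum of composites rather than a composite of sums,
  which gives the simplifier a normal form for arrows between sums.\<close>

lemma merge [simp]:
  assumes "f \<in> Arr A" "f' \<in> Arr A" "g \<in> Arr A" "g' \<in> Arr A" "Dom A f' = Cod A f" "Dom A g' = Cod A g"
  shows "(f' \<uplus> g') \<cdot> (f \<uplus> g) = (f' \<cdot> f) \<uplus> (g' \<cdot> g)"
  using assms by (intro addA_comp[symmetric]) auto

lemma merge_tail [simp]:
  assumes "f \<in> Arr A" "f' \<in> Arr A" "g \<in> Arr A" "g' \<in> Arr A" "Dom A f' = Cod A f" "Dom A g' = Cod A g"
    "r \<in> Arr A" "Cod A r = Dom A f \<oplus> Dom A g"
  shows "(f' \<uplus> g') \<cdot> ((f \<uplus> g) \<cdot> r) = ((f' \<cdot> f) \<uplus> (g' \<cdot> g)) \<cdot> r"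
  using assms by (intro comp_reduce) auto

lemma ginv_addA [simp]: "f \<in> Arr A \<Longrightarrow> g \<in> Arr A \<Longrightarrow> ginv A (f \<uplus> g) = ginv A f \<uplus> ginv A g"
  by (rule ginv_unique) auto

lemma asc_simps [simp]:
  assumes "x \<in> Obj A" "y \<in> Obj A" "z \<in> Obj A"
  shows "asc A x y z \<in> Arr A" "Dom A (asc A x y z) = (x \<oplus> y) \<oplus> z" "Cod A (asc A x y z) = x \<oplus> (y \<oplus> z)"
  using asc_hom[OF assms] by auto

lemma sym_simps [simp]:
  assumes "x \<in> Obj A" "y \<in> Obj A"
  shows "sym A x y \<in> Arr A" "Dom A (sym A x y) = x \<oplus> y" "Cod A (sym A x y) = y \<oplus> x"
  using sym_hom[OF assms] by auto

lemma unit_simps [simp]: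
  assumes "x \<in> Obj A"
  shows "lun A x \<in> Arr A" "Dom A (lun A x) = \<zero> \<oplus> x" "Cod A (lun A x) = x"
    "run A x \<in> Arr A" "Dom A (run A x) = x \<oplus> \<zero>" "Cod A (run A x) = x"
  using lun_hom[OF assms] run_hom[OF assms] by auto

lemma asc_nat1:
  assumes "f \<in> Arr A" "g \<in> Arr A" "h \<in> Arr A" "Cod A f = x" "Cod A g = y" "Cod A h = z"
  shows "asc A x y z \<cdot> ((f \<uplus> g) \<uplus> h) = (f \<uplus> (g \<uplus> h)) \<cdot> asc A (Dom A f) (Dom A g) (Dom A h)"
  using assms by (intro asc_natural) auto

lemmas asc_nat = asc_nat1 comp_reduce[OF asc_nat1]

lemma sym_nat1:
  assumes "f \<in> Arr A" "g \<in> Arr A" "Cod A f = x" "Cod A g = y"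
  shows "sym A x y \<cdot> (f \<uplus> g) = (g \<uplus> f) \<cdot> sym A (Dom A f) (Dom A g)"
  using assms by (intro sym_natural) auto

lemmas sym_nat = sym_nat1 comp_reduce[OF sym_nat1]

lemma lun_nat1:
  assumes "f \<in> Arr A" "Cod A f = x"
  shows "lun A x \<cdot> (Ide A \<zero> \<uplus> f) = f \<cdot> lun A (Dom A f)"
  using assms by (intro lun_natural) auto

lemmas lun_nat = lun_nat1 comp_reduce[OF lun_nat1]

lemma run_nat1:
  assumes "f \<in> Arr A" "Cod A f = x"
  shows "run A x \<cdot> (f \<uplus> Ide A \<zero>) = f \<cdot> run A (Dom A f)"
  using assms by (intro run_natural) auto

lemmas run_nat = run_nat1 comp_reduce[OF run_nat1]

lemma sym_sym_simp [simp]: "x \<in> Obj A \<Longrightarrow> y \<in> Obj A \<Longrightarrow> sym A y x \<cdot> sym A x y = Ide A (x \<oplus> y)"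
  by (rule sym_sym)

lemma ginv_sym [simp]: "x \<in> Obj A \<Longrightarrow> y \<in> Obj A \<Longrightarrow> ginv A (sym A x y) = sym A y x"
  by (rule ginv_unique) auto

text \<open>Together with the two lemmas that follow, this is how invertibility of objects enters:
  summands can be cancelled and divided out of arrows, and objects can be subtracted. The versions
  on the other side are conjugates by the symmetry.\<close>

lemma addA_left_faithful:
  assumes "Ide A x \<uplus> f = Ide A x \<uplus> g" "x \<in> Obj A" "f \<in> Arr A" "g \<in> Arr A"
    "Dom A f = Dom A g" "Cod A f = Cod A g"
  shows "f = g"
  using equivalence_faithful[OF translation_equivalence[OF assms(2)]] assms
  by (simp add: translation_def)

lemma addA_left_full:
  assumes "x \<in> Obj A" "y \<in> Obj A" "z \<in> Obj A" "h \<in> Arr A" "Dom A h = x \<oplus> y" "Cod A h = x \<oplus> z"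
  shows "\<exists>f. f \<in> ghom A y z \<and> Ide A x \<uplus> f = h"
proof -
  have "\<exists>f \<in> ghom A y z. fA (translation A x) f = h"
    using assms by (intro equivalence_full[OF translation_equivalence[OF assms(1)]])
      (simp_all add: translation_def)
  then show ?thesis by (simp add: translation_def Bex_def)
qed

lemma addA_left_surj:
  assumes "x \<in> Obj A" "z \<in> Obj A"
  shows "\<exists>y \<in> Obj A. \<exists>h. h \<in> ghom A (x \<oplus> y) z"
  using equivalence_surj[OF translation_equivalence[OF assms(1)] assms(2)]
  by (simp add: translation_def)

lemma addA_right_faithful:
  assumes "f \<uplus> Ide A x = g \<uplus> Ide A x" "x \<in> Obj A" "f \<in> Arr A" "g \<in> Arr A"
    "Dom A f = Dom A g" "Cod A f = Cod A g"
  shows "f = g"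
proof (rule addA_left_faithful)
  have "(Ide A x \<uplus> f) \<cdot> sym A (Dom A f) x = (Ide A x \<uplus> g) \<cdot> sym A (Dom A f) x"
    using assms sym_nat(1)[of f "Ide A x" "Cod A f" x] sym_nat(1)[of g "Ide A x" "Cod A f" x] by simp
  then show "Ide A x \<uplus> f = Ide A x \<uplus> g"
    using assms by (subst (asm) cancel_right) auto
qed (use assms in auto)

lemma addA_right_full:
  assumes "x \<in> Obj A" "y \<in> Obj A" "z \<in> Obj A" "h \<in> Arr A" "Dom A h = y \<oplus> x" "Cod A h = z \<oplus> x"
  shows "\<exists>f. f \<in> ghom A y z \<and> f \<uplus> Ide A x = h"
proof -
  obtain f where f: "f \<in> ghom A y z" "Ide A x \<uplus> f = sym A z x \<cdot> (h \<cdot> sym A x y)"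
    using addA_left_full[of x y z "sym A z x \<cdot> (h \<cdot> sym A x y)"] assms by auto
  have "sym A z x \<cdot> (f \<uplus> Ide A x) = sym A z x \<cdot> h"
    using f assms sym_nat(1)[of f "Ide A x" z x] by simp
  then have "f \<uplus> Ide A x = h"
    using f assms by (subst (asm) cancel_left) auto
  then show ?thesis using f by blast
qed

lemma addA_right_surj:
  assumes "x \<in> Obj A" "z \<in> Obj A"
  shows "\<exists>y \<in> Obj A. \<exists>h. h \<in> ghom A (y \<oplus> x) z"
proof -
  obtain y h where "y \<in> Obj A" "h \<in> ghom A (x \<oplus> y) z" using addA_left_surj[OF assms] by blast
  then show ?thesis using assms by (intro bexI[of _ y] exI[of _ "h \<cdot> sym A y x"]) auto
qed

lemma addA_right_cancel:
  assumes "f \<uplus> h = g \<uplus> h" "h \<in> Arr A" "f \<in> Arr A" "g \<in> Arr A" "Dom A f = Dom A g" "Cod A f = Cod A g"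
  shows "f = g"
proof (rule addA_right_faithful[of _ "Cod A h"])
  have "(f \<uplus> h) \<cdot> (Ide A (Dom A f) \<uplus> ginv A h) = (g \<uplus> h) \<cdot> (Ide A (Dom A f) \<uplus> ginv A h)"
    by (simp only: assms(1))
  then show "f \<uplus> Ide A (Cod A h) = g \<uplus> Ide A (Cod A h)" using assms(2-) by simp
qed (use assms(2-) in auto)

text \<open>Kelly's argument: adding zero on the left is faithful, and after that the pentagon at
  zero, zero, x, y turns the claim into two triangle identities.\<close>

lemma lun_add:
  assumes [simp]: "x \<in> Obj A" "y \<in> Obj A"
  shows "lun A (x \<oplus> y) \<cdot> asc A \<zero> x y = lun A x \<uplus> Ide A y"
proof (rule addA_left_faithful[of \<zero>])
  let ?z = "asc A \<zero> (\<zero> \<oplus> x) y \<cdot> (asc A \<zero> \<zero> x \<uplus> Ide A y)"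
  have "(Ide A \<zero> \<uplus> (lun A (x \<oplus> y) \<cdot> asc A \<zero> x y)) \<cdot> ?z
      = (Ide A \<zero> \<uplus> lun A (x \<oplus> y)) \<cdot> ((Ide A \<zero> \<uplus> asc A \<zero> x y) \<cdot> ?z)"
    by simp
  also have "\<dots> = ((Ide A \<zero> \<uplus> lun A (x \<oplus> y)) \<cdot> asc A \<zero> \<zero> (x \<oplus> y)) \<cdot> asc A (\<zero> \<oplus> \<zero>) x y"
    using pentagon[of \<zero> \<zero> x y] by simp
  also have "\<dots> = (run A \<zero> \<uplus> (Ide A x \<uplus> Ide A y)) \<cdot> asc A (\<zero> \<oplus> \<zero>) x y"
    by (subst triangle) simp_all
  also have "\<dots> = asc A \<zero> x y \<cdot> ((run A \<zero> \<uplus> Ide A x) \<uplus> Ide A y)"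
    by (subst asc_nat(1)) simp_all
  also have "\<dots> = asc A \<zero> x y \<cdot> (((Ide A \<zero> \<uplus> lun A x) \<uplus> Ide A y) \<cdot> (asc A \<zero> \<zero> x \<uplus> Ide A y))"
    by (simp add: triangle)
  also have "\<dots> = (Ide A \<zero> \<uplus> (lun A x \<uplus> Ide A y)) \<cdot> ?z"
    by (subst asc_nat(2)) simp_all
  finally show "Ide A \<zero> \<uplus> (lun A (x \<oplus> y) \<cdot> asc A \<zero> x y) = Ide A \<zero> \<uplus> (lun A x \<uplus> Ide A y)"
    by (subst (asm) cancel_right) simp_all
qed simp_all

text \<open>The mirror image of the previous argument, with the pentagon at x, y, zero, zero and
  cancellation of zero on the right.\<close>

lemma run_add:
  assumes [simp]: "x \<in> Obj A" "y \<in> Obj A"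
  shows "(Ide A x \<uplus> run A y) \<cdot> asc A x y \<zero> = run A (x \<oplus> y)"
proof (rule addA_right_faithful[of _ \<zero>])
  have "asc A x y \<zero> \<cdot> (run A (x \<oplus> y) \<uplus> Ide A \<zero>)
      = asc A x y \<zero> \<cdot> (((Ide A x \<uplus> Ide A y) \<uplus> lun A \<zero>) \<cdot> asc A (x \<oplus> y) \<zero> \<zero>)"
    by (simp add: triangle)
  also have "\<dots> = (Ide A x \<uplus> (Ide A y \<uplus> lun A \<zero>)) \<cdot> (asc A x y (\<zero> \<oplus> \<zero>) \<cdot> asc A (x \<oplus> y) \<zero> \<zero>)"
    by (subst asc_nat(2)) simp_all
  also have "\<dots> = (Ide A x \<uplus> (run A y \<uplus> Ide A \<zero>)) \<cdot> (asc A x (y \<oplus> \<zero>) \<zero> \<cdot> (asc A x y \<zero> \<uplus> Ide A \<zero>))"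
    by (subst pentagon) (simp_all add: triangle)
  also have "\<dots> = asc A x y \<zero> \<cdot> (((Ide A x \<uplus> run A y) \<uplus> Ide A \<zero>) \<cdot> (asc A x y \<zero> \<uplus> Ide A \<zero>))"
    by (subst asc_nat(2)) simp_all
  also have "\<dots> = asc A x y \<zero> \<cdot> (((Ide A x \<uplus> run A y) \<cdot> asc A x y \<zero>) \<uplus> Ide A \<zero>)"
    by simp
  finally show "((Ide A x \<uplus> run A y) \<cdot> asc A x y \<zero>) \<uplus> Ide A \<zero> = run A (x \<oplus> y) \<uplus> Ide A \<zero>"
    by (subst (asm) cancel_left) simp_all
qed simp_all

text \<open>Adding zero on the right is faithful; there the hexagon at x, zero, zero combines with
  the triangle and \<open>lun_add\<close>, and the common factor \<open>sym A x \<zero>\<close>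
  cancels.\<close>

lemma lun_sym [simp]:
  assumes [simp]: "x \<in> Obj A"
  shows "lun A x \<cdot> sym A x \<zero> = run A x"
proof (rule addA_right_faithful[of _ \<zero>])
  have "sym A x \<zero> \<cdot> (run A x \<uplus> Ide A \<zero>) = sym A x \<zero> \<cdot> ((Ide A x \<uplus> lun A \<zero>) \<cdot> asc A x \<zero> \<zero>)"
    by (simp add: triangle)
  also have "\<dots> = (lun A \<zero> \<uplus> Ide A x) \<cdot> (sym A x (\<zero> \<oplus> \<zero>) \<cdot> asc A x \<zero> \<zero>)"
    by (subst sym_nat(2)) simp_all
  also have "\<dots> = lun A (\<zero> \<oplus> x) \<cdot> (asc A \<zero> \<zero> x \<cdot> (sym A x (\<zero> \<oplus> \<zero>) \<cdot> asc A x \<zero> \<zero>))"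
    by (simp flip: lun_add)
  also have "\<dots> = lun A (\<zero> \<oplus> x) \<cdot> ((Ide A \<zero> \<uplus> sym A x \<zero>) \<cdot> (asc A \<zero> x \<zero> \<cdot> (sym A x \<zero> \<uplus> Ide A \<zero>)))"
    by (subst hexagon) simp_all
  also have "\<dots> = sym A x \<zero> \<cdot> ((lun A (x \<oplus> \<zero>) \<cdot> asc A \<zero> x \<zero>) \<cdot> (sym A x \<zero> \<uplus> Ide A \<zero>))"
    by (subst lun_nat(2)) simp_all
  also have "\<dots> = sym A x \<zero> \<cdot> ((lun A x \<cdot> sym A x \<zero>) \<uplus> Ide A \<zero>)"
    by (subst lun_add) simp_all
  finally show "(lun A x \<cdot> sym A x \<zero>) \<uplus> Ide A \<zero> = run A x \<uplus> Ide A \<zero>"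
    by (subst (asm) cancel_left) simp_all
qed simp_all

end

section \<open>Coherence of the interchange isomorphism\<close>

datatype 'x tree = Lf 'x | Nd "'x tree" "'x tree"

context scg begin

lemma asc_nat_Ide:
  assumes "x \<in> Obj A" "y \<in> Obj A" "h \<in> Arr A" "Cod A h = z"
  shows "asc A x y z \<cdot> (Ide A (x \<oplus> y) \<uplus> h) = (Ide A x \<uplus> (Ide A y \<uplus> h)) \<cdot> asc A x y (Dom A h)"
  using asc_nat(1)[of "Ide A x" "Ide A y" h x y z] assms by simp

text \<open>The functors \<open>x \<oplus> -\<close> turn the associativity constraint into an identity: a sum of
    objects,
  given by a tree, acts on \<open>w\<close> by adding its leaves one after another, and an arrow
      \<open>f\<close> between
  two such sums induces the arrow \<open>realize s t f w\<close>. The arrows induced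
      by associativity constraints
  are identities, so that a coherence condition becomes an identity between composites of swaps.\<close>

primrec tree_ok :: "'o tree \<Rightarrow> bool" where
  "tree_ok (Lf x) = (x \<in> Obj A)"
| "tree_ok (Nd s t) = (tree_ok s \<and> tree_ok t)"

primrec tree_obj :: "'o tree \<Rightarrow> 'o" where
  "tree_obj (Lf x) = x"
| "tree_obj (Nd s t) = tree_obj s \<oplus> tree_obj t"

primrec tree_act :: "'o tree \<Rightarrow> 'o \<Rightarrow> 'o" where
  "tree_act (Lf x) w = x \<oplus> w"
| "tree_act (Nd s t) w = tree_act s (tree_act t w)"

primrec tree_actA :: "'o tree \<Rightarrow> 'a \<Rightarrow> 'a" where
  "tree_actA (Lf x) h = Ide A x \<uplus> h"
| "tree_actA (Nd s t) h = tree_actA s (tree_actA t h)"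

text \<open>The canonical isomorphism from a bracketed sum plus w to the sum nested to the right,
  built from associativity constraints only.\<close>

primrec unnest :: "'o tree \<Rightarrow> 'o \<Rightarrow> 'a" where
  "unnest (Lf x) w = Ide A (x \<oplus> w)"
| "unnest (Nd s t) w = unnest s (tree_act t w) \<cdot> ((Ide A (tree_obj s) \<uplus> unnest t w)
    \<cdot> asc A (tree_obj s) (tree_obj t) w)"

lemma tree_obj_in [simp]: "tree_ok t \<Longrightarrow> tree_obj t \<in> Obj A"
  by (induction t) auto

lemma tree_act_in [simp]: "tree_ok t \<Longrightarrow> w \<in> Obj A \<Longrightarrow> tree_act t w \<in> Obj A"
  by (induction t arbitrary: w) auto

lemma tree_actA_simps [simp]:
  assumes "tree_ok t" "h \<in> Arr A"
  shows "tree_actA t h \<in> Arr A" "Dom A (tree_actA t h) = tree_act t (Dom A h)" "Cod A (tree_actA t h)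
      = tree_act t (Cod A h)"
  using assms by (induction t arbitrary: h) auto

lemma tree_actA_Ide [simp]: "tree_ok t \<Longrightarrow> w \<in> Obj A \<Longrightarrow> tree_actA t (Ide A w) = Ide A (tree_act t w)"
  by (induction t arbitrary: w) auto

lemma tree_actA_comp:
  "tree_ok t \<Longrightarrow> f \<in> Arr A \<Longrightarrow> g \<in> Arr A \<Longrightarrow> Dom A g = Cod A f \<Longrightarrow> tree_actA t (g \<cdot> f)
      = tree_actA t g \<cdot> tree_actA t f"
  by (induction t arbitrary: f g) auto

lemma unnest_simps [simp]:
  assumes "tree_ok t" "w \<in> Obj A"
  shows "unnest t w \<in> Arr A" "Dom A (unnest t w) = tree_obj t \<oplus> w" "Cod A (unnest t w) = tree_act t w"
  using assms by (induction t arbitrary: w) auto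

lemma unnest_nat:
  assumes "tree_ok t" "h \<in> Arr A" "Cod A h = w"
  shows "unnest t w \<cdot> (Ide A (tree_obj t) \<uplus> h) = tree_actA t h \<cdot> unnest t (Dom A h)"
  using assms
proof (induction t arbitrary: h w)
  case (Nd s t)
  have "unnest (Nd s t) w \<cdot> (Ide A (tree_obj (Nd s t)) \<uplus> h)
      = unnest s (tree_act t w) \<cdot> ((Ide A (tree_obj s) \<uplus> unnest t w) \<cdot>
          ((Ide A (tree_obj s) \<uplus> (Ide A (tree_obj t) \<uplus> h))
              \<cdot> asc A (tree_obj s) (tree_obj t) (Dom A h)))"
    using Nd.prems asc_nat_Ide[of "tree_obj s" "tree_obj t" h w] by auto
  also have "\<dots> = unnest s (tree_act t w) \<cdot> ((Ide A (tree_obj s) \<uplus> tree_actA t h) \<cdot>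
      ((Ide A (tree_obj s) \<uplus> unnest t (Dom A h)) \<cdot> asc A (tree_obj s) (tree_obj t) (Dom A h)))"
    using Nd.prems Nd.IH(2)[of h w] by auto
  also have "\<dots> = tree_actA s (tree_actA t h) \<cdot> (unnest s (tree_act t (Dom A h)) \<cdot>
      ((Ide A (tree_obj s) \<uplus> unnest t (Dom A h)) \<cdot> asc A (tree_obj s) (tree_obj t) (Dom A h)))"
    using Nd.prems by (subst comp_reduce[OF Nd.IH(1)]) auto
  finally show ?case by simp
qed auto

definition realize :: "'o tree \<Rightarrow> 'o tree \<Rightarrow> 'a \<Rightarrow> 'o \<Rightarrow> 'a" where
  "realize s t f w = unnest t w \<cdot> ((f \<uplus> Ide A w) \<cdot> ginv A (unnest s w))"

lemma realize_simps [simp]: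
  assumes "tree_ok s" "tree_ok t" "w \<in> Obj A" "f \<in> Arr A" "Dom A f = tree_obj s" "Cod A f = tree_obj t"
  shows "realize s t f w \<in> Arr A" "Dom A (realize s t f w) = tree_act s w" "Cod A (realize s t f w)
      = tree_act t w"
  using assms by (auto simp: realize_def)

lemma realize_can:
  assumes "tree_ok s" "tree_ok t" "w \<in> Obj A" "f \<in> Arr A" "Dom A f = tree_obj s" "Cod A f = tree_obj t"
  shows "realize s t f w \<cdot> unnest s w = unnest t w \<cdot> (f \<uplus> Ide A w)"
  using assms by (simp add: realize_def)

lemma realize_eqI:
  assumes "tree_ok s" "tree_ok t" "w \<in> Obj A" "f \<in> Arr A" "Dom A f = tree_obj s" "Cod A f = tree_obj t"
    "h \<in> Arr A" "Dom A h = tree_act s w" "unnest t w \<cdot> (f \<uplus> Ide A w) = h \<cdot> unnest s w"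
  shows "realize s t f w = h"
proof -
  have "realize s t f w \<cdot> unnest s w = h \<cdot> unnest s w"
    using assms by (simp add: realize_can)
  then show ?thesis using assms(1-8) by (subst (asm) cancel_right) auto
qed

text \<open>Since \<open>unnest\<close> is invertible, equality of realisations amounts to equality
  of f + w and g + w, and w cancels. Coherence can thus be tested on realisations.\<close>

lemma realize_inj:
  assumes "realize s t f w = realize s t g w" "tree_ok s" "tree_ok t" "w \<in> Obj A"
    "f \<in> Arr A" "Dom A f = tree_obj s" "Cod A f = tree_obj t" "g \<in> Arr A" "Dom A g
        = tree_obj s" "Cod A g = tree_obj t"
  shows "f = g"
proof (rule addA_right_faithful[of _ w])
  have "unnest t w \<cdot> (f \<uplus> Ide A w) = unnest t w \<cdot> (g \<uplus> Ide A w)"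
    using realize_can[of s t w f] realize_can[of s t w g] assms by metis
  then show "f \<uplus> Ide A w = g \<uplus> Ide A w"
    using assms(2-) by (subst (asm) cancel_left) auto
qed (use assms in auto)

lemma realize_comp:
  assumes "tree_ok s" "tree_ok t" "tree_ok u" "w \<in> Obj A" "f \<in> Arr A" "Dom A f = tree_obj s" "Cod A f
      = tree_obj t"
    "g \<in> Arr A" "Dom A g = tree_obj t" "Cod A g = tree_obj u"
  shows "realize s u (g \<cdot> f) w = realize t u g w \<cdot> realize s t f w"
  using assms by (simp add: realize_def)

lemma realize_Ide [simp]: "tree_ok s \<Longrightarrow> w \<in> Obj A \<Longrightarrow> realize s s (Ide A (tree_obj s)) w
    = Ide A (tree_act s w)"
  by (simp add: realize_def)

lemma realize_ginv:
  assumes "tree_ok s" "tree_ok t" "w \<in> Obj A" "f \<in> Arr A" "Dom A f = tree_obj s" "Cod A f = tree_obj t"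
  shows "realize t s (ginv A f) w = ginv A (realize s t f w)"
  using assms by (simp add: realize_def)

lemma realize_nat:
  assumes "tree_ok s" "tree_ok t" "w \<in> Obj A" "f \<in> Arr A" "Dom A f = tree_obj s" "Cod A f = tree_obj t"
    "h \<in> Arr A" "Cod A h = w"
  shows "realize s t f w \<cdot> tree_actA s h = tree_actA t h \<cdot> realize s t f (Dom A h)"
proof -
  have "realize s t f w \<cdot> (tree_actA s h \<cdot> unnest s (Dom A h))
      = realize s t f w \<cdot> (unnest s w \<cdot> (Ide A (tree_obj s) \<uplus> h))"
    using unnest_nat assms by simp
  also have "\<dots> = unnest t w \<cdot> (f \<uplus> h)"
    using assms by (subst comp_reduce[OF realize_can]) auto
  also have "\<dots> = unnest t w \<cdot> ((Ide A (tree_obj t) \<uplus> h) \<cdot> (f \<uplus> Ide A (Dom A h)))"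
    using assms by simp
  also have "\<dots> = tree_actA t h \<cdot> (unnest t (Dom A h) \<cdot> (f \<uplus> Ide A (Dom A h)))"
    using assms by (subst comp_reduce[OF unnest_nat]) auto
  also have "\<dots> = tree_actA t h \<cdot> (realize s t f (Dom A h) \<cdot> unnest s (Dom A h))"
    using assms by (simp add: realize_can)
  finally have "(realize s t f w \<cdot> tree_actA s h) \<cdot> unnest s (Dom A h)
      = (tree_actA t h \<cdot> realize s t f (Dom A h)) \<cdot> unnest s (Dom A h)"
    using assms by simp
  then show ?thesis
    using assms by (subst (asm) cancel_right) auto
qed

lemma realize_add:
  assumes "tree_ok s" "tree_ok s'" "tree_ok t" "tree_ok t'" "w \<in> Obj A" "f \<in> Arr A" "Dom A f
      = tree_obj s" "Cod A f = tree_obj s'"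
    "g \<in> Arr A" "Dom A g = tree_obj t" "Cod A g = tree_obj t'"
  shows "realize (Nd s t) (Nd s' t') (f \<uplus> g) w = realize s s' f (tree_act t' w)
      \<cdot> tree_actA s (realize t t' g w)"
proof (rule realize_eqI)
  have "unnest (Nd s' t') w \<cdot> ((f \<uplus> g) \<uplus> Ide A w)
     = unnest s' (tree_act t' w) \<cdot> ((Ide A (tree_obj s') \<uplus> unnest t' w) \<cdot> ((f \<uplus> (g \<uplus> Ide A w))
         \<cdot> asc A (tree_obj s) (tree_obj t) w))"
    using assms by (simp add: asc_nat)
  also have "\<dots> = unnest s' (tree_act t' w) \<cdot> ((f \<uplus> Ide A (tree_act t' w)) \<cdot>
      ((Ide A (tree_obj s) \<uplus> realize t t' g w) \<cdot> ((Ide A (tree_obj s) \<uplus> unnest t w)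
          \<cdot> asc A (tree_obj s) (tree_obj t) w)))"
    using assms by (simp add: realize_can)
  also have "\<dots> = realize s s' f (tree_act t' w) \<cdot> (unnest s (tree_act t' w) \<cdot>
      ((Ide A (tree_obj s) \<uplus> realize t t' g w) \<cdot> ((Ide A (tree_obj s) \<uplus> unnest t w)
          \<cdot> asc A (tree_obj s) (tree_obj t) w)))"
    using assms by (subst comp_reduce[OF realize_can[symmetric], of s s']) auto
  also have "\<dots> = realize s s' f (tree_act t' w) \<cdot> (tree_actA s (realize t t' g w)
      \<cdot> (unnest s (tree_act t w) \<cdot>
      ((Ide A (tree_obj s) \<uplus> unnest t w) \<cdot> asc A (tree_obj s) (tree_obj t) w)))"
    using assms by (subst comp_reduce[OF unnest_nat]) auto
  also have "\<dots> = (realize s s' f (tree_act t' w) \<cdot> tree_actA s (realize t t' g w)) \<cdot> unnest (Nd s t) w"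
    using assms by simp
  finally show "unnest (Nd s' t') w \<cdot> ((f \<uplus> g) \<uplus> Ide A w)
     = (realize s s' f (tree_act t' w) \<cdot> tree_actA s (realize t t' g w)) \<cdot> unnest (Nd s t) w" .
qed (use assms in auto)

text \<open>This is the pentagon for s, t, u and w: the two ways of unnesting the threefold sum
  differ by exactly the associativity constraint.\<close>

lemma realize_asc:
  assumes [simp]: "tree_ok s" "tree_ok t" "tree_ok u" "w \<in> Obj A"
  shows "realize (Nd (Nd s t) u) (Nd s (Nd t u)) (asc A (tree_obj s) (tree_obj t) (tree_obj u)) w
      = Ide A (tree_act s (tree_act t (tree_act u w)))"
proof (rule realize_eqI)
  let ?s = "tree_obj s" and ?t = "tree_obj t" and ?u = "tree_obj u"
  have "unnest (Nd s (Nd t u)) w \<cdot> (asc A ?s ?t ?u \<uplus> Ide A w)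
    = unnest s (tree_act t (tree_act u w)) \<cdot> ((Ide A ?s \<uplus> unnest t (tree_act u w)) \<cdot> ((Ide A ?s
        \<uplus> (Ide A ?t \<uplus> unnest u w)) \<cdot>
        ((Ide A ?s \<uplus> asc A ?t ?u w) \<cdot> (asc A ?s (?t \<oplus> ?u) w \<cdot> (asc A ?s ?t ?u \<uplus> Ide A w)))))"
    by simp
  also have "\<dots> = unnest s (tree_act t (tree_act u w)) \<cdot> ((Ide A ?s \<uplus> unnest t (tree_act u w))
      \<cdot> ((Ide A ?s \<uplus> (Ide A ?t \<uplus> unnest u w)) \<cdot>
        (asc A ?s ?t (?u \<oplus> w) \<cdot> asc A (?s \<oplus> ?t) ?u w)))"
    by (subst pentagon) auto
  also have "\<dots> = unnest s (tree_act t (tree_act u w)) \<cdot> ((Ide A ?s \<uplus> unnest t (tree_act u w)) \<cdot>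
        (asc A ?s ?t (tree_act u w) \<cdot> ((Ide A (?s \<oplus> ?t) \<uplus> unnest u w) \<cdot> asc A (?s \<oplus> ?t) ?u w)))"
    using comp_reduce[OF asc_nat_Ide[of ?s ?t "unnest u w" "tree_act u w"], of "asc A (?s
        \<oplus> ?t) ?u w"] by simp
  finally show "unnest (Nd s (Nd t u)) w \<cdot> (asc A ?s ?t ?u \<uplus> Ide A w)
      = Ide A (tree_act s (tree_act t (tree_act u w))) \<cdot> unnest (Nd (Nd s t) u) w"
    by simp
qed auto

definition swap :: "'o tree \<Rightarrow> 'o tree \<Rightarrow> 'o \<Rightarrow> 'a" where
  "swap s t w = realize (Nd s t) (Nd t s) (sym A (tree_obj s) (tree_obj t)) w"

lemma swap_simps [simp]:
  assumes "tree_ok s" "tree_ok t" "w \<in> Obj A"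
  shows "swap s t w \<in> Arr A" "Dom A (swap s t w) = tree_act s (tree_act t w)" "Cod A (swap s t w)
      = tree_act t (tree_act s w)"
    "realize (Nd s t) (Nd t s) (sym A (tree_obj s) (tree_obj t)) w = swap s t w"
  using assms by (auto simp: swap_def)

lemma swap_Sy: "tree_ok s \<Longrightarrow> tree_ok t \<Longrightarrow> w \<in> Obj A \<Longrightarrow> swap t s w \<cdot> swap s t w
    = Ide A (tree_act s (tree_act t w))"
  unfolding swap_def by (subst realize_comp[symmetric]) (auto simp flip: tree_obj.simps)

lemma swap_nat:
  assumes "tree_ok s" "tree_ok t" "h \<in> Arr A" "Cod A h = w"
  shows "swap s t w \<cdot> tree_actA s (tree_actA t h) = tree_actA t (tree_actA s h) \<cdot> swap s t (Dom A h)"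
  unfolding swap_def using assms realize_nat[of "Nd s t" "Nd t s" w "sym A (tree_obj s) (tree_obj t)"
      h] by auto

text \<open>The hexagon read through \<open>realize\<close>: its associativity constraints become
  identities, so moving s past a sum is moving it past the two summands in turn.\<close>

lemma swap_Nd_right:
  assumes [simp]: "tree_ok s" "tree_ok t" "tree_ok u" "w \<in> Obj A"
  shows "swap s (Nd t u) w = tree_actA t (swap s u w) \<cdot> swap s t (tree_act u w)"
proof -
  let ?s = "tree_obj s" and ?t = "tree_obj t" and ?u = "tree_obj u"
  let ?X = "Nd (Nd s t) u" and ?Y = "Nd t (Nd u s)"
  have "realize ?X ?Y (asc A ?t ?u ?s \<cdot> (sym A ?s (?t \<oplus> ?u) \<cdot> asc A ?s ?t ?u)) w
      = realize (Nd (Nd t u) s) ?Y (asc A ?t ?u ?s) w \<cdot> (swap s (Nd t u) w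
          \<cdot> realize ?X (Nd s (Nd t u)) (asc A ?s ?t ?u) w)"
    by (subst realize_comp[of _ "Nd (Nd t u) s"], auto, subst realize_comp[of _ "Nd s (Nd t u)"], auto
        simp: swap_def)
  also have "\<dots> = swap s (Nd t u) w"
    by (simp add: realize_asc)
  finally have *: "swap s (Nd t u) w = realize ?X ?Y (asc A ?t ?u ?s \<cdot> (sym A ?s (?t \<oplus> ?u)
      \<cdot> asc A ?s ?t ?u)) w"
    by simp
  have "realize ?X ?Y ((Ide A ?t \<uplus> sym A ?s ?u) \<cdot> (asc A ?t ?s ?u \<cdot> (sym A ?s ?t \<uplus> Ide A ?u))) w
      = realize (Nd t (Nd s u)) ?Y (Ide A ?t \<uplus> sym A ?s ?u) w \<cdot>
        (realize (Nd (Nd t s) u) (Nd t (Nd s u)) (asc A ?t ?s ?u) w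
            \<cdot> realize ?X (Nd (Nd t s) u) (sym A ?s ?t \<uplus> Ide A ?u) w)"
    by (subst realize_comp[of _ "Nd t (Nd s u)"], auto, subst realize_comp[of _ "Nd (Nd t s) u"], auto)
  also have "\<dots> = tree_actA t (swap s u w) \<cdot> swap s t (tree_act u w)"
    by (simp add: realize_asc realize_add)
  finally show ?thesis
    unfolding * by (subst hexagon) auto
qed

text \<open>Both sides are inverse to \<open>swap u (Nd s t) w\<close>, by
  \<open>swap_Nd_right\<close> and involutivity of swaps.\<close>

lemma swap_Nd_left:
  assumes [simp]: "tree_ok s" "tree_ok t" "tree_ok u" "w \<in> Obj A"
  shows "swap (Nd s t) u w = swap s u (tree_act t w) \<cdot> tree_actA s (swap t u w)"
proof -
  have "swap u (Nd s t) w \<cdot> (swap s u (tree_act t w) \<cdot> tree_actA s (swap t u w))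
      = tree_actA s (swap u t w) \<cdot> (swap u s (tree_act t w) \<cdot> (swap s u (tree_act t w)
          \<cdot> tree_actA s (swap t u w)))"
    by (simp add: swap_Nd_right)
  also have "\<dots> = tree_actA s (swap u t w \<cdot> swap t u w)"
    by (subst comp_reduce[OF swap_Sy]) (auto simp: tree_actA_comp)
  also have "\<dots> = swap u (Nd s t) w \<cdot> swap (Nd s t) u w"
    by (simp add: swap_Sy)
  finally show ?thesis
    by (subst (asm) cancel_left) auto
qed

section \<open>Naturality, associativity and symmetry laws of \<open>mid\<close>\<close>

lemma mid_simps [simp]:
  assumes "a \<in> Obj A" "b \<in> Obj A" "c \<in> Obj A" "d \<in> Obj A"
  shows "mid A a b c d \<in> Arr A" "Dom A (mid A a b c d) = (a \<oplus> b) \<oplus> (c \<oplus> d)"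
    "Cod A (mid A a b c d) = (a \<oplus> c) \<oplus> (b \<oplus> d)"
  using assms by (auto simp: mid_def)

text \<open>Of the factors in the definition of \<open>mid\<close>, all associativity constraints
  realise to identities, so only the crossing of the two middle summands remains.\<close>

lemma realize_mid:
  assumes [simp]: "tree_ok a" "tree_ok b" "tree_ok c" "tree_ok d" "w \<in> Obj A"
  shows "realize (Nd (Nd a b) (Nd c d)) (Nd (Nd a c) (Nd b d)) (mid A (tree_obj a) (tree_obj b)
      (tree_obj c) (tree_obj d)) w
     = tree_actA a (swap b c (tree_act d w))"
proof -
  let ?i = "asc A (tree_obj c) (tree_obj b) (tree_obj d) \<cdot> ((sym A (tree_obj b) (tree_obj c)
      \<uplus> Ide A (tree_obj d)) \<cdot> ginv A (asc A (tree_obj b) (tree_obj c) (tree_obj d)))"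
  have i: "realize (Nd b (Nd c d)) (Nd c (Nd b d)) ?i w = swap b c (tree_act d w)"
    by (subst realize_comp[of _ "Nd (Nd c b) d"], auto, subst realize_comp[of _ "Nd (Nd b c) d"], auto
        simp: realize_asc realize_add realize_ginv)
  show ?thesis
    unfolding mid_def
    by (subst realize_comp[of _ "Nd a (Nd c (Nd b d))"], auto, subst realize_comp[of _ "Nd a (Nd b (Nd
        c d))"],
      auto simp: realize_asc[of a c "Nd b d" w, simplified] realize_asc[of a b "Nd c d" w, simplified]
          realize_add realize_ginv i)
qed

lemma ginv_mid:
  assumes [simp]: "a \<in> Obj A" "b \<in> Obj A" "c \<in> Obj A" "d \<in> Obj A"
  shows "ginv A (mid A a b c d) = mid A a c b d"
  by (simp add: mid_def)

lemma ginv_asc_nat1: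
  assumes "f \<in> Arr A" "g \<in> Arr A" "h \<in> Arr A" "Cod A f = x" "Cod A g = y" "Cod A h = z"
  shows "ginv A (asc A x y z) \<cdot> (f \<uplus> (g \<uplus> h)) = ((f \<uplus> g) \<uplus> h)
      \<cdot> ginv A (asc A (Dom A f) (Dom A g) (Dom A h))"
proof -
  have "(f \<uplus> (g \<uplus> h)) \<cdot> asc A (Dom A f) (Dom A g) (Dom A h) = asc A x y z \<cdot> ((f \<uplus> g) \<uplus> h)"
    using assms by (simp add: asc_nat)
  then show ?thesis
    using assms by (subst (asm) ginv_move_right) auto
qed

lemmas ginv_asc_nat = ginv_asc_nat1 comp_reduce[OF ginv_asc_nat1]

lemma mid_nat1:
  assumes "f \<in> Arr A" "g \<in> Arr A" "h \<in> Arr A" "k \<in> Arr A"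
    "Cod A f = a" "Cod A g = b" "Cod A h = c" "Cod A k = d"
  shows "mid A a b c d \<cdot> ((f \<uplus> g) \<uplus> (h \<uplus> k))
    = ((f \<uplus> h) \<uplus> (g \<uplus> k)) \<cdot> mid A (Dom A f) (Dom A g) (Dom A h) (Dom A k)"
proof -
  note [simp] = assms(1-4)
  \<comment> \<open>\<open>I\<close> exchanges the first two of three summands nested to the right;
    \<open>mid\<close> is this exchange under the first summand, between two associativity
    constraints. Naturality is proved for \<open>I\<close> and then carried over to
    \<open>mid\<close>.\<close>
  define I where "I x y z = asc A y x z \<cdot> ((sym A x y \<uplus> Ide A z) \<cdot> ginv A (asc A x y z))" for x y z
  have I [simp]: "I x y z \<in> Arr A" "Dom A (I x y z) = x \<oplus> (y \<oplus> z)" "Cod A (I x y z) = y \<oplus> (x \<oplus> z)"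
    if "x \<in> Obj A" "y \<in> Obj A" "z \<in> Obj A" for x y z
    using that by (auto simp: I_def)
  have "I (Cod A g) (Cod A h) (Cod A k) \<cdot> (g \<uplus> (h \<uplus> k))
      = asc A (Cod A h) (Cod A g) (Cod A k) \<cdot> (((sym A (Cod A g) (Cod A h) \<cdot> (g \<uplus> h)) \<uplus> k) \<cdot>
          ginv A (asc A (Dom A g) (Dom A h) (Dom A k)))"
    by (simp add: I_def ginv_asc_nat)
  also have "\<dots> = asc A (Cod A h) (Cod A g) (Cod A k) \<cdot> (((h \<uplus> g) \<uplus> k) \<cdot>
      ((sym A (Dom A g) (Dom A h) \<uplus> Ide A (Dom A k)) \<cdot> ginv A (asc A (Dom A g) (Dom A h) (Dom A k))))"
    by (simp add: sym_nat)
  also have "\<dots> = (h \<uplus> (g \<uplus> k)) \<cdot> I (Dom A g) (Dom A h) (Dom A k)"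
    by (subst asc_nat(2)) (simp_all add: I_def)
  finally have *: "I (Cod A g) (Cod A h) (Cod A k) \<cdot> (g \<uplus> (h \<uplus> k))
      = (h \<uplus> (g \<uplus> k)) \<cdot> I (Dom A g) (Dom A h) (Dom A k)" .
  have m: "mid A x y z u = ginv A (asc A x z (y \<oplus> u)) \<cdot> ((Ide A x \<uplus> I y z u) \<cdot> asc A x y (z
      \<oplus> u))" for x y z u
    by (simp add: mid_def I_def)
  have "mid A a b c d \<cdot> ((f \<uplus> g) \<uplus> (h \<uplus> k)) = ginv A (asc A (Cod A f) (Cod A h) (Cod A g \<oplus> Cod A k)) \<cdot>
      ((f \<uplus> (I (Cod A g) (Cod A h) (Cod A k) \<cdot> (g \<uplus> (h \<uplus> k)))) \<cdot> asc A (Dom A f) (Dom A g) (Dom A h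
          \<oplus> Dom A k))"
    unfolding m assms(5-8)[symmetric] by (simp add: asc_nat)
  also have "\<dots> = ginv A (asc A (Cod A f) (Cod A h) (Cod A g \<oplus> Cod A k)) \<cdot> ((f \<uplus> (h \<uplus> (g \<uplus> k))) \<cdot>
      ((Ide A (Dom A f) \<uplus> I (Dom A g) (Dom A h) (Dom A k)) \<cdot> asc A (Dom A f) (Dom A g) (Dom A h
          \<oplus> Dom A k)))"
    by (simp add: *)
  also have "\<dots> = ((f \<uplus> h) \<uplus> (g \<uplus> k)) \<cdot> mid A (Dom A f) (Dom A g) (Dom A h) (Dom A k)"
    unfolding m by (subst ginv_asc_nat(2)) simp_all
  finally show ?thesis .
qed

lemmas mid_nat = mid_nat1 comp_reduce[OF mid_nat1]

text \<open>On realisations both sides move b past c, b past e and d past e; they differ only in the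
  order of the disjoint crossings of b, c and of d, e, which commute by \<open>swap_nat\<close>.
  Variables for trees keep every object in the form \<open>tree_obj\<close> that the realisation
  lemmas expect.\<close>

lemma mid_asc_tree:
  assumes [simp]: "tree_ok a" "tree_ok b" "tree_ok c" "tree_ok d" "tree_ok e" "tree_ok f"
  defines [simp]: "m \<equiv> \<lambda>s t u v. mid A (tree_obj s) (tree_obj t) (tree_obj u) (tree_obj v)"
  shows "(asc A (tree_obj a) (tree_obj c) (tree_obj e) \<uplus> asc A (tree_obj b) (tree_obj d) (tree_obj f)) \<cdot>
        (m (Nd a c) (Nd b d) e f \<cdot> (m a b c d \<uplus> Ide A (tree_obj (Nd e f))))
    = m a b (Nd c e) (Nd d f) \<cdot> ((Ide A (tree_obj (Nd a b)) \<uplus> m c d e f)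
        \<cdot> asc A (tree_obj (Nd a b)) (tree_obj (Nd c d)) (tree_obj (Nd e f)))"
proof (rule realize_inj)
  let ?X0 = "Nd (Nd (Nd a b) (Nd c d)) (Nd e f)"
  let ?X1 = "Nd (Nd (Nd a c) (Nd b d)) (Nd e f)"
  let ?X2 = "Nd (Nd (Nd a c) e) (Nd (Nd b d) f)"
  let ?X3 = "Nd (Nd a (Nd c e)) (Nd b (Nd d f))"
  let ?Y1 = "Nd (Nd a b) (Nd (Nd c d) (Nd e f))"
  let ?Y2 = "Nd (Nd a b) (Nd (Nd c e) (Nd d f))"
  let ?w = "\<zero>"
  have 1: "realize ?X2 ?X3 (asc A (tree_obj a) (tree_obj c) (tree_obj e)
      \<uplus> asc A (tree_obj b) (tree_obj d) (tree_obj f)) ?w = Ide A (tree_act ?X3 ?w)"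
    by (simp add: realize_add realize_asc)
  have 2: "realize ?X1 ?X2 (m (Nd a c) (Nd b d) e f) ?w = tree_actA (Nd a c) (swap (Nd b d) e (tree_act
      f ?w))"
    using realize_mid[of "Nd a c" "Nd b d" e f ?w] by simp
  have 3: "realize ?X0 ?X1 (m a b c d \<uplus> Ide A (tree_obj (Nd e f))) ?w
      = tree_actA a (swap b c (tree_act d (tree_act (Nd e f) ?w)))"
    using realize_Ide[of "Nd e f" ?w] by (simp add: realize_add realize_mid)
  have 4: "realize ?Y2 ?X3 (m a b (Nd c e) (Nd d f)) ?w = tree_actA a (swap b (Nd c e) (tree_act (Nd d
      f) ?w))"
    using realize_mid[of a b "Nd c e" "Nd d f" ?w] by simp
  have 5: "realize ?Y1 ?Y2 (Ide A (tree_obj (Nd a b)) \<uplus> m c d e f) ?w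
      = tree_actA (Nd a b) (tree_actA c (swap d e (tree_act f ?w)))"
    using realize_Ide[of "Nd a b"] by (simp add: realize_add realize_mid)
  have 6: "realize ?X0 ?Y1 (asc A (tree_obj (Nd a b)) (tree_obj (Nd c d)) (tree_obj (Nd e f))) ?w
      = Ide A (tree_act ?X0 ?w)"
    using realize_asc[of "Nd a b" "Nd c d" "Nd e f" ?w] by simp
  have "realize ?X0 ?X3 ((asc A (tree_obj a) (tree_obj c) (tree_obj e)
      \<uplus> asc A (tree_obj b) (tree_obj d) (tree_obj f)) \<cdot>
        (m (Nd a c) (Nd b d) e f \<cdot> (m a b c d \<uplus> Ide A (tree_obj (Nd e f))))) ?w
      = realize ?X2 ?X3 (asc A (tree_obj a) (tree_obj c) (tree_obj e)
          \<uplus> asc A (tree_obj b) (tree_obj d) (tree_obj f)) ?w \<cdot>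
        (realize ?X1 ?X2 (m (Nd a c) (Nd b d) e f) ?w \<cdot> realize ?X0 ?X1 (m a b c d
            \<uplus> Ide A (tree_obj (Nd e f))) ?w)"
    by (subst realize_comp[of _ ?X2], simp_all, subst realize_comp[of _ ?X1], simp_all)
  also have "\<dots> = tree_actA (Nd a c) (swap (Nd b d) e (tree_act f ?w))
      \<cdot> tree_actA a (swap b c (tree_act d (tree_act (Nd e f) ?w)))"
    unfolding 1 2 3 by simp
  also have "\<dots> = tree_actA a (tree_actA c (swap b e (tree_act d (tree_act f ?w))) \<cdot>
      (tree_actA c (tree_actA b (swap d e (tree_act f ?w)))
          \<cdot> swap b c (tree_act d (tree_act e (tree_act f ?w)))))"
    by (simp add: swap_Nd_left tree_actA_comp)
  also have "\<dots> = tree_actA a (tree_actA c (swap b e (tree_act d (tree_act f ?w))) \<cdot>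
      (swap b c (tree_act e (tree_act d (tree_act f ?w))) \<cdot> tree_actA b (tree_actA c (swap d e
          (tree_act f ?w)))))"
    by (simp add: swap_nat)
  also have "\<dots> = tree_actA a (swap b (Nd c e) (tree_act (Nd d f) ?w))
      \<cdot> tree_actA (Nd a b) (tree_actA c (swap d e (tree_act f ?w)))"
    by (simp add: swap_Nd_right tree_actA_comp)
  also have "\<dots> = realize ?Y2 ?X3 (m a b (Nd c e) (Nd d f)) ?w \<cdot>
      (realize ?Y1 ?Y2 (Ide A (tree_obj (Nd a b)) \<uplus> m c d e f) ?w \<cdot>
       realize ?X0 ?Y1 (asc A (tree_obj (Nd a b)) (tree_obj (Nd c d)) (tree_obj (Nd e f))) ?w)"
    unfolding 4 5 6 by simp
  also have "\<dots> = realize ?X0 ?X3 (m a b (Nd c e) (Nd d f) \<cdot> ((Ide A (tree_obj (Nd a b)) \<uplus> m c d e f) \<cdot>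
       asc A (tree_obj (Nd a b)) (tree_obj (Nd c d)) (tree_obj (Nd e f)))) ?w"
    by (subst realize_comp[of _ ?Y2], simp_all, subst realize_comp[of _ ?Y1], simp_all)
  finally show "realize ?X0 ?X3 ((asc A (tree_obj a) (tree_obj c) (tree_obj e)
      \<uplus> asc A (tree_obj b) (tree_obj d) (tree_obj f)) \<cdot>
        (m (Nd a c) (Nd b d) e f \<cdot> (m a b c d \<uplus> Ide A (tree_obj (Nd e f))))) ?w = \<dots>" .
qed simp_all

lemma mid_asc:
  assumes "a \<in> Obj A" "b \<in> Obj A" "c \<in> Obj A" "d \<in> Obj A" "e \<in> Obj A" "f \<in> Obj A"
  shows "(asc A a c e \<uplus> asc A b d f) \<cdot> (mid A (a \<oplus> c) (b \<oplus> d) e f \<cdot> (mid A a b c d \<uplus> Ide A (e \<oplus> f)))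
    = mid A a b (c \<oplus> e) (d \<oplus> f) \<cdot> ((Ide A (a \<oplus> b) \<uplus> mid A c d e f) \<cdot> asc A (a \<oplus> b) (c \<oplus> d) (e \<oplus> f))"
  using mid_asc_tree[of "Lf a" "Lf b" "Lf c" "Lf d" "Lf e" "Lf f"] assms by simp

text \<open>The inverse of \<open>mid_asc\<close>, since inverting \<open>mid\<close> exchanges its
  two middle arguments. In this form it says that the associativity constraint is a monoidal
  transformation between iterated sums.\<close>

lemma asc_mid:
  assumes [simp]: "a \<in> Obj A" "b \<in> Obj A" "c \<in> Obj A" "d \<in> Obj A" "e \<in> Obj A" "f \<in> Obj A"
  shows "asc A (a \<oplus> d) (b \<oplus> e) (c \<oplus> f) \<cdot> ((mid A a b d e \<uplus> Ide A (c \<oplus> f)) \<cdot> mid A (a \<oplus> b) c (d \<oplus> e) f)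
    = (Ide A (a \<oplus> d) \<uplus> mid A b c e f) \<cdot> (mid A a (b \<oplus> c) d (e \<oplus> f) \<cdot> (asc A a b c \<uplus> asc A d e f))"
proof -
  have "ginv A ((asc A a b c \<uplus> asc A d e f) \<cdot> (mid A (a \<oplus> b) (d \<oplus> e) c f \<cdot> (mid A a d b e \<uplus> Ide A (c
      \<oplus> f))))
    = ginv A (mid A a d (b \<oplus> c) (e \<oplus> f) \<cdot> ((Ide A (a \<oplus> d) \<uplus> mid A b e c f) \<cdot> asc A (a \<oplus> d) (b \<oplus> e) (c
        \<oplus> f)))"
    by (subst mid_asc) simp_all
  then have "(mid A a b d e \<uplus> Ide A (c \<oplus> f)) \<cdot> (mid A (a \<oplus> b) c (d \<oplus> e) f \<cdot> ginv A (asc A a b c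
      \<uplus> asc A d e f))
    = ginv A (asc A (a \<oplus> d) (b \<oplus> e) (c \<oplus> f)) \<cdot> ((Ide A (a \<oplus> d) \<uplus> mid A b c e f) \<cdot> mid A a (b \<oplus> c) d (e
        \<oplus> f))"
    by (simp add: ginv_mid)
  then have "asc A (a \<oplus> d) (b \<oplus> e) (c \<oplus> f) \<cdot> (((mid A a b d e \<uplus> Ide A (c \<oplus> f)) \<cdot>
        (mid A (a \<oplus> b) c (d \<oplus> e) f \<cdot> ginv A (asc A a b c \<uplus> asc A d e f))) \<cdot> (asc A a b c \<uplus> asc A d e f))
    = asc A (a \<oplus> d) (b \<oplus> e) (c \<oplus> f) \<cdot> ((ginv A (asc A (a \<oplus> d) (b \<oplus> e) (c \<oplus> f)) \<cdot>
        ((Ide A (a \<oplus> d) \<uplus> mid A b c e f) \<cdot> mid A a (b \<oplus> c) d (e \<oplus> f))) \<cdot> (asc A a b c \<uplus> asc A d e f))"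
    by (simp only:)
  then show ?thesis by simp
qed

lemma mid_sym_tree:
  assumes [simp]: "tree_ok a" "tree_ok b" "tree_ok c" "tree_ok d"
  defines [simp]: "m \<equiv> \<lambda>s t u v. mid A (tree_obj s) (tree_obj t) (tree_obj u) (tree_obj v)"
  shows "(sym A (tree_obj a) (tree_obj c) \<uplus> sym A (tree_obj b) (tree_obj d)) \<cdot> m a b c d
    = m c d a b \<cdot> sym A (tree_obj (Nd a b)) (tree_obj (Nd c d))"
proof (rule realize_inj)
  let ?X0 = "Nd (Nd a b) (Nd c d)"
  let ?X1 = "Nd (Nd a c) (Nd b d)"
  let ?X2 = "Nd (Nd c a) (Nd d b)"
  let ?Y1 = "Nd (Nd c d) (Nd a b)"
  let ?w = "\<zero>"
  \<comment> \<open>The symmetry of the two blocks also moves a past d, a crossing that is missing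
    on the left-hand side. This inverse pair inserts it, and the inverse that remains in front is
    the realisation of \<open>mid\<close> at c, d, a, b.\<close>
  have 1: "tree_actA c (swap d a (tree_act b ?w)) \<cdot> tree_actA c (swap a d (tree_act b ?w))
      = Ide A (tree_act c (tree_act a (tree_act d (tree_act b ?w))))"
    by (simp add: swap_Sy flip: tree_actA_comp)
  have "realize ?X0 ?X2 ((sym A (tree_obj a) (tree_obj c) \<uplus> sym A (tree_obj b) (tree_obj d))
      \<cdot> m a b c d) ?w
      = realize ?X1 ?X2 (sym A (tree_obj a) (tree_obj c) \<uplus> sym A (tree_obj b) (tree_obj d)) ?w
          \<cdot> realize ?X0 ?X1 (m a b c d) ?w"
    by (subst realize_comp[of _ ?X1], simp_all)
  also have "\<dots> = swap a c (tree_act d (tree_act b ?w)) \<cdot> (tree_actA a (tree_actA c (swap b d ?w))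
      \<cdot> tree_actA a (swap b c (tree_act d ?w)))"
    unfolding m_def by (simp add: realize_add realize_mid)
  also have "\<dots> = tree_actA c (swap d a (tree_act b ?w)) \<cdot> (tree_actA c (swap a d (tree_act b ?w)) \<cdot>
      (swap a c (tree_act d (tree_act b ?w)) \<cdot> (tree_actA a (tree_actA c (swap b d ?w))
          \<cdot> tree_actA a (swap b c (tree_act d ?w)))))"
    by (subst comp_reduce[OF 1]) simp_all
  also have "\<dots> = tree_actA c (swap d a (tree_act b ?w)) \<cdot> swap (Nd a b) (Nd c d) ?w"
    by (simp add: swap_Nd_left swap_Nd_right tree_actA_comp comp_reduce[OF swap_nat])
  also have "\<dots> = realize ?Y1 ?X2 (m c d a b) ?w \<cdot> realize ?X0 ?Y1 (sym A (tree_obj (Nd a b)) (tree_obj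
      (Nd c d))) ?w"
    unfolding m_def swap_def[of "Nd a b" "Nd c d"] by (simp add: realize_mid)
  also have "\<dots> = realize ?X0 ?X2 (m c d a b \<cdot> sym A (tree_obj (Nd a b)) (tree_obj (Nd c d))) ?w"
    by (subst realize_comp[of _ ?Y1], simp_all)
  finally show "realize ?X0 ?X2 ((sym A (tree_obj a) (tree_obj c) \<uplus> sym A (tree_obj b) (tree_obj d))
      \<cdot> m a b c d) ?w = \<dots>" .
qed simp_all

lemma mid_sym:
  assumes "a \<in> Obj A" "b \<in> Obj A" "c \<in> Obj A" "d \<in> Obj A"
  shows "(sym A a c \<uplus> sym A b d) \<cdot> mid A a b c d = mid A c d a b \<cdot> sym A (a \<oplus> b) (c \<oplus> d)"
  using mid_sym_tree[of "Lf a" "Lf b" "Lf c" "Lf d"] assms by simp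

text \<open>The inverse of \<open>mid_sym\<close>; it expresses that the symmetry constraint is a
  monoidal transformation between the two sums.\<close>

lemma sym_mid:
  assumes [simp]: "a \<in> Obj A" "b \<in> Obj A" "c \<in> Obj A" "d \<in> Obj A"
  shows "sym A (a \<oplus> c) (b \<oplus> d) \<cdot> mid A a b c d = mid A b a d c \<cdot> (sym A a b \<uplus> sym A c d)"
proof -
  have "ginv A ((sym A b a \<uplus> sym A d c) \<cdot> mid A b d a c) = ginv A (mid A a c b d \<cdot> sym A (b \<oplus> d) (a
      \<oplus> c))"
    by (subst mid_sym) simp_all
  then show ?thesis by (simp add: ginv_mid)
qed

end

section \<open>Symmetric monoidal functors and transformations\<close>

lemma (in groupoid) ginv_square:
  assumes "b \<cdot> f = g \<cdot> a" "a \<in> Arr G" "b \<in> Arr G" "f \<in> Arr G" "g \<in> Arr G"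
    "Dom G b = Cod G f" "Dom G g = Cod G a" "Dom G a = Dom G f"
  shows "ginv G b \<cdot> g = f \<cdot> ginv G a"
proof -
  have "ginv G b \<cdot> g = (ginv G b \<cdot> (g \<cdot> a)) \<cdot> ginv G a"
    using assms(2-) arg_cong[OF assms(1), of "Cod G"] by simp
  also have "\<dots> = f \<cdot> ginv G a"
    unfolding assms(1)[symmetric] using assms(2-) by simp
  finally show ?thesis .
qed

text \<open>Naturality of the left unit constraint at its own component, whose leading factor
  cancels.\<close>

lemma (in scg) lun_zero:
  assumes [simp]: "x \<in> Obj A"
  shows "Ide A \<zero> \<uplus> lun A x = lun A (\<zero> \<oplus> x)"
proof -
  have "lun A x \<cdot> (Ide A \<zero> \<uplus> lun A x) = lun A x \<cdot> lun A (\<zero> \<oplus> x)"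
    by (simp add: lun_nat)
  then show ?thesis by (subst (asm) cancel_left) simp_all
qed

text \<open>The binary part of a symmetric monoidal functor. Keeping it apart allows sums and right
  multiplications to be given by their binary constraints, with the unit constraint supplied
  afterwards by division.\<close>

locale pre_sm_functor = gfunctor A B F + A?: scg A + B?: scg B
  for A :: "('o, 'a, 'm) scg_scheme"
  and B :: "('p, 'b, 'n) scg_scheme" (structure)
  and F :: "('o, 'a, 'p, 'b, 'k) smfun_scheme" +
  assumes pre_fM_hom: "x \<in> Obj A \<Longrightarrow> y \<in> Obj A \<Longrightarrow>
        fM F x y \<in> ghom B (fO F x \<oplus> fO F y) (fO F (x \<oplus>\<^bsub>A\<^esub> y))"
    and pre_fM_natural: "f \<in> ghom A x x' \<Longrightarrow> g \<in> ghom A y y' \<Longrightarrow>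
        fM F x' y' \<cdot> (fA F f \<uplus> fA F g) = fA F (f \<uplus>\<^bsub>A\<^esub> g) \<cdot> fM F x y"
    and pre_fM_asc: "x \<in> Obj A \<Longrightarrow> y \<in> Obj A \<Longrightarrow> z \<in> Obj A \<Longrightarrow>
        fA F (asc A x y z) \<cdot> (fM F (x \<oplus>\<^bsub>A\<^esub> y) z \<cdot> (fM F x y \<uplus> Ide B (fO F z)))
        = fM F x (y \<oplus>\<^bsub>A\<^esub> z) \<cdot> ((Ide B (fO F x) \<uplus> fM F y z)
            \<cdot> asc B (fO F x) (fO F y) (fO F z))"
    and pre_fM_sym: "x \<in> Obj A \<Longrightarrow> y \<in> Obj A \<Longrightarrow>
        fA F (sym A x y) \<cdot> fM F x y = fM F y x \<cdot> sym B (fO F x) (fO F y)"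
begin

lemma fM_simps [simp]:
  assumes "x \<in> Obj A" "y \<in> Obj A"
  shows "fM F x y \<in> Arr B" "Dom B (fM F x y) = fO F x \<oplus> fO F y" "Cod B (fM F x y) = fO F (x \<oplus>\<^bsub>A\<^esub> y)"
  using pre_fM_hom[OF assms] by auto

lemma fM_nat1:
  assumes "f \<in> Arr A" "g \<in> Arr A" "Cod A f = x" "Cod A g = y"
  shows "fM F x y \<cdot> (fA F f \<uplus> fA F g) = fA F (f \<uplus>\<^bsub>A\<^esub> g) \<cdot> fM F (Dom A f) (Dom A g)"
  using assms by (intro pre_fM_natural) auto

lemmas fM_nat = fM_nat1 B.comp_reduce[OF fM_nat1]

text \<open>The arrows \<open>q x\<close> let F0 act on F x, associatively by \<open>qq\<close>. If
  u is a unit for the action on F0, then it acts trivially after precomposition with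
  \<open>q x\<close>; as \<open>q x\<close> is invertible, it acts trivially on F x itself.\<close>

lemma fM_lun_gen:
  assumes [simp]: "u \<in> Arr B" "Dom B u = \<zero>" "Cod B u = fO F \<zero>\<^bsub>A\<^esub>"
    and u: "fA F (lun A \<zero>\<^bsub>A\<^esub>) \<cdot> (fM F \<zero>\<^bsub>A\<^esub> \<zero>\<^bsub>A\<^esub> \<cdot> (u \<uplus> Ide B (fO F \<zero>\<^bsub>A\<^esub>))) = lun B (fO F \<zero>\<^bsub>A\<^esub>)"
    and [simp]: "x \<in> Obj A"
  shows "fA F (lun A x) \<cdot> (fM F \<zero>\<^bsub>A\<^esub> x \<cdot> (u \<uplus> Ide B (fO F x))) = lun B (fO F x)"
proof -
  let ?z = "\<zero>\<^bsub>A\<^esub>" and ?F0 = "fO F \<zero>\<^bsub>A\<^esub>" and ?Fx = "fO F x"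
  define q where "q x = fA F (lun A x) \<cdot> fM F ?z x" for x
  have q [simp]: "q x \<in> Arr B" "Dom B (q x) = ?F0 \<oplus> fO F x" "Cod B (q x) = fO F x" if "x \<in> Obj A" for x
    using that by (auto simp: q_def)
  have lz: "lun A ?z \<uplus>\<^bsub>A\<^esub> Ide A x = (Ide A ?z \<uplus>\<^bsub>A\<^esub> lun A x) \<cdot>\<^bsub>A\<^esub> asc A ?z ?z x"
    by (simp add: A.lun_zero A.lun_add)
  have "q x \<cdot> (q ?z \<uplus> Ide B ?Fx)
    = fA F (lun A x) \<cdot> (fM F ?z x \<cdot> ((fA F (lun A ?z) \<uplus> fA F (Ide A x)) \<cdot> (fM F ?z ?z \<uplus> Ide B ?Fx)))"
    by (simp add: q_def)
  also have "\<dots> = fA F (lun A x) \<cdot> (fA F (lun A ?z \<uplus>\<^bsub>A\<^esub> Ide A x) \<cdot> (fM F (?z \<oplus>\<^bsub>A\<^esub> ?z) x \<cdot> (fM F ?z ?z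
      \<uplus> Ide B ?Fx)))"
    by (subst fM_nat(2)) simp_all
  also have "\<dots> = fA F (lun A x) \<cdot> (fA F (Ide A ?z \<uplus>\<^bsub>A\<^esub> lun A x) \<cdot> (fA F (asc A ?z ?z x) \<cdot> (fM F (?z
      \<oplus>\<^bsub>A\<^esub> ?z) x \<cdot> (fM F ?z ?z \<uplus> Ide B ?Fx))))"
    unfolding lz by (simp add: fA_comp_simp)
  also have "\<dots> = fA F (lun A x) \<cdot> (fA F (Ide A ?z \<uplus>\<^bsub>A\<^esub> lun A x) \<cdot> (fM F ?z (?z \<oplus>\<^bsub>A\<^esub> x) \<cdot> ((Ide B ?F0
      \<uplus> fM F ?z x)
            \<cdot> asc B ?F0 ?F0 ?Fx)))"
    by (subst pre_fM_asc) simp_all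
  also have "\<dots> = fA F (lun A x) \<cdot> (fM F ?z x \<cdot> ((fA F (Ide A ?z) \<uplus> fA F (lun A x)) \<cdot> ((Ide B ?F0
      \<uplus> fM F ?z x)
            \<cdot> asc B ?F0 ?F0 ?Fx)))"
    by (subst fM_nat(2)) simp_all
  also have "\<dots> = q x \<cdot> ((Ide B ?F0 \<uplus> q x) \<cdot> asc B ?F0 ?F0 ?Fx)"
    by (simp add: q_def)
  finally have qq: "q x \<cdot> (q ?z \<uplus> Ide B ?Fx) = q x \<cdot> ((Ide B ?F0 \<uplus> q x) \<cdot> asc B ?F0 ?F0 ?Fx)" .
  let ?m = "(Ide B \<zero> \<uplus> q x) \<cdot> asc B \<zero> ?F0 ?Fx"
  have "(q x \<cdot> (u \<uplus> Ide B ?Fx)) \<cdot> ?m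
      = q x \<cdot> ((Ide B ?F0 \<uplus> q x) \<cdot> ((u \<uplus> (Ide B ?F0 \<uplus> Ide B ?Fx)) \<cdot> asc B \<zero> ?F0 ?Fx))"
    by simp
  also have "\<dots> = q x \<cdot> ((Ide B ?F0 \<uplus> q x) \<cdot> (asc B ?F0 ?F0 ?Fx \<cdot> ((u \<uplus> Ide B ?F0) \<uplus> Ide B ?Fx)))"
    by (subst B.asc_nat(1)) simp_all
  also have "\<dots> = q x \<cdot> ((q ?z \<uplus> Ide B ?Fx) \<cdot> ((u \<uplus> Ide B ?F0) \<uplus> Ide B ?Fx))"
    using B.comp_reduce[OF qq, of "(u \<uplus> Ide B ?F0) \<uplus> Ide B ?Fx"] by simp
  also have "\<dots> = q x \<cdot> (lun B ?F0 \<uplus> Ide B ?Fx)"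
    using u by (simp add: q_def)
  also have "\<dots> = q x \<cdot> (lun B (?F0 \<oplus> ?Fx) \<cdot> asc B \<zero> ?F0 ?Fx)"
    by (simp add: B.lun_add)
  also have "\<dots> = lun B ?Fx \<cdot> ?m"
    by (subst B.lun_nat(2)) simp_all
  finally have "q x \<cdot> (u \<uplus> Ide B ?Fx) = lun B ?Fx"
    by (subst (asm) B.cancel_right) simp_all
  then show ?thesis by (simp add: q_def)
qed

lemma fM_run_gen:
  assumes [simp]: "u \<in> Arr B" "Dom B u = \<zero>" "Cod B u = fO F \<zero>\<^bsub>A\<^esub>"
    and u: "fA F (lun A \<zero>\<^bsub>A\<^esub>) \<cdot> (fM F \<zero>\<^bsub>A\<^esub> \<zero>\<^bsub>A\<^esub> \<cdot> (u \<uplus> Ide B (fO F \<zero>\<^bsub>A\<^esub>))) = lun B (fO F \<zero>\<^bsub>A\<^esub>)"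
    and [simp]: "x \<in> Obj A"
  shows "fA F (run A x) \<cdot> (fM F x \<zero>\<^bsub>A\<^esub> \<cdot> (Ide B (fO F x) \<uplus> u)) = run B (fO F x)"
proof -
  have "fA F (run A x) \<cdot> (fM F x \<zero>\<^bsub>A\<^esub> \<cdot> (Ide B (fO F x) \<uplus> u))
    = fA F (lun A x) \<cdot> ((fA F (sym A x \<zero>\<^bsub>A\<^esub>) \<cdot> fM F x \<zero>\<^bsub>A\<^esub>) \<cdot> (Ide B (fO F x) \<uplus> u))"
    by (simp add: fA_comp_simp flip: A.lun_sym)
  also have "\<dots> = fA F (lun A x) \<cdot> (fM F \<zero>\<^bsub>A\<^esub> x \<cdot> ((u \<uplus> Ide B (fO F x)) \<cdot> sym B (fO F x) \<zero>))"
    by (subst pre_fM_sym) (simp_all add: B.sym_nat)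
  also have "\<dots> = (fA F (lun A x) \<cdot> (fM F \<zero>\<^bsub>A\<^esub> x \<cdot> (u \<uplus> Ide B (fO F x)))) \<cdot> sym B (fO F x) \<zero>"
    by simp
  also have "\<dots> = run B (fO F x)"
    using fM_lun_gen[of u x] u by simp
  finally show ?thesis .
qed

text \<open>The unit law at zero is an equation for u + F0, which is solvable because adding F0 is
  full.\<close>

lemma fU_ex:
  "\<exists>u. u \<in> ghom B \<zero> (fO F \<zero>\<^bsub>A\<^esub>) \<and>
    fA F (lun A \<zero>\<^bsub>A\<^esub>) \<cdot> (fM F \<zero>\<^bsub>A\<^esub> \<zero>\<^bsub>A\<^esub> \<cdot> (u \<uplus> Ide B (fO F \<zero>\<^bsub>A\<^esub>))) = lun B (fO F \<zero>\<^bsub>A\<^esub>)"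
proof -
  let ?q = "fA F (lun A \<zero>\<^bsub>A\<^esub>) \<cdot> fM F \<zero>\<^bsub>A\<^esub> \<zero>\<^bsub>A\<^esub>"
  obtain u where u: "u \<in> ghom B \<zero> (fO F \<zero>\<^bsub>A\<^esub>)" "u \<uplus> Ide B (fO F \<zero>\<^bsub>A\<^esub>) = ginv B ?q \<cdot> lun B (fO F \<zero>\<^bsub>A\<^esub>)"
    using B.addA_right_full[of "fO F \<zero>\<^bsub>A\<^esub>" "\<zero>" "fO F \<zero>\<^bsub>A\<^esub>" "ginv B ?q \<cdot> lun B (fO F \<zero>\<^bsub>A\<^esub>)"] by auto
  then show ?thesis by (intro exI[of _ u]) simp
qed

lemma sm_functor_pre:
  assumes "fU F \<in> ghom B \<zero> (fO F \<zero>\<^bsub>A\<^esub>)"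
    "fA F (lun A \<zero>\<^bsub>A\<^esub>) \<cdot> (fM F \<zero>\<^bsub>A\<^esub> \<zero>\<^bsub>A\<^esub> \<cdot> (fU F \<uplus> Ide B (fO F \<zero>\<^bsub>A\<^esub>))) = lun B (fO F \<zero>\<^bsub>A\<^esub>)"
  shows "sm_functor A B F"
  using assms fM_lun_gen[of "fU F"] fM_run_gen[of "fU F"] pre_fM_natural pre_fM_asc pre_fM_sym
  by unfold_locales auto

end

sublocale sm_functor \<subseteq> pre_sm_functor
  using fM_hom fM_natural fM_asc fM_sym by unfold_locales

lemma (in sm_functor) fU_simps [simp]: "fU F \<in> Arr B" "Dom B (fU F) = \<zero>\<^bsub>B\<^esub>" "Cod B (fU F) = fO F \<zero>\<^bsub>A\<^esub>"
  using fU_hom by auto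

lemma pre_sm_functor_fU:
  assumes "pre_sm_functor A B F"
  shows "pre_sm_functor A B (F\<lparr>fU := u\<rparr>)"
proof -
  interpret pre_sm_functor A B F by fact
  show ?thesis
    using fA_hom fA_comp pre_fM_natural pre_fM_asc pre_fM_sym by unfold_locales simp_all
qed

lemma sm_functor_fU_ex:
  fixes A (structure)
  assumes "pre_sm_functor A B F"
  shows "\<exists>u. sm_functor A B (F\<lparr>fU := u\<rparr>)"
proof -
  interpret pre_sm_functor A B F by fact
  obtain u where "u \<in> ghom B \<zero>\<^bsub>B\<^esub> (fO F \<zero>)"
    "fA F (lun A \<zero>) \<cdot>\<^bsub>B\<^esub> (fM F \<zero> \<zero> \<cdot>\<^bsub>B\<^esub> (u \<uplus>\<^bsub>B\<^esub> Ide B (fO F \<zero>))) = lun B (fO F \<zero>)"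
    using fU_ex by blast
  then show ?thesis
    by (intro exI[of _ u] pre_sm_functor.sm_functor_pre pre_sm_functor_fU assms) simp_all
qed

lemma pre_sm_functorI:
  fixes B (structure)
  assumes "scg A" "scg B"
    and "\<And>x. x \<in> Obj A \<Longrightarrow> fO F x \<in> Obj B"
    and "\<And>f. f \<in> Arr A \<Longrightarrow> fA F f \<in> Arr B" "\<And>f. f \<in> Arr A \<Longrightarrow> Dom B (fA F f) = fO F (Dom A f)"
      "\<And>f. f \<in> Arr A \<Longrightarrow> Cod B (fA F f) = fO F (Cod A f)"
    and "\<And>x. x \<in> Obj A \<Longrightarrow> fA F (Ide A x) = Ide B (fO F x)"
    and "\<And>f g. f \<in> Arr A \<Longrightarrow> g \<in> Arr A \<Longrightarrow> Dom A g = Cod A f \<Longrightarrow> fA F (g \<cdot>\<^bsub>A\<^esub> f) = fA F g \<cdot> fA F f"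
    and "\<And>x y. x \<in> Obj A \<Longrightarrow> y \<in> Obj A \<Longrightarrow> fM F x y \<in> Arr B"
      "\<And>x y. x \<in> Obj A \<Longrightarrow> y \<in> Obj A \<Longrightarrow> Dom B (fM F x y) = fO F x \<oplus> fO F y"
      "\<And>x y. x \<in> Obj A \<Longrightarrow> y \<in> Obj A \<Longrightarrow> Cod B (fM F x y) = fO F (x \<oplus>\<^bsub>A\<^esub> y)"
    and "\<And>f g. f \<in> Arr A \<Longrightarrow> g \<in> Arr A \<Longrightarrow> fM F (Cod A f) (Cod A g) \<cdot> (fA F f \<uplus> fA F g)
        = fA F (f \<uplus>\<^bsub>A\<^esub> g) \<cdot> fM F (Dom A f) (Dom A g)"
    and "\<And>x y z. x \<in> Obj A \<Longrightarrow> y \<in> Obj A \<Longrightarrow> z \<in> Obj A \<Longrightarrow>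
        fA F (asc A x y z) \<cdot> (fM F (x \<oplus>\<^bsub>A\<^esub> y) z \<cdot> (fM F x y \<uplus> Ide B (fO F z)))
        = fM F x (y \<oplus>\<^bsub>A\<^esub> z) \<cdot> ((Ide B (fO F x) \<uplus> fM F y z)
            \<cdot> asc B (fO F x) (fO F y) (fO F z))"
    and "\<And>x y. x \<in> Obj A \<Longrightarrow> y \<in> Obj A \<Longrightarrow>
        fA F (sym A x y) \<cdot> fM F x y = fM F y x \<cdot> sym B (fO F x) (fO F y)"
  shows "pre_sm_functor A B F"
proof -
  interpret A: scg A by fact
  interpret B: scg B by fact
  show ?thesis
    using assms(3-) by unfold_locales auto
qed

text \<open>The unit condition is derived by cancellation: \<open>t ?z \<cdot> fU F\<close> and
  \<open>fU G\<close>, each added to \<open>t ?z\<close> and followed by the constraint of G at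
  zero, give the same arrow. This uses the binary condition, naturality of t at
  \<open>lun A ?z\<close>, and the unit laws of F and G.\<close>

lemma sm_transI:
  fixes B (structure)
  assumes F: "sm_functor A B F" and G: "sm_functor A B G"
    and t [simp]: "\<And>x. x \<in> Obj A \<Longrightarrow> t x \<in> Arr B" "\<And>x. x \<in> Obj A \<Longrightarrow> Dom B (t x) = fO F x"
      "\<And>x. x \<in> Obj A \<Longrightarrow> Cod B (t x) = fO G x"
    and nat: "\<And>f. f \<in> Arr A \<Longrightarrow> t (Cod A f) \<cdot> fA F f = fA G f \<cdot> t (Dom A f)"
    and t_fM: "\<And>x y. x \<in> Obj A \<Longrightarrow> y \<in> Obj A \<Longrightarrow> t (x \<oplus>\<^bsub>A\<^esub> y) \<cdot> fM F x y = fM G x y \<cdot> (t x \<uplus> t y)"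
  shows "sm_trans A B F G t"
proof -
  interpret F: sm_functor A B F by fact
  interpret G: sm_functor A B G by fact
  let ?z = "\<zero>\<^bsub>A\<^esub>"
  have "(fA G (lun A ?z) \<cdot> fM G ?z ?z) \<cdot> ((t ?z \<cdot> fU F) \<uplus> t ?z)
      = fA G (lun A ?z) \<cdot> ((fM G ?z ?z \<cdot> (t ?z \<uplus> t ?z)) \<cdot> (fU F \<uplus> Ide B (fO F ?z)))"
    by simp
  also have "\<dots> = (fA G (lun A ?z) \<cdot> t (?z \<oplus>\<^bsub>A\<^esub> ?z)) \<cdot> (fM F ?z ?z \<cdot> (fU F \<uplus> Ide B (fO F ?z)))"
    by (subst t_fM[symmetric]) simp_all
  also have "\<dots> = t ?z \<cdot> (fA F (lun A ?z) \<cdot> (fM F ?z ?z \<cdot> (fU F \<uplus> Ide B (fO F ?z))))"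
    using nat[of "lun A ?z"] by (simp flip: F.B.comp_assoc_simp)
  also have "\<dots> = lun B (fO G ?z) \<cdot> (Ide B \<zero> \<uplus> t ?z)"
    using F.fM_lun[of ?z] by (simp add: F.B.lun_nat)
  also have "\<dots> = (fA G (lun A ?z) \<cdot> fM G ?z ?z) \<cdot> (fU G \<uplus> t ?z)"
    by (subst G.fM_lun[of ?z, symmetric]) simp_all
  finally have "(t ?z \<cdot> fU F) \<uplus> t ?z = fU G \<uplus> t ?z"
    by (subst (asm) F.B.cancel_left) simp_all
  then have "t ?z \<cdot> fU F = fU G"
    by (rule F.B.addA_right_cancel) simp_all
  then show ?thesis
    using nat t_fM by unfold_locales auto
qed

context sm_trans begin
lemma t_nat_tail:
  "f \<in> Arr A \<Longrightarrow> Cod A f = x \<Longrightarrow> r \<in> Arr B \<Longrightarrow> Cod B r = fO F (Dom A f) \<Longrightarrow>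
    t x \<cdot>\<^bsub>B\<^esub> (fA F f \<cdot>\<^bsub>B\<^esub> r) = fA G f \<cdot>\<^bsub>B\<^esub> (t (Dom A f) \<cdot>\<^bsub>B\<^esub> r)"
  using F.B.comp_reduce[OF t_nat[of f], of r] by auto

lemma t_fM_tail:
  "x \<in> Obj A \<Longrightarrow> y \<in> Obj A \<Longrightarrow> r \<in> Arr B \<Longrightarrow> Cod B r = fO F x \<oplus>\<^bsub>B\<^esub> fO F y \<Longrightarrow>
    t (x \<oplus>\<^bsub>A\<^esub> y) \<cdot>\<^bsub>B\<^esub> (fM F x y \<cdot>\<^bsub>B\<^esub> r) = fM G x y \<cdot>\<^bsub>B\<^esub> ((t x \<uplus>\<^bsub>B\<^esub> t y) \<cdot>\<^bsub>B\<^esub> r)"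
  using F.B.comp_reduce[OF t_fM[of x y], of r] by auto
end


section \<open>Composites, inverses and whiskerings\<close>

lemma sm_functorI:
  fixes A (structure)
  assumes "pre_sm_functor A B F" "fU F \<in> Arr B" "Dom B (fU F) = \<zero>\<^bsub>B\<^esub>" "Cod B (fU F) = fO F \<zero>"
    "fA F (lun A \<zero>) \<cdot>\<^bsub>B\<^esub> (fM F \<zero> \<zero> \<cdot>\<^bsub>B\<^esub> (fU F \<uplus>\<^bsub>B\<^esub> Ide B (fO F \<zero>))) = lun B (fO F \<zero>)"
  shows "sm_functor A B F"
  using assms by (intro pre_sm_functor.sm_functor_pre) auto

lemma sm_functor_smcomp:
  fixes C (structure)
  assumes "sm_functor A B F" "sm_functor B C G"
  shows "sm_functor A C (smcomp C G F)"
proof -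
  interpret F: sm_functor A B F by fact
  interpret G: sm_functor B C G by fact
  note [simp] = F.fA_comp_simp G.fA_comp_simp
  show ?thesis
  proof (rule sm_functorI, rule pre_sm_functorI)
    fix x y z assume xyz [simp]: "x \<in> Obj A" "y \<in> Obj A" "z \<in> Obj A"
    let ?x = "fO F x" and ?y = "fO F y" and ?z = "fO F z"
    let ?r = "fM G (?x \<oplus>\<^bsub>B\<^esub> ?y) ?z \<cdot> (fM G ?x ?y \<uplus> Ide C (fO G ?z))"
    have "fA G (fA F (asc A x y z)) \<cdot> ((fA G (fM F (x \<oplus>\<^bsub>A\<^esub> y) z) \<cdot> fM G (fO F (x \<oplus>\<^bsub>A\<^esub> y)) ?z) \<cdot>
            ((fA G (fM F x y) \<cdot> fM G ?x ?y) \<uplus> Ide C (fO G ?z)))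
       = fA G (fA F (asc A x y z)) \<cdot> (fA G (fM F (x \<oplus>\<^bsub>A\<^esub> y) z) \<cdot> (fM G (fO F (x \<oplus>\<^bsub>A\<^esub> y)) ?z \<cdot>
            ((fA G (fM F x y) \<uplus> fA G (Ide B ?z)) \<cdot> (fM G ?x ?y \<uplus> Ide C (fO G ?z)))))"
      by simp
    also have "\<dots> = fA G (fA F (asc A x y z) \<cdot>\<^bsub>B\<^esub> (fM F (x \<oplus>\<^bsub>A\<^esub> y) z \<cdot>\<^bsub>B\<^esub> (fM F x y \<uplus>\<^bsub>B\<^esub> Ide B ?z)))
        \<cdot> ?r"
      by (subst G.fM_nat(2)) simp_all
    also have "\<dots> = fA G (fM F x (y \<oplus>\<^bsub>A\<^esub> z)) \<cdot> (fA G (Ide B ?x \<uplus>\<^bsub>B\<^esub> fM F y z) \<cdot> (fA G (asc B ?x ?y ?z)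
        \<cdot> ?r))"
      by (subst F.pre_fM_asc) simp_all
    also have "\<dots> = fA G (fM F x (y \<oplus>\<^bsub>A\<^esub> z)) \<cdot> (fA G (Ide B ?x \<uplus>\<^bsub>B\<^esub> fM F y z) \<cdot> (fM G ?x (?y \<oplus>\<^bsub>B\<^esub> ?z) \<cdot>
        ((Ide C (fO G ?x) \<uplus> fM G ?y ?z) \<cdot> asc C (fO G ?x) (fO G ?y) (fO G ?z))))"
      by (subst G.pre_fM_asc) simp_all
    also have "\<dots> = fA G (fM F x (y \<oplus>\<^bsub>A\<^esub> z)) \<cdot> (fM G ?x (fO F (y \<oplus>\<^bsub>A\<^esub> z)) \<cdot> ((fA G (Ide B ?x)
        \<uplus> fA G (fM F y z)) \<cdot>
        ((Ide C (fO G ?x) \<uplus> fM G ?y ?z) \<cdot> asc C (fO G ?x) (fO G ?y) (fO G ?z))))"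
      by (subst G.fM_nat(2)) simp_all
    finally show "fA (smcomp C G F) (asc A x y z) \<cdot> (fM (smcomp C G F) (x \<oplus>\<^bsub>A\<^esub> y) z \<cdot>
          (fM (smcomp C G F) x y \<uplus> Ide C (fO (smcomp C G F) z)))
        = fM (smcomp C G F) x (y \<oplus>\<^bsub>A\<^esub> z) \<cdot> ((Ide C (fO (smcomp C G F) x) \<uplus> fM (smcomp C G F) y z)
            \<cdot> asc C (fO (smcomp C G F) x) (fO (smcomp C G F) y) (fO (smcomp C G F) z))"
      by (simp add: smcomp_def)
    have "fA G (fA F (sym A x y)) \<cdot> (fA G (fM F x y) \<cdot> fM G ?x ?y)
        = fA G (fM F y x) \<cdot> (fA G (sym B ?x ?y) \<cdot> fM G ?x ?y)"
      using arg_cong[OF F.pre_fM_sym[of x y], where f = "fA G"] by (simp flip: G.B.comp_assoc_simp)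
    then show "fA (smcomp C G F) (sym A x y) \<cdot> fM (smcomp C G F) x y
        = fM (smcomp C G F) y x \<cdot> sym C (fO (smcomp C G F) x) (fO (smcomp C G F) y)"
      by (simp add: smcomp_def G.pre_fM_sym)
  next
    fix f g assume [simp]: "f \<in> Arr A" "g \<in> Arr A"
    have *: "fA G (fM F (Cod A f) (Cod A g)) \<cdot> fA G (fA F f \<uplus>\<^bsub>B\<^esub> fA F g)
        = fA G (fA F (f \<uplus>\<^bsub>A\<^esub> g)) \<cdot> fA G (fM F (Dom A f) (Dom A g))"
      using arg_cong[OF F.fM_nat(1)[of f g "Cod A f" "Cod A g"], where f = "fA G"] by simp
    have "fA G (fM F (Cod A f) (Cod A g)) \<cdot> (fA G (fA F f \<uplus>\<^bsub>B\<^esub> fA F g)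
        \<cdot> fM G (fO F (Dom A f)) (fO F (Dom A g)))
        = (fA G (fA F (f \<uplus>\<^bsub>A\<^esub> g)) \<cdot> fA G (fM F (Dom A f) (Dom A g)))
            \<cdot> fM G (fO F (Dom A f)) (fO F (Dom A g))"
      by (rule G.B.comp_reduce[OF *]) simp_all
    then show "fM (smcomp C G F) (Cod A f) (Cod A g) \<cdot> (fA (smcomp C G F) f \<uplus> fA (smcomp C G F) g)
        = fA (smcomp C G F) (f \<uplus>\<^bsub>A\<^esub> g) \<cdot> fM (smcomp C G F) (Dom A f) (Dom A g)"
      by (simp add: smcomp_def G.fM_nat)
  next
    let ?z = "\<zero>\<^bsub>A\<^esub>" and ?zB = "\<zero>\<^bsub>B\<^esub>"
    let ?F0 = "fO F ?z"
    have "fA G (fA F (lun A ?z)) \<cdot> ((fA G (fM F ?z ?z) \<cdot> fM G ?F0 ?F0) \<cdot>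
        ((fA G (fU F) \<cdot> fU G) \<uplus> Ide C (fO G ?F0)))
      = fA G (fA F (lun A ?z)) \<cdot> (fA G (fM F ?z ?z) \<cdot> (fM G ?F0 ?F0 \<cdot>
          ((fA G (fU F) \<uplus> fA G (Ide B ?F0)) \<cdot> (fU G \<uplus> Ide C (fO G ?F0)))))"
      by simp
    also have "\<dots> = fA G (fA F (lun A ?z) \<cdot>\<^bsub>B\<^esub> (fM F ?z ?z \<cdot>\<^bsub>B\<^esub> (fU F \<uplus>\<^bsub>B\<^esub> Ide B ?F0))) \<cdot>
        (fM G ?zB ?F0 \<cdot> (fU G \<uplus> Ide C (fO G ?F0)))"
      by (subst G.fM_nat(2)) simp_all
    also have "\<dots> = lun C (fO G ?F0)"
      by (subst F.fM_lun) (simp_all add: G.fM_lun)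
    finally show "fA (smcomp C G F) (lun A ?z) \<cdot> (fM (smcomp C G F) ?z ?z \<cdot>
        (fU (smcomp C G F) \<uplus> Ide C (fO (smcomp C G F) ?z))) = lun C (fO (smcomp C G F) ?z)"
      by (simp add: smcomp_def)
  qed (simp_all add: smcomp_def F.A.scg_axioms G.B.scg_axioms)
qed

lemma sm_functor_id:
  assumes "scg A"
  shows "sm_functor A A (id_smfun A)"
proof -
  interpret scg A by fact
  show ?thesis
    by (rule sm_functorI, rule pre_sm_functorI) (simp_all add: id_smfun_def assms)
qed

lemma sm_trans_Ide:
  assumes "sm_functor A B F"
  shows "sm_trans A B F F (\<lambda>x. Ide B (fO F x))"
proof -
  interpret F: sm_functor A B F by fact
  show ?thesis by (rule sm_transI) (simp_all add: assms)
qed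

lemma sm_trans_comp:
  fixes B (structure)
  assumes "sm_trans A B F G t" "sm_trans A B G H s"
  shows "sm_trans A B F H (\<lambda>x. s x \<cdot> t x)"
proof -
  interpret t: sm_trans A B F G t by fact
  interpret s: sm_trans A B G H s by fact
  show ?thesis
    by (rule sm_transI)
      (simp_all add: t.F.sm_functor_axioms s.G.sm_functor_axioms t.t_nat t.t_fM s.t_nat_tail
          s.t_fM_tail)
qed

lemma sm_trans_ginv:
  fixes B (structure)
  assumes "sm_trans A B F G t"
  shows "sm_trans A B G F (\<lambda>x. ginv B (t x))"
proof -
  interpret t: sm_trans A B F G t by fact
  show ?thesis
  proof (rule sm_transI)
    fix f assume [simp]: "f \<in> Arr A"
    show "ginv B (t (Cod A f)) \<cdot> fA G f = fA F f \<cdot> ginv B (t (Dom A f))"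
      by (rule t.F.B.ginv_square[OF t.t_nat]) simp_all
  next
    fix x y assume [simp]: "x \<in> Obj A" "y \<in> Obj A"
    show "ginv B (t (x \<oplus>\<^bsub>A\<^esub> y)) \<cdot> fM G x y = fM F x y \<cdot> (ginv B (t x) \<uplus> ginv B (t y))"
      using t.F.B.ginv_square[OF t.t_fM[of x y]] by simp
  qed (simp_all add: t.F.sm_functor_axioms t.G.sm_functor_axioms)
qed

lemma sm_trans_whisker_left:
  fixes C (structure)
  assumes "sm_trans A B F F' t" "sm_functor B C G"
  shows "sm_trans A C (smcomp C G F) (smcomp C G F') (\<lambda>x. fA G (t x))"
proof -
  interpret t: sm_trans A B F F' t by fact
  interpret G: sm_functor B C G by fact
  show ?thesis
  proof (rule sm_transI)
    fix f assume [simp]: "f \<in> Arr A"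
    show "fA G (t (Cod A f)) \<cdot> fA (smcomp C G F) f = fA (smcomp C G F') f \<cdot> fA G (t (Dom A f))"
      by (simp add: smcomp_def t.t_nat flip: G.fA_comp_simp)
  next
    fix x y assume [simp]: "x \<in> Obj A" "y \<in> Obj A"
    have *: "fA G (t (x \<oplus>\<^bsub>A\<^esub> y)) \<cdot> fA G (fM F x y) = fA G (fM F' x y) \<cdot> fA G (t x \<uplus>\<^bsub>B\<^esub> t y)"
      by (simp add: t.t_fM flip: G.fA_comp_simp)
    have "fA G (t (x \<oplus>\<^bsub>A\<^esub> y)) \<cdot> (fA G (fM F x y) \<cdot> fM G (fO F x) (fO F y))
        = (fA G (fM F' x y) \<cdot> fA G (t x \<uplus>\<^bsub>B\<^esub> t y)) \<cdot> fM G (fO F x) (fO F y)"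
      by (rule G.B.comp_reduce[OF *]) simp_all
    then show "fA G (t (x \<oplus>\<^bsub>A\<^esub> y)) \<cdot> fM (smcomp C G F) x y
        = fM (smcomp C G F') x y \<cdot> (fA G (t x) \<uplus> fA G (t y))"
      by (simp add: smcomp_def G.fM_nat)
  qed (simp_all add: sm_functor_smcomp[OF _ assms(2)] t.F.sm_functor_axioms t.G.sm_functor_axioms,
      simp_all add: smcomp_def)
qed

lemma sm_trans_whisker_right:
  fixes C (structure)
  assumes "sm_functor A B F" "sm_trans B C G G' s"
  shows "sm_trans A C (smcomp C G F) (smcomp C G' F) (\<lambda>x. s (fO F x))"
proof -
  interpret s: sm_trans B C G G' s by fact
  interpret F: sm_functor A B F by fact
  show ?thesis
  proof (rule sm_transI)
    fix f assume [simp]: "f \<in> Arr A"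
    show "s (fO F (Cod A f)) \<cdot> fA (smcomp C G F) f = fA (smcomp C G' F) f \<cdot> s (fO F (Dom A f))"
      using s.t_nat[of "fA F f"] by (simp add: smcomp_def)
  next
    fix x y assume [simp]: "x \<in> Obj A" "y \<in> Obj A"
    show "s (fO F (x \<oplus>\<^bsub>A\<^esub> y)) \<cdot> fM (smcomp C G F) x y
        = fM (smcomp C G' F) x y \<cdot> (s (fO F x) \<uplus> s (fO F y))"
      by (simp add: smcomp_def s.t_fM s.t_nat_tail)
  qed (simp_all add: sm_functor_smcomp[OF assms(1)] s.F.sm_functor_axioms s.G.sm_functor_axioms,
      simp_all add: smcomp_def)
qed

section \<open>Pointwise sums of symmetric monoidal functors\<close>

definition smsum0 :: "('p, 'b, 'n) scg_scheme \<Rightarrow> ('o, 'a, 'p, 'b, 'k) smfun_scheme \<Rightarrow> ('o, 'a, 'p, 'b,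
    'l) smfun_scheme
    \<Rightarrow> ('o, 'a, 'p, 'b) smfun" where
  "smsum0 B F G = \<lparr>fO = \<lambda>x. fO F x \<oplus>\<^bsub>B\<^esub> fO G x, fA = \<lambda>f. fA F f \<uplus>\<^bsub>B\<^esub> fA G f,
     fM = \<lambda>x y. (fM F x y \<uplus>\<^bsub>B\<^esub> fM G x y) \<cdot>\<^bsub>B\<^esub> mid B (fO F x) (fO G x) (fO F y) (fO G y), fU
         = undefined\<rparr>"

text \<open>The unit constraint of a symmetric monoidal functor between symmetric categorical groups
  is determined by the rest of the structure, so it can be left to choice.\<close>

definition smsum :: "('o, 'a, 'm) scg_scheme \<Rightarrow> ('p, 'b, 'n) scg_scheme \<Rightarrow> ('o, 'a, 'p, 'b, 'k)
    smfun_scheme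
    \<Rightarrow> ('o, 'a, 'p, 'b, 'l) smfun_scheme \<Rightarrow> ('o, 'a, 'p, 'b) smfun" where
  "smsum A B F G = (smsum0 B F G)\<lparr>fU := SOME u. sm_functor A B ((smsum0 B F G)\<lparr>fU := u\<rparr>)\<rparr>"

lemma smsum_simps [simp]:
  "fO (smsum A B F G) x = fO F x \<oplus>\<^bsub>B\<^esub> fO G x"
  "fA (smsum A B F G) f = fA F f \<uplus>\<^bsub>B\<^esub> fA G f"
  "fM (smsum A B F G) x y = (fM F x y \<uplus>\<^bsub>B\<^esub> fM G x y) \<cdot>\<^bsub>B\<^esub> mid B (fO F x) (fO G x) (fO F y) (fO G y)"
  by (simp_all add: smsum_def smsum0_def)

text \<open>The constraints of F and G are moved past \<open>mid\<close> by naturality; what is left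
  of associativity and symmetry are the laws \<open>mid_asc\<close> and \<open>mid_sym\<close> in
  the target.\<close>

lemma sm_functor_smsum:
  fixes B (structure)
  assumes "sm_functor A B F" "sm_functor A B G"
  shows "sm_functor A B (smsum A B F G)"
proof -
  interpret F: sm_functor A B F by fact
  interpret G: sm_functor A B G by fact
  have "pre_sm_functor A B (smsum0 B F G)"
  proof (rule pre_sm_functorI)
    fix f g assume [simp]: "f \<in> Arr A" "g \<in> Arr A"
    show "fM (smsum0 B F G) (Cod A f) (Cod A g) \<cdot> (fA (smsum0 B F G) f \<uplus> fA (smsum0 B F G) g)
        = fA (smsum0 B F G) (f \<uplus>\<^bsub>A\<^esub> g) \<cdot> fM (smsum0 B F G) (Dom A f) (Dom A g)"
      by (simp add: smsum0_def F.B.mid_nat F.fM_nat G.fM_nat)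
  next
    fix x y z assume [simp]: "x \<in> Obj A" "y \<in> Obj A" "z \<in> Obj A"
    let ?i = "Ide B (fO F z \<oplus> fO G z)"
    let ?m = "mid B (fO F x) (fO G x) (fO F y) (fO G y) \<uplus> ?i"
    let ?n = "mid B (fO F x \<oplus> fO F y) (fO G x \<oplus> fO G y) (fO F z) (fO G z)"
    have "(fA F (asc A x y z) \<uplus> fA G (asc A x y z)) \<cdot> (((fM F (x \<oplus>\<^bsub>A\<^esub> y) z \<uplus> fM G (x \<oplus>\<^bsub>A\<^esub> y) z) \<cdot>
          mid B (fO F (x \<oplus>\<^bsub>A\<^esub> y)) (fO G (x \<oplus>\<^bsub>A\<^esub> y)) (fO F z) (fO G z)) \<cdot>
         (((fM F x y \<uplus> fM G x y) \<cdot> mid B (fO F x) (fO G x) (fO F y) (fO G y)) \<uplus> ?i))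
      = (fA F (asc A x y z) \<uplus> fA G (asc A x y z)) \<cdot> ((fM F (x \<oplus>\<^bsub>A\<^esub> y) z \<uplus> fM G (x \<oplus>\<^bsub>A\<^esub> y) z) \<cdot>
          (mid B (fO F (x \<oplus>\<^bsub>A\<^esub> y)) (fO G (x \<oplus>\<^bsub>A\<^esub> y)) (fO F z) (fO G z) \<cdot>
         (((fM F x y \<uplus> fM G x y) \<uplus> (Ide B (fO F z) \<uplus> Ide B (fO G z))) \<cdot> ?m)))"
      by simp
    also have "\<dots> = ((fA F (asc A x y z) \<cdot> (fM F (x \<oplus>\<^bsub>A\<^esub> y) z \<cdot> (fM F x y \<uplus> Ide B (fO F z)))) \<uplus>
        (fA G (asc A x y z) \<cdot> (fM G (x \<oplus>\<^bsub>A\<^esub> y) z \<cdot> (fM G x y \<uplus> Ide B (fO G z))))) \<cdot> (?n \<cdot> ?m)"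
      by (subst F.B.mid_nat(2)) simp_all
    also have "\<dots> = (fM F x (y \<oplus>\<^bsub>A\<^esub> z) \<uplus> fM G x (y \<oplus>\<^bsub>A\<^esub> z)) \<cdot>
        (((Ide B (fO F x) \<uplus> fM F y z) \<uplus> (Ide B (fO G x) \<uplus> fM G y z)) \<cdot>
        ((asc B (fO F x) (fO F y) (fO F z) \<uplus> asc B (fO G x) (fO G y) (fO G z)) \<cdot> (?n \<cdot> ?m)))"
      by (subst F.pre_fM_asc G.pre_fM_asc; simp)+
    also have "\<dots> = (fM F x (y \<oplus>\<^bsub>A\<^esub> z) \<uplus> fM G x (y \<oplus>\<^bsub>A\<^esub> z)) \<cdot>
        (((Ide B (fO F x) \<uplus> fM F y z) \<uplus> (Ide B (fO G x) \<uplus> fM G y z)) \<cdot>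
        (mid B (fO F x) (fO G x) (fO F y \<oplus> fO F z) (fO G y \<oplus> fO G z) \<cdot>
        ((Ide B (fO F x \<oplus> fO G x) \<uplus> mid B (fO F y) (fO G y) (fO F z) (fO G z)) \<cdot>
         asc B (fO F x \<oplus> fO G x) (fO F y \<oplus> fO G y) (fO F z \<oplus> fO G z))))"
      by (subst F.B.mid_asc) simp_all
    also have "\<dots> = (fM F x (y \<oplus>\<^bsub>A\<^esub> z) \<uplus> fM G x (y \<oplus>\<^bsub>A\<^esub> z)) \<cdot>
        (mid B (fO F x) (fO G x) (fO F (y \<oplus>\<^bsub>A\<^esub> z)) (fO G (y \<oplus>\<^bsub>A\<^esub> z)) \<cdot>
        (((Ide B (fO F x) \<uplus> Ide B (fO G x)) \<uplus> (fM F y z \<uplus> fM G y z)) \<cdot>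
        ((Ide B (fO F x \<oplus> fO G x) \<uplus> mid B (fO F y) (fO G y) (fO F z) (fO G z)) \<cdot>
         asc B (fO F x \<oplus> fO G x) (fO F y \<oplus> fO G y) (fO F z \<oplus> fO G z))))"
      by (subst F.B.mid_nat(2)) simp_all
    finally show "fA (smsum0 B F G) (asc A x y z) \<cdot> (fM (smsum0 B F G) (x \<oplus>\<^bsub>A\<^esub> y) z \<cdot>
          (fM (smsum0 B F G) x y \<uplus> Ide B (fO (smsum0 B F G) z)))
        = fM (smsum0 B F G) x (y \<oplus>\<^bsub>A\<^esub> z) \<cdot> ((Ide B (fO (smsum0 B F G) x) \<uplus> fM (smsum0 B F G) y z)
            \<cdot> asc B (fO (smsum0 B F G) x) (fO (smsum0 B F G) y) (fO (smsum0 B F G) z))"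
      by (simp add: smsum0_def)
    show "fA (smsum0 B F G) (sym A x y) \<cdot> fM (smsum0 B F G) x y
        = fM (smsum0 B F G) y x \<cdot> sym B (fO (smsum0 B F G) x) (fO (smsum0 B F G) y)"
      by (simp add: smsum0_def F.pre_fM_sym G.pre_fM_sym flip: F.B.mid_sym)
  qed (simp_all add: smsum0_def F.A.scg_axioms F.B.scg_axioms F.fA_comp_simp G.fA_comp_simp)
  then show ?thesis
    unfolding smsum_def by (rule someI_ex[OF sm_functor_fU_ex])
qed

lemma sm_trans_sum:
  fixes B (structure)
  assumes "sm_trans A B F F' t" "sm_trans A B G G' s"
  shows "sm_trans A B (smsum A B F G) (smsum A B F' G') (\<lambda>x. t x \<uplus> s x)"
proof -
  interpret t: sm_trans A B F F' t by fact
  interpret s: sm_trans A B G G' s by fact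
  show ?thesis
    by (rule sm_transI) (simp_all add: sm_functor_smsum t.F.sm_functor_axioms t.G.sm_functor_axioms
        s.F.sm_functor_axioms s.G.sm_functor_axioms t.t_nat s.t_nat t.F.B.mid_nat t.t_fM s.t_fM)
qed

lemma sm_trans_sum_asc:
  fixes B (structure)
  assumes "sm_functor A B F" "sm_functor A B G" "sm_functor A B H"
  shows "sm_trans A B (smsum A B (smsum A B F G) H) (smsum A B F (smsum A B G H)) (\<lambda>x. asc B (fO F x)
      (fO G x) (fO H x))"
proof -
  interpret F: sm_functor A B F by fact
  interpret G: sm_functor A B G by fact
  interpret H: sm_functor A B H by fact
  show ?thesis
  proof (rule sm_transI)
    fix x y assume [simp]: "x \<in> Obj A" "y \<in> Obj A"
    let ?m = "mid B (fO F x \<oplus> fO G x) (fO H x) (fO F y \<oplus> fO G y) (fO H y)"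
    let ?n = "mid B (fO F x) (fO G x) (fO F y) (fO G y)"
    have "asc B (fO F (x \<oplus>\<^bsub>A\<^esub> y)) (fO G (x \<oplus>\<^bsub>A\<^esub> y)) (fO H (x \<oplus>\<^bsub>A\<^esub> y)) \<cdot>
        ((((fM F x y \<uplus> fM G x y) \<cdot> ?n) \<uplus> fM H x y) \<cdot> ?m)
      = asc B (fO F (x \<oplus>\<^bsub>A\<^esub> y)) (fO G (x \<oplus>\<^bsub>A\<^esub> y)) (fO H (x \<oplus>\<^bsub>A\<^esub> y)) \<cdot>
        (((fM F x y \<uplus> fM G x y) \<uplus> fM H x y) \<cdot> ((?n \<uplus> Ide B (fO H x \<oplus> fO H y)) \<cdot> ?m))"
      by simp
    also have "\<dots> = (fM F x y \<uplus> (fM G x y \<uplus> fM H x y)) \<cdot>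
        ((Ide B (fO F x \<oplus> fO F y) \<uplus> mid B (fO G x) (fO H x) (fO G y) (fO H y)) \<cdot>
         (mid B (fO F x) (fO G x \<oplus> fO H x) (fO F y) (fO G y \<oplus> fO H y) \<cdot>
         (asc B (fO F x) (fO G x) (fO H x) \<uplus> asc B (fO F y) (fO G y) (fO H y))))"
      by (subst F.B.asc_nat(2); simp; subst F.B.asc_mid; simp)
    finally show "asc B (fO F (x \<oplus>\<^bsub>A\<^esub> y)) (fO G (x \<oplus>\<^bsub>A\<^esub> y)) (fO H (x \<oplus>\<^bsub>A\<^esub> y))
        \<cdot> fM (smsum A B (smsum A B F G) H) x y
      = fM (smsum A B F (smsum A B G H)) x y \<cdot> (asc B (fO F x) (fO G x) (fO H x)
          \<uplus> asc B (fO F y) (fO G y) (fO H y))"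
      by simp
  qed (simp_all add: sm_functor_smsum assms F.B.asc_nat)
qed

lemma sm_trans_sum_sym:
  assumes "sm_functor A B F" "sm_functor A B G"
  shows "sm_trans A B (smsum A B F G) (smsum A B G F) (\<lambda>x. sym B (fO F x) (fO G x))"
proof -
  interpret F: sm_functor A B F by fact
  interpret G: sm_functor A B G by fact
  show ?thesis
    by (rule sm_transI) (simp_all add: sm_functor_smsum assms F.B.sym_nat F.B.sym_mid)
qed

context pre_sm_functor begin

text \<open>The associativity law with an arbitrary arrow k into F e in the last place, so that it
  applies to a sum of two constraints, k being the second of them.\<close>

lemma fM_asc_add:
  assumes [simp]: "a \<in> Obj A" "b \<in> Obj A" "e \<in> Obj A" "k \<in> Arr B" "Cod B k = fO F e"
  shows "fA F (asc A a b e) \<cdot> (fM F (a \<oplus>\<^bsub>A\<^esub> b) e \<cdot> (fM F a b \<uplus> k))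
    = fM F a (b \<oplus>\<^bsub>A\<^esub> e) \<cdot> ((Ide B (fO F a) \<uplus> (fM F b e \<cdot> (Ide B (fO F b) \<uplus> k)))
        \<cdot> asc B (fO F a) (fO F b) (Dom B k))"
proof -
  have "fA F (asc A a b e) \<cdot> (fM F (a \<oplus>\<^bsub>A\<^esub> b) e \<cdot> (fM F a b \<uplus> k))
    = (fA F (asc A a b e) \<cdot> (fM F (a \<oplus>\<^bsub>A\<^esub> b) e \<cdot> (fM F a b \<uplus> Ide B (fO F e)))) \<cdot> (Ide B (fO F a
        \<oplus> fO F b) \<uplus> k)"
    by simp
  also have "\<dots> = fM F a (b \<oplus>\<^bsub>A\<^esub> e) \<cdot> ((Ide B (fO F a) \<uplus> fM F b e) \<cdot>
      (asc B (fO F a) (fO F b) (fO F e) \<cdot> (Ide B (fO F a \<oplus> fO F b) \<uplus> k)))"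
    by (subst pre_fM_asc) simp_all
  finally show ?thesis by (simp add: B.asc_nat_Ide)
qed

lemma fM_ginv_asc_add:
  assumes [simp]: "a \<in> Obj A" "b \<in> Obj A" "e \<in> Obj A" "k \<in> Arr B" "Cod B k = fO F e"
  shows "fA F (ginv A (asc A a b e)) \<cdot> (fM F a (b \<oplus>\<^bsub>A\<^esub> e) \<cdot> (Ide B (fO F a) \<uplus> (fM F b e
      \<cdot> (Ide B (fO F b) \<uplus> k))))
    = fM F (a \<oplus>\<^bsub>A\<^esub> b) e \<cdot> ((fM F a b \<uplus> k) \<cdot> ginv B (asc B (fO F a) (fO F b) (Dom B k)))"
proof -
  have "fA F (asc A a b e) \<cdot> (fM F (a \<oplus>\<^bsub>A\<^esub> b) e \<cdot> ((fM F a b \<uplus> k)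
      \<cdot> ginv B (asc B (fO F a) (fO F b) (Dom B k))))
     = (fA F (asc A a b e) \<cdot> (fM F (a \<oplus>\<^bsub>A\<^esub> b) e \<cdot> (fM F a b \<uplus> k)))
         \<cdot> ginv B (asc B (fO F a) (fO F b) (Dom B k))"
    by simp
  also have "\<dots> = fM F a (b \<oplus>\<^bsub>A\<^esub> e) \<cdot> (Ide B (fO F a) \<uplus> (fM F b e \<cdot> (Ide B (fO F b) \<uplus> k)))"
    by (subst fM_asc_add) simp_all
  finally show ?thesis
    by (subst (asm) B.ginv_move_left) (simp_all add: fA_ginv)
qed

text \<open>Because \<open>mid\<close> is composed of associativity and symmetry constraints, it is
  preserved by F. The middle exchange \<open>IA\<close> is treated separately and compared with its
  counterpart \<open>IB\<close> in the target.\<close>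

lemma fM_mid:
  assumes [simp]: "a \<in> Obj A" "b \<in> Obj A" "c \<in> Obj A" "d \<in> Obj A"
  shows "fA F (mid A a b c d) \<cdot> (fM F (a \<oplus>\<^bsub>A\<^esub> b) (c \<oplus>\<^bsub>A\<^esub> d) \<cdot> (fM F a b \<uplus> fM F c d))
    = fM F (a \<oplus>\<^bsub>A\<^esub> c) (b \<oplus>\<^bsub>A\<^esub> d) \<cdot> ((fM F a c \<uplus> fM F b d) \<cdot> mid B (fO F a) (fO F b) (fO F c) (fO F d))"
proof -
  let ?F = "fO F"
  define IA where "IA = asc A c b d \<cdot>\<^bsub>A\<^esub> ((sym A b c \<uplus>\<^bsub>A\<^esub> Ide A d) \<cdot>\<^bsub>A\<^esub> ginv A (asc A b c d))"
  define IB where "IB = asc B (?F c) (?F b) (?F d) \<cdot> ((sym B (?F b) (?F c) \<uplus> Ide B (?F d))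
      \<cdot> ginv B (asc B (?F b) (?F c) (?F d)))"
  have [simp]: "IA \<in> Arr A" "Dom A IA = b \<oplus>\<^bsub>A\<^esub> (c \<oplus>\<^bsub>A\<^esub> d)" "Cod A IA = c \<oplus>\<^bsub>A\<^esub> (b \<oplus>\<^bsub>A\<^esub> d)"
     "IB \<in> Arr B" "Dom B IB = ?F b \<oplus> (?F c \<oplus> ?F d)" "Cod B IB = ?F c \<oplus> (?F b \<oplus> ?F d)"
    by (simp_all add: IA_def IB_def)
  have "fA F IA \<cdot> (fM F b (c \<oplus>\<^bsub>A\<^esub> d) \<cdot> (Ide B (?F b) \<uplus> fM F c d))
     = fA F (asc A c b d) \<cdot> (fA F (sym A b c \<uplus>\<^bsub>A\<^esub> Ide A d) \<cdot> (fM F (b \<oplus>\<^bsub>A\<^esub> c) d \<cdot> ((fM F b c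
         \<uplus> Ide B (?F d)) \<cdot>
        ginv B (asc B (?F b) (?F c) (?F d)))))"
    using fM_ginv_asc_add[of b c d "Ide B (?F d)"] by (simp add: IA_def fA_comp_simp)
  also have "\<dots> = fA F (asc A c b d) \<cdot> (fM F (c \<oplus>\<^bsub>A\<^esub> b) d \<cdot> ((fA F (sym A b c) \<uplus> fA F (Ide A d))
      \<cdot> ((fM F b c \<uplus> Ide B (?F d)) \<cdot>
        ginv B (asc B (?F b) (?F c) (?F d)))))"
    by (subst fM_nat(2)) simp_all
  also have "\<dots> = (fA F (asc A c b d) \<cdot> (fM F (c \<oplus>\<^bsub>A\<^esub> b) d \<cdot> (fM F c b \<uplus> Ide B (?F d)))) \<cdot>
     ((sym B (?F b) (?F c) \<uplus> Ide B (?F d)) \<cdot> ginv B (asc B (?F b) (?F c) (?F d)))"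
    by (simp add: pre_fM_sym)
  also have "\<dots> = fM F c (b \<oplus>\<^bsub>A\<^esub> d) \<cdot> ((Ide B (?F c) \<uplus> fM F b d) \<cdot> IB)"
    by (subst pre_fM_asc) (simp_all add: IB_def)
  finally have I: "fA F IA \<cdot> (fM F b (c \<oplus>\<^bsub>A\<^esub> d) \<cdot> (Ide B (?F b) \<uplus> fM F c d))
     = fM F c (b \<oplus>\<^bsub>A\<^esub> d) \<cdot> ((Ide B (?F c) \<uplus> fM F b d) \<cdot> IB)" .
  have "fA F (mid A a b c d) \<cdot> (fM F (a \<oplus>\<^bsub>A\<^esub> b) (c \<oplus>\<^bsub>A\<^esub> d) \<cdot> (fM F a b \<uplus> fM F c d))
    = fA F (ginv A (asc A a c (b \<oplus>\<^bsub>A\<^esub> d))) \<cdot> (fA F (Ide A a \<uplus>\<^bsub>A\<^esub> IA) \<cdot> (fA F (asc A a b (c \<oplus>\<^bsub>A\<^esub> d)) \<cdot>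
       (fM F (a \<oplus>\<^bsub>A\<^esub> b) (c \<oplus>\<^bsub>A\<^esub> d) \<cdot> (fM F a b \<uplus> fM F c d))))"
    by (simp add: mid_def IA_def[symmetric] fA_comp_simp)
  also have "\<dots> = fA F (ginv A (asc A a c (b \<oplus>\<^bsub>A\<^esub> d))) \<cdot> (fA F (Ide A a \<uplus>\<^bsub>A\<^esub> IA) \<cdot> (fM F a (b \<oplus>\<^bsub>A\<^esub> (c
      \<oplus>\<^bsub>A\<^esub> d)) \<cdot>
      ((Ide B (?F a) \<uplus> (fM F b (c \<oplus>\<^bsub>A\<^esub> d) \<cdot> (Ide B (?F b) \<uplus> fM F c d))) \<cdot> asc B (?F a) (?F b) (?F c
          \<oplus> ?F d))))"
    by (subst fM_asc_add) simp_all
  also have "\<dots> = fA F (ginv A (asc A a c (b \<oplus>\<^bsub>A\<^esub> d))) \<cdot> (fM F a (c \<oplus>\<^bsub>A\<^esub> (b \<oplus>\<^bsub>A\<^esub> d)) \<cdot> ((fA F (Ide A a)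
      \<uplus> fA F IA) \<cdot>
      ((Ide B (?F a) \<uplus> (fM F b (c \<oplus>\<^bsub>A\<^esub> d) \<cdot> (Ide B (?F b) \<uplus> fM F c d))) \<cdot> asc B (?F a) (?F b) (?F c
          \<oplus> ?F d))))"
    by (subst fM_nat(2)) simp_all
  also have "\<dots> = (fA F (ginv A (asc A a c (b \<oplus>\<^bsub>A\<^esub> d))) \<cdot> (fM F a (c \<oplus>\<^bsub>A\<^esub> (b \<oplus>\<^bsub>A\<^esub> d)) \<cdot>
      (Ide B (?F a) \<uplus> (fM F c (b \<oplus>\<^bsub>A\<^esub> d) \<cdot> (Ide B (?F c) \<uplus> fM F b d))))) \<cdot>
      ((Ide B (?F a) \<uplus> IB) \<cdot> asc B (?F a) (?F b) (?F c \<oplus> ?F d))"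
    by (simp add: I)
  also have "\<dots> = fM F (a \<oplus>\<^bsub>A\<^esub> c) (b \<oplus>\<^bsub>A\<^esub> d) \<cdot> ((fM F a c \<uplus> fM F b d)
      \<cdot> mid B (?F a) (?F b) (?F c) (?F d))"
    by (subst fM_ginv_asc_add) (simp_all add: mid_def IB_def)
  finally show ?thesis .
qed

end

text \<open>The comparison of HF + HG with H(F + G) is the binary constraint of H; it is monoidal by
  \<open>fM_mid\<close>.\<close>

lemma sm_trans_comp_sum:
  fixes C (structure)
  assumes "sm_functor A B F" "sm_functor A B G" "sm_functor B C H"
  shows "sm_trans A C (smsum A C (smcomp C H F) (smcomp C H G)) (smcomp C H (smsum A B F G)) (\<lambda>x. fM H
      (fO F x) (fO G x))"
proof -
  interpret F: sm_functor A B F by fact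
  interpret G: sm_functor A B G by fact
  interpret H: sm_functor B C H by fact
  show ?thesis
  proof (rule sm_transI)
    fix x y assume [simp]: "x \<in> Obj A" "y \<in> Obj A"
    let ?m = "mid C (fO H (fO F x)) (fO H (fO G x)) (fO H (fO F y)) (fO H (fO G y))"
    have "fM H (fO F (x \<oplus>\<^bsub>A\<^esub> y)) (fO G (x \<oplus>\<^bsub>A\<^esub> y)) \<cdot>
      (((fA H (fM F x y) \<cdot> fM H (fO F x) (fO F y)) \<uplus> (fA H (fM G x y) \<cdot> fM H (fO G x) (fO G y))) \<cdot> ?m)
      = fM H (fO F (x \<oplus>\<^bsub>A\<^esub> y)) (fO G (x \<oplus>\<^bsub>A\<^esub> y)) \<cdot> ((fA H (fM F x y) \<uplus> fA H (fM G x y)) \<cdot>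
        ((fM H (fO F x) (fO F y) \<uplus> fM H (fO G x) (fO G y)) \<cdot> ?m))"
      by simp
    also have "\<dots> = fA H (fM F x y \<uplus>\<^bsub>B\<^esub> fM G x y) \<cdot> (fM H (fO F x \<oplus>\<^bsub>B\<^esub> fO F y) (fO G x \<oplus>\<^bsub>B\<^esub> fO G y) \<cdot>
        ((fM H (fO F x) (fO F y) \<uplus> fM H (fO G x) (fO G y)) \<cdot> ?m))"
      by (subst H.fM_nat(2)) simp_all
    finally show "fM H (fO F (x \<oplus>\<^bsub>A\<^esub> y)) (fO G (x \<oplus>\<^bsub>A\<^esub> y))
        \<cdot> fM (smsum A C (smcomp C H F) (smcomp C H G)) x y
      = fM (smcomp C H (smsum A B F G)) x y \<cdot> (fM H (fO F x) (fO G x) \<uplus> fM H (fO F y) (fO G y))"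
      by (simp add: smcomp_def H.fA_comp_simp H.fM_mid)
  qed (simp_all add: sm_functor_smsum sm_functor_smcomp[OF _ assms(3)] assms, simp_all add: smcomp_def
      H.fM_nat)
qed

section \<open>Functors out of \<open>\<Phi>\<close>\<close>

text \<open>The steps below arise by cancelling invertible arrows and summands, so they are
  equivalences, and one calculation serves both directions of the integers.\<close>

lemma int_iff_induct [case_names zero step]:
  fixes n :: int
  assumes "P 0" "\<And>n. P n \<longleftrightarrow> P (n + 1)"
  shows "P n"
proof (induction n rule: int_induct[where k = 0])
  case (step2 i)
  then show ?case using assms(2)[of "i - 1"] by simp
qed (use assms in auto)

text \<open>Two choices along the natural numbers, upwards by the second assumption and downwards by
  the third, are glued at their common start \<open>h0\<close>. The relation R always compares n
  with n + 1, so on the negative side it is read against the direction of choice.\<close>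

lemma int_dependent_choice:
  fixes P :: "int \<Rightarrow> 'a \<Rightarrow> bool"
  assumes "P 0 h0" "\<And>n h. P n h \<Longrightarrow> \<exists>k. P (n + 1) k \<and> R n h k" "\<And>n k. P (n + 1) k \<Longrightarrow> \<exists>h. P n h \<and> R n h k"
  shows "\<exists>t. t 0 = h0 \<and> (\<forall>n. P n (t n) \<and> R n (t n) (t (n + 1)))"
proof -
  have "\<exists>p. \<forall>n. (P (int n) (p n) \<and> (n = 0 \<longrightarrow> p n = h0)) \<and> R (int n) (p n) (p (Suc n))"
  proof (rule dependent_nat_choice)
    show "\<exists>k. (P (int (Suc n)) k \<and> (Suc n = 0 \<longrightarrow> k = h0)) \<and> R (int n) h k"
      if "P (int n) h \<and> (n = 0 \<longrightarrow> h = h0)" for h n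
      using assms(2)[of "int n" h] that by (simp add: add.commute)
  qed (use assms(1) in auto)
  then obtain p where p: "\<And>n. P (int n) (p n)" "p 0 = h0" "\<And>n. R (int n) (p n) (p (Suc n))"
    by blast
  have "\<exists>q. \<forall>n. (P (- int n) (q n) \<and> (n = 0 \<longrightarrow> q n = h0)) \<and> R (- int n - 1) (q (Suc n)) (q n)"
  proof (rule dependent_nat_choice)
    show "\<exists>k. (P (- int (Suc n)) k \<and> (Suc n = 0 \<longrightarrow> k = h0)) \<and> R (- int n - 1) k h"
      if h: "P (- int n) h \<and> (n = 0 \<longrightarrow> h = h0)" for h n
    proof -
      have "- int (Suc n) = - int n - 1" by simp
      moreover obtain k where "P (- int n - 1) k" "R (- int n - 1) k h"
        using assms(3)[of "- int n - 1" h] h by auto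
      ultimately show ?thesis by (intro exI[of _ k]) (simp only:, simp)
    qed
  qed (use assms(1) in auto)
  then obtain q where q: "\<And>n. P (- int n) (q n)" "q 0 = h0" "\<And>n. R (- int n - 1) (q (Suc n)) (q n)"
    by blast
  define t where "t n = (if 0 \<le> n then p (nat n) else q (nat (- n)))" for n
  have t: "t (int k) = p k" "t (- int k) = q k" for k
    using p(2) q(2) by (auto simp: t_def)
  show ?thesis
  proof (intro exI[of _ t] conjI allI)
    show "t 0 = h0" using t(1)[of 0] p(2) by simp
    fix n
    show "P n (t n)" using p(1) q(1) t by (cases n rule: int_cases2) auto
    show "R n (t n) (t (n + 1))"
    proof (cases "0 \<le> n")
      case True
      then obtain k where "n = int k" using nonneg_int_cases by blast
      then show ?thesis using p(3)[of k] t(1)[of k] t(1)[of "Suc k"] by (simp add: add.commute)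
    next
      case False
      then obtain k where k: "n = - int k - 1"
        using nonneg_int_cases[of "- n - 1"] by (smt (verit))
      then have e: "- int (Suc k) = n" "- int k = n + 1" by auto
      have "t n = q (Suc k)" "t (n + 1) = q k" using t(2)[of k] t(2)[of "Suc k"] unfolding e by auto
      then show ?thesis using q(3)[of k] k by simp
    qed
  qed
qed

lemma sm_functor_scg:
  assumes "sm_functor A B F"
  shows "scg B" "scg A"
  using assms unfolding sm_functor_def by auto

text \<open>The laws with the identity constraints of \<open>Phi\<close> evaluated. The symmetry of
  1 and 1 in \<open>Phi\<close> is the generator over 2, and this generator added to the identity of
  x is the generator over x + 2; so the last two laws control all automorphisms.\<close>

lemma Phi_functor:
  fixes A (structure)
  assumes "sm_functor Phi A F"
  shows Phi_functor_zero: "fA F (n, 0) = Ide A (fO F n)"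
    and Phi_functor_fA: "fA F f \<in> Arr A" "Dom A (fA F f) = fO F (fst f)" "Cod A (fA F f) = fO F (fst f)"
    and Phi_functor_fM: "fM F x y \<in> Arr A" "Dom A (fM F x y) = fO F x \<oplus> fO F y" "Cod A (fM F x y)
        = fO F (x + y)"
    and Phi_functor_fO: "fO F n \<in> Obj A"
    and Phi_functor_fU: "fU F \<in> Arr A" "Dom A (fU F) = \<zero>" "Cod A (fU F) = fO F 0"
    and Phi_functor_asc: "fM F (x + y) z \<cdot> (fM F x y \<uplus> Ide A (fO F z))
        = fM F x (y + z) \<cdot> ((Ide A (fO F x) \<uplus> fM F y z) \<cdot> asc A (fO F x) (fO F y) (fO F z))"
    and Phi_functor_lun: "fM F 0 x \<cdot> (fU F \<uplus> Ide A (fO F x)) = lun A (fO F x)"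
    and Phi_functor_run: "fM F x 0 \<cdot> (Ide A (fO F x) \<uplus> fU F) = run A (fO F x)"
    and Phi_functor_two: "fA F (2, 1) \<cdot> fM F 1 1 = fM F 1 1 \<cdot> sym A (fO F 1) (fO F 1)"
    and Phi_functor_add: "fM F x 2 \<cdot> (Ide A (fO F x) \<uplus> fA F (2, 1)) = fA F (x + 2, 1) \<cdot> fM F x 2"
proof -
  interpret F: sm_functor Phi A F by fact
  show z: "fA F (n, 0) = Ide A (fO F n)" for n
    using F.fA_Ide_simp[of n] by simp
  show f: "fA F f \<in> Arr A" "Dom A (fA F f) = fO F (fst f)" "Cod A (fA F f) = fO F (fst f)"
    "fO F n \<in> Obj A" for f n
    using F.fA_simps[of f] F.fO_in[of n] by auto
  show m: "fM F x y \<in> Arr A" "Dom A (fM F x y) = fO F x \<oplus> fO F y" "Cod A (fM F x y)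
      = fO F (x + y)" for x y
    using F.fM_simps[of x y] by auto
  show u: "fU F \<in> Arr A" "Dom A (fU F) = \<zero>" "Cod A (fU F) = fO F 0"
    using F.fU_simps by auto
  note [simp] = z f m u
  show "fM F (x + y) z \<cdot> (fM F x y \<uplus> Ide A (fO F z))
        = fM F x (y + z) \<cdot> ((Ide A (fO F x) \<uplus> fM F y z) \<cdot> asc A (fO F x) (fO F y) (fO F z))"
    using F.pre_fM_asc[of x y z] by simp
  show "fM F 0 x \<cdot> (fU F \<uplus> Ide A (fO F x)) = lun A (fO F x)"
    using F.fM_lun[of x] by simp
  show "fM F x 0 \<cdot> (Ide A (fO F x) \<uplus> fU F) = run A (fO F x)"
    using F.fM_run[of x] by simp
  show "fA F (2, 1) \<cdot> fM F 1 1 = fM F 1 1 \<cdot> sym A (fO F 1) (fO F 1)"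
    using F.pre_fM_sym[of 1 1] by simp
  show "fM F x 2 \<cdot> (Ide A (fO F x) \<uplus> fA F (2, 1)) = fA F (x + 2, 1) \<cdot> fM F x 2"
    using F.fM_nat(1)[of "(x, 0)" "(2, 1)" x 2] by simp
qed

lemma bit_01: "(a::bit) = 0 \<or> a = 1"
  by (cases a) auto

text \<open>A monoidal transformation out of \<^const>\<open>Phi\<close> only has to respect the constraints \<open>F x +
    F 1 \<rightarrow> F (x + 1)\<close>;
  naturality is automatic, because the generator \<open>\<epsilon>\<close> of the automorphisms is a symmetry.\<close>

lemma Phi_trans_ex:
  fixes A (structure)
  assumes F: "sm_functor Phi A F" and G: "sm_functor Phi A G"
    and a [simp]: "a \<in> Arr A" "Dom A a = fO F 1" "Cod A a = fO G 1"
  shows "\<exists>t. sm_trans Phi A F G t \<and> t 1 = a"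
proof -
  interpret A: scg A by (rule sm_functor_scg[OF F])
  note [simp] = Phi_functor_zero[OF F] Phi_functor_fA[OF F] Phi_functor_fM[OF F] Phi_functor_fO[OF F]
      Phi_functor_fU[OF F]
    Phi_functor_zero[OF G] Phi_functor_fA[OF G] Phi_functor_fM[OF G] Phi_functor_fO[OF G]
        Phi_functor_fU[OF G]
  let ?P = "\<lambda>n h. h \<in> Arr A \<and> Dom A h = fO F n \<and> Cod A h = fO G n"
  let ?R = "\<lambda>n h k. k \<cdot> fM F n 1 = fM G n 1 \<cdot> (h \<uplus> a)"
  \<comment> \<open>The unit condition forces the value at 0, and compatibility with the constraint
    at (n, 1) forces each next value; downwards the arrow is found by dividing by the summand over
    1.\<close>
  have "\<exists>t. t 0 = fU G \<cdot> ginv A (fU F) \<and> (\<forall>n. ?P n (t n) \<and> ?R n (t n) (t (n + 1)))"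
  proof (rule int_dependent_choice)
    fix n h assume h: "?P n h"
    show "\<exists>k. ?P (n + 1) k \<and> ?R n h k"
      using h by (intro exI[of _ "fM G n 1 \<cdot> ((h \<uplus> a) \<cdot> ginv A (fM F n 1))"]) simp
  next
    fix n k assume k: "?P (n + 1) k"
    obtain h where "h \<in> ghom A (fO F n) (fO G n)"
      "h \<uplus> Ide A (fO F 1) = (Ide A (fO G n) \<uplus> ginv A a) \<cdot> (ginv A (fM G n 1) \<cdot> (k \<cdot> fM F n 1))"
      using A.addA_right_full[of "fO F 1" "fO F n" "fO G n"
          "(Ide A (fO G n) \<uplus> ginv A a) \<cdot> (ginv A (fM G n 1) \<cdot> (k \<cdot> fM F n 1))"] k by auto
    then have h: "?P n h"
      "fM G n 1 \<cdot> ((Ide A (fO G n) \<uplus> a) \<cdot> (h \<uplus> Ide A (fO F 1))) = k \<cdot> fM F n 1"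
      using k by (simp_all del: A.merge)
    then show "\<exists>h. ?P n h \<and> ?R n h k" by (intro exI[of _ h]) simp
  qed simp
  then obtain t where t0: "t 0 = fU G \<cdot> ginv A (fU F)"
    and t [simp]: "\<And>n. t n \<in> Arr A" "\<And>n. Dom A (t n) = fO F n" "\<And>n. Cod A (t n) = fO G n"
    and tS: "\<And>n. t (n + 1) \<cdot> fM F n 1 = fM G n 1 \<cdot> (t n \<uplus> a)"
    by blast
  \<comment> \<open>The recursion does not prescribe the value at 1; that it is a comes out of its
    step at 0, through the left unit laws of F and G.\<close>
  have "t 1 \<cdot> lun A (fO F 1) = (t 1 \<cdot> fM F 0 1) \<cdot> (fU F \<uplus> Ide A (fO F 1))"
    by (simp add: Phi_functor_lun[OF F])
  also have "\<dots> = fM G 0 1 \<cdot> ((fU G \<uplus> Ide A (fO G 1)) \<cdot> (Ide A \<zero> \<uplus> a))"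
    using tS[of 0] by (simp add: t0)
  also have "\<dots> = lun A (fO G 1) \<cdot> (Ide A \<zero> \<uplus> a)"
    by (subst A.comp_reduce[OF Phi_functor_lun[OF G]]) simp_all
  also have "\<dots> = a \<cdot> lun A (fO F 1)"
    by (simp add: A.lun_nat)
  finally have t1: "t 1 = a"
    by (subst (asm) A.cancel_right) simp_all
  \<comment> \<open>By associativity the law at (x, y + 1), composed with the invertible
    \<open>?c\<close>, becomes the law at (x, y) with a added; cancelling a gives both directions of
    the step.\<close>
  have t_fM: "t (x + y) \<cdot> fM F x y = fM G x y \<cdot> (t x \<uplus> t y)" for x y
  proof (induction y rule: int_iff_induct)
    case zero
    have "t x \<cdot> (fM F x 0 \<cdot> (Ide A (fO F x) \<uplus> fU F)) = run A (fO G x) \<cdot> (t x \<uplus> Ide A \<zero>)"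
      by (simp add: Phi_functor_run[OF F] A.run_nat)
    also have "\<dots> = fM G x 0 \<cdot> ((t x \<uplus> t 0) \<cdot> (Ide A (fO F x) \<uplus> fU F))"
      by (subst Phi_functor_run[OF G, symmetric]) (simp add: t0)
    finally have "(t x \<cdot> fM F x 0) \<cdot> (Ide A (fO F x) \<uplus> fU F)
        = (fM G x 0 \<cdot> (t x \<uplus> t 0)) \<cdot> (Ide A (fO F x) \<uplus> fU F)"
      by simp
    then show ?case
      by (subst (asm) A.cancel_right) simp_all
  next
    case (step y)
    let ?l = "t (x + (y + 1)) \<cdot> fM F x (y + 1)" and ?r = "fM G x (y + 1) \<cdot> (t x \<uplus> t (y + 1))"
    let ?c = "(Ide A (fO F x) \<uplus> fM F y 1) \<cdot> asc A (fO F x) (fO F y) (fO F 1)"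
    have "?l \<cdot> ?c = t ((x + y) + 1) \<cdot> (fM F (x + y) 1 \<cdot> (fM F x y \<uplus> Ide A (fO F 1)))"
      by (subst Phi_functor_asc[OF F]) (simp add: add.assoc)
    also have "\<dots> = (fM G (x + y) 1 \<cdot> (t (x + y) \<uplus> a)) \<cdot> (fM F x y \<uplus> Ide A (fO F 1))"
      by (subst A.comp_reduce[OF tS]) simp_all
    finally have l: "?l \<cdot> ?c = fM G (x + y) 1 \<cdot> ((t (x + y) \<cdot> fM F x y) \<uplus> a)"
      by simp
    have "?r \<cdot> ?c = fM G x (y + 1) \<cdot> ((Ide A (fO G x) \<uplus> fM G y 1) \<cdot> ((t x \<uplus> (t y \<uplus> a))
        \<cdot> asc A (fO F x) (fO F y) (fO F 1)))"
      by (simp add: tS)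
    also have "\<dots> = fM G x (y + 1) \<cdot> (((Ide A (fO G x) \<uplus> fM G y 1) \<cdot> asc A (fO G x) (fO G y) (fO G 1))
        \<cdot> ((t x \<uplus> t y) \<uplus> a))"
      by (simp add: A.asc_nat)
    also have "\<dots> = (fM G (x + y) 1 \<cdot> (fM G x y \<uplus> Ide A (fO G 1))) \<cdot> ((t x \<uplus> t y) \<uplus> a)"
      by (subst Phi_functor_asc[OF G]) (simp add: add.assoc)
    finally have r: "?r \<cdot> ?c = fM G (x + y) 1 \<cdot> ((fM G x y \<cdot> (t x \<uplus> t y)) \<uplus> a)"
      by simp
    have "?l = ?r \<longleftrightarrow> ?l \<cdot> ?c = ?r \<cdot> ?c"
      by (subst A.cancel_right) simp_all
    also have "\<dots> \<longleftrightarrow> (t (x + y) \<cdot> fM F x y) \<uplus> a = (fM G x y \<cdot> (t x \<uplus> t y)) \<uplus> a"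
      unfolding l r by (rule A.cancel_left) simp_all
    also have "\<dots> \<longleftrightarrow> t (x + y) \<cdot> fM F x y = fM G x y \<cdot> (t x \<uplus> t y)"
      using A.addA_right_cancel[of "t (x + y) \<cdot> fM F x y" a "fM G x y \<cdot> (t x \<uplus> t y)"] by auto
    finally show ?case by blast
  qed
  have "(t 2 \<cdot> fA F (2, 1)) \<cdot> fM F 1 1 = (t (1 + 1) \<cdot> fM F 1 1) \<cdot> sym A (fO F 1) (fO F 1)"
    by (simp add: Phi_functor_two[OF F])
  also have "\<dots> = (fM G 1 1 \<cdot> sym A (fO G 1) (fO G 1)) \<cdot> (t 1 \<uplus> t 1)"
    by (simp only: t_fM) (simp add: A.sym_nat)
  also have "\<dots> = fA G (2, 1) \<cdot> (fM G 1 1 \<cdot> (t 1 \<uplus> t 1))"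
    by (subst Phi_functor_two[OF G, symmetric]) simp
  also have "\<dots> = (fA G (2, 1) \<cdot> t 2) \<cdot> fM F 1 1"
    by (simp add: t_fM[symmetric])
  finally have t2: "t 2 \<cdot> fA F (2, 1) = fA G (2, 1) \<cdot> t 2"
    by (subst (asm) A.cancel_right) simp_all
  \<comment> \<open>The shift by 2 covers every integer, and it exhibits the generator over n + 2 as
    the one over 2 added to an identity.\<close>
  have nat: "t (n + 2) \<cdot> fA F (n + 2, 1) = fA G (n + 2, 1) \<cdot> t (n + 2)" for n
  proof -
    have "(t (n + 2) \<cdot> fA F (n + 2, 1)) \<cdot> fM F n 2 = (t (n + 2) \<cdot> fM F n 2) \<cdot> (Ide A (fO F n)
        \<uplus> fA F (2, 1))"
      by (simp flip: Phi_functor_add[OF F])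
    also have "\<dots> = fM G n 2 \<cdot> ((Ide A (fO G n) \<uplus> fA G (2, 1)) \<cdot> (t n \<uplus> t 2))"
      by (simp add: t_fM t2)
    also have "\<dots> = (fA G (n + 2, 1) \<cdot> fM G n 2) \<cdot> (t n \<uplus> t 2)"
      by (subst A.comp_reduce[OF Phi_functor_add[OF G]]) simp_all
    also have "\<dots> = (fA G (n + 2, 1) \<cdot> t (n + 2)) \<cdot> fM F n 2"
      by (simp add: t_fM)
    finally show ?thesis
      by (subst (asm) A.cancel_right) simp_all
  qed
  have "sm_trans Phi A F G t"
  proof (rule sm_transI)
    fix f show "t (Cod Phi f) \<cdot> fA F f = fA G f \<cdot> t (Dom Phi f)"
      using bit_01[of "snd f"] nat[of "fst f - 2"] by (cases f) auto
  qed (simp_all add: F G t_fM)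
  then show ?thesis using t1 by blast
qed

text \<open>The value at 0 is fixed by the unit constraint. The values at n and n + 1 determine each
  other, because the summand \<open>t 1\<close> cancels; so negative integers are reached
  too.\<close>

lemma Phi_trans_unique:
  fixes A (structure)
  assumes t: "sm_trans Phi A F G t" and s: "sm_trans Phi A F G s" and "t 1 = s 1"
  shows "t = s"
proof
  interpret A: scg A by (rule sm_functor_scg(1)[OF sm_trans.axioms(2)[OF t]])
  interpret t: sm_trans Phi A F G t by fact
  interpret s: sm_trans Phi A F G s by fact
  have [simp]: "t n \<in> Arr A" "s n \<in> Arr A" "Dom A (t n) = fO F n" "Cod A (t n) = fO G n"
    "Dom A (s n) = fO F n" "Cod A (s n) = fO G n" for n
    using t.t_simps[of n] s.t_simps[of n] by auto
  note [simp] = Phi_functor_fM[OF t.F.sm_functor_axioms] Phi_functor_fM[OF t.G.sm_functor_axioms]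
    Phi_functor_fU[OF t.F.sm_functor_axioms] Phi_functor_fO[OF t.F.sm_functor_axioms]
  fix n show "t n = s n"
  proof (induction n rule: int_iff_induct)
    case zero
    have "t 0 \<cdot> fU F = s 0 \<cdot> fU F" using t.t_fU s.t_fU by simp
    then show ?case by (subst (asm) A.cancel_right) simp_all
  next
    case (step n)
    have "t (n + 1) = s (n + 1) \<longleftrightarrow> t (n + 1) \<cdot> fM F n 1 = s (n + 1) \<cdot> fM F n 1"
      by (subst A.cancel_right) simp_all
    also have "\<dots> \<longleftrightarrow> t n \<uplus> t 1 = s n \<uplus> t 1"
      using t.t_fM[of n 1] s.t_fM[of n 1] assms(3) by (simp add: A.cancel_left)
    also have "\<dots> \<longleftrightarrow> t n = s n"
      using A.addA_right_cancel[of "t n" "t 1" "s n"] by auto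
    finally show ?case by blast
  qed
qed


section \<open>Loops at zero and existence of functors out of \<open>Phi\<close>\<close>

context scg begin

text \<open>Transport of a loop along x + 0 -> x: the canonical isomorphism from Aut(0) to Aut(x).
  It allows one loop to stand for an automorphism of every object.\<close>

definition theta :: "'o \<Rightarrow> 'a \<Rightarrow> 'a" where
  "theta x c = run A x \<cdot> ((Ide A x \<uplus> c) \<cdot> ginv A (run A x))"

abbreviation loop :: "'a \<Rightarrow> bool" where
  "loop c \<equiv> c \<in> Arr A \<and> Dom A c = \<zero> \<and> Cod A c = \<zero>"

lemma theta_simps [simp]:
  assumes "x \<in> Obj A" "loop c"
  shows "theta x c \<in> Arr A" "Dom A (theta x c) = x" "Cod A (theta x c) = x"
  using assms by (simp_all add: theta_def)

lemma theta_run: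
  assumes "x \<in> Obj A" "loop c"
  shows "theta x c \<cdot> run A x = run A x \<cdot> (Ide A x \<uplus> c)"
  using assms by (simp add: theta_def)

lemma theta_eqI:
  assumes "x \<in> Obj A" "loop c" "h \<in> Arr A" "Dom A h = x" "h \<cdot> run A x = run A x \<cdot> (Ide A x \<uplus> c)"
  shows "theta x c = h"
proof -
  have "theta x c \<cdot> run A x = h \<cdot> run A x" using assms theta_run by simp
  then show ?thesis using assms(1-4) by (subst (asm) cancel_right) simp_all
qed

lemma theta_Ide [simp]: "x \<in> Obj A \<Longrightarrow> theta x (Ide A \<zero>) = Ide A x"
  by (simp add: theta_def)

lemma theta_comp: "x \<in> Obj A \<Longrightarrow> loop c \<Longrightarrow> loop d \<Longrightarrow> theta x c \<cdot> theta x d = theta x (c \<cdot> d)"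
  by (simp add: theta_def)

lemma theta_nat:
  assumes "f \<in> Arr A" "Cod A f = y" "loop c"
  shows "theta y c \<cdot> f = f \<cdot> theta (Dom A f) c"
proof -
  have "y \<in> Obj A" using assms by auto
  note [simp] = assms this
  have "(theta y c \<cdot> f) \<cdot> run A (Dom A f) = theta y c \<cdot> (run A y \<cdot> (f \<uplus> Ide A \<zero>))"
    by (simp add: run_nat)
  also have "\<dots> = run A y \<cdot> ((f \<uplus> Ide A \<zero>) \<cdot> (Ide A (Dom A f) \<uplus> c))"
    by (subst comp_reduce[OF theta_run]) simp_all
  also have "\<dots> = f \<cdot> (run A (Dom A f) \<cdot> (Ide A (Dom A f) \<uplus> c))"
    by (subst run_nat(2)) simp_all
  also have "\<dots> = (f \<cdot> theta (Dom A f) c) \<cdot> run A (Dom A f)"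
    by (simp add: theta_run)
  finally show ?thesis
    by (subst (asm) cancel_right) simp_all
qed

lemma theta_add_right:
  assumes [simp]: "x \<in> Obj A" "y \<in> Obj A" "loop c"
  shows "Ide A x \<uplus> theta y c = theta (x \<oplus> y) c"
proof (rule theta_eqI[symmetric])
  have "(Ide A x \<uplus> theta y c) \<cdot> run A (x \<oplus> y) = (Ide A x \<uplus> run A y) \<cdot> ((Ide A x \<uplus> (Ide A y \<uplus> c))
      \<cdot> asc A x y \<zero>)"
    by (simp add: theta_run flip: run_add)
  also have "\<dots> = (Ide A x \<uplus> run A y) \<cdot> (asc A x y \<zero> \<cdot> (Ide A (x \<oplus> y) \<uplus> c))"
    by (simp add: asc_nat_Ide)
  also have "\<dots> = run A (x \<oplus> y) \<cdot> (Ide A (x \<oplus> y) \<uplus> c)"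
    by (subst comp_reduce[OF run_add]) simp_all
  finally show "(Ide A x \<uplus> theta y c) \<cdot> run A (x \<oplus> y) = run A (x \<oplus> y) \<cdot> (Ide A (x \<oplus> y) \<uplus> c)" .
qed simp_all

lemma theta_add_left:
  assumes [simp]: "x \<in> Obj A" "y \<in> Obj A" "loop c"
  shows "theta x c \<uplus> Ide A y = theta (x \<oplus> y) c"
proof -
  have "sym A x y \<cdot> (theta x c \<uplus> Ide A y) = sym A x y \<cdot> theta (x \<oplus> y) c"
    using theta_nat[of "sym A x y" "y \<oplus> x" c] by (simp add: sym_nat theta_add_right)
  then show ?thesis
    by (subst (asm) cancel_left) simp_all
qed

text \<open>Either summand can absorb a loop, so a sum of two transported loops is the transport of
  their composite, as in the Eckmann-Hilton argument.\<close>

lemma theta_add: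
  assumes [simp]: "x \<in> Obj A" "y \<in> Obj A" "loop c" "loop d"
  shows "theta x c \<uplus> theta y d = theta (x \<oplus> y) (c \<cdot> d)"
proof -
  have "theta x c \<uplus> theta y d = (theta x c \<uplus> Ide A y) \<cdot> (Ide A x \<uplus> theta y d)"
    by simp
  then show ?thesis
    by (simp only: theta_add_left theta_add_right assms theta_comp add_in)
qed

lemma theta_surj:
  assumes [simp]: "x \<in> Obj A" "h \<in> Arr A" "Dom A h = x" "Cod A h = x"
  shows "\<exists>c. loop c \<and> theta x c = h"
proof -
  obtain c where "c \<in> ghom A \<zero> \<zero>" "Ide A x \<uplus> c = ginv A (run A x) \<cdot> (h \<cdot> run A x)"
    using addA_left_full[of x \<zero> \<zero> "ginv A (run A x) \<cdot> (h \<cdot> run A x)"] by auto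
  then show ?thesis by (intro exI[of _ c]) (simp add: theta_def)
qed

lemma theta_inj:
  assumes "theta x c = theta x d" "x \<in> Obj A" "loop c" "loop d"
  shows "c = d"
proof (rule addA_left_faithful[of x])
  have "run A x \<cdot> (Ide A x \<uplus> c) = run A x \<cdot> (Ide A x \<uplus> d)"
    using theta_run[of x c] theta_run[of x d] assms by simp
  then show "Ide A x \<uplus> c = Ide A x \<uplus> d"
    using assms(2-) by (subst (asm) cancel_left) simp_all
qed (use assms(2-) in simp_all)

lemma multiples_ex:
  assumes [simp]: "m \<in> Obj A"
  shows "\<exists>l :: int \<Rightarrow> 'o. l 0 = \<zero> \<and> l 1 = m \<and> (\<forall>n. l n \<in> Obj A) \<and> (\<forall>n. \<exists>u. u \<in> ghom A (l n
      \<oplus> m) (l (n + 1)))"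
proof -
  have "\<exists>l. l 0 = \<zero> \<and> (\<forall>n::int. l n \<in> Obj A \<and> (\<exists>u. u \<in> ghom A (l n \<oplus> m) (l (n + 1))))"
  proof (rule int_dependent_choice)
    show "\<exists>k. k \<in> Obj A \<and> (\<exists>u. u \<in> ghom A (h \<oplus> m) k)" if "h \<in> Obj A" for h
      using that by (intro exI[of _ "h \<oplus> m"] conjI exI[of _ "Ide A (h \<oplus> m)"]) simp_all
    show "\<exists>h. h \<in> Obj A \<and> (\<exists>u. u \<in> ghom A (h \<oplus> m) k)" if "k \<in> Obj A" for k
      using addA_right_surj[of m k] that by auto
  qed simp
  then obtain l where l: "l 0 = \<zero>" "\<And>n::int. l n \<in> Obj A" "\<And>n. \<exists>u. u \<in> ghom A (l n \<oplus> m) (l (n + 1))"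
    by blast
  obtain u where u: "u \<in> ghom A (l 0 \<oplus> m) (l (0 + 1))" using l(3)[of 0] by blast
  \<comment> \<open>Dependent choice gives \<open>l 1\<close> only up to isomorphism;
    \<open>v\<close> identifies m with it, so that the value at 1 can be replaced by m itself. This
    changes the arrows at 0 and 1 alone.\<close>
  define v where "v = u \<cdot> ginv A (lun A m)"
  have v: "v \<in> Arr A" "Dom A v = m" "Cod A v = l 1" using u l(1) by (simp_all add: v_def)
  show ?thesis
  proof (intro exI[of _ "l(1 := m)"] conjI allI)
    fix n
    show "\<exists>u. u \<in> ghom A ((l(1 := m)) n \<oplus> m) ((l(1 := m)) (n + 1))"
    proof -
      consider "n = 0" | "n = 1" | "n \<noteq> 0" "n \<noteq> 1" by blast
      then show ?thesis
      proof cases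
        case 1 then show ?thesis using l(1) by (intro exI[of _ "lun A m"]) simp
      next
        case 2
        obtain w where "w \<in> ghom A (l 1 \<oplus> m) (l (1 + 1))" using l(3)[of 1] by blast
        then show ?thesis using 2 v by (intro exI[of _ "w \<cdot> (v \<uplus> Ide A m)"]) simp
      next
        case 3 then show ?thesis using l(3)[of n] by simp
      qed
    qed
  qed (use l in auto)
qed

text \<open>Objects are chosen multiples of m, the constraints \<phi> grow out of the right unit
  constraint by associativity, and automorphisms are transports of a loop c. The symmetry law at (1,
  1) fixes c, functoriality asks for order two, and the two agree because the symmetry is an
  involution.\<close>

lemma Phi_functor_ex:
  assumes [simp]: "m \<in> Obj A"
  shows "\<exists>L :: (int, int \<times> bit, 'o, 'a) smfun. sm_functor Phi A L \<and> fO L 1 = m"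
proof -
  obtain l u where l0: "l 0 = \<zero>" and l1 [simp]: "l 1 = m" and l [simp]: "\<And>n::int. l n \<in> Obj A"
    and "\<And>n. u n \<in> ghom A (l n \<oplus> m) (l (n + 1))"
    using multiples_ex[OF assms] by metis
  then have u [simp]: "u n \<in> Arr A" "Dom A (u n) = l n \<oplus> m" "Cod A (u n) = l (n + 1)" for n
    by auto
  \<comment> \<open>Associativity at \<open>(x, y, 1)\<close> determines \<open>\<phi> x (y + 1)\<close> from
      \<open>\<phi> x y\<close> and conversely.\<close>
  have "\<exists>\<phi>. \<phi> 0 = run A (l x) \<and> (\<forall>y. \<phi> y \<in> ghom A (l x \<oplus> l y) (l (x + y)) \<and>
      \<phi> (y + 1) \<cdot> (Ide A (l x) \<uplus> u y) = u (x + y) \<cdot> ((\<phi> y \<uplus> Ide A m)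
          \<cdot> ginv A (asc A (l x) (l y) m)))" for x
  proof (rule int_dependent_choice)
    show "run A (l x) \<in> ghom A (l x \<oplus> l 0) (l (x + 0))" by (simp add: l0)
    show "\<exists>k. k \<in> ghom A (l x \<oplus> l (n + 1)) (l (x + (n + 1))) \<and>
        k \<cdot> (Ide A (l x) \<uplus> u n) = u (x + n) \<cdot> ((h \<uplus> Ide A m) \<cdot> ginv A (asc A (l x) (l n) m))"
      if "h \<in> ghom A (l x \<oplus> l n) (l (x + n))" for n h
      using that by (intro exI[of _ "u (x + n) \<cdot> ((h \<uplus> Ide A m) \<cdot> (ginv A (asc A (l x) (l n) m)
          \<cdot> (Ide A (l x) \<uplus> ginv A (u n))))"])
        (simp add: add.assoc)
    show "\<exists>h. h \<in> ghom A (l x \<oplus> l n) (l (x + n)) \<and>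
        k \<cdot> (Ide A (l x) \<uplus> u n) = u (x + n) \<cdot> ((h \<uplus> Ide A m) \<cdot> ginv A (asc A (l x) (l n) m))"
      if k: "k \<in> ghom A (l x \<oplus> l (n + 1)) (l (x + (n + 1)))" for n k
    proof -
      have [simp]: "k \<in> Arr A" "Dom A k = l x \<oplus> l (n + 1)" "Cod A k = l (x + n + 1)"
        using k by (simp_all add: add.assoc)
      obtain h where "h \<in> ghom A (l x \<oplus> l n) (l (x + n))"
        "h \<uplus> Ide A m = ginv A (u (x + n)) \<cdot> (k \<cdot> ((Ide A (l x) \<uplus> u n) \<cdot> asc A (l x) (l n) m))"
        using addA_right_full[of m "l x \<oplus> l n" "l (x + n)" "ginv A (u (x + n)) \<cdot> (k \<cdot> ((Ide A (l x)
            \<uplus> u n) \<cdot> asc A (l x) (l n) m))"]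
        by auto
      then show ?thesis by (intro exI[of _ h]) simp
    qed
  qed
  then obtain \<phi> where \<phi>0: "\<And>x. \<phi> x 0 = run A (l x)" and "\<And>x y. \<phi> x y \<in> ghom A (l x \<oplus> l y) (l (x + y))"
    and \<phi>S: "\<And>x y. \<phi> x (y + 1) \<cdot> (Ide A (l x) \<uplus> u y) = u (x + y) \<cdot> ((\<phi> x y \<uplus> Ide A m)
        \<cdot> ginv A (asc A (l x) (l y) m))"
    by metis
  then have \<phi> [simp]: "\<phi> x y \<in> Arr A" "Dom A (\<phi> x y) = l x \<oplus> l y" "Cod A (\<phi> x y) = l (x + y)" for x y
    by auto
  \<comment> \<open>Precomposing both sides at z + 1 with the step arrow \<open>u z\<close> reduces
    them to the sides at z with m added; the associativity constraints that appear are matched by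
    the pentagon.\<close>
  have \<phi>_asc: "\<phi> (x + y) z \<cdot> (\<phi> x y \<uplus> Ide A (l z)) = \<phi> x (y + z) \<cdot> ((Ide A (l x) \<uplus> \<phi> y z)
      \<cdot> asc A (l x) (l y) (l z))" for x y z
  proof (induction z rule: int_iff_induct)
    case zero
    show ?case by (simp add: \<phi>0 l0 run_nat run_add)
  next
    case (step z)
    let ?L = "\<phi> (x + y) (z + 1) \<cdot> (\<phi> x y \<uplus> Ide A (l (z + 1)))"
    let ?R = "\<phi> x (y + (z + 1)) \<cdot> ((Ide A (l x) \<uplus> \<phi> y (z + 1)) \<cdot> asc A (l x) (l y) (l (z + 1)))"
    let ?L' = "\<phi> (x + y) z \<cdot> (\<phi> x y \<uplus> Ide A (l z))"
    let ?R' = "\<phi> x (y + z) \<cdot> ((Ide A (l x) \<uplus> \<phi> y z) \<cdot> asc A (l x) (l y) (l z))"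
    let ?c = "Ide A (l x \<oplus> l y) \<uplus> u z"
    have eqs: "x + (y + (z + 1)) = x + y + z + 1" "x + (y + z) = x + y + z" "x + y + (z + 1)
        = x + y + z + 1" "y + (z + 1) = y + z + 1" by simp_all
    have cod: "Cod A (\<phi> x (y + z + 1)) = l (x + y + z + 1)" "Cod A (\<phi> x (y + z)) = l (x + y + z)"
      "Cod A (\<phi> (x + y) (z + 1)) = l (x + y + z + 1)" "Cod A (\<phi> y (z + 1)) = l (y + z + 1)"
      by (simp_all add: add.assoc)
    note [simp] = eqs cod
    have "?L \<cdot> ?c = \<phi> (x + y) (z + 1) \<cdot> ((Ide A (l (x + y)) \<uplus> u z) \<cdot> (\<phi> x y \<uplus> Ide A (l z \<oplus> m)))"
      by simp
    also have "\<dots> = u (x + y + z) \<cdot> ((\<phi> (x + y) z \<uplus> Ide A m) \<cdot> (ginv A (asc A (l (x + y)) (l z) m)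
        \<cdot> (\<phi> x y \<uplus> (Ide A (l z) \<uplus> Ide A m))))"
      by (subst comp_reduce[OF \<phi>S]) simp_all
    also have "\<dots> = u (x + y + z) \<cdot> ((?L' \<uplus> Ide A m) \<cdot> ginv A (asc A (l x \<oplus> l y) (l z) m))"
      by (subst ginv_asc_nat(1)) simp_all
    finally have L: "?L \<cdot> ?c = u (x + y + z) \<cdot> ((?L' \<uplus> Ide A m) \<cdot> ginv A (asc A (l x \<oplus> l y) (l z) m))" .
    have "?R \<cdot> ?c = \<phi> x (y + z + 1) \<cdot> ((Ide A (l x) \<uplus> (\<phi> y (z + 1) \<cdot> (Ide A (l y) \<uplus> u z)))
        \<cdot> asc A (l x) (l y) (l z \<oplus> m))"
      by (simp add: asc_nat_Ide)
    also have "\<dots> = \<phi> x (y + z + 1) \<cdot> ((Ide A (l x) \<uplus> u (y + z)) \<cdot> ((Ide A (l x) \<uplus> (\<phi> y z \<uplus> Ide A m)) \<cdot>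
        ((Ide A (l x) \<uplus> ginv A (asc A (l y) (l z) m)) \<cdot> asc A (l x) (l y) (l z \<oplus> m))))"
      by (subst \<phi>S) simp
    also have "\<dots> = u (x + y + z) \<cdot> ((\<phi> x (y + z) \<uplus> Ide A m) \<cdot> (ginv A (asc A (l x) (l (y + z)) m)
        \<cdot> ((Ide A (l x) \<uplus> (\<phi> y z \<uplus> Ide A m)) \<cdot>
        ((Ide A (l x) \<uplus> ginv A (asc A (l y) (l z) m)) \<cdot> asc A (l x) (l y) (l z \<oplus> m)))))"
      by (subst comp_reduce[OF \<phi>S]) simp_all
    also have "\<dots> = u (x + y + z) \<cdot> ((\<phi> x (y + z) \<uplus> Ide A m) \<cdot> (((Ide A (l x) \<uplus> \<phi> y z) \<uplus> Ide A m)
        \<cdot> (ginv A (asc A (l x) (l y \<oplus> l z) m) \<cdot>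
        ((Ide A (l x) \<uplus> ginv A (asc A (l y) (l z) m)) \<cdot> asc A (l x) (l y) (l z \<oplus> m)))))"
      by (subst ginv_asc_nat(2)) simp_all
    also have "\<dots> = u (x + y + z) \<cdot> ((?R' \<uplus> Ide A m) \<cdot> ginv A (asc A (l x \<oplus> l y) (l z) m))"
    proof -
      have "ginv A (asc A (l x) (l y \<oplus> l z) m) \<cdot> ((Ide A (l x) \<uplus> ginv A (asc A (l y) (l z) m))
          \<cdot> asc A (l x) (l y) (l z \<oplus> m))
        = ginv A ((Ide A (l x) \<uplus> asc A (l y) (l z) m) \<cdot> asc A (l x) (l y \<oplus> l z) m)
            \<cdot> asc A (l x) (l y) (l z \<oplus> m)"
        by simp
      also have "\<dots> = (asc A (l x) (l y) (l z) \<uplus> Ide A m) \<cdot> ginv A (asc A (l x \<oplus> l y) (l z) m)"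
        by (rule ginv_square) (simp_all add: pentagon)
      finally show ?thesis by simp
    qed
    finally have R: "?R \<cdot> ?c = u (x + y + z) \<cdot> ((?R' \<uplus> Ide A m) \<cdot> ginv A (asc A (l x \<oplus> l y) (l z) m))" .
    have "?L = ?R \<longleftrightarrow> ?L \<cdot> ?c = ?R \<cdot> ?c"
      by (subst cancel_right) simp_all
    also have "\<dots> \<longleftrightarrow> ?L' \<uplus> Ide A m = ?R' \<uplus> Ide A m"
      unfolding L R by (simp add: cancel_left cancel_right)
    also have "\<dots> \<longleftrightarrow> ?L' = ?R'"
      using addA_right_faithful[of ?L' m ?R'] by auto
    finally show ?case by blast
  qed
  \<comment> \<open>In \<open>Phi\<close> the symmetry of 1 and 1 is the generator over 2, so its
    image has to correspond to the symmetry of m and m, transported here to a loop at zero.\<close>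
  obtain c where c: "loop c" "theta (m \<oplus> m) c = sym A m m"
    using theta_surj[of "m \<oplus> m" "sym A m m"] by auto
  \<comment> \<open>The symmetry of m with itself is an involution; this is what makes
    \<open>e\<close> additive on Z/2.\<close>
  have cc: "c \<cdot> c = Ide A \<zero>"
    by (rule theta_inj[of "m \<oplus> m"]) (use c in \<open>simp_all flip: theta_comp\<close>)
  define e where "e a = (if a = 0 then Ide A \<zero> else c)" for a :: bit
  have e [simp]: "loop (e a)" "e 0 = Ide A \<zero>" "e 1 = c" for a
    using c(1) by (simp_all add: e_def)
  have e_add: "e (a + b) = e a \<cdot> e b" "e a \<cdot> e b = e b \<cdot> e a" for a b
    using bit_01[of a] bit_01[of b] cc c(1) by (auto simp: bit_add_self)
  \<comment> \<open>The automorphism that the functor under construction assigns to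
    \<open>sym Phi x y\<close>.\<close>
  define s where "s x y = theta (l (x + y)) (e (of_int (x * y)))" for x y
  have s [simp]: "s x y \<in> Arr A" "Dom A (s x y) = l (x + y)" "Cod A (s x y) = l (x + y)" for x y
    by (simp_all add: s_def)
  \<comment> \<open>By the hexagon the symmetry law \<open>Q\<close> is additive in each variable, so that it
      follows from \<open>Q 1 1\<close>,
    which holds by the choice of the value \<open>c\<close> of the generator.\<close>
  define Q where "Q x y \<longleftrightarrow> s x y \<cdot> \<phi> x y = \<phi> y x \<cdot> sym A (l x) (l y)" for x y
  have \<phi>_comm: "Cod A (\<phi> x y) = l (y + x)" for x y
    by (simp add: add.commute)
  have Q_add: "Q x (y + z) \<longleftrightarrow> Q x y" if "Q x z" for x y z
  proof -
    have eqs: "x + (y + z) = x + y + z" "y + x + z = x + y + z" "y + (x + z) = x + y + z" "y + z + x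
        = x + y + z"
      "y + (z + x) = x + y + z" "y + x = x + y" "z + x = x + z"
      by simp_all
    have [simp]: "Cod A (\<phi> x (y + z)) = l (x + y + z)" "Cod A (\<phi> y (x + z)) = l (x + y + z)"
      "Cod A (\<phi> (y + z) x) = l (x + y + z)" "Cod A (\<phi> y x) = l (x + y)" "Cod A (\<phi> z x) = l (x + z)"
      "Cod A (s x (y + z)) = l (x + y + z)" "Dom A (s x (y + z)) = l (x + y + z)"
      by (simp_all add: eqs)
    let ?x = "l x" and ?y = "l y" and ?z = "l z"
    let ?c = "(Ide A ?x \<uplus> \<phi> y z) \<cdot> asc A ?x ?y ?z"
    define N where "N d = theta (l (x + y + z)) (e (of_int d))" for d
    have [simp]: "N d \<in> Arr A" "Dom A (N d) = l (x + y + z)" "Cod A (N d) = l (x + y + z)" for d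
      by (simp_all add: N_def)
    have sN: "s x (y + z) = N (x * z) \<cdot> N (x * y)"
      unfolding N_def s_def by (simp add: theta_comp eqs distrib_left e_add)
    have 1: "N d \<cdot> \<phi> (x + y) z = \<phi> (x + y) z \<cdot> (theta (l (x + y)) (e (of_int d)) \<uplus> Ide A ?z)" for d
      unfolding N_def by (subst theta_nat) (simp_all add: theta_add_left)
    have 2: "N d \<cdot> \<phi> y (x + z) = \<phi> y (x + z) \<cdot> (Ide A ?y \<uplus> theta (l (x + z)) (e (of_int d)))" for d
      unfolding N_def by (subst theta_nat) (simp_all add: theta_add_right eqs)
    have "(s x (y + z) \<cdot> \<phi> x (y + z)) \<cdot> ?c = N (x * z) \<cdot> (N (x * y) \<cdot> (\<phi> x (y + z) \<cdot> ?c))"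
      by (simp add: sN eqs)
    also have "\<dots> = N (x * z) \<cdot> (N (x * y) \<cdot> (\<phi> (x + y) z \<cdot> (\<phi> x y \<uplus> Ide A ?z)))"
      by (simp only: \<phi>_asc)
    also have "\<dots> = N (x * z) \<cdot> (\<phi> (x + y) z \<cdot> ((s x y \<cdot> \<phi> x y) \<uplus> Ide A ?z))"
      by (subst comp_reduce[OF 1]) (simp_all add: s_def)
    finally have L: "(s x (y + z) \<cdot> \<phi> x (y + z)) \<cdot> ?c = N (x * z) \<cdot> (\<phi> (x + y) z \<cdot> ((s x y \<cdot> \<phi> x y)
        \<uplus> Ide A ?z))" .
    have "(\<phi> (y + z) x \<cdot> sym A ?x (l (y + z))) \<cdot> ?c = \<phi> (y + z) x \<cdot> ((\<phi> y z \<uplus> Ide A ?x)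
        \<cdot> (sym A ?x (?y \<oplus> ?z) \<cdot> asc A ?x ?y ?z))"
      by (simp add: sym_nat)
    also have "\<dots> = \<phi> y (z + x) \<cdot> ((Ide A ?y \<uplus> \<phi> z x) \<cdot> (asc A ?y ?z ?x \<cdot> (sym A ?x (?y \<oplus> ?z)
        \<cdot> asc A ?x ?y ?z)))"
      by (subst comp_reduce[OF \<phi>_asc]) simp_all
    also have "\<dots> = \<phi> y (x + z) \<cdot> ((Ide A ?y \<uplus> (\<phi> z x \<cdot> sym A ?x ?z)) \<cdot> (asc A ?y ?x ?z \<cdot> (sym A ?x ?y
        \<uplus> Ide A ?z)))"
      by (subst hexagon) (simp_all add: eqs)
    also have "\<dots> = \<phi> y (x + z) \<cdot> ((Ide A ?y \<uplus> (s x z \<cdot> \<phi> x z)) \<cdot> (asc A ?y ?x ?z \<cdot> (sym A ?x ?y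
        \<uplus> Ide A ?z)))"
      using that by (simp add: Q_def)
    also have "\<dots> = (\<phi> y (x + z) \<cdot> (Ide A ?y \<uplus> theta (l (x + z)) (e (of_int (x * z))))) \<cdot>
        ((Ide A ?y \<uplus> \<phi> x z) \<cdot> (asc A ?y ?x ?z \<cdot> (sym A ?x ?y \<uplus> Ide A ?z)))"
      by (simp add: s_def)
    also have "\<dots> = N (x * z) \<cdot> ((\<phi> (y + x) z \<cdot> (\<phi> y x \<uplus> Ide A ?z)) \<cdot> (sym A ?x ?y \<uplus> Ide A ?z))"
      by (subst \<phi>_asc, subst 2[symmetric]) (simp add: eqs)
    also have "\<dots> = N (x * z) \<cdot> (\<phi> (x + y) z \<cdot> ((\<phi> y x \<cdot> sym A ?x ?y) \<uplus> Ide A ?z))"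
      by (simp add: eqs)
    finally have R: "(\<phi> (y + z) x \<cdot> sym A ?x (l (y + z))) \<cdot> ?c = \<dots>" .
    have "Q x (y + z) \<longleftrightarrow> (s x (y + z) \<cdot> \<phi> x (y + z)) \<cdot> ?c = (\<phi> (y + z) x \<cdot> sym A ?x (l (y + z))) \<cdot> ?c"
      unfolding Q_def by (subst cancel_right) simp_all
    also have "\<dots> \<longleftrightarrow> (s x y \<cdot> \<phi> x y) \<uplus> Ide A ?z = (\<phi> y x \<cdot> sym A ?x ?y) \<uplus> Ide A ?z"
      unfolding L R by (simp add: cancel_left eqs)
    also have "\<dots> \<longleftrightarrow> Q x y"
      unfolding Q_def using addA_right_faithful[of "s x y \<cdot> \<phi> x y" ?z "\<phi> y x \<cdot> sym A ?x ?y"]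
          by (auto simp: eqs)
    finally show ?thesis .
  qed
  have Q_ind: "Q x y" if "Q x 1" for x y
  proof (induction y rule: int_iff_induct)
    case zero show ?case using Q_add[OF that, of 0] that by simp
  next
    case (step y) show ?case using Q_add[OF that, of y] by simp
  qed
  have "s 1 1 \<cdot> \<phi> 1 1 = \<phi> 1 1 \<cdot> theta (m \<oplus> m) c"
    unfolding s_def by (subst theta_nat) (simp_all add: c(1))
  then have "Q 1 1" by (simp add: Q_def c(2))
  \<comment> \<open>Induction in the second variable starts from (x, 1), whereas only (1, x) is
    available so far. The law is turned around by composing with the inverse symmetry,
    \<open>s x 1\<close> and \<open>s 1 x\<close> being inverse to each other.\<close>
  have "Q x 1" for x
  proof -
    have "Q 1 x" by (rule Q_ind) fact
    then have *: "s 1 x \<cdot> \<phi> 1 x = \<phi> x 1 \<cdot> sym A m (l x)" by (simp add: Q_def)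
    have ss: "s x 1 \<cdot> s 1 x = Ide A (l (1 + x))"
      by (simp add: s_def add.commute theta_comp bit_add_self flip: e_add)
    have "s x 1 \<cdot> \<phi> x 1 = s x 1 \<cdot> ((\<phi> x 1 \<cdot> sym A m (l x)) \<cdot> sym A (l x) m)"
      by simp
    also have "\<dots> = (s x 1 \<cdot> (s 1 x \<cdot> \<phi> 1 x)) \<cdot> sym A (l x) m"
      unfolding *[symmetric] by (simp add: add.commute)
    also have "s x 1 \<cdot> (s 1 x \<cdot> \<phi> 1 x) = \<phi> 1 x"
      using comp_reduce[OF ss, of "\<phi> 1 x"] by (simp add: add.commute)
    finally show ?thesis by (simp add: Q_def)
  qed
  then have Q: "Q x y" for x y by (rule Q_ind)
  define L :: "(int, int \<times> bit, 'o, 'a) smfun"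
    where "L = \<lparr>fO = l, fA = \<lambda>f. theta (l (fst f)) (e (snd f)), fM = \<phi>, fU = undefined\<rparr>"
  have "pre_sm_functor Phi A L"
  proof (rule pre_sm_functorI)
    fix x y z :: int
    show "fA L (asc Phi x y z) \<cdot> (fM L (x \<oplus>\<^bsub>Phi\<^esub> y) z \<cdot> (fM L x y \<uplus> Ide A (fO L z)))
        = fM L x (y \<oplus>\<^bsub>Phi\<^esub> z) \<cdot> ((Ide A (fO L x) \<uplus> fM L y z) \<cdot> asc A (fO L x) (fO L y) (fO L z))"
      by (simp add: L_def \<phi>_asc[symmetric])
    show "fA L (sym Phi x y) \<cdot> fM L x y = fM L y x \<cdot> sym A (fO L x) (fO L y)"
      using Q[of x y] by (simp add: L_def Q_def s_def)
  next
    fix f g :: "int \<times> bit"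
    have "\<phi> (fst f) (fst g) \<cdot> theta (l (fst f) \<oplus> l (fst g)) (e (snd f) \<cdot> e (snd g))
       = theta (l (fst f + fst g)) (e (snd f) \<cdot> e (snd g)) \<cdot> \<phi> (fst f) (fst g)"
      by (subst theta_nat) simp_all
    then show "fM L (Cod Phi f) (Cod Phi g) \<cdot> (fA L f \<uplus> fA L g)
        = fA L (f \<uplus>\<^bsub>Phi\<^esub> g) \<cdot> fM L (Dom Phi f) (Dom Phi g)"
      by (simp add: L_def theta_add e_add(1))
  qed (simp_all add: L_def Phi_scg scg_axioms theta_comp e_add(1))
  then obtain w where "sm_functor Phi A (L\<lparr>fU := w\<rparr>)"
    using sm_functor_fU_ex by blast
  then show ?thesis by (intro exI[of _ "L\<lparr>fU := w\<rparr>"]) (simp add: L_def)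
qed

end

section \<open>Symmetric categorical groups as \<open>\<Phi>\<close>-modules\<close>

text \<open>A module and its underlying symmetric categorical group are records of different types,
  so equality cannot relate them. Comparison of fields replaces it, and the lemmas that follow
  transport the basic notions along it.\<close>

definition same_scg :: "('o, 'a, 'm) scg_scheme \<Rightarrow> ('o, 'a, 'n) scg_scheme \<Rightarrow> bool" where
  "same_scg A B \<longleftrightarrow> Obj B = Obj A \<and> Arr B = Arr A \<and> Dom B = Dom A \<and> Cod B = Cod A \<and> Ide B
      = Ide A \<and> comp B = comp A
     \<and> add B = add A \<and> addA B = addA A \<and> zero B = zero A \<and> asc B = asc A \<and> lun B = lun A \<and> run B
         = run A \<and> sym B = sym A"

lemma same_scg_sel:
  assumes "same_scg A B"
  shows "Obj B = Obj A" "Arr B = Arr A" "Dom B = Dom A" "Cod B = Cod A" "Ide B = Ide A" "comp B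
      = comp A"
    "add B = add A" "addA B = addA A" "zero B = zero A" "asc B = asc A" "lun B = lun A" "run B
        = run A" "sym B = sym A"
  using assms by (auto simp: same_scg_def)

lemma same_scg_sym: "same_scg A B \<Longrightarrow> same_scg B A"
  by (simp add: same_scg_def)

lemma same_ghom: "same_scg A B \<Longrightarrow> ghom B = ghom A"
  by (intro ext) (simp add: ghom_def same_scg_sel)

lemma same_ginv: "same_scg A B \<Longrightarrow> ginv B = ginv A"
  by (intro ext) (simp only: ginv_def same_scg_sel same_ghom)

lemma same_mid: "same_scg A B \<Longrightarrow> mid B = mid A"
  by (intro ext) (simp only: mid_def same_scg_sel same_ginv)

lemma same_groupoid: "same_scg A B \<Longrightarrow> groupoid B \<longleftrightarrow> groupoid A"
  by (simp only: groupoid_def same_scg_sel same_ghom)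

lemma same_gfunctor:
  "same_scg A B \<Longrightarrow> gfunctor B C F \<longleftrightarrow> gfunctor A C F"
  "same_scg A B \<Longrightarrow> gfunctor C B F' \<longleftrightarrow> gfunctor C A F'"
  by (simp_all only: gfunctor_def gfunctor_axioms_def same_scg_sel same_ghom same_groupoid)

lemma same_nat_trans:
  "same_scg A B \<Longrightarrow> nat_trans B C F G t \<longleftrightarrow> nat_trans A C F G t"
  "same_scg A B \<Longrightarrow> nat_trans C B F' G' t' \<longleftrightarrow> nat_trans C A F' G' t'"
  by (simp_all only: nat_trans_def nat_trans_axioms_def same_scg_sel same_ghom same_gfunctor)

lemma same_translation: "same_scg A B \<Longrightarrow> equivalence B B (translation B x)
    \<longleftrightarrow> equivalence A A (translation A x)"
  by (simp only: equivalence_def translation_def same_scg_sel same_gfunctor same_nat_trans)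

lemma same_scg: "same_scg A B \<Longrightarrow> scg B \<longleftrightarrow> scg A"
  by (simp only: scg_def scg_axioms_def same_scg_sel same_ghom same_groupoid same_translation)

lemma same_sm_functor:
  "same_scg A B \<Longrightarrow> sm_functor B C F \<longleftrightarrow> sm_functor A C F"
  "same_scg A B \<Longrightarrow> sm_functor C B F' \<longleftrightarrow> sm_functor C A F'"
  by (simp_all only: sm_functor_def sm_functor_axioms_def same_scg_sel same_ghom same_gfunctor same_scg)

lemma same_sm_trans:
  "same_scg A B \<Longrightarrow> sm_trans B C F G t \<longleftrightarrow> sm_trans A C F G t"
  "same_scg A B \<Longrightarrow> sm_trans C B F' G' t' \<longleftrightarrow> sm_trans C A F' G' t'"
  by (simp_all only: sm_trans_def sm_trans_axioms_def same_scg_sel same_nat_trans same_sm_functor)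

lemma same_smcomp: "same_scg A B \<Longrightarrow> smcomp B = smcomp A"
  by (intro ext) (simp only: smcomp_def same_scg_sel)

lemma same_id_smfun: "same_scg A B \<Longrightarrow> id_smfun B = id_smfun A"
  by (simp only: id_smfun_def same_scg_sel)

text \<open>A strict equality of HOL functions, possible since every integer and every pair lies in
  the carriers of \<open>Phi\<close>; for other sources the argument gives agreement on the
  carriers.\<close>

lemma smcomp_assoc_Phi:
  assumes "sm_functor Phi A H" "sm_functor A B G" "sm_functor B C F"
  shows "smcomp C (smcomp C F G) H = smcomp C F (smcomp B G H)"
proof -
  interpret H: sm_functor Phi A H by fact
  interpret G: sm_functor A B G by fact
  interpret F: sm_functor B C F by fact
  note [simp] = Phi_functor_fM[OF assms(1)] Phi_functor_fO[OF assms(1)] Phi_functor_fU[OF assms(1)]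
  show ?thesis
    by (simp add: smcomp_def fun_eq_iff F.fA_comp_simp)
qed

text \<open>Composition distributes over sums from the right with identity components. It is stated
  as a transformation, as the unit constraints of the two sums are chosen separately.\<close>

lemma sm_trans_sum_comp:
  assumes "sm_functor A B H" "sm_functor B C F" "sm_functor B C G"
  shows "sm_trans A C (smsum A C (smcomp C F H) (smcomp C G H)) (smcomp C (smsum B C F G) H)
    (\<lambda>x. Ide C (fO F (fO H x) \<oplus>\<^bsub>C\<^esub> fO G (fO H x)))"
proof -
  interpret H: sm_functor A B H by fact
  interpret F: sm_functor B C F by fact
  interpret G: sm_functor B C G by fact
  show ?thesis
    by (rule sm_transI[OF sm_functor_smsum[OF sm_functor_smcomp[OF assms(1,2)] sm_functor_smcomp[OF
        assms(1,3)]]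
          sm_functor_smcomp[OF assms(1) sm_functor_smsum[OF assms(2,3)]]])
      (simp_all add: smcomp_def)
qed

text \<open>The distributivity constraint of left multiplication by 1 is trivial because
  \<open>choose2 1\<close> is 0.\<close>

lemma Phi_lmul_one:
  fixes L :: "(int, int \<times> bit, 'o, 'a) smfun"
  assumes "sm_functor Phi A L"
  shows "smcomp A L (lmul Phi 1) = L"
proof -
  interpret A: scg A by (rule sm_functor_scg[OF assms])
  note [simp] = Phi_functor_fM[OF assms] Phi_functor_fO[OF assms] Phi_functor_fU[OF assms]
      Phi_functor_zero[OF assms]
  show ?thesis
    by (intro smfun.equality) (simp_all add: smcomp_def lmul_def fun_eq_iff choose2_simps)
qed

text \<open>The monoidal condition is the identity
  \<open>choose2 (r + r') = choose2 r + choose2 r' + r * r'\<close> modulo 2: the product term is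
  the sign contributed by \<open>mid\<close> in the sum of the two left multiplications.\<close>

lemma Phi_rdist_trans:
  "sm_trans Phi Phi (smsum Phi Phi (lmul Phi r) (lmul Phi r')) (lmul Phi (r + r')) (\<lambda>s. ((r + r') * s,
      0))"
  by (rule sm_transI[OF sm_functor_smsum[OF Phi_lmul Phi_lmul] Phi_lmul])
    (auto simp: lmul_def Phi_mid choose2_simps bit_simps)


text \<open>\<open>nfold m\<close> is the functor \<open>r \<mapsto> m r\<close>. Each structure isomorphism of the
    module is the transformation
  of functors of the last ring variable that is an identity at 1.\<close>

definition (in scg) nfold :: "'o \<Rightarrow> (int, int \<times> bit, 'o, 'a) smfun" where
  "nfold m = (SOME F. sm_functor Phi A F \<and> fO F 1 = m)"

definition Phi_trans :: "('o, 'a, 'm) scg_scheme \<Rightarrow> (int, int \<times> bit, 'o, 'a, 'k) smfun_scheme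
    \<Rightarrow> (int, int \<times> bit, 'o, 'a, 'l) smfun_scheme \<Rightarrow> 'a \<Rightarrow> int \<Rightarrow> 'a" where
  "Phi_trans A F G a = (SOME t. sm_trans Phi A F G t \<and> t 1 = a)"

lemma Phi_trans:
  assumes "sm_functor Phi A F" "sm_functor Phi A G" "a \<in> Arr A" "Dom A a = fO F 1" "Cod A a = fO G 1"
  shows "sm_trans Phi A F G (Phi_trans A F G a)" "Phi_trans A F G a 1 = a"
  using someI_ex[OF Phi_trans_ex[OF assms]] by (simp_all add: Phi_trans_def)

section \<open>Multiples of objects and arrows, and the constraints between them\<close>

context scg begin

lemma nfold:
  assumes "m \<in> Obj A"
  shows nfold_functor: "sm_functor Phi A (nfold m)" and nfold_one [simp]: "fO (nfold m) 1 = m"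
  using someI_ex[OF Phi_functor_ex[OF assms]] by (simp_all add: nfold_def)

lemma nfold_simps [simp]:
  assumes "m \<in> Obj A"
  shows "fO (nfold m) r \<in> Obj A" "fA (nfold m) (r, 0) = Ide A (fO (nfold m) r)"
    "fA (nfold m) a \<in> Arr A" "Dom A (fA (nfold m) a) = fO (nfold m) (fst a)" "Cod A (fA (nfold m) a)
        = fO (nfold m) (fst a)"
    "fM (nfold m) r s \<in> Arr A" "Dom A (fM (nfold m) r s) = fO (nfold m) r
        \<oplus> fO (nfold m) s" "Cod A (fM (nfold m) r s) = fO (nfold m) (r + s)"
  using nfold_functor[OF assms] Phi_functor[of A "nfold m"] by blast+

definition nfoldA :: "'a \<Rightarrow> int \<Rightarrow> 'a" where
  "nfoldA f = Phi_trans A (nfold (Dom A f)) (nfold (Cod A f)) f"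

lemma nfoldA:
  assumes "f \<in> Arr A"
  shows nfoldA_trans: "sm_trans Phi A (nfold (Dom A f)) (nfold (Cod A f)) (nfoldA f)" and nfoldA_one
      [simp]: "nfoldA f 1 = f"
  unfolding nfoldA_def by (rule Phi_trans; simp add: assms nfold_functor)+

lemma Phi_trans_simps:
  assumes "sm_trans Phi A F G t"
  shows "t r \<in> Arr A" "Dom A (t r) = fO F r" "Cod A (t r) = fO G r"
    "t (fst a) \<cdot> fA F a = fA G a \<cdot> t (fst a)"
    "t (r + s) \<cdot> fM F r s = fM G r s \<cdot> (t r \<uplus> t s)"
proof -
  interpret sm_trans Phi A F G t by fact
  show "t r \<in> Arr A" "Dom A (t r) = fO F r" "Cod A (t r) = fO G r"
    using t_simps[of r] by auto
  show "t (fst a) \<cdot> fA F a = fA G a \<cdot> t (fst a)"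
    using t_nat[of a] by simp
  show "t (r + s) \<cdot> fM F r s = fM G r s \<cdot> (t r \<uplus> t s)"
    using t_fM[of r s] by simp
qed

lemma nfoldA_simps [simp]:
  assumes "f \<in> Arr A"
  shows "nfoldA f r \<in> Arr A" "Dom A (nfoldA f r) = fO (nfold (Dom A f)) r" "Cod A (nfoldA f r)
      = fO (nfold (Cod A f)) r"
  using Phi_trans_simps[OF nfoldA_trans[OF assms]] by auto

lemma nfoldA_nat:
  assumes "f \<in> Arr A" "Dom A f = m" "Cod A f = n"
  shows "nfoldA f (fst a) \<cdot> fA (nfold m) a = fA (nfold n) a \<cdot> nfoldA f (fst a)"
  using Phi_trans_simps(4)[OF nfoldA_trans[OF assms(1)]] assms by simp

lemma nfoldA_Ide [simp]:
  assumes "m \<in> Obj A"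
  shows "nfoldA (Ide A m) r = Ide A (fO (nfold m) r)"
proof -
  have "nfoldA (Ide A m) = (\<lambda>r. Ide A (fO (nfold m) r))"
    by (rule Phi_trans_unique[OF _ sm_trans_Ide[OF nfold_functor[OF assms]]])
      (use nfoldA_trans[of "Ide A m"] assms in simp_all)
  then show ?thesis by simp
qed

lemma nfoldA_comp:
  assumes "f \<in> Arr A" "g \<in> Arr A" "Dom A g = Cod A f"
  shows "nfoldA (g \<cdot> f) r = nfoldA g r \<cdot> nfoldA f r"
proof -
  have "nfoldA (g \<cdot> f) = (\<lambda>r. nfoldA g r \<cdot> nfoldA f r)"
  proof (rule Phi_trans_unique)
    show "sm_trans Phi A (nfold (Dom A f)) (nfold (Cod A g)) (nfoldA (g \<cdot> f))"
      using nfoldA_trans[of "g \<cdot> f"] assms by simp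
    show "sm_trans Phi A (nfold (Dom A f)) (nfold (Cod A g)) (\<lambda>r. nfoldA g r \<cdot> nfoldA f r)"
      using sm_trans_comp[OF nfoldA_trans[OF assms(1)]] nfoldA_trans[OF assms(2)] assms(3) by simp
  qed (simp add: assms)
  then show ?thesis by simp
qed

definition nfold_asc :: "'o \<Rightarrow> int \<Rightarrow> int \<Rightarrow> 'a" where
  "nfold_asc m r = Phi_trans A (nfold (fO (nfold m) r)) (smcomp A (nfold m) (lmul Phi r)) (Ide A (fO
      (nfold m) r))"

lemma nfold_asc:
  assumes "m \<in> Obj A"
  shows nfold_asc_trans: "sm_trans Phi A (nfold (fO (nfold m) r)) (smcomp A (nfold m) (lmul Phi r))
      (nfold_asc m r)"
    and nfold_asc_one [simp]: "nfold_asc m r 1 = Ide A (fO (nfold m) r)"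
  unfolding nfold_asc_def
  by (rule Phi_trans; simp add: assms nfold_functor sm_functor_smcomp[OF Phi_lmul nfold_functor]; simp
      add: smcomp_def lmul_def assms)+

lemma nfold_asc_simps [simp]:
  assumes "m \<in> Obj A"
  shows "nfold_asc m r s \<in> Arr A" "Dom A (nfold_asc m r s)
      = fO (nfold (fO (nfold m) r)) s" "Cod A (nfold_asc m r s) = fO (nfold m) (r * s)"
  using Phi_trans_simps[OF nfold_asc_trans[OF assms]] by (auto simp: smcomp_def lmul_def)

definition nfold_add :: "'o \<Rightarrow> 'o \<Rightarrow> int \<Rightarrow> 'a" where
  "nfold_add m n = Phi_trans A (smsum Phi A (nfold m) (nfold n)) (nfold (m \<oplus> n)) (Ide A (m \<oplus> n))"

lemma nfold_add:
  assumes "m \<in> Obj A" "n \<in> Obj A"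
  shows nfold_add_trans: "sm_trans Phi A (smsum Phi A (nfold m) (nfold n)) (nfold (m
      \<oplus> n)) (nfold_add m n)"
    and nfold_add_one [simp]: "nfold_add m n 1 = Ide A (m \<oplus> n)"
  unfolding nfold_add_def
  by (rule Phi_trans; simp add: assms nfold_functor sm_functor_smsum)+

lemma nfold_add_simps [simp]:
  assumes "m \<in> Obj A" "n \<in> Obj A"
  shows "nfold_add m n r \<in> Arr A" "Dom A (nfold_add m n r)
      = fO (nfold m) r \<oplus> fO (nfold n) r" "Cod A (nfold_add m n r) = fO (nfold (m \<oplus> n)) r"
  using Phi_trans_simps[OF nfold_add_trans[OF assms]] by auto

lemma nfold_add_nat:
  assumes "f \<in> Arr A" "g \<in> Arr A"
  shows "nfold_add (Cod A f) (Cod A g) r \<cdot> (nfoldA f r \<uplus> nfoldA g r)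
      = nfoldA (f \<uplus> g) r \<cdot> nfold_add (Dom A f) (Dom A g) r"
proof -
  have "(\<lambda>r. nfold_add (Cod A f) (Cod A g) r \<cdot> (nfoldA f r \<uplus> nfoldA g r))
      = (\<lambda>r. nfoldA (f \<uplus> g) r \<cdot> nfold_add (Dom A f) (Dom A g) r)"
    by (rule Phi_trans_unique[OF sm_trans_comp[OF sm_trans_sum[OF nfoldA_trans nfoldA_trans]
        nfold_add_trans]
          sm_trans_comp[OF nfold_add_trans]])
      (use nfoldA_trans[of "f \<uplus> g"] assms in simp_all)
  then show ?thesis by metis
qed

text \<open>Both sides are transformations in r out of a threefold sum of functors, with the
  associativity constraint taking part through \<open>sm_trans_sum_asc\<close>. At r = 1 every other
  factor is an identity.\<close>

lemma nfold_add_asc: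
  assumes [simp]: "x \<in> Obj A" "y \<in> Obj A" "z \<in> Obj A"
  shows "nfoldA (asc A x y z) r \<cdot> (nfold_add (x \<oplus> y) z r \<cdot> (nfold_add x y r \<uplus> Ide A (fO (nfold z) r)))
    = nfold_add x (y \<oplus> z) r \<cdot> ((Ide A (fO (nfold x) r) \<uplus> nfold_add y z r)
        \<cdot> asc A (fO (nfold x) r) (fO (nfold y) r) (fO (nfold z) r))"
proof -
  have "(\<lambda>r. nfoldA (asc A x y z) r \<cdot> (nfold_add (x \<oplus> y) z r \<cdot> (nfold_add x y r
      \<uplus> Ide A (fO (nfold z) r))))
    = (\<lambda>r. nfold_add x (y \<oplus> z) r \<cdot> ((Ide A (fO (nfold x) r) \<uplus> nfold_add y z r)
        \<cdot> asc A (fO (nfold x) r) (fO (nfold y) r) (fO (nfold z) r)))"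
    by (rule Phi_trans_unique[OF
          sm_trans_comp[OF sm_trans_comp[OF sm_trans_sum[OF nfold_add_trans sm_trans_Ide[OF
              nfold_functor]] nfold_add_trans]]
          sm_trans_comp[OF sm_trans_comp[OF sm_trans_sum_asc[OF nfold_functor nfold_functor
              nfold_functor]
            sm_trans_sum[OF sm_trans_Ide[OF nfold_functor] nfold_add_trans]] nfold_add_trans]])
      (use nfoldA_trans[of "asc A x y z"] in simp_all)
  then show ?thesis by metis
qed

lemma nfold_add_sym:
  assumes [simp]: "x \<in> Obj A" "y \<in> Obj A"
  shows "nfoldA (sym A x y) r \<cdot> nfold_add x y r = nfold_add y x r
      \<cdot> sym A (fO (nfold x) r) (fO (nfold y) r)"
proof -
  have "(\<lambda>r. nfoldA (sym A x y) r \<cdot> nfold_add x y r) = (\<lambda>r. nfold_add y x r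
      \<cdot> sym A (fO (nfold x) r) (fO (nfold y) r))"
    by (rule Phi_trans_unique[OF
          sm_trans_comp[OF nfold_add_trans]
          sm_trans_comp[OF sm_trans_sum_sym[OF nfold_functor nfold_functor] nfold_add_trans]])
      (use nfoldA_trans[of "sym A x y"] in simp_all)
  then show ?thesis by metis
qed

text \<open>The pair (f, a) acts by a on the domain of f and then by f on the multiple; by
  naturality of \<open>nfoldA f\<close> the other order gives the same arrow.\<close>

definition act_arr :: "'a \<Rightarrow> int \<times> bit \<Rightarrow> 'a" where
  "act_arr f a = nfoldA f (fst a) \<cdot> fA (nfold (Dom A f)) a"

lemma act_arr_simps [simp]:
  assumes "f \<in> Arr A"
  shows "act_arr f a \<in> Arr A" "Dom A (act_arr f a) = fO (nfold (Dom A f)) (fst a)"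
    "Cod A (act_arr f a) = fO (nfold (Cod A f)) (fst a)" "act_arr f (r, 0) = nfoldA f r"
  using assms by (simp_all add: act_arr_def)

lemma act_arr_Ide [simp]: "m \<in> Obj A \<Longrightarrow> act_arr (Ide A m) a = fA (nfold m) a"
  by (simp add: act_arr_def)

lemma Phi_lmul_arrow: "sm_trans Phi Phi (lmul Phi (fst a)) (lmul Phi (fst a)) (\<lambda>s. (fst a * s, snd a *
    of_int s))"
  using two_ring.lmul_trans[OF two_ring_Phi, of a "fst a" "fst a"] by simp

lemma nfold_fA_add: "m \<in> Obj A \<Longrightarrow> fA (nfold m) (r, x + y) = fA (nfold m) (r, x) \<cdot> fA (nfold m) (r, y)"
proof -
  assume "m \<in> Obj A"
  then interpret F: sm_functor Phi A "nfold m" by (rule nfold_functor)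
  show ?thesis using F.fA_comp_simp[of "(r, y)" "(r, x)"] by simp
qed

text \<open>Naturality in m and r with an identity in s. Uniqueness applies in s, where the arrow a
  enters through multiplication by a, a transformation between left multiplications of
  \<open>Phi\<close>.\<close>

lemma nfold_asc_nat1:
  assumes [simp]: "f \<in> Arr A"
  shows "nfold_asc (Cod A f) (fst a) s \<cdot> nfoldA (act_arr f a) s
    = (nfoldA f (fst a * s) \<cdot> fA (nfold (Dom A f)) (fst a * s, snd a * of_int s))
        \<cdot> nfold_asc (Dom A f) (fst a) s"
proof -
  have "(\<lambda>s. nfold_asc (Cod A f) (fst a) s \<cdot> nfoldA (act_arr f a) s)
    = (\<lambda>s. (nfoldA f (fO (lmul Phi (fst a)) s) \<cdot> fA (nfold (Dom A f)) (fst a * s, snd a * of_int s))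
        \<cdot> nfold_asc (Dom A f) (fst a) s)" (is "?f = ?g")
  proof (rule Phi_trans_unique)
    show "sm_trans Phi A (nfold (fO (nfold (Dom A f)) (fst a))) (smcomp A (nfold (Cod A f)) (lmul Phi
        (fst a))) ?f" (is "sm_trans _ _ ?S ?T _")
      by (rule sm_trans_comp[OF _ nfold_asc_trans]) (use nfoldA_trans[of "act_arr f a"] in simp_all)
    show "sm_trans Phi A ?S ?T ?g"
      by (rule sm_trans_comp[OF nfold_asc_trans sm_trans_comp[OF sm_trans_whisker_left[OF
          Phi_lmul_arrow nfold_functor]
            sm_trans_whisker_right[OF Phi_lmul nfoldA_trans]]]) simp_all
  qed (simp add: lmul_def act_arr_def)
  then show ?thesis by (simp add: fun_eq_iff lmul_def)
qed

lemma nfold_asc_nat: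
  assumes [simp]: "f \<in> Arr A"
  shows "nfold_asc (Cod A f) (fst a) (fst b) \<cdot> act_arr (act_arr f a) b
      = act_arr f (a \<star>\<^bsub>Phi\<^esub> b) \<cdot> nfold_asc (Dom A f) (fst a) (fst b)"
proof -
  have *: "nfold_asc (Dom A f) (fst a) (fst b) \<cdot> fA (nfold (fO (nfold (Dom A f)) (fst a))) b
      = fA (nfold (Dom A f)) (fst a * fst b, of_int (fst a) * snd b)
          \<cdot> nfold_asc (Dom A f) (fst a) (fst b)"
    using Phi_trans_simps(4)[OF nfold_asc_trans[of "Dom A f" "fst a"], of b]
        by (simp add: smcomp_def lmul_def)
  have "nfold_asc (Cod A f) (fst a) (fst b) \<cdot> act_arr (act_arr f a) b
     = (nfold_asc (Cod A f) (fst a) (fst b) \<cdot> nfoldA (act_arr f a) (fst b))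
         \<cdot> fA (nfold (fO (nfold (Dom A f)) (fst a))) b"
    by (simp add: act_arr_def[of _ b])
  also have "\<dots> = (nfoldA f (fst a * fst b) \<cdot> fA (nfold (Dom A f)) (fst a * fst b, snd a * of_int (fst
      b))) \<cdot>
      (nfold_asc (Dom A f) (fst a) (fst b) \<cdot> fA (nfold (fO (nfold (Dom A f)) (fst a))) b)"
    by (subst nfold_asc_nat1) simp_all
  also have "\<dots> = act_arr f (a \<star>\<^bsub>Phi\<^esub> b) \<cdot> nfold_asc (Dom A f) (fst a) (fst b)"
    unfolding * by (simp add: act_arr_def nfold_fA_add)
  finally show ?thesis .
qed

text \<open>Uniqueness in u, with the common value \<open>nfold_asc m r s\<close> at u = 1. The
  associativity of \<open>Phi\<close> has identity components; it passes from multiplication by r *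
  s to the composite of the two multiplications.\<close>

lemma nfold_asc_pentagon:
  assumes [simp]: "m \<in> Obj A"
  shows "nfold_asc m r (s * u) \<cdot> nfold_asc (fO (nfold m) r) s u
      = nfold_asc m (r * s) u \<cdot> nfoldA (nfold_asc m r s) u"
proof -
  have "(\<lambda>u. nfold_asc m r (fO (lmul Phi s) u) \<cdot> nfold_asc (fO (nfold m) r) s u)
    = (\<lambda>u. fA (nfold m) (masc Phi r s u) \<cdot> (nfold_asc m (r * s) u \<cdot> nfoldA (nfold_asc m r s) u))"
        (is "?f = ?g")
  proof (rule Phi_trans_unique)
    show "sm_trans Phi A (nfold (fO (nfold (fO (nfold m) r)) s)) (smcomp A (smcomp A (nfold m) (lmul
        Phi r)) (lmul Phi s)) ?f" (is "sm_trans _ _ ?S ?T _")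
      by (rule sm_trans_comp[OF nfold_asc_trans sm_trans_whisker_right[OF Phi_lmul nfold_asc_trans]])
          simp_all
    show "sm_trans Phi A ?S ?T ?g"
      unfolding smcomp_assoc_Phi[OF Phi_lmul Phi_lmul nfold_functor[OF assms]]
      by (rule sm_trans_comp[OF sm_trans_comp[OF _ nfold_asc_trans]
           sm_trans_whisker_left[OF two_ring.masc_monoidal3[OF two_ring_Phi, simplified Phi_sel(14)]
               nfold_functor]])
        (use nfoldA_trans[of "nfold_asc m r s"] in simp_all)
  qed (simp add: lmul_def)
  then show ?thesis by (simp add: fun_eq_iff lmul_def)
qed

lemma nfold_asc_unit:
  assumes [simp]: "m \<in> Obj A"
  shows "nfold_asc m 1 r = Ide A (fO (nfold m) r)"
proof -
  have "nfold_asc m 1 = (\<lambda>r. Ide A (fO (nfold m) r))"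
  proof (rule Phi_trans_unique)
    show "sm_trans Phi A (nfold m) (nfold m) (nfold_asc m 1)"
      using nfold_asc_trans[of m 1] Phi_lmul_one[OF nfold_functor[OF assms]] by simp
  qed (simp_all add: sm_trans_Ide nfold_functor)
  then show ?thesis by simp
qed

lemma nfold_asc_sum:
  assumes [simp]: "m \<in> Obj A" "n \<in> Obj A"
  shows "nfold_asc (m \<oplus> n) r s \<cdot> (nfoldA (nfold_add m n r) s
      \<cdot> nfold_add (fO (nfold m) r) (fO (nfold n) r) s) = nfold_add m n (r * s) \<cdot> (nfold_asc m r s
      \<uplus> nfold_asc n r s)"
proof -
  have "(\<lambda>s. nfold_asc (m \<oplus> n) r s \<cdot> (nfoldA (nfold_add m n r) s
      \<cdot> nfold_add (fO (nfold m) r) (fO (nfold n) r) s))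
    = (\<lambda>s. nfold_add m n (fO (lmul Phi r) s) \<cdot> (Ide A (fO (nfold m) (fO (lmul Phi r) s)
        \<oplus> fO (nfold n) (fO (lmul Phi r) s)) \<cdot> (nfold_asc m r s \<uplus> nfold_asc n r s)))" (is "?f = ?g")
  proof (rule Phi_trans_unique)
    show "sm_trans Phi A (smsum Phi A (nfold (fO (nfold m) r)) (nfold (fO (nfold n) r))) (smcomp A
        (nfold (m \<oplus> n)) (lmul Phi r)) ?f" (is "sm_trans _ _ ?S ?T _")
      by (rule sm_trans_comp[OF sm_trans_comp[OF nfold_add_trans] nfold_asc_trans]) (use
          nfoldA_trans[of "nfold_add m n r"] in simp_all)
    show "sm_trans Phi A ?S ?T ?g"
      by (rule sm_trans_comp[OF sm_trans_comp[OF sm_trans_sum[OF nfold_asc_trans nfold_asc_trans]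
          sm_trans_sum_comp[OF Phi_lmul nfold_functor nfold_functor]] sm_trans_whisker_right[OF
              Phi_lmul nfold_add_trans]]) simp_all
  qed (simp add: lmul_def)
  then show ?thesis by (simp add: fun_eq_iff lmul_def)
qed

text \<open>Additivity in the ring variable r. The distributivity of \<open>Phi\<close> enters as
  the transformation \<open>Phi_rdist_trans\<close>, and the constraint of \<open>nfold m\<close>
  through \<open>sm_trans_comp_sum\<close>.\<close>

lemma nfold_asc_add:
  assumes [simp]: "m \<in> Obj A"
  shows "nfold_asc m (r + r') s \<cdot> (nfoldA (fM (nfold m) r r') s
      \<cdot> nfold_add (fO (nfold m) r) (fO (nfold m) r') s)
    = fM (nfold m) (r * s) (r' * s) \<cdot> (nfold_asc m r s \<uplus> nfold_asc m r' s)"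
proof -
  have "(\<lambda>s. nfold_asc m (r + r') s \<cdot> (nfoldA (fM (nfold m) r r') s
      \<cdot> nfold_add (fO (nfold m) r) (fO (nfold m) r') s))
    = (\<lambda>s. fA (nfold m) ((r + r') * s, 0) \<cdot> (fM (nfold m) (fO (lmul Phi r) s) (fO (lmul Phi r') s)
        \<cdot> (nfold_asc m r s \<uplus> nfold_asc m r' s)))" (is "?f = ?g")
  proof (rule Phi_trans_unique)
    show "sm_trans Phi A (smsum Phi A (nfold (fO (nfold m) r)) (nfold (fO (nfold m) r'))) (smcomp A
        (nfold m) (lmul Phi (r + r'))) ?f" (is "sm_trans _ _ ?S ?T _")
      by (rule sm_trans_comp[OF sm_trans_comp[OF nfold_add_trans] nfold_asc_trans]) (use
          nfoldA_trans[of "fM (nfold m) r r'"] in simp_all)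
    show "sm_trans Phi A ?S ?T ?g"
      by (rule sm_trans_comp[OF sm_trans_comp[OF sm_trans_sum[OF nfold_asc_trans nfold_asc_trans]
          sm_trans_comp_sum[OF Phi_lmul Phi_lmul nfold_functor]] sm_trans_whisker_left[OF
              Phi_rdist_trans nfold_functor]]) simp_all
  qed (simp add: lmul_def)
  then show ?thesis by (simp add: fun_eq_iff lmul_def distrib_right)
qed

text \<open>The monoidal condition for the transformation \<open>nfold_add m n\<close> in the ring
  variable, with \<open>mid\<close> replaced by its inverse on the other side.\<close>

lemma nfold_add_interchange:
  assumes [simp]: "m \<in> Obj A" "n \<in> Obj A"
  shows "nfold_add m n (r + s) \<cdot> (fM (nfold m) r s \<uplus> fM (nfold n) r s)
    = fM (nfold (m \<oplus> n)) r s \<cdot> ((nfold_add m n r \<uplus> nfold_add m n s)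
        \<cdot> mid A (fO (nfold m) r) (fO (nfold m) s) (fO (nfold n) r) (fO (nfold n) s))"
proof -
  let ?m = "mid A (fO (nfold m) r) (fO (nfold n) r) (fO (nfold m) s) (fO (nfold n) s)"
  have "(nfold_add m n (r + s) \<cdot> (fM (nfold m) r s \<uplus> fM (nfold n) r s)) \<cdot> ?m
      = fM (nfold (m \<oplus> n)) r s \<cdot> (nfold_add m n r \<uplus> nfold_add m n s)"
    using Phi_trans_simps(5)[OF nfold_add_trans[of m n], of r s] by simp
  then show ?thesis
    by (subst (asm) ginv_move_right) (simp_all add: ginv_mid)
qed

section \<open>Assembling the module over \<open>Phi\<close>\<close>

definition right_mult0 :: "int \<Rightarrow> ('o, 'a, 'o, 'a) smfun" where
  "right_mult0 r = \<lparr>fO = \<lambda>m. fO (nfold m) r, fA = \<lambda>f. act_arr f (r, 0), fM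
      = \<lambda>m n. nfold_add m n r, fU = undefined\<rparr>"

text \<open>The constraint 0 -> 0r, supplied by \<open>sm_functor_fU_ex\<close> from the binary part
  of right multiplication.\<close>

definition right_unit :: "int \<Rightarrow> 'a" where
  "right_unit r = (SOME u. sm_functor A A ((right_mult0 r)\<lparr>fU := u\<rparr>))"

lemma right_mult: "sm_functor A A ((right_mult0 r)\<lparr>fU := right_unit r\<rparr>)"
proof -
  have "pre_sm_functor A A (right_mult0 r)"
    by (rule pre_sm_functorI)
      (simp_all add: right_mult0_def scg_axioms nfold_add_asc nfold_add_sym nfold_add_nat nfoldA_comp)
  then show ?thesis
    unfolding right_unit_def by (rule someI_ex[OF sm_functor_fU_ex])
qed

text \<open>The unit constraint \<open>aun\<close> can be the identity because
  \<open>nfold m\<close> has the value m at 1 on the nose.\<close>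

definition Phi_module :: "('o, 'a, int, int \<times> bit) rmod" where
  "Phi_module = \<lparr>Obj = Obj A, Arr = Arr A, Dom = Dom A, Cod = Cod A, Ide = Ide A, comp = comp A,
     add = add A, addA = addA A, zero = zero A, asc = asc A, lun = lun A, run = run A, sym = sym A,
     act = \<lambda>m. fO (nfold m), actA = act_arr, aasc = nfold_asc, aun = Ide A,
     adl = \<lambda>m. fM (nfold m), adl0 = \<lambda>m. fU (nfold m), adr = nfold_add, adr0 = right_unit\<rparr>"

lemma Phi_module_sel [simp]:
  "Obj Phi_module = Obj A" "Arr Phi_module = Arr A" "Dom Phi_module = Dom A" "Cod Phi_module
      = Cod A" "Ide Phi_module = Ide A" "comp Phi_module = comp A"
  "add Phi_module = add A" "addA Phi_module = addA A" "zero Phi_module = zero A" "asc Phi_module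
      = asc A" "lun Phi_module = lun A" "run Phi_module = run A"
  "sym Phi_module = sym A" "act Phi_module m r = fO (nfold m) r" "actA Phi_module
      = act_arr" "aasc Phi_module = nfold_asc" "aun Phi_module = Ide A"
  "adl Phi_module m = fM (nfold m)" "adl0 Phi_module m = fU (nfold m)" "adr Phi_module
      = nfold_add" "adr0 Phi_module = right_unit"
  by (simp_all add: Phi_module_def)

lemma same_Phi_module: "same_scg A Phi_module"
  by (simp add: same_scg_def)

lemma lact_Phi_module: "m \<in> Obj A \<Longrightarrow> lact Phi Phi_module m = nfold m"
  by (intro smfun.equality) (simp_all add: lact_def fun_eq_iff)

lemma ract_Phi_module: "ract Phi Phi_module r = (right_mult0 r)\<lparr>fU := right_unit r\<rparr>"
  by (simp add: ract_def right_mult0_def fun_eq_iff)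

lemma ract_Phi_module_functor: "sm_functor A A (ract Phi Phi_module r)"
  unfolding ract_Phi_module by (rule right_mult)

lemma rmodule_Phi_module: "rmodule Phi Phi_module"
proof -
  note [simp] = same_sm_functor[OF same_Phi_module] same_sm_trans[OF same_Phi_module] same_smcomp[OF
      same_Phi_module]
    same_id_smfun[OF same_Phi_module] same_mid[OF same_Phi_module] lact_Phi_module
  have nat: "nfoldA f (fst a) \<cdot> fA (nfold (Dom A f)) a = fA (nfold (Cod A f)) a
      \<cdot> nfoldA f (fst a)" if "f \<in> Arr A" for f a
    using that by (intro nfoldA_nat) simp_all
  show ?thesis
  proof (intro rmodule.intro rmodule_axioms.intro two_ring_Phi, goal_cases)
    case 1 show ?case using same_scg[OF same_Phi_module] scg_axioms by simp
  next
    \<comment> \<open>Functoriality in both variables at once: the automorphism in \<open>a'\<close>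
      has to pass f, which naturality of \<open>nfoldA f\<close> permits.\<close>
    case (5 f m m' f' m'' a r r' a' r'')
    then have f: "f \<in> Arr A" "f' \<in> Arr A" "Dom A f' = Cod A f" "fst a' = fst a" by auto
    have "act_arr (f' \<cdot> f) (fst a, snd a' + snd a) = nfoldA f' (fst a) \<cdot> ((nfoldA f (fst a)
        \<cdot> fA (nfold (Dom A f)) (fst a, snd a')) \<cdot> fA (nfold (Dom A f)) a)"
      using f nfold_fA_add[of "Dom A f" "fst a" "snd a'" "snd a"] by (simp add: act_arr_def nfoldA_comp)
    also have "nfoldA f (fst a) \<cdot> fA (nfold (Dom A f)) (fst a, snd a')
        = fA (nfold (Cod A f)) (fst a, snd a') \<cdot> nfoldA f (fst a)"
      using nat[of f "(fst a, snd a')"] f by simp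
    also have "nfoldA f' (fst a) \<cdot> ((fA (nfold (Cod A f)) (fst a, snd a') \<cdot> nfoldA f (fst a))
        \<cdot> fA (nfold (Dom A f)) a)
        = act_arr f' (fst a, snd a') \<cdot> act_arr f a"
      using f by (simp add: act_arr_def)
    finally show ?case using f by (simp add: prod_eq_iff) (metis prod.collapse)
  next
    case (7 f m m' a r r' b s s')
    then show ?case using nfold_asc_nat[of f a b] by auto
  next
    case (8 m r s u) then show ?case by (simp add: nfold_asc_pentagon)
  next
    case (9 m r) then show ?case by (simp add: nfold_asc_unit)
  next
    case (10 m) then show ?case by (simp add: nfold_functor)
  next
    case (11 r) then show ?case by (simp add: ract_Phi_module_functor)
  next
    case (12 f m m')
    then show ?case using nfoldA_trans[of f] by auto
  next
    \<comment> \<open>An automorphism of r acts through the functors \<open>nfold m\<close>; that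
      this is additive in m is naturality of \<open>nfold_add\<close> in the ring variable.\<close>
    case (13 a r r')
    have [simp]: "r' = r" "fst a = r" using 13 by auto
    have "sm_trans A A (ract Phi Phi_module r) (ract Phi Phi_module r) (\<lambda>m. act_arr (Ide A m) a)"
      using Phi_trans_simps(4)[OF nfold_add_trans, of _ _ a]
      by (intro sm_transI ract_Phi_module_functor) (simp_all add: ract_def nat[of _ a, simplified])
    then show ?case by simp
  next
    case (14 m n r s) then show ?case by (simp add: nfold_add_interchange)
  next
    case (15 r s)
    have "sm_trans A A (smcomp A (ract Phi Phi_module s) (ract Phi Phi_module r)) (ract Phi Phi_module
        (r * s)) (\<lambda>m. nfold_asc m r s)"
    proof (intro sm_transI sm_functor_smcomp[OF ract_Phi_module_functor ract_Phi_module_functor]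
        ract_Phi_module_functor)
      fix f assume "f \<in> Arr A"
      then show "nfold_asc (Cod A f) r s \<cdot> fA (smcomp A (ract Phi Phi_module s) (ract Phi Phi_module
          r)) f
          = fA (ract Phi Phi_module (r * s)) f \<cdot> nfold_asc (Dom A f) r s"
        using nfold_asc_nat[of f "(r, 0)" "(s, 0)"] by (simp add: smcomp_def ract_def)
    qed (simp_all add: smcomp_def ract_def nfold_asc_sum)
    then show ?case by simp
  next
    case (16 m s)
    then have [simp]: "m \<in> Obj A" by simp
    have "sm_trans Phi A (smcomp A (ract Phi Phi_module s) (nfold m)) (smcomp A (nfold m) (rmul Phi s))
        (\<lambda>r. nfold_asc m r s)"
    proof (intro sm_transI sm_functor_smcomp[OF nfold_functor ract_Phi_module_functor]
        sm_functor_smcomp[OF Phi_rmul nfold_functor])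
      fix a assume "a \<in> Arr Phi"
      show "nfold_asc m (Cod Phi a) s \<cdot> fA (smcomp A (ract Phi Phi_module s) (nfold m)) a
          = fA (smcomp A (nfold m) (rmul Phi s)) a \<cdot> nfold_asc m (Dom Phi a) s"
        using nfold_asc_nat[of "Ide A m" a "(s, 0)"] by (simp add: smcomp_def ract_def rmul_def)
    qed (simp_all add: smcomp_def ract_def rmul_def nfold_asc_add distrib_right)
    then show ?case by simp
  next
    case (17 m r) then show ?case by (simp add: nfold_asc_trans)
  next
    case 18
    have "sm_trans A A (ract Phi Phi_module 1) (id_smfun A) (Ide A)"
      by (intro sm_transI ract_Phi_module_functor sm_functor_id scg_axioms) (simp_all add: ract_def
          id_smfun_def)
    then show ?case by simp
  qed (auto simp: act_arr_def)
qed

end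

section \<open>Functors between \<open>\<Phi>\<close>-modules\<close>

text \<open>Equality of symmetric monoidal functors as such: HOL functions are total and may differ
  off the carriers. It also compares a functor with a module morphism, whose record is
  larger.\<close>

definition agree :: "('o, 'a, 'm) scg_scheme \<Rightarrow> ('o, 'a, 'p, 'b, 'k) smfun_scheme \<Rightarrow> ('o, 'a, 'p, 'b, 'l)
    smfun_scheme \<Rightarrow> bool" where
  "agree A F F' \<longleftrightarrow> (\<forall>x \<in> Obj A. fO F' x = fO F x) \<and> (\<forall>f \<in> Arr A. fA F' f = fA F f)
     \<and> (\<forall>x \<in> Obj A. \<forall>y \<in> Obj A. fM F' x y = fM F x y) \<and> fU F' = fU F"

lemma agree_sel:
  assumes "agree A F F'"
  shows "x \<in> Obj A \<Longrightarrow> fO F' x = fO F x" "f \<in> Arr A \<Longrightarrow> fA F' f = fA F f"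
    "x \<in> Obj A \<Longrightarrow> y \<in> Obj A \<Longrightarrow> fM F' x y = fM F x y" "fU F' = fU F"
  using assms by (auto simp: agree_def)

lemma agree_sym: "agree A F F' \<Longrightarrow> agree A F' F"
  by (simp add: agree_def)

lemma agree_sm_functor:
  assumes "agree A F F'" "sm_functor A B F"
  shows "sm_functor A B F'"
proof -
  interpret F: sm_functor A B F by fact
  note [simp] = agree_sel[OF assms(1)]
  show ?thesis
    by (rule sm_functorI[OF pre_sm_functorI])
      (simp_all add: sm_functor_scg[OF assms(2)] F.fA_comp_simp F.fM_nat F.pre_fM_asc F.pre_fM_sym
          F.fM_lun)
qed

lemma agree_sm_trans:
  assumes "agree A F F'" "agree A G G'" "\<And>x. x \<in> Obj A \<Longrightarrow> t' x = t x" "sm_trans A B F G t"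
  shows "sm_trans A B F' G' t'"
proof -
  interpret t: sm_trans A B F G t by fact
  note [simp] = agree_sel[OF assms(1)] agree_sel[OF assms(2)]
  show ?thesis
    by (rule sm_transI[OF agree_sm_functor[OF assms(1)] agree_sm_functor[OF assms(2)]])
      (simp_all add: assms(3) t.F.sm_functor_axioms t.G.sm_functor_axioms t.t_nat t.t_fM)
qed

section \<open>Derived laws in modules over \<open>Phi\<close>\<close>

context
  fixes M :: "('o, 'a, int, int \<times> bit, 'm) rmod_scheme" (structure)
  assumes M: "rmodule Phi M"
begin

interpretation SM: scg M using M by (simp add: rmodule_def)
interpretation M: rmodule Phi M by (rule M)

lemma module_simps:
  assumes "m \<in> Obj M"
  shows "m \<odot> r \<in> Obj M"
    "aasc M m r s \<in> Arr M" "Dom M (aasc M m r s) = (m \<odot> r) \<odot> s" "Cod M (aasc M m r s) = m \<odot> (r * s)"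
    "aun M m \<in> Arr M" "Dom M (aun M m) = m \<odot> 1" "Cod M (aun M m) = m"
    "Ide M m \<diamondop> (r, 0) = Ide M (m \<odot> r)"
    "n \<in> Obj M \<Longrightarrow> adr M m n r \<in> Arr M"
    "n \<in> Obj M \<Longrightarrow> Dom M (adr M m n r) = (m \<odot> r) \<oplus> (n \<odot> r)"
    "n \<in> Obj M \<Longrightarrow> Cod M (adr M m n r) = (m \<oplus> n) \<odot> r"
proof -
  show "m \<odot> r \<in> Obj M" using M.act_Obj[of m r] assms by simp
  show "aasc M m r s \<in> Arr M" "Dom M (aasc M m r s) = (m \<odot> r) \<odot> s" "Cod M (aasc M m r s) = m \<odot> (r * s)"
    using M.aasc_hom[of m r s] assms by auto
  interpret u: sm_trans M M "ract Phi M 1" "id_smfun M" "aun M" using M.aun_monoidal by simp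
  show "aun M m \<in> Arr M" "Dom M (aun M m) = m \<odot> 1" "Cod M (aun M m) = m"
    using u.t_simps[OF assms(1)] by (simp_all add: ract_def id_smfun_def)
  show "Ide M m \<diamondop> (r, 0) = Ide M (m \<odot> r)"
    using M.actA_Ide[of m r] assms by simp
  interpret r: sm_functor M M "ract Phi M r" using M.ract_functor by simp
  show "adr M m n r \<in> Arr M" "Dom M (adr M m n r) = (m \<odot> r) \<oplus> (n \<odot> r)" "Cod M (adr M m n r)
      = (m \<oplus> n) \<odot> r"
    if "n \<in> Obj M" using r.fM_simps[OF assms that] by (simp_all add: ract_def)
qed

lemma module_actA:
  assumes "f \<in> Arr M"
  shows "f \<diamondop> a \<in> Arr M" "Dom M (f \<diamondop> a) = Dom M f \<odot> fst a" "Cod M (f \<diamondop> a) = Cod M f \<odot> fst a"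
  using M.actA_hom[of f "Dom M f" "Cod M f" a "fst a" "fst a"] assms by auto

lemma module_actA_comp:
  assumes "f \<in> Arr M" "g \<in> Arr M" "Dom M g = Cod M f"
  shows "(g \<cdot> f) \<diamondop> (r, x + y) = (g \<diamondop> (r, x)) \<cdot> (f \<diamondop> (r, y))"
  using M.actA_comp[of f "Dom M f" "Cod M f" g "Cod M g" "(r, y)" r r "(r, x)" r] assms by simp

lemma module_actA_split:
  assumes "f \<in> Arr M"
  shows "f \<diamondop> a = (f \<diamondop> (fst a, 0)) \<cdot> (Ide M (Dom M f) \<diamondop> a)"
  using module_actA_comp[of "Ide M (Dom M f)" f "fst a" 0 "snd a"] assms by simp

lemma module_aun_nat:
  assumes "f \<in> Arr M"
  shows "aun M (Cod M f) \<cdot> (f \<diamondop> (1, 0)) = f \<cdot> aun M (Dom M f)"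
proof -
  interpret u: sm_trans M M "ract Phi M 1" "id_smfun M" "aun M" using M.aun_monoidal by simp
  show ?thesis using u.t_nat[OF assms] by (simp add: ract_def id_smfun_def)
qed

lemma module_aun_add:
  assumes "x \<in> Obj M" "y \<in> Obj M"
  shows "aun M (x \<oplus> y) \<cdot> adr M x y 1 = aun M x \<uplus> aun M y"
proof -
  interpret u: sm_trans M M "ract Phi M 1" "id_smfun M" "aun M" using M.aun_monoidal by simp
  show ?thesis using u.t_fM[OF assms] assms module_simps by (simp add: ract_def id_smfun_def)
qed

text \<open>Kelly's argument for the unit law at the right end: the pentagon at r, 1, 1 and the
  triangle give the equation after acting by 1, and acting by 1 is faithful by naturality of
  \<open>aun\<close>.\<close>

lemma module_aasc_one:
  assumes [simp]: "m \<in> Obj M"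
  shows "aasc M m r 1 = aun M (m \<odot> r)"
proof -
  note [simp] = module_simps module_actA
  let ?n = "m \<odot> r"
  have t: "aasc M ?n 1 1 = aun M ?n \<diamondop> (1, 0)"
    using M.act_triangle[of ?n 1] by simp
  have "aasc M m r 1 \<cdot> aasc M ?n 1 1 = aasc M m r 1 \<cdot> (aasc M m r 1 \<diamondop> (1, 0))"
    using M.act_pentagon[of m r 1 1] by simp
  then have "aun M ?n \<diamondop> (1, 0) = aasc M m r 1 \<diamondop> (1, 0)"
    unfolding t by (subst (asm) SM.cancel_left) simp_all
  then have "aun M ?n \<cdot> aun M (?n \<odot> 1) = aasc M m r 1 \<cdot> aun M (?n \<odot> 1)"
    using module_aun_nat[of "aun M ?n"] module_aun_nat[of "aasc M m r 1"] by simp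
  then show ?thesis
    by (subst (asm) SM.cancel_right) simp_all
qed

lemma module_lact: "m \<in> Obj M \<Longrightarrow> sm_functor Phi M (lact Phi M m)"
  by (rule M.lact_functor)

lemma module_lact_trans:
  assumes "f \<in> Arr M"
  shows "sm_trans Phi M (lact Phi M (Dom M f)) (lact Phi M (Cod M f)) (\<lambda>r. f \<diamondop> (r, 0))"
  using M.lact_trans[of f "Dom M f" "Cod M f"] assms by simp

text \<open>The interchange axiom, composed with the inverse of \<open>mid\<close>, is the monoidal
  condition in r. Naturality in r is the monoidal condition in m for the transformation that an
  automorphism of r induces.\<close>

lemma module_adr_trans:
  assumes [simp]: "m \<in> Obj M" "n \<in> Obj M"
  shows "sm_trans Phi M (smsum Phi M (lact Phi M m) (lact Phi M n)) (lact Phi M (m \<oplus> n)) (adr M m n)"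
proof (rule sm_transI[OF sm_functor_smsum[OF module_lact[OF assms(1)] module_lact[OF assms(2)]]
      module_lact[OF SM.add_in[OF assms]]])
  note [simp] = module_simps module_actA
  fix r s :: int
  interpret l: sm_functor Phi M "lact Phi M m" by (rule module_lact) simp
  interpret l': sm_functor Phi M "lact Phi M n" by (rule module_lact) simp
  interpret l'': sm_functor Phi M "lact Phi M (m \<oplus> n)" by (rule module_lact) simp
  have [simp]: "adl M x u v \<in> Arr M" "Dom M (adl M x u v) = (x \<odot> u) \<oplus> (x \<odot> v)" "Cod M (adl M x u v)
      = x \<odot> (u + v)"
    if "x \<in> Obj M" for x u v
    using sm_functor.fM_hom[OF module_lact[OF that], of u v] by (auto simp: lact_def)
  have "(adr M m n (r + s) \<cdot> (adl M m r s \<uplus> adl M n r s)) \<cdot> mid M (m \<odot> r) (n \<odot> r) (m \<odot> s) (n \<odot> s)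
     = (adl M (m \<oplus> n) r s \<cdot> ((adr M m n r \<uplus> adr M m n s)
            \<cdot> mid M (m \<odot> r) (m \<odot> s) (n \<odot> r) (n \<odot> s))) \<cdot> mid M (m \<odot> r) (n \<odot> r) (m \<odot> s) (n \<odot> s)"
    using M.act_interchange[of m n r s] by simp
  also have "\<dots> = adl M (m \<oplus> n) r s \<cdot> ((adr M m n r \<uplus> adr M m n s) \<cdot>
      (mid M (m \<odot> r) (m \<odot> s) (n \<odot> r) (n \<odot> s) \<cdot> mid M (m \<odot> r) (n \<odot> r) (m \<odot> s) (n \<odot> s)))"
    by simp
  also have "mid M (m \<odot> r) (m \<odot> s) (n \<odot> r) (n \<odot> s) \<cdot> mid M (m \<odot> r) (n \<odot> r) (m \<odot> s) (n \<odot> s)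
     = Ide M ((m \<odot> r) \<oplus> (n \<odot> r) \<oplus> ((m \<odot> s) \<oplus> (n \<odot> s)))"
    by (subst SM.ginv_mid[symmetric]) simp_all
  finally show "adr M m n (r \<oplus>\<^bsub>Phi\<^esub> s) \<cdot> fM (smsum Phi M (lact Phi M m) (lact Phi M n)) r s
      = fM (lact Phi M (m \<oplus> n)) r s \<cdot> (adr M m n r \<uplus> adr M m n s)"
    by (simp add: lact_def)
next
  note [simp] = module_simps module_actA
  fix a
  interpret r: sm_trans M M "ract Phi M (fst a)" "ract Phi M (fst a)" "\<lambda>m. Ide M m \<diamondop> a"
    using M.ract_trans[of a "fst a" "fst a"] by simp
  show "adr M m n (Cod Phi a) \<cdot> fA (smsum Phi M (lact Phi M m) (lact Phi M n)) a
      = fA (lact Phi M (m \<oplus> n)) a \<cdot> adr M m n (Dom Phi a)"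
    using r.t_fM[of m n] by (simp add: lact_def ract_def)
qed (simp_all add: module_simps lact_def)

lemma module_aasc_trans:
  "m \<in> Obj M \<Longrightarrow> sm_trans Phi M (lact Phi M (m \<odot> r)) (smcomp M (lact Phi M m) (lmul Phi r)) (\<lambda>s. aasc M m
      r s)"
  using M.aasc_monoidal3[of m r] by simp

end

lemma lact_fO [simp]: "fO (lact R M m) r = m \<odot>\<^bsub>M\<^esub> r" "fA (lact R M m) a = Ide M m \<diamondop>\<^bsub>M\<^esub> a"
  by (simp_all add: lact_def)

section \<open>Module structures on functors: existence, uniqueness, and tracks\<close>

context
  fixes M :: "('o, 'a, int, int \<times> bit, 'm) rmod_scheme" and N :: "('p, 'b, int, int \<times> bit, 'n)
      rmod_scheme" (structure)
  assumes M: "rmodule Phi M" and N: "rmodule Phi N"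
begin

interpretation SM: scg M using M by (simp add: rmodule_def)
interpretation SN: scg N using N by (simp add: rmodule_def)

text \<open>Naturality in m, compatibility with associativity and additivity in m are equations
  between transformations in a ring variable. At 1 each of them reduces, through the unit law
  \<open>un\<close>, to a property of \<open>aun\<close>.\<close>

lemma rmod_functorI:
  fixes F :: "('o, 'a, 'p, 'b, int, 'k) modfun_scheme"
  assumes F: "sm_functor M N F"
    and tr: "\<And>m. m \<in> Obj M \<Longrightarrow> sm_trans Phi N (lact Phi N (fO F m)) (smcomp N F (lact Phi M m)) (fAct F
        m)"
    and un: "\<And>m. m \<in> Obj M \<Longrightarrow> fA F (aun M m) \<cdot> fAct F m 1 = aun N (fO F m)"
  shows "rmod_functor Phi M N F"
proof -
  interpret F: sm_functor M N F by (rule F)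
  note [simp] = module_simps[OF M] module_simps[OF N] module_actA[OF M] module_actA[OF N]
  have f [simp]: "fAct F m r \<in> Arr N" "Dom N (fAct F m r) = fO F m \<odot> r" "Cod N (fAct F m r)
      = fO F (m \<odot>\<^bsub>M\<^esub> r)"
    if "m \<in> Obj M" for m r
    using SN.Phi_trans_simps(1-3)[OF tr[OF that], of r] by (simp_all add: smcomp_def)
  have nat0: "fAct F (Cod M f) r \<cdot> (fA F f \<diamondop> (r, 0)) = fA F (f \<diamondop>\<^bsub>M\<^esub> (r, 0)) \<cdot> fAct F (Dom M f) r"
    if [simp]: "f \<in> Arr M" for f r
  proof -
    let ?x = "Dom M f" and ?y = "Cod M f"
    have "(\<lambda>r. fAct F ?y r \<cdot> (fA F f \<diamondop> (r, 0)))
      = (\<lambda>r. fA F (f \<diamondop>\<^bsub>M\<^esub> (r, 0)) \<cdot> fAct F ?x r)" (is "?f = ?g")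
    proof (rule Phi_trans_unique)
      show "sm_trans Phi N (lact Phi N (fO F ?x)) (smcomp N F (lact Phi M ?y)) ?f"
          (is "sm_trans _ _ ?S ?T _")
        by (rule sm_trans_comp[OF _ tr]) (use module_lact_trans[OF N, of "fA F f"] in simp_all)
      show "sm_trans Phi N ?S ?T ?g"
        by (rule sm_trans_comp[OF tr sm_trans_whisker_left[OF module_lact_trans[OF M] F]]) simp_all
      \<comment> \<open>The values at 1 are compared after composing with the invertible arrow
        \<open>fA F (aun M ?y)\<close>; together with \<open>fAct\<close> it becomes
        \<open>aun\<close> of N, whose naturality is known.\<close>
      have "fA F (aun M ?y) \<cdot> (fAct F ?y 1 \<cdot> (fA F f \<diamondop> (1, 0))) = fA F f \<cdot> aun N (fO F ?x)"
        using module_aun_nat[OF N, of "fA F f"] by (subst SN.comp_reduce[OF un]) simp_all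
      also have "\<dots> = (fA F f \<cdot> fA F (aun M ?x)) \<cdot> fAct F ?x 1"
        by (simp add: un)
      also have "fA F f \<cdot> fA F (aun M ?x) = fA F (aun M ?y) \<cdot> fA F (f \<diamondop>\<^bsub>M\<^esub> (1, 0))"
        using arg_cong[OF module_aun_nat[OF M, of f], of "fA F"] by (simp add: F.fA_comp_simp)
      finally show "fAct F ?y 1 \<cdot> (fA F f \<diamondop> (1, 0)) = fA F (f \<diamondop>\<^bsub>M\<^esub> (1, 0)) \<cdot> fAct F ?x 1"
        by (simp add: SN.cancel_left)
    qed
    then show ?thesis by metis
  qed
  have nat1: "fAct F m (fst a) \<cdot> (Ide N (fO F m) \<diamondop> a) = fA F (Ide M m \<diamondop>\<^bsub>M\<^esub> a)
      \<cdot> fAct F m (fst a)" if "m \<in> Obj M" for m a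
    using SN.Phi_trans_simps(4)[OF tr[OF that], of a] by (simp add: smcomp_def)
  have nat: "fAct F (Cod M f) (fst a) \<cdot> (fA F f \<diamondop> a) = fA F (f \<diamondop>\<^bsub>M\<^esub> a) \<cdot> fAct F (Dom M f) (fst a)"
    if [simp]: "f \<in> Arr M" for f a
  proof -
    have "fAct F (Cod M f) (fst a) \<cdot> (fA F f \<diamondop> a)
       = fAct F (Cod M f) (fst a) \<cdot> ((fA F f \<diamondop> (fst a, 0)) \<cdot> (Ide N (fO F (Dom M f)) \<diamondop> a))"
      by (subst module_actA_split[OF N]) simp_all
    also have "\<dots> = fA F (f \<diamondop>\<^bsub>M\<^esub> (fst a, 0)) \<cdot> (fAct F (Dom M f) (fst a) \<cdot> (Ide N (fO F (Dom M f)) \<diamondop> a))"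
      by (subst SN.comp_reduce[OF nat0]) simp_all
    also have "\<dots> = fA F ((f \<diamondop>\<^bsub>M\<^esub> (fst a, 0)) \<cdot>\<^bsub>M\<^esub> (Ide M (Dom M f) \<diamondop>\<^bsub>M\<^esub> a)) \<cdot> fAct F (Dom M f) (fst a)"
      by (simp add: nat1 F.fA_comp_simp)
    also have "\<dots> = fA F (f \<diamondop>\<^bsub>M\<^esub> a) \<cdot> fAct F (Dom M f) (fst a)"
      by (subst (2) module_actA_split[OF M]) simp_all
    finally show ?thesis .
  qed
  have asc: "fA F (aasc M m r s) \<cdot> (fAct F (m \<odot>\<^bsub>M\<^esub> r) s \<cdot> (fAct F m r \<diamondop> (s, 0)))
        = fAct F m (r * s) \<cdot> aasc N (fO F m) r s" if [simp]: "m \<in> Obj M" for m r s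
  proof -
    have "(\<lambda>s. fA F (aasc M m r s) \<cdot> (fAct F (m \<odot>\<^bsub>M\<^esub> r) s \<cdot> (fAct F m r \<diamondop> (s, 0))))
      = (\<lambda>s. fAct F m (fO (lmul Phi r) s) \<cdot> aasc N (fO F m) r s)" (is "?f = ?g")
    proof (rule Phi_trans_unique)
      show "sm_trans Phi N (lact Phi N (fO F m \<odot> r)) (smcomp N F (smcomp M (lact Phi M m) (lmul Phi
          r))) ?f" (is "sm_trans _ _ ?S ?T _")
        by (rule sm_trans_comp[OF sm_trans_comp[OF _ tr] sm_trans_whisker_left[OF module_aasc_trans[OF
            M] F]])
          (use module_lact_trans[OF N, of "fAct F m r"] in simp_all)
      show "sm_trans Phi N ?S ?T ?g"
        unfolding smcomp_assoc_Phi[OF Phi_lmul module_lact[OF M that] F, symmetric]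
        by (rule sm_trans_comp[OF module_aasc_trans[OF N] sm_trans_whisker_right[OF Phi_lmul tr]])
            simp_all
      \<comment> \<open>With last variable 1, \<open>aasc\<close> is a unit constraint by
        \<open>module_aasc_one\<close>, so the claim becomes naturality of \<open>aun\<close> at
        \<open>fAct F m r\<close>.\<close>
      have "fA F (aasc M m r 1) \<cdot> (fAct F (m \<odot>\<^bsub>M\<^esub> r) 1 \<cdot> (fAct F m r \<diamondop> (1, 0)))
         = aun N (fO F (m \<odot>\<^bsub>M\<^esub> r)) \<cdot> (fAct F m r \<diamondop> (1, 0))"
        by (simp add: module_aasc_one[OF M] SN.comp_reduce[OF un])
      then show "fA F (aasc M m r 1) \<cdot> (fAct F (m \<odot>\<^bsub>M\<^esub> r) 1 \<cdot> (fAct F m r \<diamondop> (1, 0)))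
        = fAct F m (fO (lmul Phi r) 1) \<cdot> aasc N (fO F m) r 1"
        using module_aun_nat[OF N, of "fAct F m r"] by (simp add: module_aasc_one[OF N] lmul_def)
    qed
    then show ?thesis by (simp add: fun_eq_iff lmul_def)
  qed
  have add: "fAct F (x \<oplus>\<^bsub>M\<^esub> y) r \<cdot> ((fM F x y \<diamondop> (r, 0)) \<cdot> adr N (fO F x) (fO F y) r)
      = fA F (adr M x y r) \<cdot> (fM F (x \<odot>\<^bsub>M\<^esub> r) (y \<odot>\<^bsub>M\<^esub> r) \<cdot> (fAct F x r \<uplus> fAct F y r))"
    if [simp]: "x \<in> Obj M" "y \<in> Obj M" for x y r
  proof -
    have "(\<lambda>r. fAct F (x \<oplus>\<^bsub>M\<^esub> y) r \<cdot> ((fM F x y \<diamondop> (r, 0)) \<cdot> adr N (fO F x) (fO F y) r))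
      = (\<lambda>r. fA F (adr M x y r) \<cdot> (fM F (fO (lact Phi M x) r) (fO (lact Phi M y) r) \<cdot> (fAct F x r
          \<uplus> fAct F y r)))" (is "?f = ?g")
    proof (rule Phi_trans_unique)
      show "sm_trans Phi N (smsum Phi N (lact Phi N (fO F x)) (lact Phi N (fO F y))) (smcomp N F (lact
          Phi M (x \<oplus>\<^bsub>M\<^esub> y))) ?f" (is "sm_trans _ _ ?S ?T _")
        by (rule sm_trans_comp[OF sm_trans_comp[OF module_adr_trans[OF N]] tr])
          (use module_lact_trans[OF N, of "fM F x y"] in simp_all)
      show "sm_trans Phi N ?S ?T ?g"
        by (rule sm_trans_comp[OF sm_trans_comp[OF sm_trans_sum[OF tr tr]
              sm_trans_comp_sum[OF module_lact[OF M] module_lact[OF M] F]]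
              sm_trans_whisker_left[OF module_adr_trans[OF M] F]]) simp_all
      let ?u = "fA F (aun M (x \<oplus>\<^bsub>M\<^esub> y))"
      have "?u \<cdot> (fAct F (x \<oplus>\<^bsub>M\<^esub> y) 1 \<cdot> ((fM F x y \<diamondop> (1, 0)) \<cdot> adr N (fO F x) (fO F y) 1))
         = (aun N (fO F (x \<oplus>\<^bsub>M\<^esub> y)) \<cdot> (fM F x y \<diamondop> (1, 0))) \<cdot> adr N (fO F x) (fO F y) 1"
        by (subst SN.comp_reduce[OF un]) simp_all
      also have "\<dots> = fM F x y \<cdot> (aun N (fO F x) \<uplus> aun N (fO F y))"
        using module_aun_nat[OF N, of "fM F x y"] by (simp add: module_aun_add[OF N])
      also have "\<dots> = fM F x y \<cdot> ((fA F (aun M x) \<uplus> fA F (aun M y)) \<cdot> (fAct F x 1 \<uplus> fAct F y 1))"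
        by (simp add: un)
      also have "\<dots> = fA F (aun M x \<uplus>\<^bsub>M\<^esub> aun M y) \<cdot> (fM F (x \<odot>\<^bsub>M\<^esub> 1) (y \<odot>\<^bsub>M\<^esub> 1) \<cdot> (fAct F x 1
          \<uplus> fAct F y 1))"
        by (subst F.fM_nat(2)) simp_all
      also have "\<dots> = ?u \<cdot> (fA F (adr M x y 1) \<cdot> (fM F (x \<odot>\<^bsub>M\<^esub> 1) (y \<odot>\<^bsub>M\<^esub> 1) \<cdot> (fAct F x 1
          \<uplus> fAct F y 1)))"
        by (simp add: F.fA_comp_simp flip: module_aun_add[OF M])
      finally show "fAct F (x \<oplus>\<^bsub>M\<^esub> y) 1 \<cdot> ((fM F x y \<diamondop> (1, 0)) \<cdot> adr N (fO F x) (fO F y) 1)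
        = fA F (adr M x y 1) \<cdot> (fM F (fO (lact Phi M x) 1) (fO (lact Phi M y) 1) \<cdot> (fAct F x 1
            \<uplus> fAct F y 1))"
        by (simp add: SN.cancel_left)
    qed
    then show ?thesis by (simp add: fun_eq_iff)
  qed
  have ract: "sm_functor M M (ract Phi M r)" "sm_functor N N (ract Phi N r)" for r
    using rmodule.ract_functor[OF M, of r] rmodule.ract_functor[OF N, of r] by simp_all
  have left: "sm_trans M N (smcomp N (ract Phi N r) F) (smcomp N F (ract Phi M r)) (\<lambda>m. fAct F m r)"
      for r
  proof (rule sm_transI[OF sm_functor_smcomp[OF F ract(2)] sm_functor_smcomp[OF ract(1) F]])
    fix f assume "f \<in> Arr M"
    then show "fAct F (Cod M f) r \<cdot> fA (smcomp N (ract Phi N r) F) f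
        = fA (smcomp N F (ract Phi M r)) f \<cdot> fAct F (Dom M f) r"
      using nat0 by (simp add: smcomp_def ract_def)
  next
    fix x y assume "x \<in> Obj M" "y \<in> Obj M"
    then show "fAct F (x \<oplus>\<^bsub>M\<^esub> y) r \<cdot> fM (smcomp N (ract Phi N r) F) x y
      = fM (smcomp N F (ract Phi M r)) x y \<cdot> (fAct F x r \<uplus> fAct F y r)"
      using add by (simp add: smcomp_def ract_def)
  qed (simp_all add: smcomp_def ract_def)
  have nat': "fAct F m' r' \<cdot> (fA F f \<diamondop> a) = fA F (f \<diamondop>\<^bsub>M\<^esub> a) \<cdot> fAct F m r"
    if "f \<in> ghom M m m'" "a \<in> ghom Phi r r'" for f m m' a r r'
    using nat[of f a] that by auto
  show ?thesis
    using nat' by (intro rmod_functor.intro rmod_functor_axioms.intro F M N) (simp_all add: asc un left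
        tr)
qed

lemma rmod_functorD:
  assumes "rmod_functor Phi M N F" "m \<in> Obj M"
  shows "sm_functor M N F"
    and "sm_trans Phi N (lact Phi N (fO F m)) (smcomp N F (lact Phi M m)) (fAct F m)"
    and "fA F (aun M m) \<cdot> fAct F m 1 = aun N (fO F m)"
proof -
  interpret F: rmod_functor Phi M N F by fact
  show "sm_functor M N F" by unfold_locales
  show "sm_trans Phi N (lact Phi N (fO F m)) (smcomp N F (lact Phi M m)) (fAct F m)"
    "fA F (aun M m) \<cdot> fAct F m 1 = aun N (fO F m)"
    using F.fAct_monoidal_right[OF assms(2)] F.fAct_aun[OF assms(2)] by simp_all
qed

lemma rmod_functor_ex:
  fixes F :: "('o, 'a, 'p, 'b, int, 'k) modfun_scheme"
  assumes F: "sm_functor M N F"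
  shows "\<exists>\<alpha>. rmod_functor Phi M N (F\<lparr>fAct := \<alpha>\<rparr>)"
proof -
  interpret F: sm_functor M N F by (rule F)
  note [simp] = module_simps[OF M] module_simps[OF N]
  let ?s = "\<lambda>m. lact Phi N (fO F m)" and ?t = "\<lambda>m. smcomp N F (lact Phi M m)"
  \<comment> \<open>The value at 1 is dictated by the unit law of a module morphism, solved for the
    action constraint.\<close>
  let ?a = "\<lambda>m. ginv N (fA F (aun M m)) \<cdot> aun N (fO F m)"
  have t: "sm_trans Phi N (?s m) (?t m) (Phi_trans N (?s m) (?t m) (?a m))" "Phi_trans N (?s m) (?t m)
      (?a m) 1 = ?a m"
    if "m \<in> Obj M" for m
    using that by (intro Phi_trans module_lact[OF N] sm_functor_smcomp[OF module_lact[OF M] F]; simp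
        add: smcomp_def)+
  have ag: "agree M F (F\<lparr>fAct := \<alpha>\<rparr>)" for \<alpha> by (simp add: agree_def)
  have [simp]: "smcomp N (F\<lparr>fAct := \<alpha>\<rparr>) G = smcomp N F G" for \<alpha> and G :: "(int, int \<times> bit, 'o, 'a)
      smfun"
    by (simp add: smcomp_def)
  show ?thesis
    by (intro exI[of _ "\<lambda>m. Phi_trans N (?s m) (?t m) (?a m)"] rmod_functorI agree_sm_functor[OF ag F])
        (simp_all add: t)
qed

text \<open>The unit law determines the action constraint at 1, because F of \<open>aun\<close> is
  invertible; agreement of F and G makes the two constraints transformations between the same
  functors.\<close>

lemma rmod_functor_unique:
  assumes F: "rmod_functor Phi M N F" and G: "rmod_functor Phi M N G" and ag: "agree M F G" and m
      [simp]: "m \<in> Obj M"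
  shows "fAct G m r = fAct F m r"
proof -
  interpret F: sm_functor M N F by (rule rmod_functorD(1)[OF F m])
  note [simp] = module_simps[OF M] module_simps[OF N] agree_sel[OF ag]
  have c: "smcomp N G (lact Phi M m) = smcomp N F (lact Phi M m)"
    using Phi_functor_fM[OF module_lact[OF M m]] Phi_functor_fU[OF module_lact[OF M m]]
      Phi_functor_fA[OF module_lact[OF M m]] by (simp add: smcomp_def fun_eq_iff)
  have tF: "sm_trans Phi N (lact Phi N (fO F m)) (smcomp N F (lact Phi M m)) (fAct F m)"
    and tG: "sm_trans Phi N (lact Phi N (fO F m)) (smcomp N F (lact Phi M m)) (fAct G m)"
    using rmod_functorD(2)[OF F m] rmod_functorD(2)[OF G m] c by simp_all
  have "fA F (aun M m) \<cdot> fAct F m 1 = fA F (aun M m) \<cdot> fAct G m 1"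
    using rmod_functorD(3)[OF F m] rmod_functorD(3)[OF G m] by simp
  then have "fAct F m 1 = fAct G m 1"
    using SN.Phi_trans_simps(1-3)[OF tF, of 1] SN.Phi_trans_simps(1-3)[OF tG, of 1]
    by (subst (asm) SN.cancel_left) (simp_all add: smcomp_def)
  then show ?thesis using Phi_trans_unique[OF tF tG] by simp
qed

text \<open>Compatibility with the action is an equation between transformations in r; at 1 it
  follows from the unit laws of F and G, naturality of t at \<open>aun M m\<close> and naturality of
  \<open>aun\<close> at \<open>t m\<close>.\<close>

lemma rmod_transI:
  assumes F: "rmod_functor Phi M N F" and G: "rmod_functor Phi M N G" and t: "sm_trans M N F G t"
  shows "rmod_trans Phi M N F G t"
proof -
  interpret t: sm_trans M N F G t by (rule t)
  note [simp] = module_simps[OF M] module_simps[OF N] module_actA[OF M] module_actA[OF N]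
  have f [simp]: "fAct F m r \<in> Arr N" "Dom N (fAct F m r) = fO F m \<odot> r" "Cod N (fAct F m r)
      = fO F (m \<odot>\<^bsub>M\<^esub> r)"
     "fAct G m r \<in> Arr N" "Dom N (fAct G m r) = fO G m \<odot> r" "Cod N (fAct G m r) = fO G (m \<odot>\<^bsub>M\<^esub> r)"
    if "m \<in> Obj M" for m r
    using SN.Phi_trans_simps(1-3)[OF rmod_functorD(2)[OF F that], of r]
      SN.Phi_trans_simps(1-3)[OF rmod_functorD(2)[OF G that], of r] by (simp_all add: smcomp_def)
  have "t (m \<odot>\<^bsub>M\<^esub> r) \<cdot> fAct F m r = fAct G m r \<cdot> (t m \<diamondop> (r, 0))" if [simp]: "m \<in> Obj M" for m r
  proof -
    have "(\<lambda>r. t (fO (lact Phi M m) r) \<cdot> fAct F m r)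
      = (\<lambda>r. fAct G m r \<cdot> (t m \<diamondop> (r, 0)))" (is "?f = ?g")
    proof (rule Phi_trans_unique)
      show "sm_trans Phi N (lact Phi N (fO F m)) (smcomp N G (lact Phi M m)) ?f"
          (is "sm_trans _ _ ?S ?T _")
        by (rule sm_trans_comp[OF rmod_functorD(2)[OF F] sm_trans_whisker_right[OF module_lact[OF M]
            t]]) simp_all
      show "sm_trans Phi N ?S ?T ?g"
        by (rule sm_trans_comp[OF _ rmod_functorD(2)[OF G]]) (use module_lact_trans[OF N, of "t m"] in
            simp_all)
      have "fA G (aun M m) \<cdot> (t (m \<odot>\<^bsub>M\<^esub> 1) \<cdot> fAct F m 1) = (t m \<cdot> fA F (aun M m)) \<cdot> fAct F m 1"
        using t.t_nat[of "aun M m"] SN.comp_reduce[of "fA G (aun M m)" "t (m \<odot>\<^bsub>M\<^esub> 1)" _ "fAct F m 1"]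
            by simp
      also have "\<dots> = t m \<cdot> aun N (fO F m)"
        using rmod_functorD(3)[OF F, of m] by simp
      also have "\<dots> = aun N (fO G m) \<cdot> (t m \<diamondop> (1, 0))"
        using module_aun_nat[OF N, of "t m"] by simp
      also have "\<dots> = fA G (aun M m) \<cdot> (fAct G m 1 \<cdot> (t m \<diamondop> (1, 0)))"
        by (subst rmod_functorD(3)[OF G, of m, symmetric]) simp_all
      finally show "t (fO (lact Phi M m) 1) \<cdot> fAct F m 1 = fAct G m 1 \<cdot> (t m \<diamondop> (1, 0))"
        by (simp add: SN.cancel_left)
    qed
    then show ?thesis by (simp add: fun_eq_iff)
  qed
  then show ?thesis
    by (intro rmod_trans.intro rmod_trans_axioms.intro t F G) simp_all
qed

end

section \<open>The 2-equivalence\<close>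

lemma agree_refl: "agree A F F"
  by (simp add: agree_def)

lemma agree_trans: "agree A F G \<Longrightarrow> agree A G H \<Longrightarrow> agree A F H"
  by (simp add: agree_def)

lemma agree_smcomp:
  assumes "sm_functor A B F" "sm_functor B C G" "agree A F F'" "agree B G G'"
  shows "agree A (smcomp C G F) (smcomp C G' F')"
proof -
  interpret F: sm_functor A B F by fact
  interpret G: sm_functor B C G by fact
  note [simp] = agree_sel[OF assms(3)] agree_sel[OF assms(4)]
  show ?thesis by (simp add: agree_def smcomp_def)
qed

lemma agree_smcomp_assoc:
  assumes "sm_functor A B F" "sm_functor B C G" "sm_functor C D H"
  shows "agree A (smcomp D (smcomp D H G) F) (smcomp D H (smcomp C G F))"
proof -
  interpret F: sm_functor A B F by fact
  interpret G: sm_functor B C G by fact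
  interpret H: sm_functor C D H by fact
  show ?thesis by (simp add: agree_def smcomp_def H.fA_comp_simp)
qed

lemma agree_smcomp_id:
  assumes "sm_functor A B F"
  shows "agree A (smcomp B (id_smfun B) F) F" "agree A (smcomp B F (id_smfun A)) F"
proof -
  interpret F: sm_functor A B F by fact
  show "agree A (smcomp B (id_smfun B) F) F" "agree A (smcomp B F (id_smfun A)) F"
    by (simp_all add: agree_def smcomp_def id_smfun_def)
qed

lemma sm_trans_cong: "(\<And>x. x \<in> Obj A \<Longrightarrow> t' x = t x) \<Longrightarrow> sm_trans A B F G t \<Longrightarrow> sm_trans A B F G t'"
  by (rule agree_sm_trans[OF agree_refl agree_refl])

lemma track_eqI:
  fixes s t :: "('f, 'x \<Rightarrow> 'y) track"
  assumes "src s = src t" "trg s = trg t" "\<And>x. x \<in> S \<Longrightarrow> cmp s x = cmp t x"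
    "cmp s \<in> extensional S" "cmp t \<in> extensional S"
  shows "s = t"
  using assms(1,2) extensionalityI[OF assms(4,5,3)] by (intro track.equality) auto

text \<open>A hom groupoid of either 2-category has as objects a set \<open>X A B\<close> of chosen
    representatives of the
  symmetric monoidal functors up to agreement on the carriers.\<close>

locale track_cat =
  fixes C :: "('o, 'a, 'm) scg_scheme set"
    and X :: "('o, 'a, 'm) scg_scheme \<Rightarrow> ('o, 'a, 'm) scg_scheme \<Rightarrow> ('o, 'a, 'o, 'a, 'k) smfun_scheme set"
    and tr :: "('o, 'a, 'm) scg_scheme \<Rightarrow> ('o, 'a, 'm) scg_scheme \<Rightarrow> ('o, 'a, 'o, 'a, 'k) smfun_scheme
      \<Rightarrow> ('o, 'a, 'o, 'a, 'k) smfun_scheme \<Rightarrow> ('o \<Rightarrow> 'a) \<Rightarrow> bool"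
    and I :: "('o, 'a, 'm) scg_scheme \<Rightarrow> ('o, 'a, 'o, 'a, 'k) smfun_scheme"
    and \<kappa> :: "('o, 'a, 'm) scg_scheme \<Rightarrow> ('o, 'a, 'm) scg_scheme \<Rightarrow> ('o, 'a, 'm) scg_scheme
      \<Rightarrow> ('o, 'a, 'o, 'a, 'k) smfun_scheme \<Rightarrow> ('o, 'a, 'o, 'a, 'k) smfun_scheme \<Rightarrow> ('o, 'a, 'o, 'a, 'k)
          smfun_scheme"
  assumes X_functor: "A \<in> C \<Longrightarrow> B \<in> C \<Longrightarrow> F \<in> X A B \<Longrightarrow> sm_functor A B F"
    and X_eq: "A \<in> C \<Longrightarrow> B \<in> C \<Longrightarrow> F \<in> X A B \<Longrightarrow> G \<in> X A B \<Longrightarrow> agree A F G \<Longrightarrow> F = G"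
    and tr_iff: "A \<in> C \<Longrightarrow> B \<in> C \<Longrightarrow> F \<in> X A B \<Longrightarrow> G \<in> X A B \<Longrightarrow> tr A B F G t \<longleftrightarrow> sm_trans A B F G t"
    and I_in [simp]: "A \<in> C \<Longrightarrow> I A \<in> X A A"
    and I_agree: "A \<in> C \<Longrightarrow> agree A (id_smfun A) (I A)"
    and \<kappa>_in [simp]: "A \<in> C \<Longrightarrow> B \<in> C \<Longrightarrow> D \<in> C \<Longrightarrow> F \<in> X A B \<Longrightarrow> G \<in> X B D \<Longrightarrow> \<kappa> A B D G F \<in> X A D"
    and \<kappa>_agree: "A \<in> C \<Longrightarrow> B \<in> C \<Longrightarrow> D \<in> C \<Longrightarrow> F \<in> X A B \<Longrightarrow> G \<in> X B D \<Longrightarrow> agree A (smcomp D G F) (\<kappa> A B D G F)"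
begin

definition T where
  "T = \<lparr>Cell0 = C, Hom = \<lambda>A B. track_gpd A B (X A B) (tr A B), Id1 = I, Comp1 = \<kappa>,
    Comp2 = \<lambda>A B D s t. \<lparr>src = \<kappa> A B D (src s) (src t), trg = \<kappa> A B D (trg s) (trg t),
      cmp = track_hcomp A D (src s) (trg t) (cmp s) (cmp t)\<rparr>\<rparr>"

lemma T_sel [simp]:
  "Cell0 T = C" "Id1 T = I" "Comp1 T = \<kappa>" "Obj (Hom T A B) = X A B" "Dom (Hom T A B)
      = src" "Cod (Hom T A B) = trg"
  "Ide (Hom T A B) F = \<lparr>src = F, trg = F, cmp = \<lambda>x \<in> Obj A. Ide B (fO F x)\<rparr>"
  "s \<cdot>\<^bsub>Hom T A B\<^esub> t = \<lparr>src = src t, trg = trg s, cmp = \<lambda>x \<in> Obj A. cmp s x \<cdot>\<^bsub>B\<^esub> cmp t x\<rparr>"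
  "Comp2 T A B D s t = \<lparr>src = \<kappa> A B D (src s) (src t), trg = \<kappa> A B D (trg s) (trg t),
      cmp = track_hcomp A D (src s) (trg t) (cmp s) (cmp t)\<rparr>"
  by (simp_all add: T_def track_gpd_def)

lemma T_Arr:
  assumes "A \<in> C" "B \<in> C"
  shows "t \<in> Arr (Hom T A B) \<longleftrightarrow> src t \<in> X A B \<and> trg t \<in> X A B \<and> cmp t \<in> extensional (Obj A)
     \<and> sm_trans A B (src t) (trg t) (cmp t)"
  using assms by (auto simp: T_def track_gpd_def tr_iff)

lemma C_scg: "A \<in> C \<Longrightarrow> scg A"
  using X_functor[of A A "I A"] sm_functor_scg by auto

lemma T_arr_simps:
  assumes "A \<in> C" "B \<in> C" "t \<in> Arr (Hom T A B)" "x \<in> Obj A"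
  shows "cmp t x \<in> Arr B" "Dom B (cmp t x) = fO (src t) x" "Cod B (cmp t x) = fO (trg t) x"
proof -
  interpret sm_trans A B "src t" "trg t" "cmp t" using assms T_Arr by blast
  show "cmp t x \<in> Arr B" "Dom B (cmp t x) = fO (src t) x" "Cod B (cmp t x) = fO (trg t) x"
    using t_simps[OF assms(4)] by auto
qed

lemma T_groupoid:
  assumes A: "A \<in> C" and B: "B \<in> C"
  shows "groupoid (Hom T A B)"
proof -
  interpret B: scg B using C_scg[OF B] .
  note [simp] = T_Arr[OF A B]
  have arr [simp]: "cmp t x \<in> Arr B" "Dom B (cmp t x) = fO (src t) x" "Cod B (cmp t x) = fO (trg t) x"
    if "src t \<in> X A B" "trg t \<in> X A B" "cmp t \<in> extensional (Obj A)" "sm_trans A B (src t) (trg t) (cmp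
        t)" "x \<in> Obj A"
    for t :: "(('o, 'a, 'o, 'a, 'k) smfun_scheme, 'o \<Rightarrow> 'a) track" and x
    using T_arr_simps[OF A B] that by auto
  have ide: "sm_trans A B F F (\<lambda>x \<in> Obj A. Ide B (fO F x))" if "F \<in> X A B" for F
    by (rule sm_trans_cong[OF _ sm_trans_Ide[OF X_functor[OF A B that]]]) simp
  have comp: "sm_trans A B F H (\<lambda>x \<in> Obj A. s x \<cdot>\<^bsub>B\<^esub> t x)" if "sm_trans A B F G t" "sm_trans A B G H s"
      for F G H s t
    by (rule sm_trans_cong[OF _ sm_trans_comp[OF that]]) simp
  show ?thesis
  proof
    fix f F G assume f: "f \<in> ghom (Hom T A B) F G"
    let ?g = "\<lparr>src = G, trg = F, cmp = \<lambda>x \<in> Obj A. ginv B (cmp f x)\<rparr>"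
    have g: "?g \<in> ghom (Hom T A B) G F"
    proof -
      have "sm_trans A B G F (\<lambda>x \<in> Obj A. ginv B (cmp f x))"
        using f by (intro sm_trans_cong[OF _ sm_trans_ginv[of A B F G "cmp f"]]) auto
      then show ?thesis using f by auto
    qed
    moreover have "?g \<cdot>\<^bsub>Hom T A B\<^esub> f = Ide (Hom T A B) F" "f \<cdot>\<^bsub>Hom T A B\<^esub> ?g = Ide (Hom T A B) G"
      by (rule track_eqI[where S = "Obj A"]; use f in auto)+
    ultimately show "\<exists>g \<in> ghom (Hom T A B) G F. g \<cdot>\<^bsub>Hom T A B\<^esub> f
        = Ide (Hom T A B) F \<and> f \<cdot>\<^bsub>Hom T A B\<^esub> g = Ide (Hom T A B) G"
      by blast
    show "f \<cdot>\<^bsub>Hom T A B\<^esub> Ide (Hom T A B) F = f"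
      by (rule track_eqI[where S = "Obj A"]; use f in auto)
    show "Ide (Hom T A B) G \<cdot>\<^bsub>Hom T A B\<^esub> f = f"
      by (rule track_eqI[where S = "Obj A"]; use f in auto)
  next
    fix f g h F G H K
    assume "f \<in> ghom (Hom T A B) F G" "g \<in> ghom (Hom T A B) G H" "h \<in> ghom (Hom T A B) H K"
    then show "(h \<cdot>\<^bsub>Hom T A B\<^esub> g) \<cdot>\<^bsub>Hom T A B\<^esub> f = h \<cdot>\<^bsub>Hom T A B\<^esub> (g \<cdot>\<^bsub>Hom T A B\<^esub> f)"
      by (intro track_eqI[where S = "Obj A"]) auto
  next
    fix F assume "F \<in> Obj (Hom T A B)"
    then show "Ide (Hom T A B) F \<in> ghom (Hom T A B) F F" using ide by auto
  next
    fix f g F G H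
    assume "f \<in> ghom (Hom T A B) F G" "g \<in> ghom (Hom T A B) G H"
    then show "g \<cdot>\<^bsub>Hom T A B\<^esub> f \<in> ghom (Hom T A B) F H" using comp by auto
  qed auto
qed

lemma \<kappa>_sel:
  assumes "A \<in> C" "B \<in> C" "D \<in> C" "F \<in> X A B" "G \<in> X B D"
  shows "x \<in> Obj A \<Longrightarrow> fO (\<kappa> A B D G F) x = fO G (fO F x)" "f \<in> Arr A \<Longrightarrow> fA (\<kappa> A B D G F) f
      = fA G (fA F f)"
  using \<kappa>_agree[OF assms] by (simp_all add: agree_def smcomp_def)

lemma I_sel:
  assumes "A \<in> C"
  shows "x \<in> Obj A \<Longrightarrow> fO (I A) x = x" "f \<in> Arr A \<Longrightarrow> fA (I A) f = f"
  using I_agree[OF assms] by (simp_all add: agree_def id_smfun_def)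

lemma T_Comp2_Arr:
  assumes A: "A \<in> C" and B: "B \<in> C" and D: "D \<in> C" and t: "t \<in> Arr (Hom T A B)" and s: "s \<in> Arr (Hom T
      B D)"
  shows "Comp2 T A B D s t \<in> Arr (Hom T A D)"
proof -
  have t': "src t \<in> X A B" "trg t \<in> X A B" "sm_trans A B (src t) (trg t) (cmp t)"
    and s': "src s \<in> X B D" "trg s \<in> X B D" "sm_trans B D (src s) (trg s) (cmp s)"
    using t s T_Arr[OF A B] T_Arr[OF B D] by auto
  have "sm_trans A D (smcomp D (src s) (src t)) (smcomp D (trg s) (trg t)) (\<lambda>x. cmp s (fO (trg t) x)
      \<cdot>\<^bsub>D\<^esub> fA (src s) (cmp t x))"
    by (rule sm_trans_comp[OF sm_trans_whisker_left[OF t'(3) X_functor[OF B D s'(1)]]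
          sm_trans_whisker_right[OF X_functor[OF A B t'(2)] s'(3)]])
  then have "sm_trans A D (\<kappa> A B D (src s) (src t)) (\<kappa> A B D (trg s) (trg t)) (track_hcomp A D (src s)
      (trg t) (cmp s) (cmp t))"
    by (rule agree_sm_trans[OF \<kappa>_agree[OF A B D t'(1) s'(1)] \<kappa>_agree[OF A B D t'(2) s'(2)], rotated])
        (simp add: track_hcomp_def)
  then show ?thesis
    using t' s' A B D by (simp add: T_Arr[OF A D]) (simp add: track_hcomp_def)
qed

text \<open>Composition is strictly associative because chosen representatives that agree on the
  carriers are equal.\<close>

lemma \<kappa>_assoc:
  assumes [simp]: "A \<in> C" "B \<in> C" "D \<in> C" "E \<in> C" "f \<in> X A B" "g \<in> X B D" "h \<in> X D E"
  shows "\<kappa> A B E (\<kappa> B D E h g) f = \<kappa> A D E h (\<kappa> A B D g f)"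
proof -
  have fgh: "sm_functor A B f" "sm_functor B D g" "sm_functor D E h" by (simp_all add: X_functor)
  have "agree A (smcomp E (smcomp E h g) f) (\<kappa> A B E (\<kappa> B D E h g) f)"
    by (rule agree_trans[OF agree_smcomp[OF fgh(1) sm_functor_smcomp[OF fgh(2,3)] agree_refl \<kappa>_agree]
        \<kappa>_agree]) simp_all
  moreover have "agree A (smcomp E h (smcomp D g f)) (\<kappa> A D E h (\<kappa> A B D g f))"
    by (rule agree_trans[OF agree_smcomp[OF sm_functor_smcomp[OF fgh(1,2)] fgh(3) \<kappa>_agree agree_refl]
        \<kappa>_agree]) simp_all
  ultimately have "agree A (\<kappa> A B E (\<kappa> B D E h g) f) (\<kappa> A D E h (\<kappa> A B D g f))"
    using agree_smcomp_assoc[OF fgh] agree_trans agree_sym by metis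
  then show ?thesis by (intro X_eq[of A E]) simp_all
qed

lemma \<kappa>_I:
  assumes [simp]: "A \<in> C" "B \<in> C" "f \<in> X A B"
  shows "\<kappa> A B B (I B) f = f" "\<kappa> A A B f (I A) = f"
proof -
  have f: "sm_functor A B f" by (simp add: X_functor)
  note id = sm_functor_id[OF C_scg]
  have "agree A f (\<kappa> A B B (I B) f)"
    by (rule agree_trans[OF agree_sym[OF agree_smcomp_id(1)[OF f]]
        agree_trans[OF agree_smcomp[OF f id agree_refl I_agree] \<kappa>_agree]]) simp_all
  then show "\<kappa> A B B (I B) f = f" using X_eq[of A B f "\<kappa> A B B (I B) f"] by simp
  have "agree A f (\<kappa> A A B f (I A))"
    by (rule agree_trans[OF agree_sym[OF agree_smcomp_id(2)[OF f]]
        agree_trans[OF agree_smcomp[OF id f I_agree agree_refl] \<kappa>_agree]]) simp_all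
  then show "\<kappa> A A B f (I A) = f" using X_eq[of A B f "\<kappa> A A B f (I A)"] by simp
qed

theorem T_groupoid_enriched: "groupoid_enriched T"
proof (rule groupoid_enriched.intro)
  fix A B assume "A \<in> Cell0 T" "B \<in> Cell0 T"
  then show "groupoid (Hom T A B)" using T_groupoid by simp
next
  fix A B D f f' g g' s t
  assume "A \<in> Cell0 T" "B \<in> Cell0 T" "D \<in> Cell0 T" "t \<in> ghom (Hom T A B) f f'" "s \<in> ghom (Hom T B D) g
      g'"
  then show "Comp2 T A B D s t \<in> ghom (Hom T A D) (Comp1 T A B D g f) (Comp1 T A B D g' f')"
    using T_Comp2_Arr[of A B D t s] by auto
next
  fix A B D f g
  assume "A \<in> Cell0 T" "B \<in> Cell0 T" "D \<in> Cell0 T" "f \<in> Obj (Hom T A B)" "g \<in> Obj (Hom T B D)"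
  then have [simp]: "A \<in> C" "B \<in> C" "D \<in> C" "f \<in> X A B" "g \<in> X B D" by simp_all
  interpret f: sm_functor A B f by (rule X_functor) simp_all
  interpret g: sm_functor B D g by (rule X_functor) simp_all
  show "Comp2 T A B D (Ide (Hom T B D) g) (Ide (Hom T A B) f) = Ide (Hom T A D) (Comp1 T A B D g f)"
    by (rule track_eqI[where S = "Obj A"]) (simp_all add: track_hcomp_def \<kappa>_sel)
next
  fix A B D f f' f'' g g' g'' s s' t t'
  assume *: "A \<in> Cell0 T" "B \<in> Cell0 T" "D \<in> Cell0 T"
    "t \<in> ghom (Hom T A B) f f'" "t' \<in> ghom (Hom T A B) f' f''"
    "s \<in> ghom (Hom T B D) g g'" "s' \<in> ghom (Hom T B D) g' g''"
  then have [simp]: "A \<in> C" "B \<in> C" "D \<in> C" by simp_all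
  interpret t: sm_trans A B f f' "cmp t" using * T_Arr[of A B] by auto
  interpret t': sm_trans A B f' f'' "cmp t'" using * T_Arr[of A B] by auto
  interpret s: sm_trans B D g g' "cmp s" using * T_Arr[of B D] by auto
  interpret s': sm_trans B D g' g'' "cmp s'" using * T_Arr[of B D] by auto
  have [simp]: "src t = f" "trg t = f'" "src t' = f'" "trg t' = f''" "src s = g" "trg s = g'" "src s'
      = g'" "trg s' = g''"
    using * by auto
  show "Comp2 T A B D (s' \<cdot>\<^bsub>Hom T B D\<^esub> s) (t' \<cdot>\<^bsub>Hom T A B\<^esub> t)
        = Comp2 T A B D s' t' \<cdot>\<^bsub>Hom T A D\<^esub> Comp2 T A B D s t"
  proof (rule track_eqI[where S = "Obj A"])
    fix x assume [simp]: "x \<in> Obj A"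
    show "cmp (Comp2 T A B D (s' \<cdot>\<^bsub>Hom T B D\<^esub> s) (t' \<cdot>\<^bsub>Hom T A B\<^esub> t)) x
        = cmp (Comp2 T A B D s' t' \<cdot>\<^bsub>Hom T A D\<^esub> Comp2 T A B D s t) x"
      \<comment> \<open>Interchange of horizontal and vertical composition is naturality of s at the
        component of \<open>t'\<close>.\<close>
      using s.t_nat_tail[of "cmp t' x" "fO f'' x" "fA g (cmp t x)"]
      by (simp add: track_hcomp_def s.F.fA_comp_simp)
  qed (simp_all add: track_hcomp_def)
next
  fix A B D E f g h
  assume "A \<in> Cell0 T" "B \<in> Cell0 T" "D \<in> Cell0 T" "E \<in> Cell0 T"
    "f \<in> Obj (Hom T A B)" "g \<in> Obj (Hom T B D)" "h \<in> Obj (Hom T D E)"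
  then show "Comp1 T A B E (Comp1 T B D E h g) f = Comp1 T A D E h (Comp1 T A B D g f)"
    by (simp add: \<kappa>_assoc)
next
  fix A B D E r s t
  assume *: "A \<in> Cell0 T" "B \<in> Cell0 T" "D \<in> Cell0 T" "E \<in> Cell0 T"
    "r \<in> Arr (Hom T A B)" "s \<in> Arr (Hom T B D)" "t \<in> Arr (Hom T D E)"
  then have [simp]: "A \<in> C" "B \<in> C" "D \<in> C" "E \<in> C" by simp_all
  have [simp]: "src r \<in> X A B" "trg r \<in> X A B" "src s \<in> X B D" "trg s \<in> X B D" "src t \<in> X D E" "trg t \<in>
      X D E"
    and tr: "sm_trans A B (src r) (trg r) (cmp r)" "sm_trans B D (src s) (trg s) (cmp s)"
      "sm_trans D E (src t) (trg t) (cmp t)"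
    using * T_Arr[of A B] T_Arr[of B D] T_Arr[of D E] by auto
  interpret r: sm_trans A B "src r" "trg r" "cmp r" by (rule tr)
  interpret s: sm_trans B D "src s" "trg s" "cmp s" by (rule tr)
  interpret t: sm_trans D E "src t" "trg t" "cmp t" by (rule tr)
  show "Comp2 T A B E (Comp2 T B D E t s) r = Comp2 T A D E t (Comp2 T A B D s r)"
    by (rule track_eqI[where S = "Obj A"])
      (simp_all add: track_hcomp_def \<kappa>_sel \<kappa>_assoc t.F.fA_comp_simp)
next
  fix A B t assume "A \<in> Cell0 T" "B \<in> Cell0 T" "t \<in> Arr (Hom T A B)"
  then have [simp]: "A \<in> C" "B \<in> C" and t: "t \<in> Arr (Hom T A B)" by simp_all
  then have t' [simp]: "src t \<in> X A B" "trg t \<in> X A B" "cmp t \<in> extensional (Obj A)"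
    and tr: "sm_trans A B (src t) (trg t) (cmp t)"
    using T_Arr[of A B] by auto
  interpret t: sm_trans A B "src t" "trg t" "cmp t" by (rule tr)
  show "Comp2 T A B B (Ide (Hom T B B) (Id1 T B)) t = t"
    by (rule track_eqI[where S = "Obj A"]) (simp_all add: track_hcomp_def \<kappa>_I I_sel)
  show "Comp2 T A A B t (Ide (Hom T A A) (Id1 T A)) = t"
    by (rule track_eqI[where S = "Obj A"]) (simp_all add: track_hcomp_def \<kappa>_I I_sel)
qed (simp_all add: \<kappa>_I)

end

text \<open>As composition and identities are preserved on the nose, identities serve as comparison
  cells, and coherence reduces to unit laws in the hom groupoids and the strict laws of T.\<close>

lemma strict_pseudo_functor:
  fixes S :: "('c, 'f, 't) two_cat" and T :: "('d, 'g, 'u) two_cat"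
    and H :: "'c \<Rightarrow> 'c \<Rightarrow> ('f, 't, 'g, 'u) functr"
  assumes S: "groupoid_enriched S" and T: "groupoid_enriched T"
    and p: "\<And>A. A \<in> Cell0 S \<Longrightarrow> p A \<in> Cell0 T"
    and H: "\<And>A B. A \<in> Cell0 S \<Longrightarrow> B \<in> Cell0 S \<Longrightarrow> gfunctor (Hom S A B) (Hom T (p A) (p B)) (H A B)"
    and H_Comp1: "\<And>A B D f g. A \<in> Cell0 S \<Longrightarrow> B \<in> Cell0 S \<Longrightarrow> D \<in> Cell0 S \<Longrightarrow> f \<in> Obj (Hom S A B)
        \<Longrightarrow> g \<in> Obj (Hom S B D) \<Longrightarrow>
      fO (H A D) (Comp1 S A B D g f) = Comp1 T (p A) (p B) (p D) (fO (H B D) g) (fO (H A B) f)"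
    and H_Comp2: "\<And>A B D t s. A \<in> Cell0 S \<Longrightarrow> B \<in> Cell0 S \<Longrightarrow> D \<in> Cell0 S \<Longrightarrow> t \<in> Arr (Hom S A B)
        \<Longrightarrow> s \<in> Arr (Hom S B D) \<Longrightarrow>
      fA (H A D) (Comp2 S A B D s t) = Comp2 T (p A) (p B) (p D) (fA (H B D) s) (fA (H A B) t)"
    and H_Id1: "\<And>A. A \<in> Cell0 S \<Longrightarrow> fO (H A A) (Id1 S A) = Id1 T (p A)"
  shows "pseudo_functor S T \<lparr>pO = p, pH = H,
    pC = \<lambda>A B D g f. Ide (Hom T (p A) (p D)) (fO (H A D) (Comp1 S A B D g f)),
    pU = \<lambda>A. Ide (Hom T (p A) (p A)) (Id1 T (p A))\<rparr>" (is "pseudo_functor S T ?P")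
proof -
  interpret S: groupoid_enriched S by (rule S)
  interpret T: groupoid_enriched T by (rule T)
  have fO: "fO (H A B) f \<in> Obj (Hom T (p A) (p B))" if "A \<in> Cell0 S" "B \<in> Cell0 S" "f \<in> Obj (Hom S A
      B)" for A B f
    using gfunctor.fO_Obj[OF H[OF that(1,2)] that(3)] .
  have fA: "fA (H A B) t \<in> ghom (Hom T (p A) (p B)) (fO (H A B) f) (fO (H A B) f')"
    if "A \<in> Cell0 S" "B \<in> Cell0 S" "t \<in> ghom (Hom S A B) f f'" for A B t f f'
    using gfunctor.fA_hom[OF H[OF that(1,2)] that(3)] .
  have ide: "Ide (Hom T (p A) (p B)) f \<in> ghom (Hom T (p A) (p B)) f f"
    and ide2: "Ide (Hom T (p A) (p B)) f \<cdot>\<^bsub>Hom T (p A) (p B)\<^esub> Ide (Hom T (p A) (p B)) f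
        = Ide (Hom T (p A) (p B)) f"
    if "A \<in> Cell0 S" "B \<in> Cell0 S" "f \<in> Obj (Hom T (p A) (p B))" for A B f
  proof -
    interpret G: groupoid "Hom T (p A) (p B)" using T.Hom_groupoid p that by blast
    show "Ide (Hom T (p A) (p B)) f \<in> ghom (Hom T (p A) (p B)) f f"
      "Ide (Hom T (p A) (p B)) f \<cdot>\<^bsub>Hom T (p A) (p B)\<^esub> Ide (Hom T (p A) (p B)) f
          = Ide (Hom T (p A) (p B)) f"
      using that by simp_all
  qed
  show ?thesis
  proof (intro pseudo_functor.intro pseudo_functor_axioms.intro S T, goal_cases)
    case (3 A B D f g)
    have "fO (H A D) (Comp1 S A B D g f) \<in> Obj (Hom T (p A) (p D))"
      using 3 by (intro fO S.Comp1_Obj)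
    then show ?case using ide[of A D "fO (H A D) (Comp1 S A B D g f)"] 3 by (simp add: H_Comp1)
  next
    case (4 A B D t f f' s g g')
    have objs: "f \<in> Obj (Hom S A B)" "f' \<in> Obj (Hom S A B)" "g \<in> Obj (Hom S B D)" "g' \<in> Obj (Hom S B D)"
      and arrs: "t \<in> Arr (Hom S A B)" "s \<in> Arr (Hom S B D)"
      using 4 groupoid.Dom_Obj[OF S.Hom_groupoid] groupoid.Cod_Obj[OF S.Hom_groupoid] by auto
    have "fA (H A D) (Comp2 S A B D s t) \<in> ghom (Hom T (p A) (p D)) (fO (H A D) (Comp1 S A B D g f))
        (fO (H A D) (Comp1 S A B D g' f'))"
      using 4 by (intro fA S.Comp2_hom)
    then show ?case
      using groupoid.comp_Ide_left[OF T.Hom_groupoid] groupoid.comp_Ide_right[OF T.Hom_groupoid] 4 p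
          arrs
      by (simp add: H_Comp2[symmetric] del: ghom_iff)
  next
    case (5 A)
    then show ?case using ide[of A A "Id1 T (p A)"] p T.Id1_Obj by (simp add: H_Id1)
  next
    case (6 A B D E f g h)
    then show ?case
      using ide2[of A E] p fO S.Comp1_Obj T.Comp1_Obj
      by (simp add: H_Comp1 T.Comp2_Ide T.Comp1_assoc)
  next
    case (7 A B f)
    then show ?case
      using ide2[of A B] p fO S.Id1_Obj T.Id1_Obj
      by (simp add: H_Comp1 H_Id1 T.Comp2_Ide T.Comp1_Id1_left)
  next
    case (8 A B f)
    then show ?case
      using ide2[of A B] p fO S.Id1_Obj T.Id1_Obj
      by (simp add: H_Comp1 H_Id1 T.Comp2_Ide T.Comp1_Id1_right)
  qed (simp_all add: p H)
qed

lemma inverse_functors_equivalence: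
  fixes A :: "('o, 'a, 'm) gpd_scheme" and B :: "('p, 'b, 'n) gpd_scheme"
    and F :: "('o, 'a, 'p, 'b) functr" and G :: "('p, 'b, 'o, 'a) functr"
  assumes F: "gfunctor A B F" and G: "gfunctor B A G"
    and "\<And>x. x \<in> Obj A \<Longrightarrow> fO G (fO F x) = x" "\<And>f. f \<in> Arr A \<Longrightarrow> fA G (fA F f) = f"
    and "\<And>y. y \<in> Obj B \<Longrightarrow> fO F (fO G y) = y" "\<And>g. g \<in> Arr B \<Longrightarrow> fA F (fA G g) = g"
  shows "equivalence A B F"
proof -
  interpret F: gfunctor A B F by (rule F)
  interpret G: gfunctor B A G by (rule G)
  have "nat_trans A A id_functr (functr_comp G F) (Ide A)"
    by unfold_locales (simp_all add: id_functr_def functr_comp_def assms F.A.comp_hom F.A.comp_Ide)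
  moreover have "nat_trans B B (functr_comp F G) id_functr (Ide B)"
    by unfold_locales (simp_all add: id_functr_def functr_comp_def assms F.B.comp_hom F.B.comp_Ide)
  ultimately show ?thesis
    unfolding equivalence_def using F G by blast
qed

lemma same_agree: "same_scg A B \<Longrightarrow> agree B F G \<longleftrightarrow> agree A F G"
  by (simp add: agree_def same_scg_sel)

lemma agree_id_id:
  assumes "scg A" "same_scg A B" "agree A (id_smfun A) f" "agree A (id_smfun A) g"
  shows "agree A (id_smfun A) (smcomp B g f)"
proof -
  interpret scg A by fact
  note [simp] = agree_sel[OF assms(3)] agree_sel[OF assms(4)] same_scg_sel[OF assms(2)]
  show ?thesis by (simp add: agree_def smcomp_def) (simp add: id_smfun_def)
qed

text \<open>The shape of the comparison: p keeps the underlying symmetric categorical group,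
  \<open>lift\<close> and \<open>drop\<close> preserve 1-cells up to agreement and are therefore
  inverse to each other, and equivalences of objects come from 1-cells that agree with
  identities.\<close>

locale track_iso = S: track_cat C X tr I \<kappa> + R: track_cat C' X' tr' I' \<kappa>'
  for C :: "('o, 'a, 'm) scg_scheme set" and X tr
    and I :: "('o, 'a, 'm) scg_scheme \<Rightarrow> ('o, 'a, 'o, 'a, 'k) smfun_scheme" and \<kappa>
    and C' :: "('o, 'a, 'n) scg_scheme set" and X' tr'
    and I' :: "('o, 'a, 'n) scg_scheme \<Rightarrow> ('o, 'a, 'o, 'a, 'l) smfun_scheme" and \<kappa>' +
  fixes p :: "('o, 'a, 'm) scg_scheme \<Rightarrow> ('o, 'a, 'n) scg_scheme"
    and lift :: "('o, 'a, 'm) scg_scheme \<Rightarrow> ('o, 'a, 'm) scg_scheme \<Rightarrow> ('o, 'a, 'o, 'a, 'k) smfun_scheme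
        \<Rightarrow> ('o, 'a, 'o, 'a, 'l) smfun_scheme"
    and drop :: "('o, 'a, 'o, 'a, 'l) smfun_scheme \<Rightarrow> ('o, 'a, 'o, 'a, 'k) smfun_scheme"
  assumes p_in [simp]: "A \<in> C \<Longrightarrow> p A \<in> C'"
    and p_same: "A \<in> C \<Longrightarrow> same_scg A (p A)"
    and lift_in [simp]: "A \<in> C \<Longrightarrow> B \<in> C \<Longrightarrow> F \<in> X A B \<Longrightarrow> lift A B F \<in> X' (p A) (p B)"
    and lift_agree: "A \<in> C \<Longrightarrow> B \<in> C \<Longrightarrow> F \<in> X A B \<Longrightarrow> agree A F (lift A B F)"
    and drop_in [simp]: "A \<in> C \<Longrightarrow> B \<in> C \<Longrightarrow> G \<in> X' (p A) (p B) \<Longrightarrow> drop G \<in> X A B"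
    and drop_agree: "A \<in> C \<Longrightarrow> B \<in> C \<Longrightarrow> G \<in> X' (p A) (p B) \<Longrightarrow> agree A G (drop G)"
    and ess_surj: "D \<in> C' \<Longrightarrow> \<exists>A \<in> C. same_scg (p A) D \<and>
      (\<exists>f \<in> X' (p A) D. agree (p A) (id_smfun (p A)) f) \<and> (\<exists>g \<in> X' D (p A). agree (p A) (id_smfun (p
          A)) g)"
begin

lemma p_simps [simp]:
  assumes "A \<in> C"
  shows "agree (p A) F G \<longleftrightarrow> agree A F G" "smcomp (p A) = smcomp A" "id_smfun (p A) = id_smfun A"
    "sm_trans (p A) B F G t \<longleftrightarrow> sm_trans A B F G t" "sm_trans B (p A) F' G' t' \<longleftrightarrow> sm_trans B A F' G' t'"
    "Obj (p A) = Obj A" "Arr (p A) = Arr A" "Ide (p A) = Ide A" "comp (p A) = comp A"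
  using p_same[OF assms]
  by (simp_all add: same_agree same_smcomp same_id_smfun same_sm_trans same_scg_sel)

lemma lift_\<kappa>:
  assumes [simp]: "A \<in> C" "B \<in> C" "D \<in> C" "F \<in> X A B" "G \<in> X B D"
  shows "lift A D (\<kappa> A B D G F) = \<kappa>' (p A) (p B) (p D) (lift B D G) (lift A B F)"
proof -
  have "agree A (smcomp D G F) (smcomp D (lift B D G) (lift A B F))"
    by (rule agree_smcomp[OF S.X_functor S.X_functor lift_agree lift_agree]) simp_all
  moreover have "agree A (smcomp D (lift B D G) (lift A B F)) (\<kappa>' (p A) (p B) (p D) (lift B D G) (lift
      A B F))"
    using R.\<kappa>_agree[of "p A" "p B" "p D" "lift A B F" "lift B D G"] by simp
  moreover have "agree A (smcomp D G F) (lift A D (\<kappa> A B D G F))"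
    by (rule agree_trans[OF S.\<kappa>_agree lift_agree]) simp_all
  ultimately have "agree A (lift A D (\<kappa> A B D G F)) (\<kappa>' (p A) (p B) (p D) (lift B D G) (lift A B F))"
    using agree_sym agree_trans by metis
  then show ?thesis by (intro R.X_eq[of "p A" "p D"]) simp_all
qed

lemma lift_I:
  assumes [simp]: "A \<in> C"
  shows "lift A A (I A) = I' (p A)"
proof -
  have "agree A (id_smfun A) (lift A A (I A))"
    by (rule agree_trans[OF S.I_agree lift_agree]) simp_all
  moreover have "agree A (id_smfun A) (I' (p A))"
    using R.I_agree[of "p A"] by simp
  ultimately have "agree A (lift A A (I A)) (I' (p A))"
    using agree_sym agree_trans by metis
  then show ?thesis by (intro R.X_eq[of "p A" "p A"]) simp_all
qed

lemma drop_lift: "A \<in> C \<Longrightarrow> B \<in> C \<Longrightarrow> F \<in> X A B \<Longrightarrow> drop (lift A B F) = F"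
  by (rule S.X_eq[of A B, symmetric, OF _ _ _ _ agree_trans[OF lift_agree drop_agree[of A B]]]) simp_all

lemma lift_drop:
  assumes [simp]: "A \<in> C" "B \<in> C" "G \<in> X' (p A) (p B)"
  shows "lift A B (drop G) = G"
proof -
  have "agree A G (lift A B (drop G))"
    by (rule agree_trans[OF drop_agree[of A B] lift_agree]) simp_all
  then show ?thesis by (intro R.X_eq[of "p A" "p B", symmetric]) simp_all
qed

definition hom_lift :: "('o, 'a, 'm) scg_scheme \<Rightarrow> ('o, 'a, 'm) scg_scheme \<Rightarrow>
    (('o, 'a, 'o, 'a, 'k) smfun_scheme, (('o, 'a, 'o, 'a, 'k) smfun_scheme, 'o \<Rightarrow> 'a) track, ('o, 'a,
        'o, 'a, 'l) smfun_scheme, (('o, 'a, 'o, 'a, 'l) smfun_scheme, 'o \<Rightarrow> 'a) track) functr" where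
  "hom_lift A B = \<lparr>fO = lift A B, fA = \<lambda>t. \<lparr>src = lift A B (src t), trg = lift A B (trg t), cmp
      = cmp t\<rparr>\<rparr>"

definition hom_drop :: "('o, 'a, 'm) scg_scheme \<Rightarrow> ('o, 'a, 'm) scg_scheme \<Rightarrow>
    (('o, 'a, 'o, 'a, 'l) smfun_scheme, (('o, 'a, 'o, 'a, 'l) smfun_scheme, 'o \<Rightarrow> 'a) track, ('o, 'a,
        'o, 'a, 'k) smfun_scheme, (('o, 'a, 'o, 'a, 'k) smfun_scheme, 'o \<Rightarrow> 'a) track) functr" where
  "hom_drop A B = \<lparr>fO = drop, fA = \<lambda>t. \<lparr>src = drop (src t), trg = drop (trg t), cmp = cmp t\<rparr>\<rparr>"

lemma hom_lift_Arr:
  assumes [simp]: "A \<in> C" "B \<in> C" and t: "t \<in> Arr (Hom S.T A B)"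
  shows "fA (hom_lift A B) t \<in> Arr (Hom R.T (p A) (p B))"
proof -
  have t': "src t \<in> X A B" "trg t \<in> X A B" "cmp t \<in> extensional (Obj A)" "sm_trans A B (src t) (trg t)
      (cmp t)"
    using t S.T_Arr[of A B] by auto
  have "sm_trans A B (lift A B (src t)) (lift A B (trg t)) (cmp t)"
    by (rule agree_sm_trans[OF lift_agree lift_agree _ t'(4)]) (simp_all add: t')
  then show ?thesis
    using t' by (simp add: R.T_Arr hom_lift_def)
qed

lemma hom_drop_Arr:
  assumes [simp]: "A \<in> C" "B \<in> C" and t: "t \<in> Arr (Hom R.T (p A) (p B))"
  shows "fA (hom_drop A B) t \<in> Arr (Hom S.T A B)"
proof -
  have t': "src t \<in> X' (p A) (p B)" "trg t \<in> X' (p A) (p B)" "cmp t \<in> extensional (Obj A)" "sm_trans A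
      B (src t) (trg t) (cmp t)"
    using t by (simp_all add: R.T_Arr)
  have "sm_trans A B (drop (src t)) (drop (trg t)) (cmp t)"
    by (rule agree_sm_trans[OF drop_agree[of A B] drop_agree[of A B] _ t'(4)]) (simp_all add: t')
  then show ?thesis
    using t' by (simp add: S.T_Arr hom_drop_def)
qed

lemma hom_lift_functor:
  assumes AB [simp]: "A \<in> C" "B \<in> C"
  shows "gfunctor (Hom S.T A B) (Hom R.T (p A) (p B)) (hom_lift A B)"
proof (intro gfunctor.intro gfunctor_axioms.intro S.T_groupoid R.T_groupoid)
  fix F assume "F \<in> Obj (Hom S.T A B)"
  then have F [simp]: "F \<in> X A B" by simp
  then show "fA (hom_lift A B) (Ide (Hom S.T A B) F) = Ide (Hom R.T (p A) (p B)) (fO (hom_lift A B) F)"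
    using agree_sel(1)[OF lift_agree[OF AB F]] by (auto simp: hom_lift_def restrict_def)
next
  fix s t F G K assume "t \<in> ghom (Hom S.T A B) F G" "s \<in> ghom (Hom S.T A B) G K"
  then show "fA (hom_lift A B) (s \<cdot>\<^bsub>Hom S.T A B\<^esub> t) = fA (hom_lift A B) s
      \<cdot>\<^bsub>Hom R.T (p A) (p B)\<^esub> fA (hom_lift A B) t"
    by (simp add: hom_lift_def)
next
  fix t F G assume "t \<in> ghom (Hom S.T A B) F G"
  then show "fA (hom_lift A B) t \<in> ghom (Hom R.T (p A) (p B)) (fO (hom_lift A B) F) (fO (hom_lift A B)
      G)"
    using hom_lift_Arr[of A B t] by (auto simp: hom_lift_def)
qed (simp_all add: hom_lift_def)

lemma hom_drop_functor:
  assumes AB [simp]: "A \<in> C" "B \<in> C"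
  shows "gfunctor (Hom R.T (p A) (p B)) (Hom S.T A B) (hom_drop A B)"
proof (intro gfunctor.intro gfunctor_axioms.intro S.T_groupoid R.T_groupoid)
  fix F assume "F \<in> Obj (Hom R.T (p A) (p B))"
  then have F [simp]: "F \<in> X' (p A) (p B)" by simp
  then show "fA (hom_drop A B) (Ide (Hom R.T (p A) (p B)) F) = Ide (Hom S.T A B) (fO (hom_drop A B) F)"
    using agree_sel(1)[OF drop_agree[OF AB F]] by (auto simp: hom_drop_def restrict_def)
next
  fix s t F G K assume "t \<in> ghom (Hom R.T (p A) (p B)) F G" "s \<in> ghom (Hom R.T (p A) (p B)) G K"
  then show "fA (hom_drop A B) (s \<cdot>\<^bsub>Hom R.T (p A) (p B)\<^esub> t)
      = fA (hom_drop A B) s \<cdot>\<^bsub>Hom S.T A B\<^esub> fA (hom_drop A B) t"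
    by (simp add: hom_drop_def)
next
  fix t F G assume "t \<in> ghom (Hom R.T (p A) (p B)) F G"
  then show "fA (hom_drop A B) t \<in> ghom (Hom S.T A B) (fO (hom_drop A B) F) (fO (hom_drop A B) G)"
    using hom_drop_Arr[of A B t] by (auto simp: hom_drop_def)
qed (simp_all add: hom_drop_def)

lemma hom_lift_equivalence:
  assumes AB [simp]: "A \<in> C" "B \<in> C"
  shows "equivalence (Hom S.T A B) (Hom R.T (p A) (p B)) (hom_lift A B)"
proof (rule inverse_functors_equivalence[OF hom_lift_functor[OF AB] hom_drop_functor[OF AB]])
  fix t assume "t \<in> Arr (Hom S.T A B)"
  then show "fA (hom_drop A B) (fA (hom_lift A B) t) = t"
    by (simp add: S.T_Arr hom_lift_def hom_drop_def drop_lift)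
next
  fix t assume "t \<in> Arr (Hom R.T (p A) (p B))"
  then show "fA (hom_lift A B) (fA (hom_drop A B) t) = t"
    by (simp add: R.T_Arr hom_lift_def hom_drop_def lift_drop)
qed (simp_all add: hom_lift_def hom_drop_def drop_lift lift_drop)

theorem two_equivalent_T: "two_equivalent S.T R.T"
proof -
  let ?P = "\<lparr>pO = p, pH = hom_lift,
    pC = \<lambda>A B D g f. Ide (Hom R.T (p A) (p D)) (fO (hom_lift A D) (Comp1 S.T A B D g f)),
    pU = \<lambda>A. Ide (Hom R.T (p A) (p A)) (Id1 R.T (p A))\<rparr>"
  have "pseudo_functor S.T R.T ?P"
  proof (rule strict_pseudo_functor[OF S.T_groupoid_enriched R.T_groupoid_enriched])
    fix A B D t s assume *: "A \<in> Cell0 S.T" "B \<in> Cell0 S.T" "D \<in> Cell0 S.T" "t \<in> Arr (Hom S.T A B)" "s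
        \<in> Arr (Hom S.T B D)"
    then have [simp]: "A \<in> C" "B \<in> C" "D \<in> C" by simp_all
    then have t [simp]: "src t \<in> X A B" "trg t \<in> X A B" "src s \<in> X B D" "trg s \<in> X B D"
      using * S.T_Arr[of A B] S.T_Arr[of B D] by auto
    interpret tr: sm_trans A B "src t" "trg t" "cmp t" using * S.T_Arr[of A B] by simp
    note [simp] = agree_sel[OF lift_agree[of A B "trg t"]] agree_sel[OF lift_agree[of B D "src s"]]
    show "fA (hom_lift A D) (Comp2 S.T A B D s t) = Comp2 R.T (p A) (p B) (p D) (fA (hom_lift B D) s)
        (fA (hom_lift A B) t)"
      by (simp add: hom_lift_def lift_\<kappa> track_hcomp_def restrict_def fun_eq_iff)
  qed (simp_all add: hom_lift_functor lift_\<kappa> lift_I, simp_all add: hom_lift_def lift_\<kappa> lift_I)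
  moreover have "\<exists>A \<in> C. equivalent_objects R.T (p A) D" if D [simp]: "D \<in> C'" for D
  proof -
    \<comment> \<open>Here f and g carry the identity functor in the two directions, so both
      composites agree with identities and, by uniqueness of representatives, are the identity
      1-cells.\<close>
    obtain A f g where A [simp]: "A \<in> C" and s: "same_scg (p A) D"
      and f [simp]: "f \<in> X' (p A) D" and fa: "agree (p A) (id_smfun (p A)) f"
      and g [simp]: "g \<in> X' D (p A)" and ga: "agree (p A) (id_smfun (p A)) g"
      using ess_surj[OF D] by blast
    have id: "scg (p A)" using R.C_scg by simp
    have "agree (p A) (id_smfun (p A)) (\<kappa>' (p A) D (p A) g f)"
      by (rule agree_trans[OF agree_id_id[OF id _ fa ga] R.\<kappa>_agree]) (simp_all add: same_scg_def)
    then have "agree (p A) (I' (p A)) (\<kappa>' (p A) D (p A) g f)"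
      using R.I_agree[of "p A"] agree_sym agree_trans A p_in by metis
    then have gf: "\<kappa>' (p A) D (p A) g f = I' (p A)"
      by (intro R.X_eq[of "p A" "p A", symmetric]) simp_all
    have "agree (p A) (id_smfun (p A)) (smcomp D f g)"
      by (rule agree_id_id[OF id s ga fa])
    then have "agree D (id_smfun D) (smcomp D f g)"
      by (simp add: same_agree[OF s] same_id_smfun[OF s])
    then have "agree D (id_smfun D) (\<kappa>' D (p A) D f g)"
      by (rule agree_trans[OF _ R.\<kappa>_agree]) simp_all
    then have "agree D (I' D) (\<kappa>' D (p A) D f g)"
      using R.I_agree[OF D] agree_sym agree_trans by metis
    then have fg: "\<kappa>' D (p A) D f g = I' D"
      by (intro R.X_eq[of D D, symmetric]) simp_all
    have ne: "ghom (Hom R.T B B) (I' B) (I' B) \<noteq> {}" if "B \<in> C'" for B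
      using that groupoid.Ide_hom[OF R.T_groupoid[OF that that], of "I' B"] by (auto simp del: ghom_iff)
    have fg': "f \<in> Obj (Hom R.T (p A) D)" "g \<in> Obj (Hom R.T D (p A))" by simp_all
    have "equivalent_objects R.T (p A) D"
      unfolding equivalent_objects_def
      by (rule bexI[OF bexI[OF conjI fg'(2)] fg'(1)]) (use gf fg ne[of D] ne[of "p A"] in simp_all)
    then show ?thesis by (intro bexI[of _ A]) simp_all
  qed
  ultimately have "two_equivalence S.T R.T ?P"
    by (intro two_equivalence.intro two_equivalence_axioms.intro) (simp_all add: hom_lift_equivalence)
  then show ?thesis unfolding two_equivalent_def by blast
qed

end

section \<open>The two 2-categories as instances, and the comparison between them\<close>

lemma agree_smres: "agree A F (smres A F)"
  by (simp add: agree_def smres_def)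

lemma smres_cong: "agree A F G \<Longrightarrow> smfun.more F = smfun.more G \<Longrightarrow> smres A F = smres A G"
  by (rule smfun.equality) (auto simp: smres_def agree_def restrict_def fun_eq_iff)

lemma smres_smres: "smres A (smres A F) = smres A F"
  by (rule smres_cong[OF agree_sym[OF agree_smres]]) (simp add: smres_def)

lemma sm_functor_smres: "sm_functor A B F \<Longrightarrow> sm_functor A B (smres A F)"
  by (rule agree_sm_functor[OF agree_smres])

interpretation SCG: track_cat "{A :: ('o, 'a) scg. scg A}" "\<lambda>A B. {F. sm_functor A B F \<and> smres A F = F}"
  sm_trans "\<lambda>A. smres A (id_smfun A)" "\<lambda>A B D G F. smres A (smcomp D G F)"
proof (rule track_cat.intro)
  fix A B :: "('o, 'a) scg" and F G :: "('o, 'a, 'o, 'a) smfun"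
  assume "F \<in> {F. sm_functor A B F \<and> smres A F = F}" "G \<in> {F. sm_functor A B F \<and> smres A F
      = F}" "agree A F G"
  then show "F = G" using smres_cong[of A F G] by simp
qed (auto simp: smres_smres agree_smres intro!: sm_functor_smres sm_functor_id intro: sm_functor_smcomp)

lemma SCG_T: "SCG.T = (SCG :: ('o, 'a) scg_two_cat)"
  by (simp add: SCG.T_def SCG_def)

lemma agree_smcomp_Phi:
  assumes "sm_functor Phi A K" "agree A F F'"
  shows "smcomp B F' K = smcomp B F K"
  using Phi_functor_fM[OF assms(1)] Phi_functor_fA[OF assms(1)] Phi_functor_fO[OF assms(1)]
      Phi_functor_fU[OF assms(1)]
  by (simp add: smcomp_def agree_sel[OF assms(2)] fun_eq_iff)

lemma rmod_functor_cong:
  assumes F: "rmod_functor Phi M N F" and ag: "agree M F G"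
    and act: "\<And>m r. m \<in> Obj M \<Longrightarrow> fAct G m r = fAct F m r"
  shows "rmod_functor Phi M N G"
proof -
  have M: "rmodule Phi M" and N: "rmodule Phi N"
    using F by (simp_all add: rmod_functor_def)
  have s: "sm_functor M N F" using F by (simp add: rmod_functor_def)
  show ?thesis
  proof (rule rmod_functorI[OF M N agree_sm_functor[OF ag s]])
    fix m assume m: "m \<in> Obj M"
    have eqs: "fAct G m = fAct F m" "fO G m = fO F m" "fA G (aun M m) = fA F (aun M m)"
      using act m agree_sel[OF ag] module_simps[OF M] by auto
    show "sm_trans Phi N (lact Phi N (fO G m)) (smcomp N G (lact Phi M m)) (fAct G m)"
      using rmod_functorD(2)[OF M N F m] unfolding eqs agree_smcomp_Phi[OF module_lact[OF M m] ag] .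
    show "fA G (aun M m) \<cdot>\<^bsub>N\<^esub> fAct G m 1 = aun N (fO G m)"
      using rmod_functorD(3)[OF M N F m] by (simp add: eqs)
  qed
qed

lemma agree_modres: "agree M F (modres R M F)"
  by (simp add: agree_def modres_def smres_def)

lemma modres_fAct: "m \<in> Obj M \<Longrightarrow> fAct (modres Phi M F) m r = fAct F m r"
  by (simp add: modres_def)

lemma rmod_functor_modres: "rmod_functor Phi M N F \<Longrightarrow> rmod_functor Phi M N (modres Phi M F)"
  by (rule rmod_functor_cong[OF _ agree_modres modres_fAct])

lemma modres_cong:
  fixes F G :: "('o, 'a, 'p, 'b, int) modfun"
  assumes "agree M F G" "\<And>m r. m \<in> Obj M \<Longrightarrow> fAct G m r = fAct F m r"
  shows "modres Phi M F = modres Phi M G"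
  by (rule modfun.equality) (use assms in \<open>auto simp: modres_def smres_def agree_def restrict_def
      fun_eq_iff\<close>)

lemma modres_modres:
  fixes F :: "('o, 'a, 'p, 'b, int) modfun"
  shows "modres Phi M (modres Phi M F) = modres Phi M F"
  by (rule modres_cong[OF agree_sym[OF agree_modres]]) (simp add: modres_fAct)

lemma agree_id_modfun: "agree M (id_smfun M) (id_modfun Phi M)"
  by (simp add: agree_def id_modfun_def id_smfun_def smfun.defs)

lemma rmod_functor_id:
  assumes M: "rmodule Phi M"
  shows "rmod_functor Phi M M (id_modfun Phi M)"
proof -
  interpret M: scg M using M by (simp add: rmodule_def)
  show ?thesis
  proof (rule rmod_functorI[OF M M agree_sm_functor[OF agree_id_modfun sm_functor_id[OF M.scg_axioms]]])
    fix m assume m: "m \<in> Obj M"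
    have "smcomp M (id_modfun Phi M) (lact Phi M m) = lact Phi M m"
      using Phi_functor_fM[OF module_lact[OF M m]] Phi_functor_fU[OF module_lact[OF M m]]
        Phi_functor_fO[OF module_lact[OF M m]]
      by (intro smfun.equality) (simp_all add: smcomp_def id_modfun_def id_smfun_def smfun.defs
          fun_eq_iff)
    then show "sm_trans Phi M (lact Phi M (fO (id_modfun Phi M) m)) (smcomp M (id_modfun Phi M) (lact
        Phi M m))
        (fAct (id_modfun Phi M) m)"
      using sm_trans_Ide[OF module_lact[OF M m]] by (simp add: id_modfun_def id_smfun_def smfun.defs)
    show "fA (id_modfun Phi M) (aun M m) \<cdot>\<^bsub>M\<^esub> fAct (id_modfun Phi M) m 1
        = aun M (fO (id_modfun Phi M) m)"
      using m module_simps[OF M] by (simp add: id_modfun_def id_smfun_def smfun.defs)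
  qed
qed

lemma agree_modcomp: "agree M (smcomp P G F) (modcomp P G F)"
  by (simp add: agree_def modcomp_def smcomp_def smfun.defs)

lemma rmod_functor_comp:
  assumes F: "rmod_functor Phi M N F" and G: "rmod_functor Phi N P G"
  shows "rmod_functor Phi M P (modcomp P G F)"
proof -
  have M: "rmodule Phi M" and N: "rmodule Phi N" and P: "rmodule Phi P"
    and F': "sm_functor M N F" and G': "sm_functor N P G"
    using F G by (simp_all add: rmod_functor_def)
  interpret F: sm_functor M N F by (rule F')
  interpret G: sm_functor N P G by (rule G')
  have act: "fAct (modcomp P G F) m = (\<lambda>r. fA G (fAct F m r) \<cdot>\<^bsub>P\<^esub> fAct G (fO F m) r)" for m
    by (simp add: modcomp_def smfun.defs)
  have sel: "fO (modcomp P G F) m = fO G (fO F m)" "fA (modcomp P G F) f = fA G (fA F f)" for m f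
    by (simp_all add: modcomp_def smfun.defs smcomp_def)
  show ?thesis
  proof (rule rmod_functorI[OF M P agree_sm_functor[OF agree_modcomp sm_functor_smcomp[OF F' G']]])
    fix m assume m [simp]: "m \<in> Obj M"
    have "sm_trans Phi P (lact Phi P (fO G (fO F m))) (smcomp P (smcomp P G F) (lact Phi M m))
        (\<lambda>r. fA G (fAct F m r) \<cdot>\<^bsub>P\<^esub> fAct G (fO F m) r)"
      unfolding smcomp_assoc_Phi[OF module_lact[OF M m] F' G']
      by (rule sm_trans_comp[OF rmod_functorD(2)[OF N P G] sm_trans_whisker_left[OF rmod_functorD(2)[OF
          M N F] G']]) simp_all
    then show "sm_trans Phi P (lact Phi P (fO (modcomp P G F) m)) (smcomp P (modcomp P G F) (lact Phi M
        m)) (fAct (modcomp P G F) m)"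
      unfolding act sel agree_smcomp_Phi[OF module_lact[OF M m] agree_modcomp] .
    interpret f: sm_trans Phi N "lact Phi N (fO F m)" "smcomp N F (lact Phi M m)" "fAct F m"
      by (rule rmod_functorD(2)[OF M N F m])
    interpret g: sm_trans Phi P "lact Phi P (fO G (fO F m))" "smcomp P G (lact Phi N (fO F m))" "fAct G
        (fO F m)"
      by (rule rmod_functorD(2)[OF N P G]) simp
    note [simp] = module_simps[OF M m]
    have "fA G (fA F (aun M m)) \<cdot>\<^bsub>P\<^esub> (fA G (fAct F m 1) \<cdot>\<^bsub>P\<^esub> fAct G (fO F m) 1)
      = fA G (fA F (aun M m) \<cdot>\<^bsub>N\<^esub> fAct F m 1) \<cdot>\<^bsub>P\<^esub> fAct G (fO F m) 1"
      using f.t_simps[of 1] g.t_simps[of 1] by (simp add: G.fA_comp_simp smcomp_def)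
    also have "\<dots> = aun P (fO G (fO F m))"
      by (simp add: rmod_functorD(3)[OF M N F m] rmod_functorD(3)[OF N P G])
    finally show "fA (modcomp P G F) (aun M m) \<cdot>\<^bsub>P\<^esub> fAct (modcomp P G F) m 1
        = aun P (fO (modcomp P G F) m)"
      by (simp add: act sel)
  qed
qed

text \<open>Agreement of underlying functors gives equality of 1-cells, because the action
  constraint is unique on the carriers and \<open>modres\<close> normalises it elsewhere; by
  \<open>rmod_transI\<close> the tracks are the monoidal transformations.\<close>

interpretation RMod: track_cat "{M :: ('o, 'a, int, int \<times> bit) rmod. rmodule Phi M}"
  "\<lambda>M N. {F. rmod_functor Phi M N F \<and> modres Phi M F = F}" "rmod_trans Phi"
  "\<lambda>M. modres Phi M (id_modfun Phi M)" "\<lambda>M N P G F. modres Phi M (modcomp P G F)"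
proof (rule track_cat.intro)
  fix M N :: "('o, 'a, int, int \<times> bit) rmod" and F G :: "('o, 'a, 'o, 'a, int) modfun"
  assume "M \<in> {M. rmodule Phi M}" "N \<in> {M. rmodule Phi M}"
    and F: "F \<in> {F. rmod_functor Phi M N F \<and> modres Phi M F
        = F}" and G: "G \<in> {F. rmod_functor Phi M N F \<and> modres Phi M F = F}"
  then have M: "rmodule Phi M" and N: "rmodule Phi N" by auto
  show "sm_functor M N F" using F by (simp add: rmod_functor_def)
  show "rmod_trans Phi M N F G t \<longleftrightarrow> sm_trans M N F G t" for t
    using rmod_transI[OF M N, of F G t] F G by (auto simp: rmod_trans_def)
  assume ag: "agree M F G"
  then have "modres Phi M F = modres Phi M G"
    using rmod_functor_unique[OF M N _ _ ag] F G by (intro modres_cong) auto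
  then show "F = G" using F G by simp
next
  fix M :: "('o, 'a, int, int \<times> bit) rmod"
  assume "M \<in> {M. rmodule Phi M}"
  then show "modres Phi M (id_modfun Phi M) \<in> {F. rmod_functor Phi M M F \<and> modres Phi M F = F}"
    by (simp add: modres_modres rmod_functor_modres rmod_functor_id)
  show "agree M (id_smfun M) (modres Phi M (id_modfun Phi M))"
    by (rule agree_trans[OF agree_id_modfun agree_modres])
next
  fix M N P :: "('o, 'a, int, int \<times> bit) rmod" and F G :: "('o, 'a, 'o, 'a, int) modfun"
  assume "F \<in> {F. rmod_functor Phi M N F \<and> modres Phi M F = F}" "G \<in> {F. rmod_functor Phi N P F \<and>
      modres Phi N F = F}"
  then show "modres Phi M (modcomp P G F) \<in> {F. rmod_functor Phi M P F \<and> modres Phi M F = F}"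
    by (auto simp: modres_modres intro!: rmod_functor_modres rmod_functor_comp)
  show "agree M (smcomp P G F) (modres Phi M (modcomp P G F))"
    by (rule agree_trans[OF agree_modcomp agree_modres])
qed

lemma RMod_T: "RMod.T = (RMod Phi :: ('o, 'a, int, int \<times> bit) rmod_two_cat)"
  by (simp add: RMod.T_def RMod_def)

definition lift_functor :: "('o, 'a, int, int \<times> bit) rmod \<Rightarrow> ('o, 'a, int, int \<times> bit) rmod
    \<Rightarrow> ('o, 'a, 'o, 'a) smfun \<Rightarrow> ('o, 'a, 'o, 'a, int) modfun" where
  "lift_functor M N F = (let F' = smfun.extend F \<lparr>fAct = undefined\<rparr>
     in modres Phi M (F'\<lparr>fAct := SOME \<alpha>. rmod_functor Phi M N (F'\<lparr>fAct := \<alpha>\<rparr>)\<rparr>))"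

lemma lift_functor:
  assumes M: "rmodule Phi M" and N: "rmodule Phi N" and F: "sm_functor M N F"
  shows "rmod_functor Phi M N (lift_functor M N F)" "modres Phi M (lift_functor M N F)
      = lift_functor M N F"
    "agree M F (lift_functor M N F)"
proof -
  define F' where "F' = smfun.extend F \<lparr>fAct = undefined :: 'a \<Rightarrow> int \<Rightarrow> 'b\<rparr>"
  have "agree M F F'" by (simp add: agree_def F'_def smfun.defs)
  then have "sm_functor M N F'" using F by (rule agree_sm_functor)
  then have *: "rmod_functor Phi M N (F'\<lparr>fAct := SOME \<alpha>. rmod_functor Phi M N (F'\<lparr>fAct := \<alpha>\<rparr>)\<rparr>)"
    by (rule someI_ex[OF rmod_functor_ex[OF M N]])
  have l: "lift_functor M N F = modres Phi M (F'\<lparr>fAct := SOME \<alpha>. rmod_functor Phi M N (F'\<lparr>fAct := \<alpha>\<rparr>)\<rparr>)"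
    by (simp add: lift_functor_def F'_def Let_def)
  show "rmod_functor Phi M N (lift_functor M N F)" "modres Phi M (lift_functor M N F)
      = lift_functor M N F"
    unfolding l using * by (simp_all add: rmod_functor_modres modres_modres)
  have "agree M F (F'\<lparr>fAct := \<alpha>\<rparr>)" for \<alpha>
    by (simp add: agree_def F'_def smfun.defs)
  then show "agree M F (lift_functor M N F)"
    unfolding l by (rule agree_trans[OF _ agree_modres])
qed

lemma agree_truncate: "agree A F (smfun.truncate F)"
  by (simp add: agree_def smfun.defs)

lemma same_truncate: "same_scg A (scg.truncate A)"
  by (simp add: same_scg_def scg.defs)

interpretation track_iso "{A :: ('o, 'a) scg. scg A}" "\<lambda>A B. {F. sm_functor A B F \<and> smres A F = F}"
  sm_trans "\<lambda>A. smres A (id_smfun A)" "\<lambda>A B D G F. smres A (smcomp D G F)"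
  "{M :: ('o, 'a, int, int \<times> bit) rmod. rmodule Phi M}"
  "\<lambda>M N. {F. rmod_functor Phi M N F \<and> modres Phi M F = F}" "rmod_trans Phi"
  "\<lambda>M. modres Phi M (id_modfun Phi M)" "\<lambda>M N P G F. modres Phi M (modcomp P G F)"
  scg.Phi_module "\<lambda>A B. lift_functor (scg.Phi_module A) (scg.Phi_module B)" smfun.truncate
proof (intro track_iso.intro SCG.track_cat_axioms RMod.track_cat_axioms track_iso_axioms.intro)
  fix A :: "('o, 'a) scg" assume "A \<in> {A. scg A}"
  then show "scg.Phi_module A \<in> {M. rmodule Phi M}" "same_scg A (scg.Phi_module A)"
    by (simp_all add: scg.rmodule_Phi_module scg.same_Phi_module)
next
  fix A B :: "('o, 'a) scg"
  assume "A \<in> {A. scg A}" "B \<in> {A. scg A}"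
  then have A: "scg A" and B: "scg B" by simp_all
  note [simp] = same_sm_functor[OF scg.same_Phi_module[OF A]] same_sm_functor[OF scg.same_Phi_module[OF
      B]] same_agree[OF scg.same_Phi_module[OF A]]
  {
    fix F :: "('o, 'a, 'o, 'a) smfun" assume "F \<in> {F. sm_functor A B F \<and> smres A F = F}"
    then have "sm_functor (scg.Phi_module A) (scg.Phi_module B) F" by simp
    then show "lift_functor (scg.Phi_module A) (scg.Phi_module B) F \<in> {F. rmod_functor Phi
        (scg.Phi_module A) (scg.Phi_module B) F \<and> modres Phi (scg.Phi_module A) F = F}"
      "agree A F (lift_functor (scg.Phi_module A) (scg.Phi_module B) F)"
      using lift_functor[OF scg.rmodule_Phi_module[OF A] scg.rmodule_Phi_module[OF B], of F] by simp_all
  next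
    fix G :: "('o, 'a, 'o, 'a, int) modfun" assume G: "G \<in> {F. rmod_functor Phi (scg.Phi_module A)
        (scg.Phi_module B) F \<and> modres Phi (scg.Phi_module A) F = F}"
    then have "sm_functor (scg.Phi_module A) (scg.Phi_module B) G" by (simp add: rmod_functor_def)
    then have "sm_functor A B G" by simp
    then have "sm_functor A B (smfun.truncate G)" by (rule agree_sm_functor[OF agree_truncate])
    moreover have "smres A (smfun.truncate G) = smfun.truncate G"
    proof -
      have "modres Phi (scg.Phi_module A) G = G" using G by simp
      then have "smfun.truncate (modres Phi (scg.Phi_module A) G) = smfun.truncate G" by simp
      then show ?thesis using A
        by (simp add: modres_def smres_def smfun.defs scg.Phi_module_sel)
    qed
    ultimately show "smfun.truncate G \<in> {F. sm_functor A B F \<and> smres A F = F}" by simp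
    show "agree A G (smfun.truncate G)" by (rule agree_truncate)
  }
next
  fix D :: "('o, 'a, int, int \<times> bit) rmod" assume "D \<in> {M. rmodule Phi M}"
  then have D: "rmodule Phi D" and sD: "scg D" by (simp_all add: rmodule_def)
  \<comment> \<open>The underlying symmetric categorical group of D. The module rebuilt on it shares
    everything with D except possibly the action, so the identity functor is symmetric monoidal in
    both directions and is lifted each way.\<close>
  define A where "A = scg.truncate D"
  have s: "same_scg D A" by (simp add: A_def same_truncate)
  have A: "scg A" using sD same_scg[OF s] by simp
  define M where "M = scg.Phi_module A"
  have M: "rmodule Phi M" using A by (simp add: M_def scg.rmodule_Phi_module)
  have MD: "same_scg M D"
    using same_scg_sym[OF scg.same_Phi_module[OF A]] same_scg_sym[OF s]
        by (simp add: M_def same_scg_def)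
  have id: "sm_functor M M (id_smfun M)"
    using M by (intro sm_functor_id) (simp add: rmodule_def)
  then have "sm_functor M D (id_smfun M)" "sm_functor D M (id_smfun M)"
    by (simp_all add: same_sm_functor[OF MD])
  then have "lift_functor M D (id_smfun M) \<in> {F. rmod_functor Phi M D F \<and> modres Phi M F = F}"
    "agree M (id_smfun M) (lift_functor M D (id_smfun M))"
    "lift_functor D M (id_smfun M) \<in> {F. rmod_functor Phi D M F \<and> modres Phi D F = F}"
    "agree M (id_smfun M) (lift_functor D M (id_smfun M))"
    using lift_functor[OF M D, of "id_smfun M"] lift_functor[OF D M, of "id_smfun M"]
        by (simp_all add: same_agree[OF MD])
  then show "\<exists>A \<in> {A :: ('o, 'a) scg. scg A}. same_scg (scg.Phi_module A) D \<and>
      (\<exists>f \<in> {F :: ('o, 'a, 'o, 'a, int) modfun. rmod_functor Phi (scg.Phi_module A) D F \<and> modres Phi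
          (scg.Phi_module A) F = F}. agree (scg.Phi_module A) (id_smfun (scg.Phi_module A)) f) \<and>
      (\<exists>g \<in> {F :: ('o, 'a, 'o, 'a, int) modfun. rmod_functor Phi D (scg.Phi_module A) F \<and> modres Phi D
          F = F}. agree (scg.Phi_module A) (id_smfun (scg.Phi_module A)) g)"
    using A MD unfolding M_def
    by blast
qed

theorem proposition13:
  shows "two_equivalent (SCG :: ('o, 'a) scg_two_cat)
           (RMod Phi :: ('o, 'a, int, int \<times> bit) rmod_two_cat)"
  using two_equivalent_T unfolding SCG_T RMod_T .

end
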